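(* Let $X$ be a projective variety over an algebraically closed field of characteristic zero, let $A$ be an ample line bundle on $X$, and let $E$ be a vector bundle on $X$. Then $$\mathbb{B}_-(E)=\bigcup_{q\geq 1}\bigcap_{m\geq 1}\mathrm{Bs}(S^{mq}E\otimes A^m)\quad\text{and}\quad \mathbb{B}_+(E)=\bigcap_{q\geq 1}\bigcap_{m\geq 1}\mathrm{Bs}(S^{mq}E\otimes A^{-m}).$$
   Context: A vector bundle is a locally free sheaf of finite positive rank. Write $S^m=\mathrm{Sym}^m$. For a vector bundle $V$ on $X$, $\mathrm{Bs}(V)$ is the set of $x\in X$ such that $H^0(X,V)\to V(x)=V\otimes\kappa(x)$ is not surjective. For any ample line bundle $A$ on $X$ (the definitions do not depend on the choice), the augmented and diminished base loci are $$\mathbb{B}_+(E)=\bigcap_{q\geq 1}\bigcap_{m\geq 1}\mathrm{Bs}(S^mS^qE\otimes A^{-m}),\qquad \mathbb{B}_-(E)=\bigcup_{q\geq 1}\bigcap_{m\geq 1}\mathrm{Bs}(S^mS^qE\otimes A^{m}).$$ *)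

theory Defs
  imports
    "HOL-Analysis.Function_Topology"
    "HOL-Library.Poly_Mapping"
    "HOL-Library.Multiset"
    "HOL-Computational_Algebra.Polynomial"
    "HOL-Algebra.Module"
    "HOL-Algebra.QuotRing"
begin

hide_const (open) Polynomial.smult

section \<open>Modules given by generators and relations\<close>

text \<open>
  A module is a record extending a ring record; the multiplication and the unit of that
  record are irrelevant for modules and left undefined.
\<close>

definition semilinear ::
  "('r, 'a) ring_scheme \<Rightarrow> ('r \<Rightarrow> 'r2) \<Rightarrow> ('r, 'm) module \<Rightarrow> ('r2, 'n) module \<Rightarrow> ('m \<Rightarrow> 'n) \<Rightarrow> bool"
  where
  "semilinear R \<rho> M N h \<longleftrightarrow>
     h \<in> carrier M \<rightarrow> carrier N \<and>
     (\<forall>x\<in>carrier M. \<forall>y\<in>carrier M. h (x \<oplus>\<^bsub>M\<^esub> y) = h x \<oplus>\<^bsub>N\<^esub> h y) \<and>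
     (\<forall>r\<in>carrier R. \<forall>x\<in>carrier M. h (r \<odot>\<^bsub>M\<^esub> x) = \<rho> r \<odot>\<^bsub>N\<^esub> h x)"

definition submodule_span :: "('r, 'a) ring_scheme \<Rightarrow> ('r, 'm) module \<Rightarrow> 'm set \<Rightarrow> 'm set" where
  "submodule_span R M S = \<Inter>{N. submodule N R M \<and> S \<subseteq> N}"

definition quotient_module :: "('r, 'm) module \<Rightarrow> 'm set \<Rightarrow> ('r, 'm set) module" where
  "quotient_module M N =
     \<lparr>carrier = a_rcosets\<^bsub>M\<^esub> N, mult = undefined, one = undefined, zero = N, add = set_add M,
      smult = (\<lambda>r C. \<Union>x\<in>C. N +>\<^bsub>M\<^esub> (r \<odot>\<^bsub>M\<^esub> x))\<rparr>"

definition free_module :: "('r, 'a) ring_scheme \<Rightarrow> 's set \<Rightarrow> ('r, 's \<Rightarrow> 'r) module" where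
  "free_module R S =
     \<lparr>carrier = {f. (\<forall>s\<in>S. f s \<in> carrier R) \<and> (\<forall>s. s \<notin> S \<longrightarrow> f s = \<zero>\<^bsub>R\<^esub>) \<and> finite {s. f s \<noteq> \<zero>\<^bsub>R\<^esub>}},
      mult = undefined, one = undefined, zero = (\<lambda>_. \<zero>\<^bsub>R\<^esub>),
      add = (\<lambda>f g s. f s \<oplus>\<^bsub>R\<^esub> g s), smult = (\<lambda>r f s. r \<otimes>\<^bsub>R\<^esub> f s)\<rparr>"

definition basis_elt :: "('r, 'a) ring_scheme \<Rightarrow> 's \<Rightarrow> 's \<Rightarrow> 'r" where
  "basis_elt R s = (\<lambda>t. if t = s then \<one>\<^bsub>R\<^esub> else \<zero>\<^bsub>R\<^esub>)"

definition presented_module ::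
  "('r, 'a) ring_scheme \<Rightarrow> 's set \<Rightarrow> ('s \<Rightarrow> 'r) set \<Rightarrow> ('r, ('s \<Rightarrow> 'r) set) module" where
  "presented_module R S Rel =
     quotient_module (free_module R S) (submodule_span R (free_module R S) Rel)"

definition presented_class ::
  "('r, 'a) ring_scheme \<Rightarrow> 's set \<Rightarrow> ('s \<Rightarrow> 'r) set \<Rightarrow> ('s \<Rightarrow> 'r) \<Rightarrow> ('s \<Rightarrow> 'r) set" where
  "presented_class R S Rel f = submodule_span R (free_module R S) Rel +>\<^bsub>free_module R S\<^esub> f"

text \<open>
  The map into the module presented by \<open>S'\<close> and \<open>Rel'\<close> over \<open>R'\<close> that is induced by a ring
  homomorphism \<open>\<rho>\<close> from \<open>R\<close> to \<open>R'\<close> and a map \<open>\<theta>\<close> of generators: the class of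
  \<open>\<Sum>i. r\<^sub>i s\<^sub>i\<close> goes to the class of \<open>\<Sum>i. \<rho>(r\<^sub>i) \<theta>(s\<^sub>i)\<close>.
\<close>

definition push_formal_sum ::
  "('r, 'a) ring_scheme \<Rightarrow> ('r2, 'b) ring_scheme \<Rightarrow> ('r \<Rightarrow> 'r2) \<Rightarrow> ('s \<Rightarrow> 't) \<Rightarrow>
   ('s \<Rightarrow> 'r) \<Rightarrow> 't \<Rightarrow> 'r2" where
  "push_formal_sum R R' \<rho> \<theta> f =
     (\<lambda>t. \<Oplus>\<^bsub>R'\<^esub>s\<in>{s. f s \<noteq> \<zero>\<^bsub>R\<^esub> \<and> \<theta> s = t}. \<rho> (f s))"

definition presented_map ::
  "('r, 'a) ring_scheme \<Rightarrow> ('r2, 'b) ring_scheme \<Rightarrow> 't set \<Rightarrow> ('t \<Rightarrow> 'r2) set \<Rightarrow>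
   ('r \<Rightarrow> 'r2) \<Rightarrow> ('s \<Rightarrow> 't) \<Rightarrow> ('s \<Rightarrow> 'r) set \<Rightarrow> ('t \<Rightarrow> 'r2) set" where
  "presented_map R R' S' Rel' \<rho> \<theta> C =
     (\<Union>f\<in>C. presented_class R' S' Rel' (push_formal_sum R R' \<rho> \<theta> f))"

definition bilinear_relations ::
  "('r, 'a) ring_scheme \<Rightarrow> ('r, 'm) module \<Rightarrow> ('r, 'n) module \<Rightarrow> ('m \<times> 'n \<Rightarrow> 'r) set" where
  "bilinear_relations R M N =
     (let F = free_module R (carrier M \<times> carrier N); d = basis_elt R in
      {d (x \<oplus>\<^bsub>M\<^esub> x', y) \<ominus>\<^bsub>F\<^esub> (d (x, y) \<oplus>\<^bsub>F\<^esub> d (x', y)) | x x' y.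
         x \<in> carrier M \<and> x' \<in> carrier M \<and> y \<in> carrier N} \<union>
      {d (x, y \<oplus>\<^bsub>N\<^esub> y') \<ominus>\<^bsub>F\<^esub> (d (x, y) \<oplus>\<^bsub>F\<^esub> d (x, y')) | x y y'.
         x \<in> carrier M \<and> y \<in> carrier N \<and> y' \<in> carrier N} \<union>
      {d (r \<odot>\<^bsub>M\<^esub> x, y) \<ominus>\<^bsub>F\<^esub> (r \<odot>\<^bsub>F\<^esub> d (x, y)) | r x y.
         r \<in> carrier R \<and> x \<in> carrier M \<and> y \<in> carrier N} \<union>
      {d (x, r \<odot>\<^bsub>N\<^esub> y) \<ominus>\<^bsub>F\<^esub> (r \<odot>\<^bsub>F\<^esub> d (x, y)) | r x y.
         r \<in> carrier R \<and> x \<in> carrier M \<and> y \<in> carrier N})"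

definition tensor_module ::
  "('r, 'a) ring_scheme \<Rightarrow> ('r, 'm) module \<Rightarrow> ('r, 'n) module \<Rightarrow> ('r, ('m \<times> 'n \<Rightarrow> 'r) set) module"
  where
  "tensor_module R M N =
     presented_module R (carrier M \<times> carrier N) (bilinear_relations R M N)"

definition pure_tensor ::
  "('r, 'a) ring_scheme \<Rightarrow> ('r, 'm) module \<Rightarrow> ('r, 'n) module \<Rightarrow> 'm \<Rightarrow> 'n \<Rightarrow> ('m \<times> 'n \<Rightarrow> 'r) set"
  where
  "pure_tensor R M N x y =
     presented_class R (carrier M \<times> carrier N) (bilinear_relations R M N) (basis_elt R (x, y))"

text \<open>
  The tensor power \<open>T\<^sup>q M\<close> is generated by the lists of length \<open>q\<close>, the list \<open>[x\<^sub>1, \<dots>, x\<^sub>q]\<close>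
  standing for \<open>x\<^sub>1 \<otimes> \<dots> \<otimes> x\<^sub>q\<close>; for \<open>Sym\<^sup>q M\<close> permuted lists are identified in addition.
\<close>

definition words :: "('r, 'm) module \<Rightarrow> nat \<Rightarrow> 'm list set" where
  "words M q = {l. length l = q \<and> set l \<subseteq> carrier M}"

definition multilinear_relations ::
  "('r, 'a) ring_scheme \<Rightarrow> nat \<Rightarrow> ('r, 'm) module \<Rightarrow> ('m list \<Rightarrow> 'r) set" where
  "multilinear_relations R q M =
     (let F = free_module R (words M q); d = basis_elt R in
      {d (l @ [x \<oplus>\<^bsub>M\<^esub> y] @ l') \<ominus>\<^bsub>F\<^esub> (d (l @ [x] @ l') \<oplus>\<^bsub>F\<^esub> d (l @ [y] @ l')) | l x y l'.
         l @ [x] @ l' \<in> words M q \<and> y \<in> carrier M} \<union>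
      {d (l @ [r \<odot>\<^bsub>M\<^esub> x] @ l') \<ominus>\<^bsub>F\<^esub> (r \<odot>\<^bsub>F\<^esub> d (l @ [x] @ l')) | l r x l'.
         l @ [x] @ l' \<in> words M q \<and> r \<in> carrier R})"

definition permutation_relations ::
  "('r, 'a) ring_scheme \<Rightarrow> nat \<Rightarrow> ('r, 'm) module \<Rightarrow> ('m list \<Rightarrow> 'r) set" where
  "permutation_relations R q M =
     {basis_elt R l \<ominus>\<^bsub>free_module R (words M q)\<^esub> basis_elt R l' | l l'.
        l \<in> words M q \<and> l' \<in> words M q \<and> mset l = mset l'}"

definition tensor_power_module ::
  "('r, 'a) ring_scheme \<Rightarrow> nat \<Rightarrow> ('r, 'm) module \<Rightarrow> ('r, ('m list \<Rightarrow> 'r) set) module" where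
  "tensor_power_module R q M = presented_module R (words M q) (multilinear_relations R q M)"

definition sym_module ::
  "('r, 'a) ring_scheme \<Rightarrow> nat \<Rightarrow> ('r, 'm) module \<Rightarrow> ('r, ('m list \<Rightarrow> 'r) set) module" where
  "sym_module R q M =
     presented_module R (words M q) (multilinear_relations R q M \<union> permutation_relations R q M)"

section \<open>Sheaves and ringed spaces\<close>

text \<open>
  The type \<open>'o\<close> is \<open>unit\<close> for sheaves of rings; for sheaves of modules it adds the scalar
  multiplication to the record.
\<close>

record ('p, 's, 'o) presheaf =
  sections :: "'p set \<Rightarrow> ('s, 'o) ring_scheme"
  restr :: "'p set \<Rightarrow> 'p set \<Rightarrow> 's \<Rightarrow> 's"

type_synonym ('p, 'r) ring_presheaf = "('p, 'r, unit) presheaf"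
type_synonym ('p, 'r, 'm) mod_presheaf = "('p, 'm, ('r, 'm, unit) module_ext) presheaf"

definition is_presheaf :: "'p topology \<Rightarrow> ('p, 's, 'o) presheaf \<Rightarrow> bool" where
  "is_presheaf T F \<longleftrightarrow>
     (\<forall>U V. openin T U \<and> openin T V \<and> V \<subseteq> U \<longrightarrow>
        restr F U V \<in> carrier (sections F U) \<rightarrow> carrier (sections F V)) \<and>
     (\<forall>U. openin T U \<longrightarrow> (\<forall>s\<in>carrier (sections F U). restr F U U s = s)) \<and>
     (\<forall>U V W. openin T U \<and> openin T V \<and> openin T W \<and> W \<subseteq> V \<and> V \<subseteq> U \<longrightarrow>
        (\<forall>s\<in>carrier (sections F U). restr F V W (restr F U V s) = restr F U W s))"

definition is_sheaf :: "'p topology \<Rightarrow> ('p, 's, 'o) presheaf \<Rightarrow> bool" where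
  "is_sheaf T F \<longleftrightarrow> is_presheaf T F \<and>
     (\<forall>\<U>. (\<forall>U\<in>\<U>. openin T U) \<longrightarrow>
        (\<forall>s\<in>carrier (sections F (\<Union>\<U>)). \<forall>t\<in>carrier (sections F (\<Union>\<U>)).
           (\<forall>U\<in>\<U>. restr F (\<Union>\<U>) U s = restr F (\<Union>\<U>) U t) \<longrightarrow> s = t)) \<and>
     (\<forall>\<U> \<sigma>. (\<forall>U\<in>\<U>. openin T U \<and> \<sigma> U \<in> carrier (sections F U)) \<and>
        (\<forall>U\<in>\<U>. \<forall>V\<in>\<U>. restr F U (U \<inter> V) (\<sigma> U) = restr F V (U \<inter> V) (\<sigma> V)) \<longrightarrow>
        (\<exists>s\<in>carrier (sections F (\<Union>\<U>)). \<forall>U\<in>\<U>. restr F (\<Union>\<U>) U s = \<sigma> U))"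

definition germ :: "'p topology \<Rightarrow> ('p, 's, 'o) presheaf \<Rightarrow> 'p \<Rightarrow> 'p set \<Rightarrow> 's \<Rightarrow> ('p set \<times> 's) set" where
  "germ T F x U s =
     {(V, t). openin T V \<and> x \<in> V \<and> t \<in> carrier (sections F V) \<and>
        (\<exists>W. openin T W \<and> x \<in> W \<and> W \<subseteq> U \<inter> V \<and> restr F U W s = restr F V W t)}"

definition stalk_carrier :: "'p topology \<Rightarrow> ('p, 's, 'o) presheaf \<Rightarrow> 'p \<Rightarrow> ('p set \<times> 's) set set" where
  "stalk_carrier T F x =
     {germ T F x U s | U s. openin T U \<and> x \<in> U \<and> s \<in> carrier (sections F U)}"

definition stalk_add ::
  "'p topology \<Rightarrow> ('p, 's, 'o) presheaf \<Rightarrow> 'p \<Rightarrow>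
   ('p set \<times> 's) set \<Rightarrow> ('p set \<times> 's) set \<Rightarrow> ('p set \<times> 's) set" where
  "stalk_add T F x a b =
     (\<Union>(U, s)\<in>a. \<Union>(V, t)\<in>b.
        germ T F x (U \<inter> V)
          (restr F U (U \<inter> V) s \<oplus>\<^bsub>sections F (U \<inter> V)\<^esub> restr F V (U \<inter> V) t))"

definition stalk_zero :: "'p topology \<Rightarrow> ('p, 's, 'o) presheaf \<Rightarrow> 'p \<Rightarrow> ('p set \<times> 's) set" where
  "stalk_zero T F x = germ T F x (topspace T) \<zero>\<^bsub>sections F (topspace T)\<^esub>"

record ('p, 'r) ringed_space =
  space_top :: "'p topology"
  str_sheaf :: "('p, 'r) ring_presheaf"

definition stalk_ring :: "('p, 'r, 'z) ringed_space_scheme \<Rightarrow> 'p \<Rightarrow> ('p set \<times> 'r) set ring" where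
  "stalk_ring X x =
     (let T = space_top X; Ox = str_sheaf X in
      \<lparr>carrier = stalk_carrier T Ox x,
       mult = (\<lambda>a b. \<Union>(U, s)\<in>a. \<Union>(V, t)\<in>b.
         germ T Ox x (U \<inter> V)
           (restr Ox U (U \<inter> V) s \<otimes>\<^bsub>sections Ox (U \<inter> V)\<^esub> restr Ox V (U \<inter> V) t)),
       one = germ T Ox x (topspace T) \<one>\<^bsub>sections Ox (topspace T)\<^esub>,
       zero = stalk_zero T Ox x,
       add = stalk_add T Ox x\<rparr>)"

definition is_ringed_space :: "('p, 'r, 'z) ringed_space_scheme \<Rightarrow> bool" where
  "is_ringed_space X \<longleftrightarrow>
     is_sheaf (space_top X) (str_sheaf X) \<and>
     (\<forall>U. openin (space_top X) U \<longrightarrow> cring (sections (str_sheaf X) U)) \<and>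
     (\<forall>U V. openin (space_top X) U \<and> openin (space_top X) V \<and> V \<subseteq> U \<longrightarrow>
        restr (str_sheaf X) U V \<in> ring_hom (sections (str_sheaf X) U) (sections (str_sheaf X) V))"

definition local_ring :: "('r, 'a) ring_scheme \<Rightarrow> bool" where
  "local_ring R \<longleftrightarrow> cring R \<and> (\<exists>!\<mm>. maximalideal \<mm> R)"

definition max_ideal :: "('r, 'a) ring_scheme \<Rightarrow> 'r set" where
  "max_ideal R = (THE \<mm>. maximalideal \<mm> R)"

definition is_locally_ringed_space :: "('p, 'r, 'z) ringed_space_scheme \<Rightarrow> bool" where
  "is_locally_ringed_space X \<longleftrightarrow>
     is_ringed_space X \<and> (\<forall>x\<in>topspace (space_top X). local_ring (stalk_ring X x))"

text \<open>The residue field of a local ring \<open>R\<close>, with its structure of an \<open>R\<close>-module.\<close>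

definition residue_field_module :: "('r, 'a) ring_scheme \<Rightarrow> ('r, 'r set) module" where
  "residue_field_module R =
     (let \<mm> = max_ideal R; K = R Quot \<mm> in
      \<lparr>carrier = carrier K, mult = mult K, one = one K, zero = zero K, add = add K,
       smult = (\<lambda>r c. (\<mm> +>\<^bsub>R\<^esub> r) \<otimes>\<^bsub>K\<^esub> c)\<rparr>)"

section \<open>Projective varieties\<close>

text \<open>
  A graded ring is a ring \<open>S\<close> together with the sets \<open>gr d\<close> of its homogeneous elements of
  degree \<open>d\<close>, each containing \<open>0\<close>.
\<close>

definition homogeneous_ideal :: "'s ring \<Rightarrow> (nat \<Rightarrow> 's set) \<Rightarrow> 's set \<Rightarrow> bool" where
  "homogeneous_ideal S gr I \<longleftrightarrow> ideal I S \<and> I = Idl\<^bsub>S\<^esub> (I \<inter> (\<Union>d. gr d))"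

definition relevant_prime :: "'s ring \<Rightarrow> (nat \<Rightarrow> 's set) \<Rightarrow> 's set \<Rightarrow> bool" where
  "relevant_prime S gr \<pp> \<longleftrightarrow>
     primeideal \<pp> S \<and> homogeneous_ideal S gr \<pp> \<and> \<not> (\<Union>d\<in>{1..}. gr d) \<subseteq> \<pp>"

definition Proj_points :: "'s ring \<Rightarrow> (nat \<Rightarrow> 's set) \<Rightarrow> 's set set" where
  "Proj_points S gr = {\<pp>. relevant_prime S gr \<pp>}"

definition Proj_top :: "'s ring \<Rightarrow> (nat \<Rightarrow> 's set) \<Rightarrow> 's set topology" where
  "Proj_top S gr =
     topology_generated_by {{\<pp> \<in> Proj_points S gr. f \<notin> \<pp>} | f. f \<in> (\<Union>d. gr d)}"

text \<open>
  The fraction \<open>a/b\<close> in the degree zero part \<open>S\<^bsub>(\<pp>)\<^esub>\<close> of the localisation of \<open>S\<close> at the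
  homogeneous elements outside \<open>\<pp>\<close>, where \<open>a\<close> and \<open>b\<close> are homogeneous of the same degree.
\<close>

definition hom_frac :: "'s ring \<Rightarrow> (nat \<Rightarrow> 's set) \<Rightarrow> 's set \<Rightarrow> 's \<Rightarrow> 's \<Rightarrow> ('s \<times> 's) set" where
  "hom_frac S gr \<pp> a b =
     {(c, d). \<exists>e. c \<in> gr e \<and> d \<in> gr e - \<pp> \<and>
        (\<exists>t\<in>(\<Union>j. gr j) - \<pp>. t \<otimes>\<^bsub>S\<^esub> (a \<otimes>\<^bsub>S\<^esub> d \<ominus>\<^bsub>S\<^esub> c \<otimes>\<^bsub>S\<^esub> b) = \<zero>\<^bsub>S\<^esub>)}"

definition homogeneous_localization ::
  "'s ring \<Rightarrow> (nat \<Rightarrow> 's set) \<Rightarrow> 's set \<Rightarrow> ('s \<times> 's) set ring" where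
  "homogeneous_localization S gr \<pp> =
     \<lparr>carrier = {hom_frac S gr \<pp> a b | a b e. a \<in> gr e \<and> b \<in> gr e - \<pp>},
      mult = (\<lambda>u v. \<Union>(a, b)\<in>u. \<Union>(c, d)\<in>v. hom_frac S gr \<pp> (a \<otimes>\<^bsub>S\<^esub> c) (b \<otimes>\<^bsub>S\<^esub> d)),
      one = hom_frac S gr \<pp> \<one>\<^bsub>S\<^esub> \<one>\<^bsub>S\<^esub>,
      zero = hom_frac S gr \<pp> \<zero>\<^bsub>S\<^esub> \<one>\<^bsub>S\<^esub>,
      add = (\<lambda>u v. \<Union>(a, b)\<in>u. \<Union>(c, d)\<in>v.
        hom_frac S gr \<pp> (a \<otimes>\<^bsub>S\<^esub> d \<oplus>\<^bsub>S\<^esub> c \<otimes>\<^bsub>S\<^esub> b) (b \<otimes>\<^bsub>S\<^esub> d))\<rparr>"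

definition Proj_sections ::
  "'s ring \<Rightarrow> (nat \<Rightarrow> 's set) \<Rightarrow> 's set set \<Rightarrow> ('s set \<Rightarrow> ('s \<times> 's) set) ring" where
  "Proj_sections S gr U =
     (let L = homogeneous_localization S gr in
      \<lparr>carrier = {s \<in> (\<Pi>\<^sub>E \<pp>\<in>U. carrier (L \<pp>)).
         \<forall>\<pp>\<in>U. \<exists>V e a b. openin (Proj_top S gr) V \<and> \<pp> \<in> V \<and> V \<subseteq> U \<and> a \<in> gr e \<and> b \<in> gr e \<and>
           (\<forall>\<qq>\<in>V. b \<notin> \<qq> \<and> s \<qq> = hom_frac S gr \<qq> a b)},
       mult = (\<lambda>s t. \<lambda>\<pp>\<in>U. s \<pp> \<otimes>\<^bsub>L \<pp>\<^esub> t \<pp>),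
       one = (\<lambda>\<pp>\<in>U. \<one>\<^bsub>L \<pp>\<^esub>),
       zero = (\<lambda>\<pp>\<in>U. \<zero>\<^bsub>L \<pp>\<^esub>),
       add = (\<lambda>s t. \<lambda>\<pp>\<in>U. s \<pp> \<oplus>\<^bsub>L \<pp>\<^esub> t \<pp>)\<rparr>)"

definition Proj ::
  "'s ring \<Rightarrow> (nat \<Rightarrow> 's set) \<Rightarrow> ('s set, 's set \<Rightarrow> ('s \<times> 's) set) ringed_space" where
  "Proj S gr =
     \<lparr>space_top = Proj_top S gr,
      str_sheaf = \<lparr>sections = Proj_sections S gr, restr = (\<lambda>U V s. restrict s V)\<rparr>\<rparr>"

text \<open>The polynomial ring \<open>k[x\<^sub>0, \<dots>, x\<^sub>n]\<close> and its homogeneous elements.\<close>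

type_synonym 'k mpoly = "(nat \<Rightarrow>\<^sub>0 nat) \<Rightarrow>\<^sub>0 'k"

definition poly_ring_n :: "nat \<Rightarrow> 'k::field mpoly ring" where
  "poly_ring_n n =
     \<lparr>carrier = {p. \<forall>m\<in>Poly_Mapping.keys p. Poly_Mapping.keys m \<subseteq> {..n}},
      mult = (*), one = 1, zero = 0, add = (+)\<rparr>"

definition homogeneous_polys :: "nat \<Rightarrow> nat \<Rightarrow> 'k::field mpoly set" where
  "homogeneous_polys n d =
     {p \<in> carrier (poly_ring_n n).
        \<forall>m\<in>Poly_Mapping.keys p. (\<Sum>i\<in>Poly_Mapping.keys m. Poly_Mapping.lookup m i) = d}"

definition const_poly :: "'k::field \<Rightarrow> 'k mpoly" where
  "const_poly c = Poly_Mapping.single 0 c"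

definition coord_ring :: "nat \<Rightarrow> 'k::field mpoly set \<Rightarrow> 'k mpoly set ring" where
  "coord_ring n I = poly_ring_n n Quot I"

definition coord_grading :: "nat \<Rightarrow> 'k::field mpoly set \<Rightarrow> nat \<Rightarrow> 'k mpoly set set" where
  "coord_grading n I d = (\<lambda>p. I +>\<^bsub>poly_ring_n n\<^esub> p) ` homogeneous_polys n d"

text \<open>A ringed space together with a map from \<open>k\<close> to its ring of global functions.\<close>

record ('p, 'r, 'k) space_over = "('p, 'r) ringed_space" +
  scalar_map :: "'k \<Rightarrow> 'r"

definition is_locally_ringed_space_over :: "('p, 'r, 'k::field) space_over \<Rightarrow> bool" where
  "is_locally_ringed_space_over X \<longleftrightarrow>
     is_locally_ringed_space X \<and>
     scalar_map X \<in> ring_hom \<lparr>carrier = UNIV, mult = (*), one = 1, zero = 0, add = (+)\<rparr>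
       (sections (str_sheaf X) (topspace (space_top X)))"

definition closed_subvariety ::
  "nat \<Rightarrow> 'k::field mpoly set \<Rightarrow>
   ('k mpoly set set, 'k mpoly set set \<Rightarrow> ('k mpoly set \<times> 'k mpoly set) set, 'k) space_over" where
  "closed_subvariety n I =
     (let S = coord_ring n I; gr = coord_grading n I in
      \<lparr>space_top = space_top (Proj S gr), str_sheaf = str_sheaf (Proj S gr),
       scalar_map = (\<lambda>c. \<lambda>\<pp>\<in>Proj_points S gr.
         hom_frac S gr \<pp> (I +>\<^bsub>poly_ring_n n\<^esub> const_poly c) \<one>\<^bsub>S\<^esub>)\<rparr>)"

definition isomorphic_over :: "('p, 'r, 'k) space_over \<Rightarrow> ('q, 's, 'k) space_over \<Rightarrow> bool" where
  "isomorphic_over X Y \<longleftrightarrow>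
     (\<exists>\<phi> \<psi>. homeomorphic_map (space_top X) (space_top Y) \<phi> \<and>
        (let pre = (\<lambda>V. {x \<in> topspace (space_top X). \<phi> x \<in> V}) in
         (\<forall>V. openin (space_top Y) V \<longrightarrow>
            \<psi> V \<in> ring_iso (sections (str_sheaf Y) V) (sections (str_sheaf X) (pre V))) \<and>
         (\<forall>V W. openin (space_top Y) V \<and> openin (space_top Y) W \<and> W \<subseteq> V \<longrightarrow>
            (\<forall>s\<in>carrier (sections (str_sheaf Y) V).
               restr (str_sheaf X) (pre V) (pre W) (\<psi> V s) = \<psi> W (restr (str_sheaf Y) V W s)))) \<and>
        (\<forall>c. \<psi> (topspace (space_top Y)) (scalar_map Y c) = scalar_map X c))"

text \<open>
  A projective variety over \<open>k\<close> is an integral closed subscheme \<open>Proj (k[x\<^sub>0, \<dots>, x\<^sub>n] / I)\<close> of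
  some projective space, up to isomorphism of (locally) ringed spaces over \<open>k\<close>. Its points are
  all scheme-theoretic points.
\<close>

definition projective_variety :: "('p, 'r, 'k::field) space_over \<Rightarrow> bool" where
  "projective_variety X \<longleftrightarrow>
     is_locally_ringed_space_over X \<and>
     (\<exists>n I. relevant_prime (poly_ring_n n) (homogeneous_polys n) I \<and>
        isomorphic_over X (closed_subvariety n I))"

section \<open>Sheaves of modules\<close>

definition stalk_module ::
  "('p, 'r, 'z) ringed_space_scheme \<Rightarrow> ('p, 'r, 'm) mod_presheaf \<Rightarrow> 'p \<Rightarrow>
   (('p set \<times> 'r) set, ('p set \<times> 'm) set) module" where
  "stalk_module X F x =
     (let T = space_top X; Ox = str_sheaf X in
      \<lparr>carrier = stalk_carrier T F x, mult = undefined, one = undefined,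
       zero = stalk_zero T F x, add = stalk_add T F x,
       smult = (\<lambda>a b. \<Union>(U, r)\<in>a. \<Union>(V, s)\<in>b.
         germ T F x (U \<inter> V)
           (restr Ox U (U \<inter> V) r \<odot>\<^bsub>sections F (U \<inter> V)\<^esub> restr F V (U \<inter> V) s))\<rparr>)"

definition mod_sheaf :: "('p, 'r, 'z) ringed_space_scheme \<Rightarrow> ('p, 'r, 'm) mod_presheaf \<Rightarrow> bool" where
  "mod_sheaf X F \<longleftrightarrow>
     is_sheaf (space_top X) F \<and>
     (\<forall>U. openin (space_top X) U \<longrightarrow> Module.module (sections (str_sheaf X) U) (sections F U)) \<and>
     (\<forall>U V. openin (space_top X) U \<and> openin (space_top X) V \<and> V \<subseteq> U \<longrightarrow>
        semilinear (sections (str_sheaf X) U) (restr (str_sheaf X) U V)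
          (sections F U) (sections F V) (restr F U V))"

definition sheafify ::
  "('p, 'r, 'z) ringed_space_scheme \<Rightarrow> ('p, 'r, 'm) mod_presheaf \<Rightarrow>
   ('p, 'r, 'p \<Rightarrow> ('p set \<times> 'm) set) mod_presheaf" where
  "sheafify X P =
     (let T = space_top X; st = stalk_module X P in
      \<lparr>sections = (\<lambda>U.
         \<lparr>carrier = {s \<in> (\<Pi>\<^sub>E x\<in>U. carrier (st x)).
            \<forall>x\<in>U. \<exists>V t. openin T V \<and> x \<in> V \<and> V \<subseteq> U \<and> t \<in> carrier (sections P V) \<and>
              (\<forall>y\<in>V. s y = germ T P y V t)},
          mult = undefined, one = undefined,
          zero = (\<lambda>x\<in>U. \<zero>\<^bsub>st x\<^esub>),
          add = (\<lambda>s t. \<lambda>x\<in>U. s x \<oplus>\<^bsub>st x\<^esub> t x),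
          smult = (\<lambda>r s. \<lambda>x\<in>U. germ T (str_sheaf X) x U r \<odot>\<^bsub>st x\<^esub> s x)\<rparr>),
       restr = (\<lambda>U V s. restrict s V)\<rparr>)"

definition tensor_sheaf ::
  "('p, 'r, 'z) ringed_space_scheme \<Rightarrow> ('p, 'r, 'm) mod_presheaf \<Rightarrow> ('p, 'r, 'n) mod_presheaf \<Rightarrow>
   ('p, 'r, 'p \<Rightarrow> ('p set \<times> ('m \<times> 'n \<Rightarrow> 'r) set) set) mod_presheaf" where
  "tensor_sheaf X F G =
     (let Ox = str_sheaf X in
      sheafify X
        \<lparr>sections = (\<lambda>U. tensor_module (sections Ox U) (sections F U) (sections G U)),
         restr = (\<lambda>U V. presented_map (sections Ox U) (sections Ox V)
           (carrier (sections F V) \<times> carrier (sections G V))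
           (bilinear_relations (sections Ox V) (sections F V) (sections G V))
           (restr Ox U V) (map_prod (restr F U V) (restr G U V)))\<rparr>)"

definition tensor_power_sheaf ::
  "('p, 'r, 'z) ringed_space_scheme \<Rightarrow> nat \<Rightarrow> ('p, 'r, 'm) mod_presheaf \<Rightarrow>
   ('p, 'r, 'p \<Rightarrow> ('p set \<times> ('m list \<Rightarrow> 'r) set) set) mod_presheaf" where
  "tensor_power_sheaf X q F =
     (let Ox = str_sheaf X in
      sheafify X
        \<lparr>sections = (\<lambda>U. tensor_power_module (sections Ox U) q (sections F U)),
         restr = (\<lambda>U V. presented_map (sections Ox U) (sections Ox V) (words (sections F V) q)
           (multilinear_relations (sections Ox V) q (sections F V))
           (restr Ox U V) (map (restr F U V)))\<rparr>)"

definition sym_sheaf ::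
  "('p, 'r, 'z) ringed_space_scheme \<Rightarrow> nat \<Rightarrow> ('p, 'r, 'm) mod_presheaf \<Rightarrow>
   ('p, 'r, 'p \<Rightarrow> ('p set \<times> ('m list \<Rightarrow> 'r) set) set) mod_presheaf" where
  "sym_sheaf X q F =
     (let Ox = str_sheaf X in
      sheafify X
        \<lparr>sections = (\<lambda>U. sym_module (sections Ox U) q (sections F U)),
         restr = (\<lambda>U V. presented_map (sections Ox U) (sections Ox V) (words (sections F V) q)
           (multilinear_relations (sections Ox V) q (sections F V) \<union>
            permutation_relations (sections Ox V) q (sections F V))
           (restr Ox U V) (map (restr F U V)))\<rparr>)"

text \<open>Homomorphisms of sheaves of modules on the open set \<open>U\<close>.\<close>

definition mod_sheaf_hom ::
  "('p, 'r, 'z) ringed_space_scheme \<Rightarrow> 'p set \<Rightarrow> ('p, 'r, 'm) mod_presheaf \<Rightarrow>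
   ('p, 'r, 'n) mod_presheaf \<Rightarrow> ('p set \<Rightarrow> 'm \<Rightarrow> 'n) \<Rightarrow> bool" where
  "mod_sheaf_hom X U F G h \<longleftrightarrow>
     (\<forall>V. openin (space_top X) V \<and> V \<subseteq> U \<longrightarrow>
        semilinear (sections (str_sheaf X) V) id (sections F V) (sections G V) (h V)) \<and>
     (\<forall>V W. openin (space_top X) V \<and> openin (space_top X) W \<and> V \<subseteq> U \<and> W \<subseteq> V \<longrightarrow>
        (\<forall>s\<in>carrier (sections F V). restr G V W (h V s) = h W (restr F V W s)))"

definition struct_module :: "('p, 'r, 'z) ringed_space_scheme \<Rightarrow> ('p, 'r, 'r) mod_presheaf" where
  "struct_module X =
     \<lparr>sections = (\<lambda>U. let R = sections (str_sheaf X) U in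
        \<lparr>carrier = carrier R, mult = mult R, one = one R, zero = zero R, add = add R,
         smult = mult R\<rparr>),
      restr = restr (str_sheaf X)\<rparr>"

text \<open>
  The dual \<open>Hom(F, O\<^sub>X)\<close>, the inverse of \<open>F\<close> if \<open>F\<close> is a line bundle. The values of a
  homomorphism outside its domain are normalised to be undefined.
\<close>

definition dual_sheaf ::
  "('p, 'r, 'z) ringed_space_scheme \<Rightarrow> ('p, 'r, 'm) mod_presheaf \<Rightarrow>
   ('p, 'r, 'p set \<Rightarrow> 'm \<Rightarrow> 'r) mod_presheaf" where
  "dual_sheaf X F =
     (let Ox = str_sheaf X; opens = (\<lambda>U. {V. openin (space_top X) V \<and> V \<subseteq> U}) in
      \<lparr>sections = (\<lambda>U.
         \<lparr>carrier = {h \<in> (\<Pi>\<^sub>E V\<in>opens U. carrier (sections F V) \<rightarrow>\<^sub>E carrier (sections Ox V)).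
            mod_sheaf_hom X U F (struct_module X) h},
          mult = undefined, one = undefined,
          zero = (\<lambda>V\<in>opens U. \<lambda>s\<in>carrier (sections F V). \<zero>\<^bsub>sections Ox V\<^esub>),
          add = (\<lambda>g h. \<lambda>V\<in>opens U. \<lambda>s\<in>carrier (sections F V). g V s \<oplus>\<^bsub>sections Ox V\<^esub> h V s),
          smult = (\<lambda>r h. \<lambda>V\<in>opens U. \<lambda>s\<in>carrier (sections F V).
            restr Ox U V r \<otimes>\<^bsub>sections Ox V\<^esub> h V s)\<rparr>),
       restr = (\<lambda>U V h. restrict h (opens V))\<rparr>)"

definition free_sheaf :: "('p, 'r, 'z) ringed_space_scheme \<Rightarrow> nat \<Rightarrow> ('p, 'r, nat \<Rightarrow> 'r) mod_presheaf" where
  "free_sheaf X n =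
     \<lparr>sections = (\<lambda>U. let R = sections (str_sheaf X) U in
        \<lparr>carrier = {..<n} \<rightarrow>\<^sub>E carrier R, mult = undefined, one = undefined,
         zero = (\<lambda>i\<in>{..<n}. \<zero>\<^bsub>R\<^esub>),
         add = (\<lambda>f g. \<lambda>i\<in>{..<n}. f i \<oplus>\<^bsub>R\<^esub> g i),
         smult = (\<lambda>r f. \<lambda>i\<in>{..<n}. r \<otimes>\<^bsub>R\<^esub> f i)\<rparr>),
      restr = (\<lambda>U V f. \<lambda>i\<in>{..<n}. restr (str_sheaf X) U V (f i))\<rparr>"

definition locally_free :: "('p, 'r, 'z) ringed_space_scheme \<Rightarrow> nat \<Rightarrow> ('p, 'r, 'm) mod_presheaf \<Rightarrow> bool"
  where
  "locally_free X n F \<longleftrightarrow> mod_sheaf X F \<and>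
     (\<forall>x\<in>topspace (space_top X). \<exists>U h. openin (space_top X) U \<and> x \<in> U \<and>
        mod_sheaf_hom X U (free_sheaf X n) F h \<and>
        (\<forall>V. openin (space_top X) V \<and> V \<subseteq> U \<longrightarrow>
           bij_betw (h V) (carrier (sections (free_sheaf X n) V)) (carrier (sections F V))))"

definition vector_bundle :: "('p, 'r, 'z) ringed_space_scheme \<Rightarrow> ('p, 'r, 'm) mod_presheaf \<Rightarrow> bool" where
  "vector_bundle X E \<longleftrightarrow> (\<exists>n\<ge>1. locally_free X n E)"

definition line_bundle :: "('p, 'r, 'z) ringed_space_scheme \<Rightarrow> ('p, 'r, 'm) mod_presheaf \<Rightarrow> bool" where
  "line_bundle X L \<longleftrightarrow> locally_free X 1 L"

section \<open>Ample line bundles\<close>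

definition in_image_sheaf ::
  "('p, 'r, 'z) ringed_space_scheme \<Rightarrow> ('p, 'r, 'm) mod_presheaf \<Rightarrow> ('p, 'r, 'n) mod_presheaf \<Rightarrow>
   ('p set \<Rightarrow> 'm \<Rightarrow> 'n) \<Rightarrow> 'p set \<Rightarrow> 'n \<Rightarrow> bool" where
  "in_image_sheaf X F G h V t \<longleftrightarrow>
     (\<forall>x\<in>V. \<exists>W. openin (space_top X) W \<and> x \<in> W \<and> W \<subseteq> V \<and>
        restr G V W t \<in> h W ` carrier (sections F W))"

text \<open>
  On a noetherian scheme the coherent sheaves are the sheaves of modules which locally are
  cokernels of homomorphisms \<open>O\<^sup>m \<rightarrow> O\<^sup>n\<close>.
\<close>

definition coherent :: "('p, 'r, 'z) ringed_space_scheme \<Rightarrow> ('p, 'r, 'm) mod_presheaf \<Rightarrow> bool" where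
  "coherent X F \<longleftrightarrow> mod_sheaf X F \<and>
     (\<forall>x\<in>topspace (space_top X). \<exists>U m n g h. openin (space_top X) U \<and> x \<in> U \<and>
        mod_sheaf_hom X U (free_sheaf X m) (free_sheaf X n) g \<and>
        mod_sheaf_hom X U (free_sheaf X n) F h \<and>
        (\<forall>V. openin (space_top X) V \<and> V \<subseteq> U \<longrightarrow>
           (\<forall>t\<in>carrier (sections F V). in_image_sheaf X (free_sheaf X n) F h V t) \<and>
           (\<forall>s\<in>carrier (sections (free_sheaf X n) V).
              h V s = \<zero>\<^bsub>sections F V\<^esub> \<longleftrightarrow>
              in_image_sheaf X (free_sheaf X m) (free_sheaf X n) g V s)))"

definition globally_generated ::
  "('p, 'r, 'z) ringed_space_scheme \<Rightarrow> ('p, 'r, 'm) mod_presheaf \<Rightarrow> bool" where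
  "globally_generated X F \<longleftrightarrow>
     (let T = space_top X in
      \<forall>x\<in>topspace T.
        submodule_span (stalk_ring X x) (stalk_module X F x)
          (germ T F x (topspace T) ` carrier (sections F (topspace T)))
        = carrier (stalk_module X F x))"

text \<open>
  A line bundle \<open>L\<close> is ample if for every coherent sheaf \<open>F\<close> the sheaves \<open>F \<otimes> L\<^sup>n\<close> are globally
  generated for all large \<open>n\<close>. HOL cannot quantify over the type in which the sections of \<open>F\<close>
  live, but the type of families \<open>'p \<Rightarrow> nat \<Rightarrow> ('p set \<times> 'r) set\<close> of germs of functions is large
  enough to contain a copy of every coherent sheaf: identify a section with the family of
  coordinates, with respect to local generators, of its germs at all points.
\<close>

definition ample :: "('p, 'r, 'z) ringed_space_scheme \<Rightarrow> ('p, 'r, 'm) mod_presheaf \<Rightarrow> bool" where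
  "ample X L \<longleftrightarrow> line_bundle X L \<and>
     (\<forall>F :: ('p, 'r, 'p \<Rightarrow> nat \<Rightarrow> ('p set \<times> 'r) set) mod_presheaf. coherent X F \<longrightarrow>
        (\<exists>n\<^sub>0. \<forall>n\<ge>n\<^sub>0. globally_generated X (tensor_sheaf X F (tensor_power_sheaf X n L))))"

section \<open>Base loci\<close>

text \<open>The fibre \<open>V(x) = V\<^sub>x \<otimes> \<kappa>(x)\<close>, as a module over the local ring at \<open>x\<close>.\<close>

definition fibre ::
  "('p, 'r, 'z) ringed_space_scheme \<Rightarrow> ('p, 'r, 'm) mod_presheaf \<Rightarrow> 'p \<Rightarrow>
   (('p set \<times> 'r) set,
    (('p set \<times> 'm) set \<times> ('p set \<times> 'r) set set \<Rightarrow> ('p set \<times> 'r) set) set) module" where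
  "fibre X V x =
     tensor_module (stalk_ring X x) (stalk_module X V x) (residue_field_module (stalk_ring X x))"

definition fibre_value ::
  "('p, 'r, 'z) ringed_space_scheme \<Rightarrow> ('p, 'r, 'm) mod_presheaf \<Rightarrow> 'p \<Rightarrow> 'm \<Rightarrow>
   (('p set \<times> 'm) set \<times> ('p set \<times> 'r) set set \<Rightarrow> ('p set \<times> 'r) set) set" where
  "fibre_value X V x s =
     (let K = residue_field_module (stalk_ring X x) in
      pure_tensor (stalk_ring X x) (stalk_module X V x) K
        (germ (space_top X) V x (topspace (space_top X)) s) \<one>\<^bsub>K\<^esub>)"

text \<open>
  Surjectivity of \<open>H\<^sup>0(X, V) \<rightarrow> V(x)\<close> is understood \<open>\<kappa>(x)\<close>-linearly: the values of the global
  sections span \<open>V(x)\<close>. The span over the local ring is the span over \<open>\<kappa>(x)\<close>. At a closed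
  point \<open>\<kappa>(x) = k\<close> and the image of \<open>H\<^sup>0(X, V)\<close> is a subspace, so there this is plain
  surjectivity.
\<close>

definition Bs :: "('p, 'r, 'z) ringed_space_scheme \<Rightarrow> ('p, 'r, 'm) mod_presheaf \<Rightarrow> 'p set" where
  "Bs X V =
     {x \<in> topspace (space_top X).
        submodule_span (stalk_ring X x) (fibre X V x)
          (fibre_value X V x ` carrier (sections V (topspace (space_top X))))
        \<noteq> carrier (fibre X V x)}"

text \<open>
  The base loci of \<open>E\<close> computed with the ample line bundle \<open>H\<close>; the negative powers of \<open>H\<close> are
  the tensor powers of its dual.
\<close>

definition B_plus ::
  "('p, 'r, 'z) ringed_space_scheme \<Rightarrow> ('p, 'r, 'h) mod_presheaf \<Rightarrow> ('p, 'r, 'e) mod_presheaf \<Rightarrow> 'p set"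
  where
  "B_plus X H E =
     (\<Inter>q\<in>{1..}. \<Inter>m\<in>{1..}.
        Bs X (tensor_sheaf X (sym_sheaf X m (sym_sheaf X q E))
                (tensor_power_sheaf X m (dual_sheaf X H))))"

definition B_minus ::
  "('p, 'r, 'z) ringed_space_scheme \<Rightarrow> ('p, 'r, 'h) mod_presheaf \<Rightarrow> ('p, 'r, 'e) mod_presheaf \<Rightarrow> 'p set"
  where
  "B_minus X H E =
     (\<Union>q\<in>{1..}. \<Inter>m\<in>{1..}.
        Bs X (tensor_sheaf X (sym_sheaf X m (sym_sheaf X q E)) (tensor_power_sheaf X m H)))"

end

(* A projective variety is integral, so it has a generic point, and on a locally free sheaf the
   restriction maps to it are injective.  Hence every sheaf that occurs is named by a family of
   lattices M x, one for each point x, in one polynomial ring over the ring of germs at the generic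
   point; tensor products with line bundles become multiplication by units, symmetric powers become
   powers of lattices of linear forms, and by Nakayama's lemma x lies outside of Bs F iff M x is
   generated by the global sections.

   The ample line bundles A and H can be exchanged because some power of one, divided by the other,
   is globally generated.  One half of the comparison holds since S^m S^q E maps onto S^(mq) E.  For
   the other half, comultiplication S^(kq) E -> S^k S^q E sends l^(kq) to a non-zero multiple of
   (l^q)^k, and in characteristic zero the q-th powers l^q generate S^q E; a remaining factor of
   bounded degree is generated after a twist by an ample line bundle. *)
theory Submission
  imports Defs
begin

text \<open>Symmetric and tensor powers are sheafified quotients of free modules on sets of
  sections, so each construction changes the type of sections, and S^m S^q E nests two of them.
  Naming by subsets of one commutative ring type removes this nesting. The price is that equality of
  sections becomes congruence modulo an ideal of names of zero: the generic stalk is a ring on a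
  carrier set, and a type can only surject onto it. A product of linear forms is a faithful name for
  an element of S^q only if monomials in a frame are independent. Hence frames are kept inside the
  span of a set of variables (\<open>lintype\<close>), and once S^q is formed its monomials are
  renamed as new variables (\<open>rn\<close>), so that S^m can be formed in the same way. In the
  hard half the constant \<open>k0 = n * (c + 1)\<close> is chosen so that a factor z^k0 uses up
  only the twist h^(c n) out of the available h^k0. The n spare twists per factor accumulate until
  they generate the remaining factor, whose degree is bounded by the pigeonhole principle.\<close>

abbreviation (input) "Sec \<equiv> sections"
abbreviation (input) "cr \<equiv> carrier"
abbreviation (input) "oin \<equiv> openin"
abbreviation (input) "bas \<equiv> basis_elt"
abbreviation (input) "FM \<equiv> free_module"
abbreviation (input) "sspan \<equiv> submodule_span"
abbreviation (input) radd ("_ +[_] _" [65, 0, 66] 65) where "a +[R] b \<equiv> a \<oplus>\<^bsub>R\<^esub> b"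
abbreviation (input) rmult ("_ *[_] _" [70, 0, 71] 70) where "a *[R] b \<equiv> a \<otimes>\<^bsub>R\<^esub> b"
abbreviation (input) rsmult ("_ #[_] _" [70, 0, 71] 70) where "a #[M] b \<equiv> a \<odot>\<^bsub>M\<^esub> b"
abbreviation (input) rzero ("0[_]") where "0[R] \<equiv> \<zero>\<^bsub>R\<^esub>"
abbreviation (input) rone ("1[_]") where "1[R] \<equiv> \<one>\<^bsub>R\<^esub>"
notation (input) subset_eq (infix "[=" 50)

section \<open>Linear algebra over ring records: quotients, free modules, presentations\<close>

section \<open>Modules given by generators and relations\<close>

locale mrec = module R M for R :: "('r, 'a) ring_scheme" (structure) and M :: "('r, 'm) module" (structure)
begin

lemma span_sub: assumes "S [= cr M" shows "submodule (sspan R M S) R M"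
proof -
 let ?C = "{N. submodule N R M & S [= N}"
 have c: "cr M : ?C" using carrier_is_submodule assms by auto
 show ?thesis unfolding submodule_span_def
 proof (rule submoduleI)
  show "\<Inter>?C [= cr M" using c by blast
  show "0[M] : \<Inter>?C" using subgroup.one_closed[OF submodule.axioms(1)] by fastforce
  show "\<ominus>\<^bsub>M\<^esub> a : \<Inter>?C" if "a : \<Inter>?C" for a using that by(auto simp: submoduleE(3))
  show "a +[M] b : \<Inter>?C" if "a : \<Inter>?C" "b : \<Inter>?C" for a b using that by(auto simp: submoduleE(5))
  show "r #[M] a : \<Inter>?C" if "r : cr R" "a : \<Inter>?C" for r a using that by(auto simp: submoduleE(4))
 qed
qed

lemma span_incl: "S [= sspan R M S" unfolding submodule_span_def by blast

lemma span_least: "submodule H R M ==> S [= H ==> sspan R M S [= H" unfolding submodule_span_def by blast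

lemma sub_zero: "submodule H R M ==> 0[M] : H" using subgroup.one_closed[OF submodule.axioms(1)] by fastforce

lemma submodule_coset_eq: assumes H: "submodule H R M" and x: "x : cr M" and y: "y : cr M"
 shows "H +>\<^bsub>M\<^esub> x = H +>\<^bsub>M\<^esub> y \<longleftrightarrow> x \<ominus>\<^bsub>M\<^esub> y : H"
proof -
 have sg: "subgroup H (add_monoid M)" using H by(rule submodule.axioms(1))
 have hc: "H [= cr M" using submoduleE(1)[OF H] .
 show ?thesis
 proof
  assume e: "H +>\<^bsub>M\<^esub> x = H +>\<^bsub>M\<^esub> y"
  have "x : H +>\<^bsub>M\<^esub> x" using a_rcosI[OF sub_zero[OF H] hc x] x by simp
  hence "x : H +>\<^bsub>M\<^esub> y" by(simp only: e)
  then obtain h where "h : H" "x = h +[M] y" unfolding a_r_coset_def' by auto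
  thus "x \<ominus>\<^bsub>M\<^esub> y : H" using hc y by(auto simp: a_minus_def M.a_assoc M.r_neg)
 next
  assume d: "x \<ominus>\<^bsub>M\<^esub> y : H"
  have "x = (x \<ominus>\<^bsub>M\<^esub> y) +[M] y" using x y by(simp add: a_minus_def M.a_assoc M.l_neg)
  hence "x : H +>\<^bsub>M\<^esub> y" using a_rcosI[OF d hc y] by simp
  thus "H +>\<^bsub>M\<^esub> x = H +>\<^bsub>M\<^esub> y" using a_repr_independence[OF _ y sg] by simp
 qed
qed

lemma quotient_carrier: "cr (quotient_module M H) = {H +>\<^bsub>M\<^esub> x | x. x : cr M}"
 unfolding quotient_module_def A_RCOSETS_def RCOSETS_def a_r_coset_def by auto

lemma quotient_zero: "0[quotient_module M H] = H" unfolding quotient_module_def by simp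

lemma quotient_add: assumes "submodule H R M" "x : cr M" "y : cr M"
 shows "(H +>\<^bsub>M\<^esub> x) +[quotient_module M H] (H +>\<^bsub>M\<^esub> y) = H +>\<^bsub>M\<^esub> (x +[M] y)"
proof -
 have "abelian_subgroup H M" by(rule abelian_subgroupI3) (auto intro: additive_subgroup.intro submodule.axioms(1) assms M.abelian_group_axioms)
 thus ?thesis using abelian_subgroup.a_rcos_sum[of H M x y] assms by(simp add: quotient_module_def)
qed

lemma quotient_smult: assumes H: "submodule H R M" and r: "r : cr R" and x: "x : cr M"
 shows "r #[quotient_module M H] (H +>\<^bsub>M\<^esub> x) = H +>\<^bsub>M\<^esub> (r #[M] x)"
proof -
 have hc: "H [= cr M" using submoduleE(1)[OF H] .
 \<comment> \<open>Scalar multiplication of cosets is defined as a union over all representatives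
   \<open>z\<close>; the members of this union coincide, so it collapses.\<close>
 have "H +>\<^bsub>M\<^esub> (r #[M] z) = H +>\<^bsub>M\<^esub> (r #[M] x)" if "z : H +>\<^bsub>M\<^esub> x" for z
 proof -
  from that obtain h where h: "h : H" "z = h +[M] x" unfolding a_r_coset_def' by auto
  hence hm: "h : cr M" using hc by auto
  have rh: "r #[M] h : H" using submodule.smult_closed[OF H r h(1)] .
  have "r #[M] z \<ominus>\<^bsub>M\<^esub> r #[M] x = r #[M] h" using hm x r by(simp add: h smult_r_distr a_minus_def M.a_assoc M.r_neg)
  thus ?thesis using submodule_coset_eq[OF H] rh hm x r h by simp
 qed
 moreover have "x : H +>\<^bsub>M\<^esub> x" using a_rcosI[OF sub_zero[OF H] hc x] x by simp
 ultimately have "(UN z:H +>\<^bsub>M\<^esub> x. H +>\<^bsub>M\<^esub> (r #[M] z)) = H +>\<^bsub>M\<^esub> (r #[M] x)" by(meson UN_constant_eq)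
 thus ?thesis unfolding quotient_module_def by simp
qed

lemma quotient_is_module: assumes H: "submodule H R M" shows "module R (quotient_module M H)"
proof -
 let ?Q = "quotient_module M H"
 have car: "cr ?Q = (%x. H +>\<^bsub>M\<^esub> x) ` cr M" unfolding quotient_carrier by auto
 have hc: "H [= cr M" using submoduleE(1)[OF H] .
 have z: "0[?Q] = H +>\<^bsub>M\<^esub> 0[M]" by(simp add: quotient_zero a_coset_add_zero[OF hc])
 note simps = quotient_add[OF H] quotient_smult[OF H]
 have "abelian_group ?Q"
 proof (rule abelian_groupI)
  fix X assume "X : cr ?Q"
  then obtain x where x: "x : cr M" "X = H +>\<^bsub>M\<^esub> x" unfolding car by auto
  thus "EX y:cr ?Q. y +[?Q] X = 0[?Q]" by(intro bexI[of _ "H +>\<^bsub>M\<^esub> (\<ominus>\<^bsub>M\<^esub> x)"]) (auto simp: simps z M.l_neg car)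
 next
  fix X Y assume "X : cr ?Q" "Y : cr ?Q"
  then obtain x y where "x : cr M" "X = H +>\<^bsub>M\<^esub> x" "y : cr M" "Y = H +>\<^bsub>M\<^esub> y" unfolding car by auto
  thus "X +[?Q] Y = Y +[?Q] X" by(simp add: simps M.a_comm[of x])
 qed (auto simp: car simps z M.a_assoc)
 thus ?thesis by(rule moduleI[OF R.is_cring]) (auto simp: car simps smult_l_distr smult_r_distr smult_assoc1)
qed

end

lemma free_sel [simp]: "0[FM R S] = (%_. 0[R])" "f +[FM R S] g = (%s. f s +[R] g s)" "r #[FM R S] f = (%s. r *[R] f s)"
 by(simp_all add: free_module_def)

lemma f_cr: "f : cr (FM R S) \<longleftrightarrow> (ALL s:S. f s : cr R) & (ALL s. s \<notin> S --> f s = 0[R]) & finite {s. f s ~= 0[R]}"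
 by(simp add: free_module_def)

context cring
begin

lemma f_val: "f : cr (FM R S) ==> f s : cr R" by(cases "s : S") (auto simp: f_cr)

lemma f_add: assumes "f : cr (FM R S)" "g : cr (FM R S)" shows "(%s. f s \<oplus> g s) : cr (FM R S)"
proof -
 have "{s. f s \<oplus> g s ~= \<zero>} [= {s. f s ~= \<zero>} Un {s. g s ~= \<zero>}" by auto
 moreover have "finite ({s. f s ~= \<zero>} Un {s. g s ~= \<zero>})" using assms by(simp add: f_cr)
 ultimately have "finite {s. f s \<oplus> g s ~= \<zero>}" by(rule finite_subset)
 thus ?thesis using assms unfolding f_cr by auto
qed

lemma f_smult: assumes "f : cr (FM R S)" "r : cr R" shows "(%s. r \<otimes> f s) : cr (FM R S)"
proof -
 have "{s. r \<otimes> f s ~= \<zero>} [= {s. f s ~= \<zero>}" using assms by auto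
 moreover have "finite {s. f s ~= \<zero>}" using assms by(simp add: f_cr)
 ultimately have "finite {s. r \<otimes> f s ~= \<zero>}" by(rule finite_subset)
 thus ?thesis using assms unfolding f_cr by auto
qed

lemma f_mod: "module R (FM R S)"
proof -
 let ?F = "FM R S"
 note val = f_val
 have "abelian_group ?F"
 proof (rule abelian_groupI)
  fix f assume f: "f : cr ?F"
  have "(%s. (\<ominus> \<one>) \<otimes> f s) : cr ?F" by(rule f_smult[OF f]) simp
  moreover have "(%s. (\<ominus> \<one>) \<otimes> f s \<oplus> f s) = (%s. \<zero>)" using val[OF f] by(intro ext) (simp add: l_minus l_neg)
  ultimately show "EX g:cr ?F. g +[?F] f = 0[?F]" by auto
 next
  show "0[?F] : cr ?F" by(simp add: f_cr)
 qed (auto simp: f_add fun_eq_iff val a_ac)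
 thus ?thesis by(rule moduleI[OF is_cring]) (auto simp: f_smult fun_eq_iff val l_distr r_distr m_assoc)
qed

lemma free_a_inv: assumes f: "f : cr (FM R S)" shows "\<ominus>\<^bsub>FM R S\<^esub> f = (%s. \<ominus> f s)"
proof -
 interpret F: mrec R "FM R S" by(intro mrec.intro f_mod)
 have "\<ominus>\<^bsub>FM R S\<^esub> f = (\<ominus> \<one>) #[FM R S] f" using F.smult_l_minus[of \<one> f] f F.smult_one by simp
 also have "\<dots> = (%s. \<ominus> f s)" using f_val[OF f] by(simp add: l_minus)
 finally show ?thesis .
qed

lemma free_minus: assumes "f : cr (FM R S)" "g : cr (FM R S)" shows "f \<ominus>\<^bsub>FM R S\<^esub> g = (%s. f s \<ominus> g s)"
 using assms by(simp add: a_minus_def free_a_inv)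

lemma bas_cr: "s : S ==> bas R s : cr (FM R S)" unfolding f_cr basis_elt_def by(auto intro: finite_subset[of _ "{s}"])

text \<open>Induction on the finite support, removing one coefficient at a time; it reduces linear
  statements about formal sums to basis elements.\<close>

lemma free_induct [consumes 1, case_names zero add]: assumes f: "f : cr (FM R S)" and z: "P (%_. \<zero>)"
  and a: "!!r s g. r : cr R ==> s : S ==> g : cr (FM R S) ==> P g ==> P (%t. r \<otimes> bas R s t \<oplus> g t)" shows "P f"
proof -
 have "finite {s. f s ~= \<zero>}" using f by(simp add: f_cr)
 thus ?thesis using f
 proof (induction "{s. f s ~= \<zero>}" arbitrary: f rule: finite_induct)
  case empty
  hence "f = (%_. \<zero>)" by auto
  thus ?case using z by simp
 next
  case (insert x A)
  let ?g = "f(x := \<zero>)"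
  have x: "f x ~= \<zero>" "x : S" using insert.hyps insert.prems by(auto simp: f_cr)
  have A: "A = {s. ?g s ~= \<zero>}" using insert.hyps by auto
  have g: "?g : cr (FM R S)" using insert.prems insert.hyps(1) A unfolding f_cr by auto
  have "P ?g" by(rule insert.hyps(3)[OF A g])
  from a[OF f_val[OF insert.prems, of x] x(2) g this]
  have "P (%t. f x \<otimes> bas R x t \<oplus> ?g t)" .
  moreover have "(%t. f x \<otimes> bas R x t \<oplus> ?g t) = f" using f_val[OF insert.prems] by(auto simp: basis_elt_def fun_eq_iff)
  ultimately show ?case by simp
 qed
qed

lemma free_submodule_all: assumes H: "submodule H R (FM R S)" and b: "!!s. s : S ==> bas R s : H" shows "cr (FM R S) [= H"
proof
 interpret F: mrec R "FM R S" by(intro mrec.intro f_mod)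
 fix f assume "f : cr (FM R S)"
 thus "f : H"
 proof (induction rule: free_induct)
  case zero
  thus ?case using F.sub_zero[OF H] by simp
 next
  case (add r s g)
  have "r #[FM R S] bas R s +[FM R S] g : H" by(intro F.submoduleE(5)[OF H] F.submoduleE(4)[OF H] b add)
  thus ?case by simp
 qed
qed

end

locale presented = cring R for R (structure) + fixes S :: "'s set" and Rel assumes Rel_sub: "Rel [= cr (FM R S)"
begin

abbreviation "F \<equiv> FM R S"
abbreviation "Sp \<equiv> sspan R F Rel"
abbreviation "P \<equiv> presented_module R S Rel"
abbreviation "cls \<equiv> presented_class R S Rel"

lemma F_mod: "mrec R F" by(intro mrec.intro f_mod)

lemma F_ab: "abelian_group F" using f_mod by(rule module.axioms)

lemma Sp_sub: "submodule Sp R F" using mrec.span_sub[OF F_mod Rel_sub] .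

lemma pres_carrier: "cr P = {cls f | f. f : cr F}" unfolding presented_module_def presented_class_def by(rule mrec.quotient_carrier[OF F_mod])

lemma pres_zero: "0[P] = cls (%_. \<zero>)" unfolding presented_module_def presented_class_def mrec.quotient_zero[OF F_mod]
 using abelian_group.a_coset_add_zero[OF F_ab, of Sp] module.submoduleE(1)[OF f_mod Sp_sub] by simp

lemma pres_add: "f : cr F ==> g : cr F ==> cls f +[P] cls g = cls (%s. f s \<oplus> g s)"
 unfolding presented_module_def presented_class_def using mrec.quotient_add[OF F_mod Sp_sub] by simp

lemma pres_smult: "r : cr R ==> f : cr F ==> r #[P] cls f = cls (%s. r \<otimes> f s)"
 unfolding presented_module_def presented_class_def using mrec.quotient_smult[OF F_mod Sp_sub] by simp

lemma cls_eq: "f : cr F ==> g : cr F ==> cls f = cls g \<longleftrightarrow> (%s. f s \<ominus> g s) : Sp"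
 unfolding presented_class_def using mrec.submodule_coset_eq[OF F_mod Sp_sub] free_minus[of f S g] by simp

lemma pres_module: "module R P" unfolding presented_module_def by(rule mrec.quotient_is_module[OF F_mod Sp_sub])

text \<open>\<open>presented_map\<close> is a union over all members of a class; this lemma and
  \<open>cls_self\<close> are what is needed to evaluate it.\<close>

lemma cls_mem: "f : cr F ==> g : cls f ==> g : cr F & (%s. g s \<ominus> f s) : Sp"
proof -
 assume f: "f : cr F" and "g : cls f"
 then obtain h where h: "h : Sp" "g = h +[F] f" unfolding presented_class_def a_r_coset_def' by auto
 have hc: "h : cr F" using h module.submoduleE(1)[OF f_mod Sp_sub] by auto
 have "(%s. g s \<ominus> f s) = h" using f_val[OF hc] f_val[OF f] by(auto simp: h fun_eq_iff a_minus_def a_assoc r_neg)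
 thus ?thesis using h hc f f_add by simp
qed

lemma cls_self: "f : cr F ==> f : cls f" unfolding presented_class_def
 using abelian_group.a_rcosI[OF F_ab mrec.sub_zero[OF F_mod Sp_sub] module.submoduleE(1)[OF f_mod Sp_sub], of f] f_val[of f] by(simp add: fun_eq_iff)

end

subsection \<open>Induced maps\<close>

locale push = A: cring R + B: cring R' for R :: "('r, 'a) ring_scheme" and R' :: "('r2, 'b) ring_scheme" +
 fixes \<rho> and S :: "'s set" and S' :: "'t set" and te assumes hom: "\<rho> : ring_hom R R'" and te: "te : S \<rightarrow> S'"
begin

abbreviation "F \<equiv> FM R S"
abbreviation "F' \<equiv> FM R' S'"
abbreviation "pu \<equiv> push_formal_sum R R' \<rho> te"

lemma F_mod: "mrec R F" by(intro mrec.intro A.f_mod)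

lemma F'_mod: "mrec R' F'" by(intro mrec.intro B.f_mod)

lemma h: "ring_hom_cring R R' \<rho>" using hom by(intro ring_hom_cring.intro ring_hom_cring_axioms.intro A.is_cring B.is_cring)

lemmas h_simps [simp] = ring_hom_closed[OF hom] ring_hom_add[OF hom] ring_hom_mult[OF hom] ring_hom_cring.hom_zero[OF h] ring_hom_one[OF hom]
 ring_hom_cring.hom_a_inv[OF h]

lemma push_alt: assumes f: "f : cr F" and A: "finite A" "{s. f s ~= 0[R]} [= A"
 shows "pu f t = (\<Oplus>\<^bsub>R'\<^esub>s\<in>{s\<in>A. te s = t}. \<rho> (f s))"
proof -
 have "(\<Oplus>\<^bsub>R'\<^esub>s\<in>{s\<in>A. te s = t}. \<rho> (f s)) =
   (\<Oplus>\<^bsub>R'\<^esub>s\<in>{s. f s ~= 0[R] & te s = t}. \<rho> (f s))"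
  using A A.f_val[OF f] by(intro B.add.finprod_mono_neutral_cong_left[symmetric]) auto
 thus ?thesis unfolding push_formal_sum_def by simp
qed

lemma push_closed: assumes f: "f : cr F" shows "pu f : cr F'"
proof -
 let ?A = "{s. f s ~= 0[R]}"
 have A: "finite ?A" "?A [= S" using f by(auto simp: f_cr)
 have v: "pu f t : cr R'" for t unfolding push_formal_sum_def using A.f_val[OF f] by(intro B.finsum_closed) auto
 have z: "pu f t = 0[R']" if "t \<notin> te ` ?A" for t
 proof -
  have "{s. f s ~= 0[R] & te s = t} = {}" using that by auto
  thus ?thesis unfolding push_formal_sum_def by(metis B.finsum_empty)
 qed
 have "finite {t. pu f t ~= 0[R']}" by(rule finite_subset[of _ "te ` ?A"]) (use z A in auto)
 moreover have "t \<notin> S' ==> pu f t = 0[R']" for t using z A te by(intro z) auto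
 ultimately show ?thesis using v unfolding f_cr by auto
qed

lemma push_add: assumes f: "f : cr F" and g: "g : cr F" shows "pu (%s. f s +[R] g s) = (%t. pu f t +[R'] pu g t)"
proof
 fix t
 let ?A = "{s. f s ~= 0[R]} Un {s. g s ~= 0[R]}"
 have A: "finite ?A" using f g by(auto simp: f_cr)
 note v = A.f_val[OF f] A.f_val[OF g]
 have "pu (%s. f s +[R] g s) t = (\<Oplus>\<^bsub>R'\<^esub>s\<in>{s\<in>?A. te s = t}. \<rho> (f s +[R] g s))"
  by(rule push_alt[OF A.f_add[OF f g] A]) auto
 also have "\<dots> = (\<Oplus>\<^bsub>R'\<^esub>s\<in>{s\<in>?A. te s = t}. \<rho> (f s) +[R'] \<rho> (g s))" using v by(intro B.finsum_cong') auto
 also have "\<dots> = (\<Oplus>\<^bsub>R'\<^esub>s\<in>{s\<in>?A. te s = t}. \<rho> (f s)) +[R'] (\<Oplus>\<^bsub>R'\<^esub>s\<in>{s\<in>?A. te s = t}. \<rho> (g s))"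
  using v by(intro B.finsum_addf) auto
 also have "\<dots> = pu f t +[R'] pu g t" using push_alt[OF f A] push_alt[OF g A] by simp
 finally show "pu (%s. f s +[R] g s) t = pu f t +[R'] pu g t" .
qed

lemma push_smult: assumes r: "r : cr R" and f: "f : cr F" shows "pu (%s. r *[R] f s) = (%t. \<rho> r *[R'] pu f t)"
proof
 fix t
 let ?A = "{s. f s ~= 0[R]}"
 have A: "finite ?A" using f by(auto simp: f_cr)
 note v = A.f_val[OF f]
 have "pu (%s. r *[R] f s) t = (\<Oplus>\<^bsub>R'\<^esub>s\<in>{s\<in>?A. te s = t}. \<rho> (r *[R] f s))"
  by(rule push_alt[OF A.f_smult[OF f r] A]) (use r in auto)
 also have "\<dots> = (\<Oplus>\<^bsub>R'\<^esub>s\<in>{s\<in>?A. te s = t}. \<rho> r *[R'] \<rho> (f s))" using v r by(intro B.finsum_cong') auto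
 also have "\<dots> = \<rho> r *[R'] (\<Oplus>\<^bsub>R'\<^esub>s\<in>{s\<in>?A. te s = t}. \<rho> (f s))"
  using v r A by(intro B.finsum_rdistr[symmetric]) auto
 also have "\<dots> = \<rho> r *[R'] pu f t" using push_alt[OF f A] by simp
 finally show "pu (%s. r *[R] f s) t = \<rho> r *[R'] pu f t" .
qed

lemma push_zero: "pu (%_. 0[R]) = (%_. 0[R'])" using B.finsum_empty by(simp add: push_formal_sum_def)

lemma push_minus: assumes f: "f : cr F" and g: "g : cr F"
 shows "pu (%s. f s \<ominus>\<^bsub>R\<^esub> g s) = (%t. pu f t \<ominus>\<^bsub>R'\<^esub> pu g t)"
proof -
 have m: "\<ominus>\<^bsub>R\<^esub> 1[R] : cr R" by simp
 have "(%s. f s \<ominus>\<^bsub>R\<^esub> g s) = (%s. f s +[R] (\<ominus>\<^bsub>R\<^esub> 1[R]) *[R] g s)"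
  using A.f_val[OF g] by(simp add: a_minus_def A.l_minus)
 moreover have "(%t. pu f t \<ominus>\<^bsub>R'\<^esub> pu g t) = (%t. pu f t +[R'] \<rho> (\<ominus>\<^bsub>R\<^esub> 1[R]) *[R'] pu g t)"
  using B.f_val[OF push_closed[OF g]] by(simp add: a_minus_def B.l_minus)
 ultimately show ?thesis using push_add[OF f A.f_smult[OF g m]] push_smult[OF m g] by simp
qed

lemma push_basis: assumes s: "s : S" shows "pu (bas R s) = bas R' (te s)"
proof
 fix t
 have "pu (bas R s) t = (\<Oplus>\<^bsub>R'\<^esub>u\<in>{u\<in>{s}. te u = t}. \<rho> (bas R s u))"
  by(rule push_alt[OF A.bas_cr[OF s]]) (auto simp: basis_elt_def)
 also have "{u\<in>{s}. te u = t} = (if te s = t then {s} else {})" by auto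
 also have "(\<Oplus>\<^bsub>R'\<^esub>u\<in>(if te s = t then {s} else {}). \<rho> (bas R s u)) = bas R' (te s) t" by(auto simp: basis_elt_def)
 finally show "pu (bas R s) t = bas R' (te s) t" .
qed

text \<open>The formal sums that \<open>pu\<close> sends into the span of \<open>Rel'\<close> form a
  submodule, so it suffices to test the relations themselves.\<close>

lemma push_span: assumes Rel: "Rel [= cr F" and Rel': "Rel' [= cr F'" and r: "!!f. f : Rel ==> pu f : sspan R' F' Rel'" and f: "f : sspan R F Rel"
 shows "pu f : sspan R' F' Rel'"
proof -
 let ?Sp' = "sspan R' F' Rel'"
 interpret F: mrec R F by(rule F_mod)
 interpret F': mrec R' F' by(rule F'_mod)
 have sp: "submodule ?Sp' R' F'" by(rule F'.span_sub[OF Rel'])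
 have "submodule {f : cr F. pu f : ?Sp'} R F"
 proof (rule F.submoduleI)
  show "0[F] : {f : cr F. pu f : ?Sp'}" using F.zero_closed F'.sub_zero[OF sp] by(simp add: push_zero)
 next
  fix a assume a: "a : {f : cr F. pu f : ?Sp'}"
  have "\<ominus>\<^bsub>F\<^esub> a = 0[F] \<ominus>\<^bsub>F\<^esub> a" using a F.a_inv_closed by(simp add: a_minus_def del: free_sel)
  also have "\<dots> = (%s. 0[R] \<ominus>\<^bsub>R\<^esub> a s)" using A.free_minus[of _ S a] F.zero_closed a by simp
  finally have 1: "\<ominus>\<^bsub>F\<^esub> a = (%s. 0[R] \<ominus>\<^bsub>R\<^esub> a s)" .
  have "pu (\<ominus>\<^bsub>F\<^esub> a) = (%t. 0[R'] \<ominus>\<^bsub>R'\<^esub> pu a t)"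
   unfolding 1 using push_minus[of "%_. 0[R]" a] F.zero_closed a by(simp add: push_zero)
  also have "\<dots> = \<ominus>\<^bsub>F'\<^esub> pu a" using B.free_a_inv[OF push_closed[of a]] B.f_val[OF push_closed[of a]] a
   by(simp add: a_minus_def)
  also have "\<dots> : ?Sp'" using F'.submoduleE(3)[OF sp] a by simp
  finally show "\<ominus>\<^bsub>F\<^esub> a : {f : cr F. pu f : ?Sp'}" using a F.a_inv_closed by simp
 next
  fix a b assume "a : {f : cr F. pu f : ?Sp'}" "b : {f : cr F. pu f : ?Sp'}"
  thus "a +[F] b : {f : cr F. pu f : ?Sp'}" using F'.submoduleE(5)[OF sp, of "pu a" "pu b"] by(simp add: push_add A.f_add)
 next
  fix r x assume "r : cr R" "x : {f : cr F. pu f : ?Sp'}"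
  thus "r #[F] x : {f : cr F. pu f : ?Sp'}" using F'.submoduleE(4)[OF sp, of "\<rho> r" "pu x"] by(simp add: push_smult A.f_smult)
 qed auto
 hence "sspan R F Rel [= {f : cr F. pu f : ?Sp'}" by(rule F.span_least) (use Rel r in auto)
 thus ?thesis using f by auto
qed

text \<open>Two representatives of a class differ by an element of the span of \<open>Rel\<close>,
  which \<open>push_span\<close> sends into the span of \<open>Rel'\<close>; hence the union in
  \<open>presented_map\<close> runs over a constant family.\<close>

lemma presented_map_cls: assumes Rel: "Rel [= cr F" and Rel': "Rel' [= cr F'" and r: "!!f. f : Rel ==> pu f : sspan R' F' Rel'" and f: "f : cr F"
 shows "presented_map R R' S' Rel' \<rho> te (presented_class R S Rel f) = presented_class R' S' Rel' (pu f)"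
proof -
 interpret P: presented R S Rel by unfold_locales (rule Rel)
 interpret P': presented R' S' Rel' by unfold_locales (rule Rel')
 have "P'.cls (pu g) = P'.cls (pu f)" if "g : P.cls f" for g
 proof -
  have g: "g : cr F" "(%s. g s \<ominus>\<^bsub>R\<^esub> f s) : P.Sp" using P.cls_mem[OF f that] by auto
  show ?thesis using push_span[OF Rel Rel' r g(2)] push_minus[OF g(1) f] P'.cls_eq[of "pu g" "pu f"] push_closed[OF f] push_closed[OF g(1)] by auto
 qed
 thus ?thesis unfolding presented_map_def using P.cls_self[OF f] by(meson UN_constant_eq)
qed

end

section \<open>Congruence calculus in a type-class ring\<close>

section \<open>Submodules of a commutative ring over a subring\<close>

text \<open>Submodules of \<open>'w\<close> over a set \<open>A\<close> of scalars, of which no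
  structure is demanded. With \<open>A = UNIV\<close> this says that \<open>D\<close> is an ideal,
  which is how \<open>N\<close> is specified below.\<close>

definition osub :: "'w::comm_ring_1 set => 'w set => bool" where
 "osub A D \<longleftrightarrow> 0 : D & (ALL v:D. ALL w:D. v + w : D) & (ALL a:A. ALL v:D. a * v : D)"

definition osubring :: "'w::comm_ring_1 set => bool" where "osubring A \<longleftrightarrow> 1 : A & - 1 : A & osub A A"

lemma osubD: assumes "osub A D" shows "0 : D" "v : D ==> w : D ==> v + w : D" "a : A ==> v : D ==> a * v : D" using assms by(auto simp: osub_def)

lemma osrD: assumes "osubring A" shows "1 : A" "- 1 : A" "0 : A" "a : A ==> b : A ==> a + b : A" "a : A ==> b : A ==> a * b : A"
  "a : A ==> - a : A" "a : A ==> b : A ==> a - b : A"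
proof -
 show 1: "1 : A" "- 1 : A" "0 : A" "a : A ==> b : A ==> a + b : A" for a b using assms by(auto simp: osubring_def osub_def)
 show 2: "a : A ==> b : A ==> a * b : A" for a b using assms by(auto simp: osubring_def osub_def)
 show 3: "a : A ==> - a : A" for a using 2[of "- 1" a] 1 by simp
 show "a : A ==> b : A ==> a - b : A" using 1(4)[of a "- b"] 3 by simp
qed

lemma osubring_of_nat: "osubring A ==> of_nat n : A" by(induction n) (auto simp: osrD)

lemma osub_minus: "osubring A ==> osub A D ==> v : D ==> w : D ==> v - w : D"
 using osubD(2)[of A D v "- 1 * w"] osubD(3)[of A D "- 1" w] by(auto simp: osrD)

lemma osub_uminus: "osubring A ==> osub A D ==> v : D ==> - v : D" using osubD(3)[of A D "- 1" v] by(auto simp: osrD)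

lemma osub_sum: "osub A D ==> (!!i. i : I ==> f i : D) ==> sum f I : D" by(induction I rule: infinite_finite_induct) (auto simp: osubD)

lemma osub_mono: "osub A D ==> B [= A ==> osub B D" by(auto simp: osub_def)

text \<open>All lattices contain the ideal of names of zero, so membership in them depends only on
  the class modulo that ideal. This is the transfer rule used throughout.\<close>

lemma osub_tr: assumes "osub A D" "N [= D" "w - v : N" "v : D" shows "w : D" using osubD(2)[OF assms(1), of "w - v" v] assms by auto

inductive_set ospan :: "'w::comm_ring_1 set => 'w set => 'w set" for A S where zero: "0 : ospan A S"
| step: "a : A ==> s : S ==> v : ospan A S ==> a * s + v : ospan A S"

lemma ospan_least: assumes "osub A D" "S [= D" shows "ospan A S [= D"
proof
 fix v assume "v : ospan A S"
 thus "v : D" by induction (use assms in \<open>auto simp: osub_def\<close>)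
qed

lemma ospan_add: "v : ospan A S ==> w : ospan A S ==> v + w : ospan A S" by(induction rule: ospan.induct) (auto simp: add.assoc intro: ospan.step)

lemma ospan_mult: assumes "osub A A" "a : A" shows "v : ospan A S ==> a * v : ospan A S"
proof (induction rule: ospan.induct)
 case zero
 thus ?case by(simp add: ospan.zero)
next
 case (step b s v)
 hence "(a * b) * s + a * v : ospan A S" by(intro ospan.step) (use assms in \<open>auto simp: osub_def\<close>)
 thus ?case by(simp add: algebra_simps)
qed

lemma osub_ospan: "osub A A ==> osub A (ospan A S)" unfolding osub_def using ospan_add ospan_mult[of A] by(auto intro: ospan.zero simp: osub_def)

lemma osr_osub: "osubring A ==> osub A A" by(simp add: osubring_def)

lemma ospan_osub: "osubring A ==> osub A (ospan A S)" by(simp add: osub_ospan osubring_def)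

lemma ospanI: "osubring A ==> S [= ospan A S"
proof
 fix s assume "osubring A" "s : S"
 hence "1 * s + 0 : ospan A S" by(intro ospan.step ospan.zero) (auto simp: osrD)
 thus "s : ospan A S" by simp
qed

lemma ospan_mono: "A [= A' ==> S [= S' ==> ospan A S [= ospan A' S'"
proof
 fix v assume a: "A [= A'" "S [= S'" and "v : ospan A S"
 from this(3) show "v : ospan A' S'" by induction (use a in \<open>auto intro: ospan.intros\<close>)
qed

lemma ospan_product: assumes A: "osubring A" and v: "v : ospan A S" and w: "w : ospan A T"
  and D: "osub A D" and st: "!!s t. s : S ==> t : T ==> s * t : D" shows "v * w : D" using v
proof induction
 case zero
 thus ?case using D by(simp add: osubD)
next
 case (step a s v)
 from w have "s * w : D"
 proof induction
  case zero
  thus ?case using D by(simp add: osubD)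
 next
  case (step b t u)
  have "b * (s * t) + s * u : D" using step st \<open>s : S\<close> D by(auto simp: osubD)
  thus ?case by(simp add: algebra_simps)
 qed
 hence "a * (s * w) + v * w : D" using step D by(auto simp: osubD)
 thus ?case by(simp add: algebra_simps)
qed

text \<open>For finite \<open>B\<close> this is the span of \<open>B\<close> and \<open>N\<close>
  (\<open>fspan_ospan\<close>), but written with one coefficient function on \<open>B\<close>; only
  in this form can uniqueness of the coefficients be stated.\<close>

definition fspan :: "'w::comm_ring_1 set => 'w set => 'w set => 'w set" where
 "fspan N A B = {w. EX c. (ALL b:B. c b : A) & w - (SUM b:B. c b * b) : N}"

lemma osub_UNIV_minus: "osub UNIV N ==> a : N ==> b : N ==> a - b : N" using osubD(2)[of UNIV N a "- 1 * b"] osubD(3)[of UNIV N "- 1" b] by auto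

lemma osub_UNIV_uminus: "osub UNIV N ==> a : N ==> - a : N" using osubD(3)[of UNIV N "- 1" a] by auto

text \<open>The rules from here to \<open>c_refl\<close> are the calculus of congruence modulo the
  ideal \<open>N\<close>, which replaces equality of sections.\<close>

lemma c_sym: "osub UNIV N ==> a - b : N ==> b - a : N" using osub_UNIV_uminus[of N "a - b"] by simp

lemma c_trans: "osub UNIV N ==> a - b : N ==> b - c : N ==> a - c : N" using osubD(2)[of UNIV N "a - b" "b - c"] by simp

lemma c_add: "osub UNIV N ==> a - b : N ==> c - d : N ==> (a + c) - (b + d) : N" using osubD(2)[of UNIV N "a - b" "c - d"] by(simp add: algebra_simps)

lemma c_diff: "osub UNIV N ==> a - b : N ==> c - d : N ==> (a - c) - (b - d) : N"
 using osub_UNIV_minus[of N "a - b" "c - d"] by(simp add: algebra_simps)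

lemma c_mult: assumes "osub UNIV N" "a - b : N" "c - d : N" shows "a * c - b * d : N"
proof -
 have "c * (a - b) + b * (c - d) : N" using assms by(auto simp: osubD)
 thus ?thesis by(simp add: algebra_simps)
qed

lemma c_sum: "osub UNIV N ==> (!!i. i : I ==> f i - g i : N) ==> sum f I - sum g I : N" unfolding sum_subtractf[symmetric] by(rule osub_sum)

lemma c_mem: "osub UNIV N ==> a - b : N ==> a : N \<longleftrightarrow> b : N"
 using osubD(2)[of UNIV N "a - b" b] osub_UNIV_minus[of N a "a - b"] by auto

lemma c_refl: "osub UNIV N ==> a - a : N" by(simp add: osubD)

section \<open>Rings and modules named by elements of a commutative ring\<close>

text \<open>\<open>tu\<close> identifies \<open>A\<close> modulo \<open>N\<close> with the ring
  record \<open>R\<close>. The names live in a type-class ring, so identities between them can be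
  proved by \<open>algebra_simps\<close>.\<close>

locale nring = cring R for R :: "('r, 'z) ring_scheme" (structure) + fixes A N :: "'w::comm_ring_1 set" and tu :: "'w => 'r"
 assumes A: "osubring A" and N: "osub UNIV N" and NA: "N [= A" and tau_cl: "a : A ==> tu a : cr R" and tau_surj: "r : cr R ==> EX a:A. tu a = r"
  and tau_add: "a : A ==> b : A ==> tu (a + b) = tu a \<oplus> tu b" and tau_mult: "a : A ==> b : A ==> tu (a * b) = tu a \<otimes> tu b"
  and tau_one: "tu 1 = \<one>" and tau_ker: "a : A ==> tu a = \<zero> \<longleftrightarrow> a : N"
begin

lemma tau_zero: "tu 0 = \<zero>" using tau_ker[of 0] osrD[OF A] osubD(1)[OF N] by auto

lemma tau_uminus: "a : A ==> tu (- a) = \<ominus> tu a"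
 using tau_add[of "- a" a] tau_cl tau_zero osrD[OF A] by(metis add.left_inverse add.inv_equality minus_equality)

lemma tau_diff: "a : A ==> b : A ==> tu (a - b) = tu a \<ominus> tu b" using tau_add[of a "- b"] tau_uminus[of b] osrD[OF A] by(simp add: a_minus_def)

lemma tau_eq: "a : A ==> b : A ==> tu a = tu b \<longleftrightarrow> a - b : N"
proof -
 assume a: "a : A" and b: "b : A"
 have d: "a - b : A" by(rule osrD(7)[OF A a b])
 have "tu a = tu (a - b) \<oplus> tu b" using tau_add[OF d b] by simp
 thus ?thesis using tau_ker[OF d] tau_cl[OF d] tau_cl[OF b] by(metis add.r_cancel_one)
qed

definition lr :: "'r => 'w" where "lr r = (SOME a. a : A & tu a = r)"

lemma lr: "r : cr R ==> lr r : A" "r : cr R ==> tu (lr r) = r" using someI_ex[of "%a. a : A & tu a = r"] tau_surj[of r] unfolding lr_def by blast+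

lemma lr_tau: "a : A ==> lr (tu a) - a : N" by(simp add: lr tau_eq[symmetric] tau_cl)

lemma lr_cong: "r : cr R ==> a : A ==> tu a = r ==> lr r - a : N" using lr_tau by auto

lemma lr_add: "r : cr R ==> s : cr R ==> lr (r \<oplus> s) - (lr r + lr s) : N" by(intro lr_cong) (auto simp: lr tau_add osrD[OF A])

lemma lr_mult: "r : cr R ==> s : cr R ==> lr (r \<otimes> s) - lr r * lr s : N" by(intro lr_cong) (auto simp: lr tau_mult osrD[OF A])

lemma lr_one: "lr \<one> - 1 : N" by(intro lr_cong) (auto simp: tau_one osrD[OF A])

lemma lr_zero: "lr \<zero> : N" using lr_cong[of \<zero> 0] by(auto simp: tau_zero osrD[OF A])

text \<open>The value of a formal sum when the generator \<open>s\<close> is given the value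
  \<open>ga s\<close>. As \<open>lr\<close> merely chooses representatives, \<open>ev\<close> is
  linear only modulo \<open>N\<close>.\<close>

definition ev :: "('s => 'w) => ('s => 'r) => 'w" where "ev ga f = (\<Sum>s | f s ~= \<zero>. lr (f s) * ga s)"

lemma ev_alt: assumes B: "finite B" "{s. f s ~= \<zero>} [= B" shows "ev ga f - (SUM s:B. lr (f s) * ga s) : N"
proof -
 have "(SUM s:B. lr (f s) * ga s) = ev ga f + (SUM s:B - {s. f s ~= \<zero>}. lr (f s) * ga s)"
  unfolding ev_def using B by(subst sum.subset_diff[OF B(2)]) (auto simp: add.commute)
 moreover have "(SUM s:B - {s. f s ~= \<zero>}. lr (f s) * ga s) : N"
 proof (intro osub_sum[OF N])
  fix s assume "s : B - {s. f s ~= \<zero>}"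
  thus "lr (f s) * ga s : N" using osubD(3)[OF N UNIV_I lr_zero, of "ga s"] by(simp add: mult.commute)
 qed
 ultimately show ?thesis using osub_UNIV_uminus[OF N] by auto
qed

lemma ev_zero: "ev ga (%_. \<zero>) = 0" by(simp add: ev_def)

lemma ev_add: assumes f: "f : cr (FM R S)" and g: "g : cr (FM R S)" shows "ev ga (%s. f s \<oplus> g s) - (ev ga f + ev ga g) : N"
proof -
 let ?B = "{s. f s ~= \<zero>} Un {s. g s ~= \<zero>}"
 have B: "finite ?B" using f g by(auto simp: f_cr)
 note v = f_val[OF f] f_val[OF g]
 have 1: "ev ga (%s. f s \<oplus> g s) - (SUM s:?B. lr (f s \<oplus> g s) * ga s) : N" by(rule ev_alt[OF B]) auto
 have 2: "(SUM s:?B. lr (f s \<oplus> g s) * ga s) - (SUM s:?B. (lr (f s) + lr (g s)) * ga s) : N"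
  by(intro c_sum[OF N] c_mult[OF N] lr_add v c_refl[OF N])
 have 3: "(SUM s:?B. (lr (f s) + lr (g s)) * ga s) - (ev ga f + ev ga g) : N"
  unfolding distrib_right sum.distrib by(intro c_add[OF N] c_sym[OF N ev_alt[OF B]]) auto
 show ?thesis using c_trans[OF N 1 c_trans[OF N 2 3]] .
qed

lemma ev_smult: assumes r: "r : cr R" and f: "f : cr (FM R S)" shows "ev ga (%s. r \<otimes> f s) - lr r * ev ga f : N"
proof -
 let ?B = "{s. f s ~= \<zero>}"
 have B: "finite ?B" using f by(auto simp: f_cr)
 note v = f_val[OF f]
 have 1: "ev ga (%s. r \<otimes> f s) - (SUM s:?B. lr (r \<otimes> f s) * ga s) : N" by(rule ev_alt[OF B]) (use r in auto)
 have 2: "(SUM s:?B. lr (r \<otimes> f s) * ga s) - (SUM s:?B. (lr r * lr (f s)) * ga s) : N"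
  by(intro c_sum[OF N] c_mult[OF N] lr_mult v r c_refl[OF N])
 have 3: "(SUM s:?B. (lr r * lr (f s)) * ga s) = lr r * ev ga f" by(simp add: ev_def sum_distrib_left mult.assoc)
 show ?thesis using c_trans[OF N 1 2] 3 by simp
qed

lemma ev_diff: assumes f: "f : cr (FM R S)" and g: "g : cr (FM R S)" shows "ev ga (%s. f s \<ominus> g s) - (ev ga f - ev ga g) : N"
proof -
 let ?h = "%s. f s \<ominus> g s"
 interpret F: mrec R "FM R S" by(intro mrec.intro f_mod)
 have h: "?h : cr (FM R S)" using free_minus[OF f g] F.M.minus_closed[OF f g] by simp
 have "(%s. ?h s \<oplus> g s) = f" using f_val[OF f] f_val[OF g] by(simp add: fun_eq_iff a_minus_def a_assoc l_neg)
 hence "ev ga f - (ev ga ?h + ev ga g) : N" using ev_add[OF h g, of ga] by simp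
 from c_sym[OF N this] show ?thesis by(simp add: algebra_simps)
qed

lemma ev_basis: "ev ga (bas R s) - ga s : N"
proof -
 have "ev ga (bas R s) - (SUM t:{s}. lr (bas R s t) * ga t) : N" by(rule ev_alt) (auto simp: basis_elt_def)
 moreover have "lr \<one> * ga s - 1 * ga s : N" by(intro c_mult[OF N] lr_one c_refl[OF N])
 ultimately show ?thesis using c_trans[OF N] by(auto simp: basis_elt_def)
qed

text \<open>The formal sums with value in \<open>D\<close> form a submodule. With
  \<open>D = N\<close> this shows that values are well defined on a presented module; a larger
  \<open>D\<close> is used for the fibres in \<open>Bs_iff\<close>.\<close>

lemma ev_span: assumes D: "osub A D" and ND: "N [= D" and Rel: "Rel [= cr (FM R S)" and r: "!!f. f : Rel ==> ev ga f : D"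
  and f: "f : sspan R (FM R S) Rel" shows "ev ga f : D"
proof -
 interpret F: mrec R "FM R S" by(intro mrec.intro f_mod)
 note tr = osub_tr[OF D ND]
 let ?H = "{f : cr (FM R S). ev ga f : D}"
 have sm: "r : cr R ==> x : ?H ==> r #[FM R S] x : ?H" for r x using tr[OF ev_smult[of r x S]] osubD(3)[OF D, of "lr r"] lr(1) by(auto simp: f_smult)
 have "submodule ?H R (FM R S)"
 proof (rule F.submoduleI)
  show "0[FM R S] : ?H" using osubD(1)[OF D] F.zero_closed by(simp add: ev_zero)
  show "\<ominus>\<^bsub>FM R S\<^esub> a : ?H" if "a : ?H" for a
  proof -
   have "\<ominus>\<^bsub>FM R S\<^esub> a = (\<ominus> \<one>) #[FM R S] a" using F.smult_l_minus[of \<one> a] F.smult_one[of a] that by simp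
   thus ?thesis using sm[of "\<ominus> \<one>" a] that by simp
  qed
  show "a +[FM R S] b : ?H" if "a : ?H" "b : ?H" for a b using that tr[OF ev_add[of a S b]] osubD(2)[OF D] by(auto simp: f_add)
 qed (use sm in auto)
 hence "sspan R (FM R S) Rel [= ?H" by(rule F.span_least) (use Rel r in auto)
 thus ?thesis using f by auto
qed

end

text \<open>\<open>si\<close> identifies \<open>L\<close> modulo \<open>N\<close> with
  \<open>M\<close>, compatibly with the identification of \<open>A\<close> modulo \<open>N\<close>
  with \<open>R\<close>. That the record \<open>M\<close> is a module is a consequence, see
  \<open>is_mod\<close>.\<close>

locale nmod = nring R A N tu for R :: "('r, 'z) ring_scheme" (structure) and A N :: "'w::comm_ring_1 set" and tu +
 fixes M :: "('r, 'm) module" and L :: "'w set" and si :: "'w => 'm" assumes L: "osub A L" and NL: "N [= L" and sig_closed: "w : L ==> si w : cr M"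
  and sig_surj: "m : cr M ==> EX w:L. si w = m" and sig_add: "v : L ==> w : L ==> si (v + w) = si v +[M] si w"
  and sig_smult: "a : A ==> w : L ==> si (a * w) = tu a #[M] si w" and sig_ker: "w : L ==> si w = 0[M] \<longleftrightarrow> w : N"
begin

lemma sig_zero: "si 0 = 0[M]" using sig_ker[of 0] osubD(1)[OF L] osubD(1)[OF N] by auto

lemma M_carrier: "cr M = si ` L" using sig_closed sig_surj by auto

lemma is_mod: "module R M"
proof -
 note cl = osubD[OF L]
 have z: "0[M] = si 0" by(simp add: sig_zero)
 have a1: "si v +[M] si w = si (v + w)" if "v : L" "w : L" for v w using sig_add that by simp
 have a2: "tu a #[M] si w = si (a * w)" if "a : A" "w : L" for a w using sig_smult that by simp
 have "abelian_group M"
 proof (rule abelian_groupI)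
  show "EX y:cr M. y +[M] x = 0[M]" if "x : cr M" for x
  proof -
   obtain w where w: "w : L" "x = si w" using \<open>x : cr M\<close> unfolding M_carrier by auto
   have "- w : L" using osub_uminus[OF A L] w by simp
   thus ?thesis using w a1 by(intro bexI[of _ "si (- w)"]) (auto simp: z sig_closed)
  qed
 qed (auto simp: M_carrier z a1 cl add_ac)
 moreover have "cr R = tu ` A" using tau_cl tau_surj by auto
 moreover have "\<one> = tu 1" "1 : A" using tau_one osrD[OF A] by auto
 ultimately show ?thesis by(intro moduleI is_cring) (auto simp: M_carrier a1 a2 cl tau_add[symmetric] tau_mult[symmetric] osrD[OF A] algebra_simps)
qed

lemma sig_eq: "v : L ==> w : L ==> si v = si w \<longleftrightarrow> v - w : N"
proof -
 assume v: "v : L" and w: "w : L"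
 interpret M: mrec R M by(intro mrec.intro is_mod)
 have d: "v - w : L" using osub_minus[OF A L v w] .
 have "si v = si (v - w) +[M] si w" using sig_add[OF d w] by simp
 thus ?thesis using sig_ker[OF d] sig_closed[OF d] sig_closed[OF w] sig_closed[OF v] by(metis M.M.add.r_cancel_one)
qed

definition lm :: "'m => 'w" where "lm m = (SOME w. w : L & si w = m)"

lemma lm: "m : cr M ==> lm m : L" "m : cr M ==> si (lm m) = m" using someI_ex[of "%a. a : L & si a = m"] sig_surj[of m] unfolding lm_def by blast+

lemma lm_cong: "w : L ==> si w = m ==> lm m - w : N" using lm[of m] sig_eq[of "lm m" w] sig_closed[of w] by auto

lemma lm_add: "m : cr M ==> n : cr M ==> lm (m +[M] n) - (lm m + lm n) : N" by(intro lm_cong) (auto simp: lm sig_add osubD[OF L])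

lemma lm_smult: "r : cr R ==> m : cr M ==> lm (r #[M] m) - lr r * lm m : N" by(intro lm_cong) (auto simp: lm lr sig_smult osubD[OF L])

lemma span_image: assumes T: "T [= L" shows "sspan R M (si ` T) = si ` ospan A T"
proof -
 interpret M: mrec R M by(intro mrec.intro is_mod)
 have sub: "ospan A T [= L" by(rule ospan_least[OF L T])
 have R_carrier: "cr R = tu ` A" using tau_cl tau_surj by auto
 note os = ospan_osub[OF A, of T]
 have sm: "r #[M] x : si ` ospan A T" if rx: "r : cr R" "x : si ` ospan A T" for r x
 proof -
  obtain a w where "a : A" "r = tu a" "w : ospan A T" "x = si w" using rx tau_surj[of r] by auto
  thus ?thesis using sig_smult[of a w] osubD(3)[OF os] sub by(metis image_eqI subsetD)
 qed
 have "submodule (si ` ospan A T) R M"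
 proof (rule M.submoduleI)
  show "si ` ospan A T [= cr M" using sub sig_closed by auto
  show "0[M] : si ` ospan A T" using sig_zero osubD(1)[OF os] by(metis image_eqI)
  show "a +[M] b : si ` ospan A T" if ab: "a : si ` ospan A T" "b : si ` ospan A T" for a b
  proof -
   obtain v w where "v : ospan A T" "a = si v" "w : ospan A T" "b = si w" using ab by auto
   thus ?thesis using sig_add[of v w] osubD(2)[OF os] sub by(metis image_eqI subsetD)
  qed
  show "\<ominus>\<^bsub>M\<^esub> a : si ` ospan A T" if "a : si ` ospan A T" for a
  proof -
   have "a : cr M" using that sub sig_closed by auto
   hence "\<ominus>\<^bsub>M\<^esub> a = (\<ominus> \<one>) #[M] a" using M.smult_l_minus[of \<one> a] M.smult_one[of a] by simp
   thus ?thesis using sm[OF _ that, of "\<ominus> \<one>"] by simp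
  qed
 qed (rule sm)
 hence 1: "sspan R M (si ` T) [= si ` ospan A T" by(rule M.span_least) (use ospanI[OF A] in auto)
 have "si v : sspan R M (si ` T)" if "v : ospan A T" for v using that
 proof induction
  have sp: "submodule (sspan R M (si ` T)) R M" by(rule M.span_sub) (use sig_closed T in auto) {
   case zero
   thus ?case using M.sub_zero[OF sp] by(simp add: sig_zero)
  next
   case (step a s v)
   hence "tu a #[M] si s +[M] si v : sspan R M (si ` T)" using M.span_incl[of "si ` T"] tau_cl
    by(intro M.submoduleE(5)[OF sp] M.submoduleE(4)[OF sp]) auto
   moreover have "s : L" "v : L" "a * s : L" using step T sub osubD(3)[OF L] by auto
   ultimately show ?case using step sig_add sig_smult by simp }
 qed
 thus ?thesis using 1 by auto
qed

end

section \<open>The dictionary between sheaves and lattices\<close>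

section \<open>Sheaves named by lattices\<close>

text \<open>A section over a non-empty open set is determined at the generic point, so it is one
  element that lies in the lattice of every point of \<open>U\<close>. For empty \<open>U\<close>
  this set is everything, whence the many assumptions \<open>U ~= {}\<close>.\<close>

definition sec :: "('p => 'w set) => 'p set => 'w set" where "sec M U = {w. ALL x:U. w : M x}"

lemma sec_mono: "V [= U ==> w : sec M U ==> w : sec M V" by(auto simp: sec_def)

lemma secD: "w : sec M U ==> x : U ==> w : M x" by(auto simp: sec_def)

text \<open>\<open>K\<close> is meant to name the germs at the generic point, \<open>Ox x\<close>
  those that are regular at \<open>x\<close>, and \<open>N\<close> consists of the names of zero.
  The generic point itself does not occur: \<open>irr\<close> replaces it in all gluing
  arguments.\<close>

locale gmodel = fixes X :: "('p, 'r, 'z) ringed_space_scheme" and K N :: "'w::comm_ring_1 set" and Ox :: "'p => 'w set" and tu :: "'p set => 'w => 'r"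
 assumes lrs: "is_locally_ringed_space X" and irr: "oin (space_top X) U ==> oin (space_top X) V ==> U ~= {} ==> V ~= {} ==> U Int V ~= {}"
  and K: "osubring K" and N: "osub UNIV N" and Ox: "x : topspace (space_top X) ==> osubring (Ox x)"
  and NOx: "x : topspace (space_top X) ==> N [= Ox x" and OxK: "x : topspace (space_top X) ==> Ox x [= K"
  and Ox_open: "x : topspace (space_top X) ==> a : Ox x ==> EX U. oin (space_top X) U & x : U & a : sec Ox U"
  and nr: "oin (space_top X) U ==> U ~= {} ==> nring (Sec (str_sheaf X) U) (sec Ox U) N (tu U)"
  and tau_restr: "oin (space_top X) U ==> oin (space_top X) V ==> V ~= {} ==> V [= U ==> a : sec Ox U ==> restr (str_sheaf X) U V (tu U a) = tu V a"
begin

abbreviation "T \<equiv> space_top X"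
abbreviation "pts \<equiv> topspace T"
abbreviation "OX \<equiv> str_sheaf X"
abbreviation "SX \<equiv> Sec OX"

lemma sub_top: "oin T U ==> x : U ==> x : pts" using openin_subset by blast

lemma open_top: "oin T pts" by simp

lemma rs: "is_ringed_space X" using lrs by(simp add: is_locally_ringed_space_def)

lemma osr_sec: assumes "oin T U" shows "osubring (sec Ox U)"
proof -
 have 1: "osubring (Ox x)" if "x : U" for x using Ox sub_top assms that by blast
 show ?thesis by(auto simp: osubring_def osub_def sec_def osrD[OF 1])
qed

text \<open>The empty set is left out because \<open>sec M {}\<close> is everything, while a sheaf
  of modules has only the zero section there.\<close>

definition realizes :: "('p, 'r, 'm) mod_presheaf => ('p set => 'w => 'm) => ('p => 'w set) => bool" where "realizes F si M \<longleftrightarrow>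
  (ALL U. oin T U & U ~= {} --> nmod (SX U) (sec Ox U) N (tu U) (Sec F U) (sec M U) (si U)) &
  (ALL U V w. oin T U & oin T V & V ~= {} & V [= U & w : sec M U --> restr F U V (si U w) = si V w)"

text \<open>One \<open>B\<close> serves at all points of \<open>U\<close> and is independent over
  \<open>K\<close>; so the coefficients found at different points can be compared, and they agree
  modulo \<open>N\<close>.\<close>

definition fr_at :: "('p => 'w set) => 'p set => 'w set => bool" where
 "fr_at M U B \<longleftrightarrow> finite B & (ALL y:U. M y = fspan N (Ox y) B) &
  (ALL c. (ALL b:B. c b : K) & (SUM b:B. c b * b) : N --> (ALL b:B. c b : N))"

definition framed :: "('p => 'w set) => bool" where "framed M \<longleftrightarrow> (ALL x:pts. EX U B. oin T U & x : U & fr_at M U B)"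

end

text \<open>Operations on germs are defined as unions over all pairs of representatives; each of
  these unions is over a constant family.\<close>

lemma UN_pair_const: assumes "A ~= {}" "B ~= {}" "!!U s V t. (U, s) : A ==> (V, t) : B ==> g U s V t = c"
 shows "(UN (U, s):A. UN (V, t):B. g U s V t) = c"
proof -
 have 1: "(case q of (V, t) => g U s V t) = c" if "(U, s) : A" "q : B" for U s q using assms(3) that by(cases q) simp
 have "(case p of (U, s) => UN (V, t):B. g U s V t) = c" if "p : A" for p
 proof (cases p)
  case (Pair U s)
  have "(UN q:B. case q of (V, t) => g U s V t) = (UN q:B. c)" by(rule SUP_cong[OF refl 1]) (use Pair that in auto)
  thus ?thesis using Pair assms(2) by simp
 qed
 hence "(UN p:A. case p of (U, s) => UN (V, t):B. g U s V t) = (UN p:A. c)" by(rule SUP_cong[OF refl])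
 thus ?thesis using assms(1) by simp
qed

subsection \<open>Names for the Sec of a presheaf\<close>

text \<open>\<open>NM U w t\<close> says that \<open>w\<close> is a name of the section
  \<open>t\<close>. It is a relation because \<open>P\<close> is only a presheaf: by
  \<open>nm_inj\<close> sections with the same name agree after shrinking, but not necessarily on
  \<open>U\<close> itself.\<close>

locale names = gmodel X K N Ox tu for X :: "('p, 'r, 'z) ringed_space_scheme" and K N :: "'w::comm_ring_1 set" and Ox and tu +
 fixes P :: "('p, 'r, 'm) mod_presheaf" and NM :: "'p set => 'w => 'm => bool" and M :: "'p => 'w set"
 assumes nm_closed: "oin T U ==> U ~= {} ==> NM U w t ==> t : cr (Sec P U)" and nm_ex: "oin T U ==> U ~= {} ==> t : cr (Sec P U) ==> EX w. NM U w t"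
  and nm_uniq: "oin T U ==> U ~= {} ==> NM U w t ==> NM U w' t ==> w - w' : N"
  and nm_cong: "oin T U ==> U ~= {} ==> NM U w t ==> w' - w : N ==> NM U w' t" and nm_add: "oin T U ==> U ~= {} ==> NM U w t ==> NM U w' t' ==>
     NM U (w + w') (t +[Sec P U] t')" and nm_smult: "oin T U ==> U ~= {} ==> a : sec Ox U ==> NM U w t ==> NM U (a * w) (tu U a #[Sec P U] t)"
  and nm_zero: "oin T U ==> U ~= {} ==> NM U 0 0[Sec P U]"
  and nm_restr: "oin T U ==> oin T V ==> V ~= {} ==> V [= U ==> NM U w t ==> NM V w (restr P U V t)"
  and nm_inj: "oin T U ==> oin T U' ==> NM U w t ==> NM U' w t' ==> x : U Int U' ==>
     EX V. oin T V & x : V & V [= U Int U' & restr P U V t = restr P U' V t'"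
  and M_iff: "x : pts ==> w : M x \<longleftrightarrow> (EX U t. oin T U & x : U & NM U w t)"
begin

definition gm :: "'p => 'w => ('p set \<times> 'm) set" where "gm x w = {(V, t). oin T V & x : V & NM V w t}"

lemma germ_eq: assumes U: "oin T U" "x : U" and t: "NM U w t" shows "germ T P x U t = gm x w"
proof -
 have ne: "U ~= {}" using U by auto
 have "(EX W. oin T W & x : W & W [= U Int V & restr P U W t = restr P V W s) \<longleftrightarrow> NM V w s"
  if V: "oin T V" "x : V" and s: "s : cr (Sec P V)" for V s
 proof
  assume "EX W. oin T W & x : W & W [= U Int V & restr P U W t = restr P V W s"
  then obtain W where W: "oin T W" "x : W" "W [= U Int V" "restr P U W t = restr P V W s" by auto
  have W0: "W ~= {}" "V ~= {}" "W [= U" "W [= V" using W V by auto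
  obtain v where v: "NM V v s" using nm_ex[OF V(1) W0(2) s] by auto
  have "w - v : N" using nm_uniq[OF W(1) W0(1) nm_restr[OF U(1) W(1) W0(1,3) t]] nm_restr[OF V(1) W(1) W0(1,4) v] W(4) by simp
  thus "NM V w s" by(rule nm_cong[OF V(1) W0(2) v])
 next
  assume "NM V w s"
  from nm_inj[OF U(1) V(1) t this, of x]
  show "EX W. oin T W & x : W & W [= U Int V & restr P U W t = restr P V W s" using U V by auto
 qed
 moreover have "s : cr (Sec P V)" if "oin T V" "x : V" "NM V w s" for V s using nm_closed that by auto
 ultimately show ?thesis unfolding germ_def gm_def by blast
qed

lemma gm_ex: "x : pts ==> w : M x ==> EX U t. oin T U & x : U & NM U w t & gm x w = germ T P x U t" using M_iff germ_eq by metis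

lemma gm_eq: assumes x: "x : pts" and w: "w : M x" and w': "w' : M x" shows "gm x w = gm x w' \<longleftrightarrow> w - w' : N"
proof
 obtain U t where U: "oin T U" "x : U" "NM U w t" using M_iff[OF x] w by auto
 assume "gm x w = gm x w'"
 hence "NM U w' t" using U unfolding gm_def by auto
 thus "w - w' : N" using nm_uniq[OF U(1) _ U(3)] U by auto
next
 assume d: "w - w' : N"
 have "NM V w t \<longleftrightarrow> NM V w' t" if "oin T V" "x : V" for V t using nm_cong[OF that(1)] d c_sym[OF N d] that by blast
 thus "gm x w = gm x w'" unfolding gm_def by blast
qed

lemma stalk_carrier_eq: "x : pts ==> stalk_carrier T P x = gm x ` M x"
proof -
 assume x: "x : pts"
 have "germ T P x U s : gm x ` M x" if U: "oin T U" "x : U" and s: "s : cr (Sec P U)" for U s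
 proof -
  obtain w where w: "NM U w s" using nm_ex[OF U(1) _ s] U by auto
  hence "w : M x" using M_iff[OF x] U by auto
  thus ?thesis using germ_eq[OF U w] by simp
 qed
 moreover have "gm x w : stalk_carrier T P x" if w: "w : M x" for w
 proof -
  obtain U t where "oin T U" "x : U" "NM U w t" "gm x w = germ T P x U t" using gm_ex[OF x w] by auto
  thus ?thesis using nm_closed[of U w t] unfolding stalk_carrier_def by blast
 qed
 ultimately show ?thesis unfolding stalk_carrier_def by auto
qed

lemma gm_nonempty: "x : pts ==> w : M x ==> gm x w ~= {}" using M_iff unfolding gm_def by auto

lemma stalk_add_eq: assumes x: "x : pts" and w: "w : M x" and w': "w' : M x" shows "stalk_add T P x (gm x w) (gm x w') = gm x (w + w')"
 unfolding stalk_add_def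
proof (rule UN_pair_const[OF gm_nonempty[OF x w] gm_nonempty[OF x w']])
 fix U s V t assume a: "(U, s) : gm x w" "(V, t) : gm x w'"
 have o: "oin T U" "oin T V" "x : U" "x : V" "NM U w s" "NM V w' t" using a unfolding gm_def by auto
 hence I: "oin T (U Int V)" "x : U Int V" "U Int V ~= {}" by auto
 show "germ T P x (U Int V) (restr P U (U Int V) s +[Sec P (U Int V)] restr P V (U Int V) t) = gm x (w + w')"
  by(intro germ_eq I nm_add nm_restr[OF o(1) I(1,3) _ o(5)] nm_restr[OF o(2) I(1,3) _ o(6)]) auto
qed

lemma stalk_zero_eq: "x : pts ==> stalk_zero T P x = gm x 0" unfolding stalk_zero_def by(intro germ_eq nm_zero) auto

end

context gmodel
begin

lemma r_mod: "realizes F si M ==> oin T U ==> U ~= {} ==> nmod (SX U) (sec Ox U) N (tu U) (Sec F U) (sec M U) (si U)" by(simp add: realizes_def)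

lemma r_restr: "realizes F si M ==> oin T U ==> oin T V ==> V ~= {} ==> V [= U ==> w : sec M U ==> restr F U V (si U w) = si V w"
 by(simp add: realizes_def)

lemma r_names: assumes F: "realizes F si M" and op: "!!x w. x : pts ==> w : M x ==> EX U. oin T U & x : U & w : sec M U"
 shows "names X K N Ox tu F (%U w t. w : sec M U & si U w = t) M"
proof (unfold_locales, goal_cases)
 case (1 U w t)
 thus ?case using nmod.sig_closed[OF r_mod[OF F]] by blast
next
 case (2 U t)
 thus ?case using nmod.sig_surj[OF r_mod[OF F]] by blast
next
 case (3 U w t w')
 thus ?case using nmod.sig_eq[OF r_mod[OF F 3(1,2)], of w w'] by auto
next
 case (4 U w t w')
 note nm = r_mod[OF F 4(1,2)]
 have "w' : sec M U" using osub_tr[OF nmod.L[OF nm] nmod.NL[OF nm] 4(4)] 4(3) by blast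
 thus ?case using nmod.sig_eq[OF nm, of w' w] 4 by blast
next
 case (5 U w t w' t')
 note nm = r_mod[OF F 5(1,2)]
 thus ?case using nmod.sig_add[OF nm, of w w'] osubD(2)[OF nmod.L[OF nm]] 5 by auto
next
 case (6 U a w t)
 note nm = r_mod[OF F 6(1,2)]
 thus ?case using nmod.sig_smult[OF nm, of a w] osubD(3)[OF nmod.L[OF nm]] 6 by auto
next
 case (7 U)
 note nm = r_mod[OF F 7]
 thus ?case using nmod.sig_zero[OF nm] osubD(1)[OF nmod.L[OF nm]] by auto
next
 case (8 U V w t)
 thus ?case using r_restr[OF F, of U V w] sec_mono[of V U w M] by auto
next
 case (9 U U' w t t' x)
 hence I: "oin T (U Int U')" "U Int U' ~= {}" by auto
 show ?case using 9 I r_restr[OF F 9(1) I, of w] r_restr[OF F 9(2) I, of w] by(intro exI[of _ "U Int U'"]) auto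
next
 case (10 x w)
 thus ?case using op[of x w] by(auto simp: sec_def)
qed

lemma struct_sel [simp]: "cr (Sec (struct_module X) U) = cr (SX U)" "a +[Sec (struct_module X) U] b = a +[SX U] b"
 "0[Sec (struct_module X) U] = 0[SX U]" "a #[Sec (struct_module X) U] b = a *[SX U] b" "restr (struct_module X) = restr OX"
 by(simp_all add: struct_module_def Let_def)

lemma struct_germ: "germ T (struct_module X) x U a = germ T OX x U a" by(simp add: germ_def)

lemma struct_realizes: "realizes (struct_module X) tu Ox" unfolding realizes_def
proof (intro conjI allI impI)
 fix U assume U: "oin T U & U ~= {}"
 interpret nr: nring "SX U" "sec Ox U" N "tu U" using nr U by blast
 show "nmod (SX U) (sec Ox U) N (tu U) (Sec (struct_module X) U) (sec Ox U) (tu U)" by unfold_locales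
   (use nr.A nr.NA nr.tau_cl nr.tau_surj nr.tau_add nr.tau_mult nr.tau_ker in \<open>auto simp: osubring_def\<close>)
qed (use tau_restr in auto)

lemma struct_names: "names X K N Ox tu (struct_module X) (%U w t. w : sec Ox U & tu U w = t) Ox" by(rule r_names[OF struct_realizes Ox_open])

definition go :: "'p => 'w => ('p set \<times> 'r) set" where "go x a = {(V, t). oin T V & x : V & a : sec Ox V & tu V a = t}"

lemma go_gm: "go x a = names.gm X (%U w t. w : sec Ox U & tu U w = t) x a" unfolding names.gm_def[OF struct_names] go_def by simp

lemma go_germ: "oin T U ==> x : U ==> a : sec Ox U ==> germ T OX x U (tu U a) = go x a"
 using names.germ_eq[OF struct_names, of U x a "tu U a"] by(simp add: go_gm struct_germ)

lemma stalk_ring_sel: "cr (stalk_ring X x) = stalk_carrier T OX x" "a +[stalk_ring X x] b = stalk_add T OX x a b"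
 "0[stalk_ring X x] = stalk_zero T OX x" "1[stalk_ring X x] = germ T OX x pts 1[SX pts]" by(simp_all add: stalk_ring_def Let_def)

lemma go_nonempty: "x : pts ==> a : Ox x ==> go x a ~= {}" using names.gm_nonempty[OF struct_names] by(simp add: go_gm)

lemma stalk_mult_eq: assumes x: "x : pts" and a: "a : Ox x" and b: "b : Ox x" shows "go x a *[stalk_ring X x] go x b = go x (a * b)"
 unfolding stalk_ring_def Let_def ring_record_simps
proof (simp, rule UN_pair_const[OF go_nonempty[OF x a] go_nonempty[OF x b]])
 fix U s V t assume a: "(U, s) : go x a" "(V, t) : go x b"
 have o: "oin T U" "oin T V" "x : U" "x : V" "a : sec Ox U" "b : sec Ox V" "s = tu U a" "t = tu V b" using a unfolding go_def by auto
 hence I: "oin T (U Int V)" "x : U Int V" "U Int V ~= {}" by auto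
 have ab: "a : sec Ox (U Int V)" "b : sec Ox (U Int V)" using o by(auto simp: sec_def)
 interpret nr: nring "SX (U Int V)" "sec Ox (U Int V)" N "tu (U Int V)" using nr I by blast
 have "restr OX U (U Int V) s *[SX (U Int V)] restr OX V (U Int V) t = tu (U Int V) (a * b)"
  using tau_restr[OF o(1) I(1,3) _ o(5)] tau_restr[OF o(2) I(1,3) _ o(6)] o ab nr.tau_mult by simp
 thus "germ T OX x (U Int V) (restr OX U (U Int V) s *[SX (U Int V)] restr OX V (U Int V) t) = go x (a * b)"
  using go_germ[OF I(1,2), of "a * b"] ab osrD(5)[OF nr.A] by simp
qed

lemma stalk_named_ring: assumes x: "x : pts" shows "nring (stalk_ring X x) (Ox x) N (go x)"
proof -
 interpret S: names X K N Ox tu "struct_module X" "%U w t. w : sec Ox U & tu U w = t" Ox by(rule struct_names)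
 have g: "go = S.gm" by(intro ext go_gm)
 have e: "stalk_carrier T OX x = stalk_carrier T (struct_module X) x" "stalk_add T OX x = stalk_add T (struct_module X) x"
  "stalk_zero T OX x = stalk_zero T (struct_module X) x" unfolding stalk_carrier_def stalk_add_def stalk_zero_def by(simp_all add: struct_germ)
 have o: "germ T OX x pts 1[SX pts] = go x 1"
 proof -
  interpret nr: nring "SX pts" "sec Ox pts" N "tu pts" using nr x by auto
  show ?thesis using go_germ[OF open_top x, of 1] nr.tau_one osrD[OF nr.A] by simp
 qed
 note ox = osrD[OF Ox[OF x]]
 interpret cring "stalk_ring X x" using lrs x by(auto simp: is_locally_ringed_space_def local_ring_def)
 show ?thesis
 proof (unfold_locales, goal_cases)
  case 1 thus ?case by(rule Ox[OF x])
 next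
  case 2 thus ?case by(rule N)
 next
  case 3 thus ?case by(rule NOx[OF x])
 next
  case (4 a) thus ?case using S.stalk_carrier_eq[OF x] by(auto simp: stalk_ring_sel e g)
 next
  case (5 a) thus ?case using S.stalk_carrier_eq[OF x] by(auto simp: stalk_ring_sel e g)
 next
  case (6 a b) thus ?case using S.stalk_add_eq[OF x] by(simp add: stalk_ring_sel e g)
 next
  case (7 a b) thus ?case using stalk_mult_eq[OF x] by simp
 next
  case 8 thus ?case using o by(simp add: stalk_ring_sel)
 next
  case (9 a) thus ?case using S.gm_eq[OF x, of a 0] S.stalk_zero_eq[OF x] ox by(simp add: stalk_ring_sel e g)
 qed
qed

end

context names
begin

lemma stalk_module_sel: "cr (stalk_module X P x) = stalk_carrier T P x" "a +[stalk_module X P x] b = stalk_add T P x a b"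
 "0[stalk_module X P x] = stalk_zero T P x" by(simp_all add: stalk_module_def Let_def)

lemma stalk_smult_eq: assumes x: "x : pts" and a: "a : Ox x" and w: "w : M x" shows "go x a #[stalk_module X P x] gm x w = gm x (a * w)"
 unfolding stalk_module_def Let_def
proof (simp, rule UN_pair_const[OF go_nonempty[OF x a] gm_nonempty[OF x w]])
 fix U s V t assume a: "(U, s) : go x a" "(V, t) : gm x w"
 have o: "oin T U" "oin T V" "x : U" "x : V" "a : sec Ox U" "NM V w t" "s = tu U a" using a unfolding go_def gm_def by auto
 hence I: "oin T (U Int V)" "x : U Int V" "U Int V ~= {}" by auto
 have ab: "a : sec Ox (U Int V)" using o by(auto simp: sec_def)
 have "NM (U Int V) (a * w) (tu (U Int V) a #[Sec P (U Int V)] restr P V (U Int V) t)" by(intro nm_smult I ab nm_restr[OF o(2) I(1,3) _ o(6)]) auto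
 from germ_eq[OF I(1,2) this]
 show "germ T P x (U Int V) (restr OX U (U Int V) s #[Sec P (U Int V)] restr P V (U Int V) t) = gm x (a * w)"
  using tau_restr[OF o(1) I(1,3) _ o(5)] o(7) by simp
qed

lemma M_I: "oin T U ==> x : U ==> NM U w t ==> w : M x" using M_iff[OF sub_top[of U x]] by auto

lemma M_E: assumes "x : pts" "w : M x" obtains U t where "oin T U" "x : U" "NM U w t" using M_iff[OF assms(1)] assms(2) by auto

lemma M_osub: assumes x: "x : pts" shows "osub (Ox x) (M x)" unfolding osub_def
proof (intro conjI ballI)
 from x have t: "pts ~= {}" by auto
 show "0 : M x" by(rule M_I[OF open_top x nm_zero[OF open_top t]])
next
 fix v w assume v: "v : M x" and w: "w : M x"
 obtain U s where U: "oin T U" "x : U" "NM U v s" by(rule M_E[OF x v])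
 obtain V t where V: "oin T V" "x : V" "NM V w t" by(rule M_E[OF x w])
 from U V have I: "oin T (U Int V)" "x : U Int V" "U Int V ~= {}" by auto
 show "v + w : M x" by(rule M_I[OF I(1,2)], rule nm_add[OF I(1,3) nm_restr[OF U(1) I(1,3) _ U(3)] nm_restr[OF V(1) I(1,3) _ V(3)]]) auto
next
 fix a w assume a: "a : Ox x" and w: "w : M x"
 obtain U where U: "oin T U" "x : U" "a : sec Ox U" using Ox_open[OF x a] by auto
 obtain V t where V: "oin T V" "x : V" "NM V w t" by(rule M_E[OF x w])
 from U V have I: "oin T (U Int V)" "x : U Int V" "U Int V ~= {}" by auto
 have a': "a : sec Ox (U Int V)" using U by(auto simp: sec_def)
 show "a * w : M x" by(rule M_I[OF I(1,2)], rule nm_smult[OF I(1,3) a' nm_restr[OF V(1) I(1,3) _ V(3)]]) auto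
qed

lemma M_N: assumes x: "x : pts" shows "N [= M x"
proof
 fix n assume n: "n : N"
 from x have t: "pts ~= {}" by auto
 show "n : M x" by(rule M_I[OF open_top x], rule nm_cong[OF open_top t nm_zero[OF open_top t]]) (use n in simp)
qed

lemma stalk_named_module: assumes x: "x : pts" shows "nmod (stalk_ring X x) (Ox x) N (go x) (stalk_module X P x) (M x) (gm x)"
proof -
 interpret nr: nring "stalk_ring X x" "Ox x" N "go x" by(rule stalk_named_ring[OF x])
 show ?thesis by unfold_locales (use M_osub[OF x] M_N[OF x] stalk_carrier_eq[OF x] stalk_add_eq[OF x] stalk_smult_eq[OF x]
    gm_eq[OF x, of _ 0] osubD(1)[OF M_osub[OF x]] stalk_zero_eq[OF x] in \<open>auto simp: stalk_module_sel\<close>)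
qed

lemma sheafify_carrier: "cr (Sec (sheafify X P) U) = {s : (\<Pi>\<^sub>E x\<in>U. cr (stalk_module X P x)).
      ALL x:U. EX V t. oin T V & x : V & V [= U & t : cr (Sec P V) & (ALL y:V. s y = germ T P y V t)}" by(simp add: sheafify_def Let_def)

lemma sheafify_sel: "s +[Sec (sheafify X P) U] t = (\<lambda>x\<in>U. s x +[stalk_module X P x] t x)"
 "r #[Sec (sheafify X P) U] s = (\<lambda>x\<in>U. germ T OX x U r #[stalk_module X P x] s x)"
 "0[Sec (sheafify X P) U] = (\<lambda>x\<in>U. 0[stalk_module X P x])" "restr (sheafify X P) U V s = restrict s V"
 by(simp_all add: sheafify_def Let_def)

text \<open>A section of the sheafification is locally the family of germs of one section, so it has
  local names. Any two non-empty open sets meet, and where they meet the names have equal germs;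
  hence all local names agree modulo \<open>N\<close>, and a single one serves on the whole of
  \<open>U\<close>.\<close>

theorem sheafify_realizes: "realizes (sheafify X P) (%U w. \<lambda>x\<in>U. gm x w) M" unfolding realizes_def
proof (intro conjI allI impI, goal_cases)
 case (1 U)
 hence U: "oin T U" "U ~= {}" by auto
 note tp = sub_top[OF U(1)]
 interpret nr: nring "SX U" "sec Ox U" N "tu U" by(rule nr[OF U])
 have st: "nmod (stalk_ring X x) (Ox x) N (go x) (stalk_module X P x) (M x) (gm x)" if "x : U" for x by(rule stalk_named_module[OF tp[OF that]])
 have cl: "(\<lambda>x\<in>U. gm x w) : cr (Sec (sheafify X P) U)" if w: "w : sec M U" for w unfolding sheafify_carrier
 proof (intro CollectI conjI ballI PiE_I)
  fix x assume x: "x : U"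
  show "(\<lambda>x\<in>U. gm x w) x : cr (stalk_module X P x)" using nmod.sig_closed[OF st[OF x]] x secD[OF w x] by simp
  obtain V t where V: "oin T V" "x : V" "NM V w t" using M_iff[OF tp[OF x]] secD[OF w x] by auto
  have I: "oin T (U Int V)" "U Int V ~= {}" using U V x by auto
  have n: "NM (U Int V) w (restr P V (U Int V) t)" by(rule nm_restr[OF V(1) I _ V(3)]) simp
  show "EX V t. oin T V & x : V & V [= U & t : cr (Sec P V) & (ALL y:V. (\<lambda>x\<in>U. gm x w) y = germ T P y V t)"
   using germ_eq[OF I(1) _ n] nm_closed[OF I n] I V x by(intro exI[of _ "U Int V"] exI[of _ "restr P V (U Int V) t"]) auto
 qed simp
 show ?case
 proof (unfold_locales, goal_cases)
  case 1
  thus ?case using osubD[OF M_osub[OF tp]] unfolding osub_def sec_def by auto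
 next
  case 2
  thus ?case using M_N[OF tp] unfolding sec_def by auto
 next
  case (3 w)
  thus ?case by(rule cl)
 next
  case (4 s)
  have "EX V w. oin T V & x : V & V [= U & (ALL y:V. s y = gm y w & w : M y)" if x: "x : U" for x
  proof -
   obtain V t where V: "oin T V" "x : V" "V [= U" "t : cr (Sec P V)" "ALL y:V. s y = germ T P y V t" using 4 x unfolding sheafify_carrier by blast
   hence V0: "V ~= {}" by auto
   obtain w where w: "NM V w t" using nm_ex[OF V(1) V0 V(4)] by auto
   have "s y = gm y w & w : M y" if y: "y : V" for y using germ_eq[OF V(1) y w] M_iff[OF sub_top[OF V(1) y]] V w y by auto
   thus ?thesis using V by blast
  qed
  then obtain V w where Vw: "!!x. x : U ==> oin T (V x) & x : V x & V x [= U & (ALL y:V x. s y = gm y (w x) & w x : M y)" by metis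
  obtain x0 where x0: "x0 : U" using U by auto
  have d: "w x0 - w x : N" if x: "x : U" for x
  proof -
   have "V x Int V x0 ~= {}" using irr[of "V x" "V x0"] Vw[OF x] Vw[OF x0] by auto
   then obtain y where y: "y : V x" "y : V x0" by auto
   have "gm y (w x0) = gm y (w x)" "w x0 : M y" "w x : M y" using Vw[OF x] Vw[OF x0] y by metis+
   thus ?thesis using gm_eq[of y "w x0" "w x"] sub_top Vw[OF x] y by auto
  qed
  have m: "w x0 : M x" "s x = gm x (w x0)" if x: "x : U" for x
  proof -
   have wx: "w x : M x" "s x = gm x (w x)" using Vw[OF x] by auto
   show "w x0 : M x" by(rule osub_tr[OF M_osub[OF tp[OF x]] M_N[OF tp[OF x]] d[OF x] wx(1)])
   thus "s x = gm x (w x0)" using gm_eq[OF tp[OF x] _ wx(1), of "w x0"] d[OF x] wx(2) by simp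
  qed
  have "s = (\<lambda>x\<in>U. gm x (w x0))" using 4 m(2) unfolding sheafify_carrier by(auto simp: fun_eq_iff PiE_def extensional_def)
  thus ?case using m(1) by(intro bexI[of _ "w x0"]) (auto simp: sec_def)
 next
  case (5 v w)
  thus ?case using nmod.sig_add[OF st] by(auto simp: sheafify_sel fun_eq_iff sec_def)
 next
  case (6 a w)
  have "go x a #[stalk_module X P x] gm x w = gm x (a * w)" if "x : U" for x using stalk_smult_eq[OF tp[OF that]] 6 that by(auto simp: sec_def)
  thus ?case using go_germ[OF U(1) _ 6(1)] by(auto simp: sheafify_sel fun_eq_iff)
 next
  case (7 w)
  have "gm x w = 0[stalk_module X P x] \<longleftrightarrow> w : N" if "x : U" for x using nmod.sig_ker[OF st[OF that]] 7 that by(auto simp: sec_def)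
  thus ?case using U by(auto simp: sheafify_sel fun_eq_iff restrict_def)
 qed
next
 case (2 U V w)
 thus ?case by(auto simp: sheafify_sel fun_eq_iff restrict_def)
qed

end

section \<open>Names for presheaves given by generators and relations\<close>

section \<open>Sheaves associated with presented modules\<close>

context gmodel
begin

abbreviation "evU U \<equiv> nring.ev (SX U) (sec Ox U) (tu U)"
abbreviation "lrU U \<equiv> nring.lr (sec Ox U) (tu U)"
abbreviation "FU U S \<equiv> FM (SX U) S"

lemma nr_cring: "oin T U ==> cring (SX U)" using rs by(simp add: is_ringed_space_def)

lemma restr_hom: "oin T U ==> oin T V ==> V [= U ==> restr OX U V : ring_hom (SX U) (SX V)" using rs by(simp add: is_ringed_space_def)

lemma lr_restr: assumes "oin T U" "oin T V" "V ~= {}" "V [= U" and r: "r : cr (SX U)" shows "lrU V (restr OX U V r) - lrU U r : N"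
proof -
 have U: "U ~= {}" using assms by auto
 interpret A: nring "SX U" "sec Ox U" N "tu U" using nr assms(1) U by blast
 interpret B: nring "SX V" "sec Ox V" N "tu V" using nr assms by blast
 have a: "A.lr r : sec Ox U" "tu U (A.lr r) = r" using A.lr[OF r] by auto
 have b: "A.lr r : sec Ox V" using sec_mono[OF assms(4) a(1)] .
 have "restr OX U V r = tu V (A.lr r)" using tau_restr[OF assms(1,2,3,4) a(1)] a(2) by simp
 thus ?thesis using B.lr_tau[OF b] by simp
qed

end

text \<open>The common setting of symmetric powers, tensor powers and tensor products, with a value
  \<open>ga U s\<close> in \<open>'w\<close> for each generator. The decisive condition is
  \<open>local_basis\<close>: locally, finitely many generators with independent values represent
  everything, so that the value of an element determines it after shrinking.\<close>

locale pres_sheaf = gmodel X K N Ox tu for X :: "('p, 'r, 'z) ringed_space_scheme" and K N :: "'w::comm_ring_1 set" and Ox and tu +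
 fixes S :: "'p set => 's set" and Rel :: "'p set => ('s => 'r) set" and te :: "'p set => 'p set => 's => 's" and ga :: "'p set => 's => 'w"
 assumes rel_sub: "oin T U ==> U ~= {} ==> Rel U [= cr (FU U (S U))"
  and th: "oin T U ==> oin T V ==> V ~= {} ==> V [= U ==> te U V : S U \<rightarrow> S V"
  and rel_push: "oin T U ==> oin T V ==> V ~= {} ==> V [= U ==> f : Rel U ==> push_formal_sum (SX U) (SX V) (restr OX U V) (te U V) f
     : sspan (SX V) (FU V (S V)) (Rel V)" and ev_rel: "oin T U ==> U ~= {} ==> f : Rel U ==> evU U (ga U) f : N"
  and gam_restr: "oin T U ==> oin T V ==> V ~= {} ==> V [= U ==> s : S U ==> ga V (te U V s) - ga U s : N"
  and local_basis: "oin T U ==> x : U ==> EX V B. oin T V & x : V & V [= U & finite B & B [= S V &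
    (ALL c. (ALL s:B. c s : sec Ox V) & (SUM s:B. c s * ga V s) : N --> (ALL s:B. c s : N)) &
    (ALL s:S V. EX f:cr (FU V (S V)). {t. f t ~= 0[SX V]} [= B & (%t. bas (SX V) s t \<ominus>\<^bsub>SX V\<^esub> f t)
      : sspan (SX V) (FU V (S V)) (Rel V))"
begin

definition P :: "('p, 'r, ('s => 'r) set) mod_presheaf" where "P = \<lparr>sections = (%U. presented_module (SX U) (S U) (Rel U)),
    restr = (%U V. presented_map (SX U) (SX V) (S V) (Rel V) (restr OX U V) (te U V))\<rparr>"

lemma P_sel: "Sec P U = presented_module (SX U) (S U) (Rel U)" "restr P U V = presented_map (SX U) (SX V) (S V) (Rel V) (restr OX U V) (te U V)"
 by(simp_all add: P_def)

abbreviation "cl U \<equiv> presented_class (SX U) (S U) (Rel U)"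
abbreviation "pu U V \<equiv> push_formal_sum (SX U) (SX V) (restr OX U V) (te U V)"
abbreviation "SpU U \<equiv> sspan (SX U) (FU U (S U)) (Rel U)"

definition NM :: "'p set => 'w => ('s => 'r) set => bool" where
 "NM U w t \<longleftrightarrow> (EX f:cr (FU U (S U)). t = cl U f & w - evU U (ga U) f : N)"

definition LT :: "'p => 'w set" where "LT x = {w. EX U t. oin T U & x : U & NM U w t}"

lemma pres: "oin T U ==> U ~= {} ==> presented (SX U) (S U) (Rel U)" by(intro presented.intro presented_axioms.intro nr_cring rel_sub)

lemma push: "oin T U ==> oin T V ==> V ~= {} ==> V [= U ==> push (SX U) (SX V) (restr OX U V) (S U) (S V) (te U V)"
 by(intro push.intro push_axioms.intro nr_cring restr_hom th)

lemma restr_cls: assumes "oin T U" "oin T V" "V ~= {}" "V [= U" "f : cr (FU U (S U))" shows "restr P U V (cl U f) = cl V (pu U V f)"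
 unfolding P_sel using assms by(intro push.presented_map_cls[OF push] rel_sub rel_push) auto

text \<open>Both sides are linear modulo \<open>N\<close>, so \<open>free_induct\<close> leaves only
  the generators, for which \<open>gam_restr\<close> is the claim.\<close>

lemma ev_push: assumes o: "oin T U" "oin T V" "V ~= {}" "V [= U" and f: "f : cr (FU U (S U))" shows "evU V (ga V) (pu U V f) - evU U (ga U) f : N"
proof -
 have U: "U ~= {}" using o by auto
 interpret A: nring "SX U" "sec Ox U" N "tu U" using nr o(1) U by blast
 interpret B: nring "SX V" "sec Ox V" N "tu V" using nr o by blast
 interpret p: push "SX U" "SX V" "restr OX U V" "S U" "S V" "te U V" by(rule push[OF o])
 from f show ?thesis
 proof (induction rule: A.free_induct)
  case zero
  thus ?case by(simp add: p.push_zero A.ev_zero B.ev_zero osubD[OF N])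
 next
  case (add r s g)
  note bs = A.bas_cr[OF add(2)]
  note rs = A.f_smult[OF bs add(1)]
  have ts: "te U V s : S V" using p.te add(2) by auto
  note bt = B.bas_cr[OF ts]
  have r': "restr OX U V r : cr (SX V)" using add(1) by simp
  note rt = B.f_smult[OF bt r']
  have e: "pu U V (%t. r *[SX U] bas (SX U) s t +[SX U] g t) = (%t. restr OX U V r *[SX V] bas (SX V) (te U V s) t +[SX V] pu U V g t)"
   using p.push_add[OF rs add(3)] p.push_smult[OF add(1) bs] p.push_basis[OF add(2)] by simp
  have 1: "evU V (ga V) (%t. restr OX U V r *[SX V] bas (SX V) (te U V s) t +[SX V] pu U V g t) -
   (B.lr (restr OX U V r) * ga V (te U V s) + evU V (ga V) (pu U V g)) : N"
   by(rule c_trans[OF N B.ev_add[OF rt p.push_closed[OF add(3)]] c_add[OF N _ c_refl[OF N]]],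
     rule c_trans[OF N B.ev_smult[OF r' bt] c_mult[OF N c_refl[OF N] B.ev_basis]])
  have 2: "evU U (ga U) (%t. r *[SX U] bas (SX U) s t +[SX U] g t) - (A.lr r * ga U s + evU U (ga U) g) : N"
   by(rule c_trans[OF N A.ev_add[OF rs add(3)] c_add[OF N _ c_refl[OF N]]],
     rule c_trans[OF N A.ev_smult[OF add(1) bs] c_mult[OF N c_refl[OF N] A.ev_basis]])
  have 3: "(B.lr (restr OX U V r) * ga V (te U V s) + evU V (ga V) (pu U V g)) - (A.lr r * ga U s + evU U (ga U) g) : N"
   by(intro c_add[OF N] c_mult[OF N] lr_restr o add gam_restr)
  show ?case unfolding e by(rule c_trans[OF N 1 c_trans[OF N 3 c_sym[OF N 2]]])
 qed
qed

lemma NM_uniq: assumes U: "oin T U" "U ~= {}" and f: "f : cr (FU U (S U))" and g: "g : cr (FU U (S U))" and e: "cl U f = cl U g"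
 shows "evU U (ga U) f - evU U (ga U) g : N"
proof -
 interpret A: nring "SX U" "sec Ox U" N "tu U" by(rule nr[OF U])
 interpret P: presented "SX U" "S U" "Rel U" by(rule pres[OF U])
 have "(%s. f s \<ominus>\<^bsub>SX U\<^esub> g s) : SpU U" using P.cls_eq[OF f g] e by simp
 hence "evU U (ga U) (%s. f s \<ominus>\<^bsub>SX U\<^esub> g s) : N"
  by(rule A.ev_span[OF osub_mono[OF N] order_refl rel_sub[OF U] ev_rel[OF U], rotated -1]) auto
 thus ?thesis using A.ev_diff[OF f g, of "ga U"] c_mem[OF N] by blast
qed

lemma local_reduce: assumes V: "oin T V" "V ~= {}" and B: "B [= S V" and b: "ALL s:S V. EX f:cr (FU V (S V)). {t. f t ~= 0[SX V]} [= B &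
     (%t. bas (SX V) s t \<ominus>\<^bsub>SX V\<^esub> f t) : SpU V" and g: "g : cr (FU V (S V))"
 shows "EX f:cr (FU V (S V)). {t. f t ~= 0[SX V]} [= B & cl V g = cl V f"
proof -
 interpret P: presented "SX V" "S V" "Rel V" by(rule pres[OF V])
 interpret F: mrec "SX V" "FU V (S V)" by(rule P.F_mod)
 show ?thesis using g
 proof (induction rule: P.free_induct)
  case zero
  thus ?case using F.zero_closed by(intro bexI[of _ "%_. 0[SX V]"]) auto
 next
  case (add r s g)
  obtain f where f: "f : cr (FU V (S V))" "{t. f t ~= 0[SX V]} [= B"
   "(%t. bas (SX V) s t \<ominus>\<^bsub>SX V\<^esub> f t) : SpU V" using b add(2) by auto
  obtain h where h: "h : cr (FU V (S V))" "{t. h t ~= 0[SX V]} [= B" "cl V g = cl V h" using add(4) by auto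
  note bs = P.bas_cr[OF add(2)]
  have c: "cl V (bas (SX V) s) = cl V f" using P.cls_eq[OF bs f(1)] f(3) by simp
  let ?k = "%t. r *[SX V] f t +[SX V] h t"
  have "cl V (%t. r *[SX V] bas (SX V) s t +[SX V] g t) = r #[P.P] cl V (bas (SX V) s) +[P.P] cl V g"
   using P.pres_add[OF P.f_smult[OF bs add(1)] add(3)] P.pres_smult[OF add(1) bs] by simp
  also have "\<dots> = cl V ?k" unfolding c h(3) using P.pres_add[OF P.f_smult[OF f(1) add(1)] h(1)] P.pres_smult[OF add(1) f(1)] by simp
  finally have "cl V (%t. r *[SX V] bas (SX V) s t +[SX V] g t) = cl V ?k" .
  moreover have "?k : cr (FU V (S V))" by(intro P.f_add P.f_smult f h add)
  moreover have "{t. ?k t ~= 0[SX V]} [= B"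
  proof
   fix t assume t: "t : {t. ?k t ~= 0[SX V]}"
   show "t : B"
   proof (rule ccontr)
    assume "t \<notin> B"
    hence "f t = 0[SX V]" "h t = 0[SX V]" using f(2) h(2) by auto
    thus False using t add(1) by simp
   qed
  qed
  ultimately show ?case by(intro bexI[of _ ?k] conjI)
 qed
qed

theorem NM_names: "names X K N Ox tu P NM LT"
proof (unfold_locales, goal_cases)
 case (1 U w t)
 thus ?case unfolding NM_def P_sel presented.pres_carrier[OF pres[OF 1(1,2)]] by auto
next
 case (2 U t)
 thus ?case unfolding NM_def P_sel presented.pres_carrier[OF pres[OF 2(1,2)]] using c_refl[OF N] by blast
next
 case (3 U w t w')
 then obtain f g where f: "f : cr (FU U (S U))" "t = cl U f" "w - evU U (ga U) f : N"
  "g : cr (FU U (S U))" "t = cl U g" "w' - evU U (ga U) g : N" unfolding NM_def by auto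
 hence e: "cl U f = cl U g" by simp
 show ?case using c_trans[OF N f(3) c_trans[OF N NM_uniq[OF 3(1,2) f(1,4) e] c_sym[OF N f(6)]]] .
next
 case (4 U w t w')
 thus ?case unfolding NM_def using c_trans[OF N 4(4)] by blast
next
 case (5 U w t w' t')
 interpret A: nring "SX U" "sec Ox U" N "tu U" by(rule nr[OF 5(1,2)])
 obtain f g where f: "f : cr (FU U (S U))" "t = cl U f" "w - evU U (ga U) f : N"
  "g : cr (FU U (S U))" "t' = cl U g" "w' - evU U (ga U) g : N" using 5(3,4) unfolding NM_def by auto
 have "w + w' - evU U (ga U) (%s. f s +[SX U] g s) : N" by(rule c_trans[OF N c_add[OF N f(3,6)] c_sym[OF N A.ev_add[OF f(1,4)]]])
 thus ?case unfolding NM_def P_sel using presented.pres_add[OF pres[OF 5(1,2)] f(1,4)] f A.f_add[OF f(1,4)] by auto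
next
 case (6 U a w t)
 interpret A: nring "SX U" "sec Ox U" N "tu U" by(rule nr[OF 6(1,2)])
 obtain f where f: "f : cr (FU U (S U))" "t = cl U f" "w - evU U (ga U) f : N" using 6(4) unfolding NM_def by auto
 note ta = A.tau_cl[OF 6(3)]
 have "a * w - evU U (ga U) (%s. tu U a *[SX U] f s) : N"
  by(rule c_trans[OF N c_mult[OF N c_sym[OF N A.lr_tau[OF 6(3)]] f(3)] c_sym[OF N A.ev_smult[OF ta f(1)]]])
 thus ?case unfolding NM_def P_sel using presented.pres_smult[OF pres[OF 6(1,2)] ta f(1)] f A.f_smult[OF f(1) ta] by auto
next
 case (7 U)
 interpret A: nring "SX U" "sec Ox U" N "tu U" by(rule nr[OF 7])
 interpret Q: presented "SX U" "S U" "Rel U" by(rule pres[OF 7])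
 interpret F: mrec "SX U" "FU U (S U)" by(rule Q.F_mod)
 show ?case unfolding NM_def P_sel Q.pres_zero using F.zero_closed by(intro bexI[of _ "%_. 0[SX U]"]) (auto simp: A.ev_zero osubD[OF N])
next
 case (8 U V w t)
 then obtain f where f: "f : cr (FU U (S U))" "t = cl U f" "w - evU U (ga U) f : N" unfolding NM_def by auto
 have "pu U V f : cr (FU V (S V))" by(rule push.push_closed[OF push[OF 8(1-4)] f(1)])
 moreover have "w - evU V (ga V) (pu U V f) : N" by(rule c_trans[OF N f(3) c_sym[OF N ev_push[OF 8(1-4) f(1)]]])
 ultimately show ?case unfolding NM_def using restr_cls[OF 8(1-4) f(1)] f(2) by auto
next
 \<comment> \<open>Over the set \<open>V\<close> of \<open>local_basis\<close> both sections are
   represented by formal sums supported on \<open>B\<close>. Equal names put the value of the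
   difference into \<open>N\<close>, and independence makes all its coefficients zero.\<close>
 case (9 U U' w t t' x)
 hence "oin T (U Int U')" "x : U Int U'" by auto
 from local_basis[OF this] obtain V B where V: "oin T V" "x : V" "V [= U Int U'" "finite B" "B [= S V"
  and ind: "!!c. (ALL s:B. c s : sec Ox V) & (SUM s:B. c s * ga V s) : N ==> (ALL s:B. c s : N)"
  and b: "ALL s:S V. EX f:cr (FU V (S V)). {t. f t ~= 0[SX V]} [= B & (%t. bas (SX V) s t \<ominus>\<^bsub>SX V\<^esub> f t) : SpU V" by blast
 have V0: "V ~= {}" "V [= U" "V [= U'" using V by auto
 interpret A: nring "SX V" "sec Ox V" N "tu V" by(rule nr[OF V(1) V0(1)])
 have red: "EX h:cr (FU V (S V)). {t. h t ~= 0[SX V]} [= B & restr P W V u = cl V h &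
   w - evU V (ga V) h : N" if W: "oin T W" "V [= W" "NM W w u" for W u
 proof -
  obtain f where f: "f : cr (FU W (S W))" "u = cl W f" "w - evU W (ga W) f : N" using W(3) unfolding NM_def by auto
  have p: "pu W V f : cr (FU V (S V))" by(rule push.push_closed[OF push[OF W(1) V(1) V0(1) W(2)] f(1)])
  obtain h where h: "h : cr (FU V (S V))" "{t. h t ~= 0[SX V]} [= B" "cl V (pu W V f) = cl V h" using local_reduce[OF V(1) V0(1) V(5) b p] by auto
  have "w - evU V (ga V) h : N"
   by(rule c_trans[OF N f(3) c_trans[OF N c_sym[OF N ev_push[OF W(1) V(1) V0(1) W(2) f(1)]] NM_uniq[OF V(1) V0(1) p h(1,3)]]])
  thus ?thesis using h restr_cls[OF W(1) V(1) V0(1) W(2) f(1)] f(2) by auto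
 qed
 obtain h where h: "h : cr (FU V (S V))" "{t. h t ~= 0[SX V]} [= B" "restr P U V t = cl V h" "w - evU V (ga V) h : N"
  using red[OF 9(1) V0(2) 9(3)] by auto
 obtain h' where h': "h' : cr (FU V (S V))" "{t. h' t ~= 0[SX V]} [= B" "restr P U' V t' = cl V h'" "w - evU V (ga V) h' : N"
  using red[OF 9(2) V0(3) 9(4)] by auto
 let ?d = "%s. h s \<ominus>\<^bsub>SX V\<^esub> h' s"
 note hv = A.f_val[OF h(1)] A.f_val[OF h'(1)]
 have "evU V (ga V) h - evU V (ga V) h' : N" using c_trans[OF N c_sym[OF N h(4)] h'(4)] .
 hence 1: "evU V (ga V) ?d : N" using A.ev_diff[OF h(1) h'(1), of "ga V"] c_mem[OF N] by blast
 have zz: "0[SX V] \<ominus>\<^bsub>SX V\<^esub> 0[SX V] = 0[SX V]" by(simp add: A.minus_eq)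
 have hB: "h s = 0[SX V]" "h' s = 0[SX V]" if "s \<notin> B" for s using h(2) h'(2) that by auto
 have "{s. ?d s ~= 0[SX V]} [= B"
 proof
  fix s assume "s : {s. ?d s ~= 0[SX V]}"
  thus "s : B" using hB[of s] zz by(cases "s : B") auto
 qed
 from A.ev_alt[OF V(4) this, of "ga V"] 1 have "(SUM s:B. A.lr (?d s) * ga V s) : N" using c_mem[OF N] by blast
 hence l: "A.lr (?d s) : N" if "s : B" for s using ind[of "%s. A.lr (?d s)"] A.lr(1) hv that by auto
 have "h s = h' s" for s
 proof (cases "s : B")
  case True
  have dc: "?d s : cr (SX V)" using hv by simp
  have "?d s = 0[SX V]" using A.tau_ker[OF A.lr(1)[OF dc]] A.lr(2)[OF dc] l[OF True] by simp
  moreover have "h s = ?d s +[SX V] h' s" using hv by(simp add: A.minus_eq A.a_assoc A.l_neg)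
  ultimately show ?thesis using hv by simp
 next
  case False
  thus ?thesis using hB by simp
 qed
 hence "h = h'" by auto
 thus ?case using h(3) h'(3) V by auto
next
 case (10 x w)
 thus ?case unfolding LT_def by simp
qed

lemma LT_eq: assumes x: "x : pts" and D: "osub (Ox x) D" "N [= D" and 1: "!!U s. oin T U ==> x : U ==> s : S U ==> ga U s : D"
  and 2: "D [= ospan (Ox x) ({ga U s | U s. oin T U & x : U & s : S U} Un N)" shows "LT x = D"
proof
 interpret nm: names X K N Ox tu P NM LT by(rule NM_names)
 have gM: "ga U s : LT x" if U: "oin T U" "x : U" "s : S U" for U s
 proof -
  have U0: "U ~= {}" using U by auto
  interpret A: nring "SX U" "sec Ox U" N "tu U" by(rule nr[OF U(1) U0])
  have "NM U (ga U s) (cl U (bas (SX U) s))" unfolding NM_def by(intro bexI[of _ "bas (SX U) s"] conjI refl c_sym[OF N A.ev_basis] A.bas_cr U)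
  thus ?thesis using U unfolding LT_def by blast
 qed
 have "ospan (Ox x) ({ga U s | U s. oin T U & x : U & s : S U} Un N) [= LT x" by(rule ospan_least[OF nm.M_osub[OF x]]) (use gM nm.M_N[OF x] in auto)
 thus "D [= LT x" using 2 by auto
 show "LT x [= D"
 proof
  fix w assume "w : LT x"
  then obtain U f where U: "oin T U" "x : U" and f: "f : cr (FU U (S U))" "w - evU U (ga U) f : N" unfolding LT_def NM_def by auto
  have U0: "U ~= {}" using U by auto
  interpret A: nring "SX U" "sec Ox U" N "tu U" by(rule nr[OF U(1) U0])
  have "evU U (ga U) f : D" unfolding A.ev_def
  proof (rule osub_sum[OF D(1)])
   fix s assume s: "s : {s. f s ~= 0[SX U]}"
   hence "s : S U" using f(1) by(auto simp: f_cr)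
   moreover have "A.lr (f s) : Ox x" using A.lr(1)[OF A.f_val[OF f(1)]] U(2) by(auto simp: sec_def)
   ultimately show "A.lr (f s) * ga U s : D" using osubD(3)[OF D(1)] 1[OF U] by auto
  qed
  thus "w : D" by(rule osub_tr[OF D f(2)])
 qed
qed

lemma pres_realizes: "EX si. realizes (sheafify X P) si LT" using names.sheafify_realizes[OF NM_names] by blast

end

section \<open>Frames\<close>

lemma fspan_ospan: assumes B: "finite B" and A: "osubring A" and N: "osub UNIV N" and NA: "N [= A" shows "fspan N A B = ospan A (B Un N)"
proof
 show "fspan N A B [= ospan A (B Un N)"
 proof
  fix w assume "w : fspan N A B"
  then obtain c where c: "ALL b:B. c b : A" "w - (SUM b:B. c b * b) : N" unfolding fspan_def by auto
  note os = ospan_osub[OF A, of "B Un N"]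
  have "(SUM b:B. c b * b) : ospan A (B Un N)" using c ospanI[OF A, of "B Un N"] by(intro osub_sum[OF os] osubD(3)[OF os]) auto
  from osub_tr[OF os _ c(2) this] show "w : ospan A (B Un N)" using ospanI[OF A, of "B Un N"] by auto
 qed
 show "ospan A (B Un N) [= fspan N A B"
 proof (rule ospan_least)
  show "osub A (fspan N A B)" unfolding osub_def
  proof (intro conjI ballI)
   show "0 : fspan N A B" unfolding fspan_def using osrD(3)[OF A] osubD(1)[OF N] by(auto intro!: exI[of _ "%_. 0"])
  next
   fix v w assume "v : fspan N A B" "w : fspan N A B"
   then obtain c d where c: "ALL b:B. c b : A" "v - (SUM b:B. c b * b) : N"
    "ALL b:B. d b : A" "w - (SUM b:B. d b * b) : N" unfolding fspan_def by auto
   from c_add[OF N c(2,4)] have "v + w - (SUM b:B. (c b + d b) * b) : N" by(simp add: sum.distrib distrib_right)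
   thus "v + w : fspan N A B" unfolding fspan_def using c osrD(4)[OF A] by(auto intro!: exI[of _ "%b. c b + d b"])
  next
   fix a w assume "a : A" "w : fspan N A B"
   then obtain c where c: "a : A" "ALL b:B. c b : A" "w - (SUM b:B. c b * b) : N" unfolding fspan_def by auto
   from c_mult[OF N c_refl[OF N, of a] c(3)] have "a * w - (SUM b:B. (a * c b) * b) : N" by(simp add: sum_distrib_left mult.assoc)
   thus "a * w : fspan N A B" unfolding fspan_def using c osrD(5)[OF A] by(auto intro!: exI[of _ "%b. a * c b"])
  qed
  show "B Un N [= fspan N A B"
  proof
   fix w assume w: "w : B Un N"
   show "w : fspan N A B"
   proof (cases "w : N")
    case True
    thus ?thesis unfolding fspan_def using osrD(3)[OF A] by(auto intro!: exI[of _ "%_. 0"])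
   next
    case False
    hence "w : B" using w by auto
    hence "(SUM b:B. (if b = w then 1 else 0) * b) = w" using B by(simp add: if_distrib[of "%x. x * _"] cong: if_cong)
    thus ?thesis unfolding fspan_def using osrD(1,3)[OF A] osubD(1)[OF N] by(auto intro!: exI[of _ "%b. if b = w then 1 else 0"])
   qed
  qed
 qed
qed

definition msets :: "'w set => nat => 'w multiset set" where "msets B q = {A. set_mset A [= B & size A = q}"

lemma finite_msets: "finite B ==> finite (msets B q)"
proof -
 assume B: "finite B"
 have "msets B q [= mset ` {l. set l [= B & length l = q}"
 proof
  fix A assume "A : msets B q"
  hence A: "set_mset A [= B" "size A = q" by(auto simp: msets_def)
  obtain l where "mset l = A" using ex_mset by blast
  thus "A : mset ` {l. set l [= B & length l = q}" using A by(intro image_eqI[of _ _ l]) auto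
 qed
 thus ?thesis by(rule finite_subset[OF _ finite_imageI[OF finite_lists_length_eq[OF B]]])
qed

context gmodel
begin

lemma fr_atD: assumes "fr_at M U B" shows "finite B" "y : U ==> M y = fspan N (Ox y) B"
  "(!!b. b : B ==> c b : K) ==> (SUM b:B. c b * b) : N ==> b : B ==> c b : N" using assms unfolding fr_at_def by blast+

lemma fr_at_mono: "fr_at M U B ==> V [= U ==> fr_at M V B" unfolding fr_at_def by blast

lemma fr_at_span: assumes U: "oin T U" and fr: "fr_at M U B" and y: "y : U" shows "M y = ospan (Ox y) (B Un N)" unfolding fr_atD(2)[OF fr y]
 by(rule fspan_ospan[OF fr_atD(1)[OF fr] Ox[OF sub_top[OF U y]] N NOx[OF sub_top[OF U y]]])

lemma N_sec: "oin T U ==> N [= sec Ox U" using NOx[OF sub_top] unfolding sec_def by blast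

text \<open>At each point the coefficients of \<open>w\<close> are regular at that point.
  Independence over \<open>K\<close> makes the coefficients from different points agree modulo
  \<open>N\<close>, so those from one point are regular on all of \<open>U\<close>.\<close>

lemma framed_sec: assumes U: "oin T U" "U ~= {}" and fr: "fr_at M U B" shows "sec M U = ospan (sec Ox U) (B Un N)"
proof -
 have "sec M U = fspan N (sec Ox U) B"
 proof
  show "fspan N (sec Ox U) B [= sec M U"
  proof
   fix w assume "w : fspan N (sec Ox U) B"
   then obtain c where c: "ALL b:B. c b : sec Ox U" "w - (SUM b:B. c b * b) : N" unfolding fspan_def by auto
   have "w : fspan N (Ox y) B" if "y : U" for y unfolding fspan_def using c that by(auto simp: sec_def intro!: exI[of _ c])
   thus "w : sec M U" unfolding sec_def using fr_atD(2)[OF fr] by blast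
  qed
  show "sec M U [= fspan N (sec Ox U) B"
  proof
   fix w assume w: "w : sec M U"
   have "EX c. (ALL b:B. c b : Ox y) & w - (SUM b:B. c b * b) : N" if "y : U" for y
    using secD[OF w that] fr_atD(2)[OF fr that] by(auto simp: fspan_def)
   then obtain c where c: "!!y b. y : U ==> b : B ==> c y b : Ox y" "!!y. y : U ==> w - (SUM b:B. c y b * b) : N" by metis
   obtain z where z: "z : U" using U by auto
   have "c z b : Ox y" if y: "y : U" and b: "b : B" for y b
   proof -
    have "(SUM b:B. c z b * b) - (SUM b:B. c y b * b) : N" by(rule c_trans[OF N c_sym[OF N c(2)[OF z]] c(2)[OF y]])
    hence "(SUM b:B. (c z b - c y b) * b) : N" by(simp add: sum_subtractf left_diff_distrib)
    moreover have "c z b - c y b : K" if "b : B" for b using c(1) that y z OxK[OF sub_top[OF U(1)]] by(intro osrD(7)[OF K]) auto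
    ultimately have "c z b - c y b : N" using fr_atD(3)[OF fr, of "%b. c z b - c y b" b] b by blast
    thus ?thesis using osub_tr[OF osr_osub[OF Ox] NOx] c(1)[OF y b] sub_top[OF U(1) y] by blast
   qed
   thus "w : fspan N (sec Ox U) B" using c(2)[OF z] by(auto simp: fspan_def sec_def intro!: exI[of _ "c z"])
  qed
 qed
 thus ?thesis using fspan_ospan[OF fr_atD(1)[OF fr] osr_sec[OF U(1)] N N_sec[OF U(1)]] by simp
qed

text \<open>Only finitely many coefficients from \<open>Ox x\<close> occur in \<open>w\<close>, and
  each is regular on a neighbourhood of \<open>x\<close>.\<close>

lemma framed_open: assumes M: "framed M" and x: "x : pts" and w: "w : M x" shows "EX U. oin T U & x : U & w : sec M U"
proof -
 obtain U B where U: "oin T U" "x : U" and fr: "fr_at M U B" using M x unfolding framed_def by blast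
 note os = fr_at_span[OF U(1) fr]
 have "w : ospan (Ox x) (B Un N)" using w os[OF U(2)] by simp
 thus ?thesis
 proof induction
  case zero
  have "0 : sec M U" using os by(auto simp: sec_def intro: ospan.zero)
  thus ?case using U by auto
 next
  case (step a s v)
  then obtain V where V: "oin T V" "x : V" "v : sec M V" by auto
  obtain W where W: "oin T W" "x : W" "a : sec Ox W" using Ox_open[OF x step(1)] by auto
  have "a * s + v : sec M (U Int V Int W)" unfolding sec_def
  proof (intro CollectI ballI)
   fix y assume y: "y : U Int V Int W"
   hence "v : ospan (Ox y) (B Un N)" "a : Ox y" using V W os by(auto simp: sec_def)
   thus "a * s + v : M y" using os[of y] y step(2) by(auto intro: ospan.step)
  qed
  thus ?case using U V W by(intro exI[of _ "U Int V Int W"]) auto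
 qed
qed

lemma framed_osub: assumes M: "framed M" and x: "x : pts" shows "osub (Ox x) (M x)" "N [= M x"
proof -
 obtain U B where U: "oin T U" "x : U" and fr: "fr_at M U B" using M x unfolding framed_def by blast
 show "osub (Ox x) (M x)" "N [= M x" unfolding fr_at_span[OF U(1) fr U(2)] using ospan_osub[OF Ox[OF x]] ospanI[OF Ox[OF x], of "B Un N"] by auto
qed

text \<open>The relation \<open>b - b' : N\<close> has the coefficients 1 and -1, so
  \<open>1 : N\<close>. The case \<open>N = UNIV\<close> is possible in \<open>gmodel\<close>; there
  every claim of membership in \<open>N\<close> is trivial.\<close>

lemma framed_at_inj: assumes fr: "fr_at M U B" and b: "b : B" "b' : B" "b - b' : N" "b ~= b'" shows "N = UNIV"
proof -
 let ?c = "%x. if x = b then 1 else if x = b' then - 1 else (0::'w)"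
 have "(SUM x:B. ?c x * x) = (SUM x:{b, b'}. ?c x * x)" using b fr_atD(1)[OF fr] by(intro sum.mono_neutral_right) auto
 also have "\<dots> = b - b'" using b by simp
 finally have "(SUM x:B. ?c x * x) : N" using b by simp
 moreover have "?c x : K" for x using osrD[OF K] by auto
 ultimately have "?c b : N" using fr_atD(3)[OF fr, of ?c b] b by blast
 hence "1 : N" by simp
 thus ?thesis using osubD(3)[OF N, of _ 1] by auto
qed

abbreviation "lmU si M U \<equiv> nmod.lm (sec M U) (si U)"

lemma lm_restr: assumes F: "realizes F si M" and o: "oin T U" "oin T V" "V ~= {}" "V [= U" and s: "s : cr (Sec F U)"
 shows "lmU si M V (restr F U V s) - lmU si M U s : N"
proof -
 have U: "U ~= {}" using o by auto
 interpret A: nmod "SX U" "sec Ox U" N "tu U" "Sec F U" "sec M U" "si U" by(rule r_mod[OF F o(1) U])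
 interpret B: nmod "SX V" "sec Ox V" N "tu V" "Sec F V" "sec M V" "si V" by(rule r_mod[OF F o(2,3)])
 have a: "A.lm s : sec M U" "si U (A.lm s) = s" using A.lm[OF s] by auto
 have "restr F U V s = si V (A.lm s)" using r_restr[OF F o a(1)] a(2) by simp
 thus ?thesis by(intro B.lm_cong) (use sec_mono[OF o(4) a(1)] in auto)
qed

lemma r_res_cl: assumes F: "realizes F si M" and o: "oin T U" "oin T V" "V ~= {}" "V [= U" shows "s : cr (Sec F U) ==> restr F U V s : cr (Sec F V)"
  "s : cr (Sec F U) ==> t : cr (Sec F U) ==> restr F U V (s +[Sec F U] t) = restr F U V s +[Sec F V] restr F U V t"
  "r : cr (SX U) ==> s : cr (Sec F U) ==> restr F U V (r #[Sec F U] s) = restr OX U V r #[Sec F V] restr F U V s"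
proof -
 have U: "U ~= {}" using o by auto
 interpret A: nmod "SX U" "sec Ox U" N "tu U" "Sec F U" "sec M U" "si U" by(rule r_mod[OF F o(1) U])
 interpret B: nmod "SX V" "sec Ox V" N "tu V" "Sec F V" "sec M V" "si V" by(rule r_mod[OF F o(2,3)])
 note r = r_restr[OF F o]
 show "s : cr (Sec F U) ==> restr F U V s : cr (Sec F V)" for s using A.sig_surj[of s] r B.sig_closed sec_mono[OF o(4)] by force
 show "restr F U V (s +[Sec F U] t) = restr F U V s +[Sec F V] restr F U V t" if s: "s : cr (Sec F U)" and t: "t : cr (Sec F U)" for s t
 proof -
  obtain v w where v: "v : sec M U" "w : sec M U" "s = si U v" "t = si U w" using A.sig_surj[OF s] A.sig_surj[OF t] by auto
  thus ?thesis using r[OF v(1)] r[OF v(2)] r[OF osubD(2)[OF A.L v(1,2)]] A.sig_add[OF v(1,2)]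
    B.sig_add[OF sec_mono[OF o(4) v(1)] sec_mono[OF o(4) v(2)]] by simp
 qed
 show "restr F U V (a #[Sec F U] s) = restr OX U V a #[Sec F V] restr F U V s" if a: "a : cr (SX U)" and s: "s : cr (Sec F U)" for a s
 proof -
  obtain b w where v: "b : sec Ox U" "w : sec M U" "a = tu U b" "s = si U w" using A.sig_surj[OF s] A.tau_surj[OF a] by auto
  thus ?thesis using tau_restr[OF o v(1)] r[OF v(2)] r[OF osubD(3)[OF A.L v(1,2)]] A.sig_smult[OF v(1,2)]
    B.sig_smult[OF sec_mono[OF o(4) v(1)] sec_mono[OF o(4) v(2)]] by simp
 qed
qed

text \<open>This makes multiplication from the symmetric power into \<open>'w\<close> injective,
  without which products could not name its elements. It holds for units in rank one and, by
  \<open>vars_mon_indep\<close>, for frames that span the same space as a set of variables.\<close>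

definition mon_indep :: "'w set => nat => bool" where
 "mon_indep B q \<longleftrightarrow> (ALL c. (ALL A. c A : K) --> (SUM A:msets B q. c A * prod_mset A) : N --> (ALL A:msets B q. c A : N))"

lemma mon_indepD: "mon_indep B q ==> (!!A. c A : K) ==> (SUM A:msets B q. c A * prod_mset A) : N ==> A : msets B q ==> c A : N"
 unfolding mon_indep_def by blast

text \<open>The image of the \<open>q\<close>-th symmetric power of \<open>M x\<close> under
  multiplication in \<open>'w\<close>; \<open>N\<close> is added so that the result is again closed
  under congruence.\<close>

definition pw :: "('p => 'w set) => nat => 'p => 'w set" where "pw M q x = ospan (Ox x) ({prod_list l | l. length l = q & set l [= M x} Un N)"

lemma pw_osub: "x : pts ==> osub (Ox x) (pw M q x)" unfolding pw_def by(rule ospan_osub[OF Ox])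

lemma pw_N: "x : pts ==> N [= pw M q x" unfolding pw_def using ospanI[OF Ox, of x "{prod_list l | l. length l = q & set l [= M x} Un N"] by blast

lemma pw_prod: "x : pts ==> length l = q ==> set l [= M x ==> prod_list l : pw M q x"
 unfolding pw_def using ospanI[OF Ox, of x "{prod_list l | l. length l = q & set l [= M x} Un N"] by blast

lemma pw_frame_span: assumes U: "oin T U" "y : U" and fr: "fr_at M U B" shows "pw M q y = fspan N (Ox y) (prod_mset ` msets B q)"
proof -
 have y: "y : pts" using sub_top[OF U] .
 note A = Ox[OF y] and NA = NOx[OF y]
 let ?B = "%q. prod_mset ` msets B q"
 have fb: "finite (?B q)" for q using finite_msets[OF fr_atD(1)[OF fr]] by simp
 have My: "M y = ospan (Ox y) (B Un N)" by(rule fr_at_span[OF U(1) fr U(2)])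
 have e: "fspan N (Ox y) (?B q) = ospan (Ox y) (?B q Un N)" for q by(rule fspan_ospan[OF fb A N NA])
 note os = ospan_osub[OF A]
 note inc = ospanI[OF A]
 have "prod_list l : ospan (Ox y) (?B (length l) Un N)" if "set l [= M y" for l using that
 proof (induction l)
  case Nil
  have "{#} : msets B 0" by(simp add: msets_def)
  hence "prod_mset {#} : ?B 0 Un N" by blast
  thus ?case using inc[of "?B 0 Un N"] by auto
 next
  case (Cons a l)
  have "a : ospan (Ox y) (B Un N)" "prod_list l : ospan (Ox y) (?B (length l) Un N)" using Cons My by auto
  thus ?case unfolding prod_list.Cons
  proof (rule ospan_product[OF A _ _ os])
   fix s t assume s: "s : B Un N" and t: "t : ?B (length l) Un N"
   consider "s : N" | "t : N" | A where "s : B" "A : msets B (length l)" "t = prod_mset A" using s t by auto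
   hence "s * t : ?B (length (a # l)) Un N"
   proof cases
    case 1
    thus ?thesis using osubD(3)[OF N UNIV_I, of s t] by(simp add: mult.commute)
   next
    case 2
    thus ?thesis using osubD(3)[OF N UNIV_I, of t s] by simp
   next
    case 3
    hence "add_mset s A : msets B (length (a # l))" by(auto simp: msets_def)
    thus ?thesis using 3 by(intro UnI1 image_eqI[of _ _ "add_mset s A"]) auto
   qed
   thus "s * t : ospan (Ox y) (?B (length (a # l)) Un N)" by(rule subsetD[OF inc])
  qed
 qed
 hence "pw M q y [= ospan (Ox y) (?B q Un N)" unfolding pw_def by(intro ospan_least[OF os]) (use inc[of "?B q Un N"] in auto)
 moreover have "ospan (Ox y) (?B q Un N) [= pw M q y"
 proof (rule ospan_least[OF pw_osub[OF y]])
  have "prod_mset A : pw M q y" if A: "A : msets B q" for A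
  proof -
   obtain l where l: "mset l = A" using ex_mset by blast
   have "B [= M y" unfolding My using inc[of "B Un N"] by auto
   moreover have "length l = q" "set l [= B" using A l by(auto simp: msets_def)
   ultimately have "prod_list l : pw M q y" by(intro pw_prod[OF y]) auto
   thus ?thesis using l prod_mset_prod_list[of l] by simp
  qed
  thus "?B q Un N [= pw M q y" using pw_N[OF y] by auto
 qed
 ultimately show ?thesis unfolding e by blast
qed

lemma mon_indep_inj: assumes B: "finite B" and mi: "mon_indep B q" and A: "A : msets B q" "A' : msets B q" "A ~= A'"
  and d: "prod_mset A - prod_mset A' : N" shows "N = UNIV"
proof -
 let ?c = "%x. if x = A then 1 else if x = A' then - 1 else (0::'w)"
 have "(SUM x:msets B q. ?c x * prod_mset x) = (SUM x:{A, A'}. ?c x * prod_mset x)" using A finite_msets[OF B] by(intro sum.mono_neutral_right) auto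
 also have "\<dots> = prod_mset A - prod_mset A'" using A by simp
 finally have "(SUM x:msets B q. ?c x * prod_mset x) : N" using d by simp
 moreover have k: "?c x : K" for x using osrD[OF K] by auto
 ultimately have "?c A : N" by(intro mon_indepD[OF mi, of ?c A] A k)
 hence "1 : N" by simp
 thus ?thesis using osubD(3)[OF N, of _ 1] by auto
qed

lemma framed_pw: assumes fr: "fr_at M U B" and U: "oin T U" and mi: "mon_indep B q" shows "fr_at (pw M q) U (prod_mset ` msets B q)"
 unfolding fr_at_def
proof (intro conjI ballI allI impI)
 have fB: "finite (msets B q)" using finite_msets[OF fr_atD(1)[OF fr]] .
 thus "finite (prod_mset ` msets B q)" by simp
 show "pw M q y = fspan N (Ox y) (prod_mset ` msets B q)" if "y : U" for y by(rule pw_frame_span[OF U that fr])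
 fix c b assume c: "(ALL b:prod_mset ` msets B q. c b : K) & (SUM b:prod_mset ` msets B q. c b * b) : N" and b: "b : prod_mset ` msets B q"
 show "c b : N"
 proof (cases "N = UNIV")
  case False
  hence inj: "inj_on prod_mset (msets B q)" using mon_indep_inj[OF fr_atD(1)[OF fr] mi] c_refl[OF N] by(metis inj_onI)
  let ?c = "%A. if A : msets B q then c (prod_mset A) else 0"
  have "(SUM b:prod_mset ` msets B q. c b * b) = (SUM A:msets B q. ?c A * prod_mset A)" by(simp add: sum.reindex[OF inj])
  moreover have k: "?c A : K" for A using c osrD(3)[OF K] by auto
  ultimately have "(SUM A:msets B q. ?c A * prod_mset A) : N" using c by simp
  from mon_indepD[OF mi k this] have "ALL A:msets B q. ?c A : N" by blast
  thus ?thesis using b by auto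
 qed simp
qed

end

section \<open>Symmetric and tensor powers\<close>

text \<open>The flag \<open>sy\<close> selects between symmetric and tensor powers, so that one
  proof covers both sheaves.\<close>

definition wrel :: "('r, 'a) ring_scheme => ('r, 'm) module => bool => nat => ('m list => 'r) set" where
 "wrel R M sy q = multilinear_relations R q M Un (if sy then permutation_relations R q M else {})"

context mrec
begin

lemma words_mid: "l @ [x] @ l' : words M q ==> x : cr M & set l [= cr M & set l' [= cr M" by(auto simp: words_def)

lemma w_repl: "l @ [x] @ l' : words M q ==> y : cr M ==> l @ [y] @ l' : words M q" by(auto simp: words_def)

abbreviation "Fw q \<equiv> FM R (words M q)"

lemma basis_minus: assumes "l1 : words M q" "l2 : words M q" "l3 : words M q" "r : cr R"
 shows "bas R l1 \<ominus>\<^bsub>Fw q\<^esub> bas R l2 = (%s. bas R l1 s \<ominus> bas R l2 s)"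
  "bas R l1 \<ominus>\<^bsub>Fw q\<^esub> (bas R l2 +[Fw q] bas R l3) = (%s. bas R l1 s \<ominus> (bas R l2 s \<oplus> bas R l3 s))"
  "bas R l1 \<ominus>\<^bsub>Fw q\<^esub> (r #[Fw q] bas R l2) = (%s. bas R l1 s \<ominus> r \<otimes> bas R l2 s)"
proof -
 note b = R.bas_cr[OF assms(1)] R.bas_cr[OF assms(2)] R.bas_cr[OF assms(3)]
 show "bas R l1 \<ominus>\<^bsub>Fw q\<^esub> bas R l2 = (%s. bas R l1 s \<ominus> bas R l2 s)" by(rule R.free_minus[OF b(1,2)])
 show "bas R l1 \<ominus>\<^bsub>Fw q\<^esub> (bas R l2 +[Fw q] bas R l3) = (%s. bas R l1 s \<ominus> (bas R l2 s \<oplus> bas R l3 s))"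
  by(simp add: R.free_minus[OF b(1) R.f_add[OF b(2,3)]])
 show "bas R l1 \<ominus>\<^bsub>Fw q\<^esub> (r #[Fw q] bas R l2) = (%s. bas R l1 s \<ominus> r \<otimes> bas R l2 s)"
  by(simp add: R.free_minus[OF b(1) R.f_smult[OF b(2) assms(4)]])
qed

lemma multilinear_cases: assumes "f : multilinear_relations R q M" obtains (add) l x y l' where "l @ [x] @ l' : words M q" "y : cr M"
   "f = (%s. bas R (l @ [x +[M] y] @ l') s \<ominus> (bas R (l @ [x] @ l') s \<oplus> bas R (l @ [y] @ l') s))"
  | (smult) l r x l' where "l @ [x] @ l' : words M q" "r : cr R"
   "f = (%s. bas R (l @ [r #[M] x] @ l') s \<ominus> r \<otimes> bas R (l @ [x] @ l') s)" using assms unfolding multilinear_relations_def Let_def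
proof (elim UnE CollectE exE conjE, goal_cases)
 case (1 l x y l')
 hence x: "x : cr M" using words_mid by blast
 have "l @ [x +[M] y] @ l' : words M q" "l @ [y] @ l' : words M q" using w_repl[OF 1(4)] x 1(5) by auto
 thus ?case using 1(1)[OF 1(4,5)] 1(3) basis_minus(2)[of _ q _ _ \<zero>] 1(4) by simp
next
 case (2 l r x l')
 hence x: "x : cr M" using words_mid by blast
 have "l @ [r #[M] x] @ l' : words M q" using w_repl[OF 2(4)] x 2(5) by auto
 thus ?case using 2(2)[OF 2(4,5)] 2(3) basis_minus(3)[of _ q _ _ r] 2(4,5) by simp
qed

lemma multilinear_add: assumes "l @ [x] @ l' : words M q" "y : cr M"
 shows "(%s. bas R (l @ [x +[M] y] @ l') s \<ominus> (bas R (l @ [x] @ l') s \<oplus> bas R (l @ [y] @ l') s)) : multilinear_relations R q M"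
proof -
 have x: "x : cr M" using words_mid assms by blast
 have "l @ [x +[M] y] @ l' : words M q" "l @ [y] @ l' : words M q" using w_repl[OF assms(1)] x assms by auto
 from basis_minus(2)[OF this(1) assms(1) this(2) R.zero_closed, symmetric] show ?thesis
  unfolding multilinear_relations_def Let_def using assms by blast
qed

lemma multilinear_smult: assumes "l @ [x] @ l' : words M q" "r : cr R"
 shows "(%s. bas R (l @ [r #[M] x] @ l') s \<ominus> r \<otimes> bas R (l @ [x] @ l') s) : multilinear_relations R q M"
proof -
 have x: "x : cr M" using words_mid assms by blast
 have "l @ [r #[M] x] @ l' : words M q" using w_repl[OF assms(1)] x assms by auto
 from basis_minus(3)[OF this assms(1) assms(1) assms(2), symmetric] show ?thesis unfolding multilinear_relations_def Let_def using assms by blast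
qed

lemma permutation_iff: "f : permutation_relations R q M \<longleftrightarrow>
  (EX l l'. f = (%s. bas R l s \<ominus> bas R l' s) & l : words M q & l' : words M q & mset l = mset l')"
proof -
 have "bas R l \<ominus>\<^bsub>Fw q\<^esub> bas R l' = (%s. bas R l s \<ominus> bas R l' s)"
  if "l : words M q" "l' : words M q" for l l' using basis_minus(1)[OF that that(1) R.zero_closed] .
 thus ?thesis unfolding permutation_relations_def by(auto; metis)
qed

lemma wrel_sub: "wrel R M sy q [= cr (Fw q)"
proof
 interpret F: mrec R "Fw q" by(intro mrec.intro R.f_mod)
 note mc = R.free_minus F.M.minus_closed
 have min: "(%s. f s \<ominus> g s) : cr (Fw q)" if "f : cr (Fw q)" "g : cr (Fw q)" for f g
  using F.M.minus_closed[OF that] R.free_minus[OF that] by simp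
 fix f assume "f : wrel R M sy q"
 then consider "f : multilinear_relations R q M" | "f : permutation_relations R q M" unfolding wrel_def by(auto split: if_splits)
 thus "f : cr (Fw q)"
 proof cases
  case 1
  thus ?thesis
  proof (cases rule: multilinear_cases)
   case (add l x y l')
   have x: "x : cr M" using words_mid[OF add(1)] by blast
   show ?thesis unfolding add(3) by(intro min R.f_add R.bas_cr w_repl[OF add(1)] M.a_closed x add(2))
  next
   case (smult l r x l')
   have x: "x : cr M" using words_mid[OF smult(1)] by blast
   show ?thesis unfolding smult(3) by(intro min R.f_smult R.bas_cr w_repl[OF smult(1)] smult_closed x smult(2))
  qed
 next
  case 2
  then obtain l l' where l: "f = (%s. bas R l s \<ominus> bas R l' s)" "l : words M q" "l' : words M q" unfolding permutation_iff by(elim exE conjE)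
  show ?thesis unfolding l(1) by(intro min R.bas_cr l)
 qed
qed

text \<open>\<open>d\<close> is linear modulo \<open>Z\<close>, so the vectors \<open>u\<close> with
  \<open>d u\<close> in \<open>Z\<close> form a submodule. It is applied to one slot of a word or of
  a pair while the others are fixed.\<close>

lemma expand_linear: assumes Z: "submodule Z R (FM R S)" and d: "!!u. u : cr M ==> d u : cr (FM R S)"
  and add: "!!u v. u : cr M ==> v : cr M ==> (%s. d (u +[M] v) s \<ominus> (d u s \<oplus> d v s)) : Z"
  and smult: "!!r u. r : cr R ==> u : cr M ==> (%s. d (r #[M] u) s \<ominus> r \<otimes> d u s) : Z"
  and G: "sspan R M G = cr M" "!!u. u : G ==> u : cr M & d u : Z" and t: "t : cr M" shows "d t : Z"
proof -
 interpret F: mrec R "FM R S" by(intro mrec.intro R.f_mod)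
 have Zc: "Z [= cr (FM R S)" using F.submoduleE(1)[OF Z] .
 have eqZ: "f : Z" if d: "(%s. f s \<ominus> h s) : Z" and h: "h : Z" and f: "f : cr (FM R S)" for f h
 proof -
  have hc: "h : cr (FM R S)" using h Zc by auto
  have "(%s. f s \<ominus> h s) +[FM R S] h : Z" by(rule F.submoduleE(5)[OF Z d h])
  moreover have "(%s. f s \<ominus> h s) +[FM R S] h = f" using R.f_val[OF hc] R.f_val[OF f] by(simp add: fun_eq_iff R.minus_eq R.a_assoc R.l_neg)
  ultimately show ?thesis by simp
 qed
 let ?H = "{u : cr M. d u : Z}"
 \<comment> \<open>The alternative \<open>r = \<zero>\<close> serves the zero vector: it is zero
   times a vector, so \<open>d\<close> sends it into \<open>Z\<close> before anything is known about
   \<open>?H\<close>.\<close>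
 have H0: "r #[M] u : ?H" if r: "r : cr R" and u: "u : cr M" "r = \<zero> \<or> u : ?H" for r u
 proof -
  have h: "(%s. r \<otimes> d u s) : Z"
  proof (cases "r = \<zero>")
   case True
   hence "(%s. r \<otimes> d u s) = (%_. \<zero>)" using R.f_val[OF d[OF u(1)]] by simp
   thus ?thesis using F.sub_zero[OF Z] by simp
  next
   case False
   thus ?thesis using F.submoduleE(4)[OF Z r, of "d u"] u by simp
  qed
  have "d (r #[M] u) : Z" by(rule eqZ[OF smult[OF r u(1)] h d[OF smult_closed[OF r u(1)]]])
  thus ?thesis using r u by simp
 qed
 have "submodule ?H R M"
 proof (rule submoduleI)
  show "0[M] : ?H" using H0[of \<zero> "0[M]"] by simp
  show "r #[M] u : ?H" if "r : cr R" "u : ?H" for r u using H0[of r u] that by simp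
  show "\<ominus>\<^bsub>M\<^esub> u : ?H" if "u : ?H" for u
  proof -
   have "\<ominus>\<^bsub>M\<^esub> u = (\<ominus> \<one>) #[M] u" using smult_l_minus[of \<one> u] smult_one[of u] that by simp
   thus ?thesis using H0[of "\<ominus> \<one>" u] that by simp
  qed
  show "u +[M] v : ?H" if u: "u : ?H" and v: "v : ?H" for u v
  proof -
   have uv: "u : cr M" "v : cr M" using u v by auto
   have h: "(%s. d u s \<oplus> d v s) : Z" using F.submoduleE(5)[OF Z, of "d u" "d v"] u v by simp
   have "d (u +[M] v) : Z" by(rule eqZ[OF add[OF uv] h d[OF M.a_closed[OF uv]]])
   thus ?thesis using uv by simp
  qed
 qed auto
 hence "sspan R M G [= ?H" by(rule span_least) (use G(2) in blast)
 thus ?thesis using G(1) t by blast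
qed

text \<open>Induction on the part \<open>l'\<close> of the word whose letters are still arbitrary;
  \<open>expand_linear\<close> replaces its first letter by generators.\<close>

lemma words_expand: assumes Z: "submodule Z R (Fw q)" and rZ: "multilinear_relations R q M [= Z" and G: "G [= cr M" "sspan R M G = cr M"
  and g: "!!l. l : words M q ==> set l [= G ==> bas R l : Z" and l: "l : words M q" shows "bas R l : Z"
proof -
 have "bas R (l @ l') : Z" if "set l [= G" "l @ l' : words M q" for l l' using that
 proof (induction l' arbitrary: l)
  case Nil
  thus ?case using g by simp
 next
  case (Cons t l')
  have w: "l @ [u] @ l' : words M q" if "u : cr M" for u using w_repl[of l t l' q u] Cons.prems that by simp
  have t: "t : cr M" using Cons.prems(2) by(auto simp: words_def)
  have "bas R (l @ [t] @ l') : Z"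
  proof (rule expand_linear[OF Z _ _ _ G(2) _ t, where d = "%u. bas R (l @ [u] @ l')"])
   show "u : cr M & bas R (l @ [u] @ l') : Z" if "u : G" for u using Cons.IH[of "l @ [u]"] Cons.prems(1) w[of u] G(1) that by auto
  qed (use R.bas_cr[OF w] subsetD[OF rZ multilinear_add[OF w]] subsetD[OF rZ multilinear_smult[OF w]] in blast)+
  thus ?case by simp
 qed
 from this[of "[]" l] l show ?thesis by simp
qed

end

context presented
begin

text \<open>A submodule that contains all relations. Showing that it contains the basis elements is
  how the last clause of \<open>local_basis\<close> is proved.\<close>

definition red where "red B = {f : cr F. EX g:cr F. {t. g t ~= \<zero>} [= B & cls f = cls g}"

lemma redI: "f : cr F ==> g : cr F ==> {t. g t ~= \<zero>} [= B ==> cls f = cls g ==> f : red B" unfolding red_def by blast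

lemma redE: assumes "f : red B" obtains g where "f : cr F" "g : cr F" "{t. g t ~= \<zero>} [= B" "cls f = cls g"
 using assms unfolding red_def by blast

lemma red_smult: assumes r: "r : cr R" and f: "f : red B" shows "(%s. r \<otimes> f s) : red B"
proof -
 obtain g where g: "f : cr F" "g : cr F" "{t. g t ~= \<zero>} [= B" "cls f = cls g" by(rule redE[OF f])
 show ?thesis
 proof (rule redI[OF f_smult[OF g(1) r] f_smult[OF g(2) r]])
  show "{t. r \<otimes> g t ~= \<zero>} [= B" using g(3) r by auto
  show "cls (%s. r \<otimes> f s) = cls (%s. r \<otimes> g s)" using pres_smult[OF r g(1)] pres_smult[OF r g(2)] g(4) by simp
 qed
qed

lemma red_add: assumes f: "f : red B" and f': "f' : red B" shows "(%s. f s \<oplus> f' s) : red B"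
proof -
 obtain g where g: "f : cr F" "g : cr F" "{t. g t ~= \<zero>} [= B" "cls f = cls g" by(rule redE[OF f])
 obtain g' where g': "f' : cr F" "g' : cr F" "{t. g' t ~= \<zero>} [= B" "cls f' = cls g'" by(rule redE[OF f'])
 show ?thesis
 proof (rule redI[OF f_add[OF g(1) g'(1)] f_add[OF g(2) g'(2)]])
  show "{t. g t \<oplus> g' t ~= \<zero>} [= B"
  proof
   fix t assume t: "t : {t. g t \<oplus> g' t ~= \<zero>}"
   have "g t ~= \<zero> \<or> g' t ~= \<zero>" using t by(cases "g t = \<zero>") auto
   thus "t : B" using g(3) g'(3) by auto
  qed
  show "cls (%s. f s \<oplus> f' s) = cls (%s. g s \<oplus> g' s)" using pres_add[OF g(1) g'(1)] pres_add[OF g(2) g'(2)] g(4) g'(4) by simp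
 qed
qed

lemma red_Sp: "Sp [= red B"
proof
 fix f assume f: "f : Sp"
 interpret F: mrec R F by(rule F_mod)
 have fc: "f : cr F" using F.submoduleE(1)[OF Sp_sub] f by auto
 have zc: "(%_. \<zero>) : cr F" using F.zero_closed by simp
 have "(%s. f s \<ominus> \<zero>) = f" using f_val[OF fc] by(simp add: minus_eq)
 hence "cls f = cls (%_. \<zero>)" using cls_eq[OF fc zc] f by simp
 thus "f : red B" by(intro redI[OF fc zc]) auto
qed

lemma red_submodule: "submodule (red B) R F"
proof -
 interpret F: mrec R F by(rule F_mod)
 show ?thesis
 proof (rule F.submoduleI)
  show "red B [= cr F" unfolding red_def by blast
  show "0[F] : red B" using red_Sp F.sub_zero[OF Sp_sub] by blast
  show "r #[F] f : red B" if "r : cr R" "f : red B" for r f using red_smult that by simp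
  show "f +[F] g : red B" if "f : red B" "g : red B" for f g using red_add that by simp
  show "\<ominus>\<^bsub>F\<^esub> f : red B" if f: "f : red B" for f
  proof -
   have "f : cr F" using f unfolding red_def by blast
   hence "\<ominus>\<^bsub>F\<^esub> f = (\<ominus> \<one>) #[F] f" using F.smult_l_minus[of \<one> f] F.smult_one[of f] by simp
   thus ?thesis using red_smult[of "\<ominus> \<one>" f] f by simp
  qed
 qed
qed

lemma red_basis: "s : S ==> s : B ==> bas R s : red B" by(rule redI[OF bas_cr bas_cr]) (auto simp: basis_elt_def)

lemma red_basis_diff: assumes "bas R s : red B" shows "EX f:cr F. {t. f t ~= \<zero>} [= B & (%t. bas R s t \<ominus> f t) : Sp"
 using assms cls_eq unfolding red_def by blast

lemma red_cls_eq: "f : red B ==> g : cr F ==> (%s. g s \<ominus> f s) : Sp ==> g : red B" using cls_eq unfolding red_def by blast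

end

lemma cong_prod_map: assumes N: "osub UNIV N" shows "(!!x. x : set l ==> f x - g x : N) ==> prod_list (map f l) - prod_list (map g l) : N"
 by(induction l) (use N in \<open>auto simp: osubD(1) intro: c_mult\<close>)

context gmodel
begin

abbreviation "lwU si M U l \<equiv> prod_list (map (lmU si M U) l)"

lemma sec_span: assumes F: "realizes F si M" and U: "oin T U" "U ~= {}" and fr: "fr_at M U B" shows "sspan (SX U) (Sec F U) (si U ` B) = cr (Sec F U)"
proof -
 interpret A: nmod "SX U" "sec Ox U" N "tu U" "Sec F U" "sec M U" "si U" by(rule r_mod[OF F U])
 interpret m: mrec "SX U" "Sec F U" by(intro mrec.intro A.is_mod)
 have s: "sec M U = ospan (sec Ox U) (B Un N)" by(rule framed_sec[OF U fr])
 have BN: "B Un N [= sec M U" unfolding s by(rule ospanI[OF A.A])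
 hence Bc: "si U ` B [= cr (Sec F U)" using A.sig_closed by auto
 note sub = m.span_sub[OF Bc]
 have "si U ` (B Un N) [= sspan (SX U) (Sec F U) (si U ` B)"
 proof
  fix m assume "m : si U ` (B Un N)"
  then obtain w where w: "w : B Un N" "m = si U w" by auto
  show "m : sspan (SX U) (Sec F U) (si U ` B)"
  proof (cases "w : B")
   case True
   thus ?thesis using m.span_incl w by blast
  next
   case False
   hence "m = 0[Sec F U]" using w BN A.sig_ker[of w] by auto
   thus ?thesis using m.sub_zero[OF sub] by simp
  qed
 qed
 hence "sspan (SX U) (Sec F U) (si U ` (B Un N)) [= sspan (SX U) (Sec F U) (si U ` B)" by(rule m.span_least[OF sub])
 moreover have "sspan (SX U) (Sec F U) (si U ` (B Un N)) = cr (Sec F U)" unfolding A.span_image[OF BN] s[symmetric] A.M_carrier ..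
 ultimately show ?thesis using m.submoduleE(1)[OF sub] by blast
qed

text \<open>The value of a word is the product of its letters, which forgets their order. Hence for
  tensor powers the frame must have at most one element, which is the case of a line bundle.\<close>

theorem words_pres_sheaf: assumes F: "realizes F si M" and M: "framed M"
  and good: "!!x. x : pts ==> EX U B. oin T U & x : U & fr_at M U B & mon_indep B q & (sy \<or> card B <= 1)"
 shows "pres_sheaf X K N Ox tu (%U. words (Sec F U) q) (%U. wrel (SX U) (Sec F U) sy q) (%U V. map (restr F U V)) (%U l. lwU si M U l)"
proof (unfold_locales, goal_cases)
 case (1 U)
 interpret A: nmod "SX U" "sec Ox U" N "tu U" "Sec F U" "sec M U" "si U" by(rule r_mod[OF F 1])
 show ?case by(rule mrec.wrel_sub) (intro mrec.intro A.is_mod)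
next
 case (2 U V)
 show ?case by(auto simp: words_def intro!: r_res_cl(1)[OF F 2])
next
 case (3 U V f)
 note o = 3(1-4)
 have U0: "U ~= {}" using o by auto
 interpret A: nmod "SX U" "sec Ox U" N "tu U" "Sec F U" "sec M U" "si U" by(rule r_mod[OF F 3(1) U0])
 interpret B: nmod "SX V" "sec Ox V" N "tu V" "Sec F V" "sec M V" "si V" by(rule r_mod[OF F 3(2,3)])
 interpret mA: mrec "SX U" "Sec F U" by(intro mrec.intro A.is_mod)
 interpret mB: mrec "SX V" "Sec F V" by(intro mrec.intro B.is_mod)
 let ?te = "map (restr F U V)"
 note rc = r_res_cl[OF F o]
 have th: "?te : words (Sec F U) q \<rightarrow> words (Sec F V) q" by(auto simp: words_def intro!: rc(1))
 interpret p: push "SX U" "SX V" "restr OX U V" "words (Sec F U) q" "words (Sec F V) q" ?te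
  by(intro push.intro push_axioms.intro nr_cring restr_hom o th)
 have "p.pu f : wrel (SX V) (Sec F V) sy q"
 proof (cases "f : multilinear_relations (SX U) q (Sec F U)")
  case True
  thus ?thesis
  proof (cases rule: mA.multilinear_cases)
   case (add l x y l')
   note x = mA.words_mid[OF add(1), THEN conjunct1]
   have w: "l @ [x +[Sec F U] y] @ l' : words (Sec F U) q" "l @ [y] @ l' : words (Sec F U) q" using mA.w_repl[OF add(1)] x add(2) by auto
   note b = A.bas_cr[OF w(1)] A.bas_cr[OF add(1)] A.bas_cr[OF w(2)]
   have e: "p.pu f = (%s. bas (SX V) (?te (l @ [x +[Sec F U] y] @ l')) s \<ominus>\<^bsub>SX V\<^esub>
     (bas (SX V) (?te (l @ [x] @ l')) s +[SX V] bas (SX V) (?te (l @ [y] @ l')) s))"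
    unfolding add(3) p.push_minus[OF b(1) A.f_add[OF b(2,3)]] p.push_add[OF b(2,3)]
     p.push_basis[OF w(1)] p.push_basis[OF w(2)] p.push_basis[OF add(1)] ..
   have "?te l @ [restr F U V x] @ ?te l' : words (Sec F V) q" using funcset_mem[OF th add(1)] by simp
   from mB.multilinear_add[OF this rc(1)[OF add(2)]] show ?thesis unfolding e wrel_def using rc(2)[OF x add(2)] by simp
  next
   case (smult l r x l')
   note x = mA.words_mid[OF smult(1), THEN conjunct1]
   have w: "l @ [r #[Sec F U] x] @ l' : words (Sec F U) q" using mA.w_repl[OF smult(1)] x smult(2) by auto
   note b = A.bas_cr[OF w] A.bas_cr[OF smult(1)]
   have e: "p.pu f = (%s. bas (SX V) (?te (l @ [r #[Sec F U] x] @ l')) s \<ominus>\<^bsub>SX V\<^esub>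
     restr OX U V r *[SX V] bas (SX V) (?te (l @ [x] @ l')) s)"
    unfolding smult(3) p.push_minus[OF b(1) A.f_smult[OF b(2) smult(2)]] p.push_smult[OF smult(2) b(2)]
     p.push_basis[OF w(1)] p.push_basis[OF smult(1)] ..
   have "?te l @ [restr F U V x] @ ?te l' : words (Sec F V) q" using funcset_mem[OF th smult(1)] by simp
   moreover have "restr OX U V r : cr (SX V)" using smult(2) by simp
   ultimately show ?thesis unfolding e wrel_def using mB.multilinear_smult rc(3)[OF smult(2) x] by fastforce
  qed
 next
  case False
  hence sy: "sy" and "f : permutation_relations (SX U) q (Sec F U)" using 3(5) by(auto simp: wrel_def split: if_splits)
  then obtain l l' where l: "f = (%s. bas (SX U) l s \<ominus>\<^bsub>SX U\<^esub> bas (SX U) l' s)"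
   "l : words (Sec F U) q" "l' : words (Sec F U) q" "mset l = mset l'" unfolding mA.permutation_iff by(elim exE conjE)
  note b = A.bas_cr[OF l(2)] A.bas_cr[OF l(3)]
  have e: "p.pu f = (%s. bas (SX V) (?te l) s \<ominus>\<^bsub>SX V\<^esub> bas (SX V) (?te l') s)"
   unfolding l(1) p.push_minus[OF b] p.push_basis[OF l(2)] p.push_basis[OF l(3)] ..
  have "mset (?te l) = mset (?te l')" using l(4) by simp
  hence "p.pu f : permutation_relations (SX V) q (Sec F V)"
   unfolding e mB.permutation_iff using funcset_mem[OF th l(2)] funcset_mem[OF th l(3)] by blast
  thus ?thesis unfolding wrel_def using sy by simp
 qed
 thus ?case using mrec.span_incl[OF p.F'_mod] by(rule subsetD[rotated])
next
 case (4 U f)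
 interpret A: nmod "SX U" "sec Ox U" N "tu U" "Sec F U" "sec M U" "si U" by(rule r_mod[OF F 4(1,2)])
 interpret mA: mrec "SX U" "Sec F U" by(intro mrec.intro A.is_mod)
 let ?ga = "lwU si M U"
 show ?case
 proof (cases "f : multilinear_relations (SX U) q (Sec F U)")
  case True
  thus ?thesis
  proof (cases rule: mA.multilinear_cases)
   case (add l x y l')
   note x = mA.words_mid[OF add(1), THEN conjunct1]
   have w: "l @ [x +[Sec F U] y] @ l' : words (Sec F U) q" "l @ [y] @ l' : words (Sec F U) q" using mA.w_repl[OF add(1)] x add(2) by auto
   note b = A.bas_cr[OF w(1)] A.bas_cr[OF add(1)] A.bas_cr[OF w(2)]
   have 1: "A.ev ?ga f - (?ga (l @ [x +[Sec F U] y] @ l') - (?ga (l @ [x] @ l') + ?ga (l @ [y] @ l'))) : N" unfolding add(3)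
    by(rule c_trans[OF N A.ev_diff[OF b(1) A.f_add[OF b(2,3)]] c_diff[OF N A.ev_basis
       c_trans[OF N A.ev_add[OF b(2,3)] c_add[OF N A.ev_basis A.ev_basis]]]])
   have "?ga l * ?ga l' * (A.lm (x +[Sec F U] y) - (A.lm x + A.lm y)) : N" by(rule osubD(3)[OF N UNIV_I A.lm_add[OF x add(2)]])
   hence "?ga (l @ [x +[Sec F U] y] @ l') - (?ga (l @ [x] @ l') + ?ga (l @ [y] @ l')) : N" by(simp add: algebra_simps)
   thus ?thesis using 1 c_mem[OF N] by blast
  next
   case (smult l r x l')
   note x = mA.words_mid[OF smult(1), THEN conjunct1]
   have w: "l @ [r #[Sec F U] x] @ l' : words (Sec F U) q" using mA.w_repl[OF smult(1)] x smult(2) by auto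
   note b = A.bas_cr[OF w] A.bas_cr[OF smult(1)]
   have 1: "A.ev ?ga f - (?ga (l @ [r #[Sec F U] x] @ l') - A.lr r * ?ga (l @ [x] @ l')) : N" unfolding smult(3)
    by(rule c_trans[OF N A.ev_diff[OF b(1) A.f_smult[OF b(2) smult(2)]] c_diff[OF N A.ev_basis
       c_trans[OF N A.ev_smult[OF smult(2) b(2)] c_mult[OF N c_refl[OF N] A.ev_basis]]]])
   have "?ga l * ?ga l' * (A.lm (r #[Sec F U] x) - A.lr r * A.lm x) : N" by(rule osubD(3)[OF N UNIV_I A.lm_smult[OF smult(2) x]])
   hence "?ga (l @ [r #[Sec F U] x] @ l') - A.lr r * ?ga (l @ [x] @ l') : N" by(simp add: algebra_simps)
   thus ?thesis using 1 c_mem[OF N] by blast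
  qed
 next
  case False
  hence "f : permutation_relations (SX U) q (Sec F U)" using 4(3) by(auto simp: wrel_def split: if_splits)
  then obtain l l' where l: "f = (%s. bas (SX U) l s \<ominus>\<^bsub>SX U\<^esub> bas (SX U) l' s)"
   "l : words (Sec F U) q" "l' : words (Sec F U) q" "mset l = mset l'" unfolding mA.permutation_iff by(elim exE conjE)
  note b = A.bas_cr[OF l(2)] A.bas_cr[OF l(3)]
  have 1: "A.ev ?ga f - (?ga l - ?ga l') : N" unfolding l(1) by(rule c_trans[OF N A.ev_diff[OF b] c_diff[OF N A.ev_basis A.ev_basis]])
  have "mset (map A.lm l) = mset (map A.lm l')" using l(4) by simp
  hence "?ga l = ?ga l'" using prod_mset_prod_list by metis
  thus ?thesis using 1 c_mem[OF N] osubD(1)[OF N] by auto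
 qed
next
 case (5 U V l)
 have "lmU si M V (restr F U V s) - lmU si M U s : N" if "s : set l" for s using lm_restr[OF F 5(1-4), of s] 5(5) that by(auto simp: words_def)
 thus ?case unfolding map_map o_def by(rule cong_prod_map[OF N])
next
 case (6 U x)
 have x: "x : pts" using sub_top[OF 6] .
 obtain U' B where U': "oin T U'" "x : U'" "fr_at M U' B" and mi: "mon_indep B q" and c: "sy \<or> card B <= 1" using good[OF x] by auto
 define V where "V = U Int U'"
 have V: "oin T V" "x : V" "V [= U" "V ~= {}" using 6 U' by(auto simp: V_def)
 have fr: "fr_at M V B" by(rule fr_at_mono[OF U'(3)]) (auto simp: V_def)
 interpret A: nmod "SX V" "sec Ox V" N "tu V" "Sec F V" "sec M V" "si V" by(rule r_mod[OF F V(1,4)])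
 interpret mA: mrec "SX V" "Sec F V" by(intro mrec.intro A.is_mod)
 interpret P: presented "SX V" "words (Sec F V) q" "wrel (SX V) (Sec F V) sy q"
  by(intro presented.intro presented_axioms.intro A.is_cring mA.wrel_sub)
 have sB: "B [= sec M V" unfolding framed_sec[OF V(1,4) fr] using ospanI[OF A.A, of "B Un N"] by auto
 \<comment> \<open>A chosen ordering of each multiset, so that every monomial in the frame is
   represented by exactly one word \<open>wd A\<close>.\<close>
 define la where "la A = (SOME l. mset l = A)" for A :: "'w multiset"
 have la: "mset (la A) = A" for A unfolding la_def by(rule someI_ex[OF ex_mset])
 define wd where "wd A = map (si V) (la A)" for A
 let ?W = "wd ` msets B q"
 have lw: "length (la A) = q" "set (la A) [= B" if "A : msets B q" for A
 proof -
  have "size (mset (la A)) = q" "set_mset (mset (la A)) [= B" unfolding la using that by(auto simp: msets_def)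
  thus "length (la A) = q" "set (la A) [= B" by simp_all
 qed
 have W: "?W [= words (Sec F V) q"
 proof
  fix l assume "l : ?W"
  then obtain A where A: "A : msets B q" "l = map (si V) (la A)" unfolding wd_def by blast
  have "si V b : cr (Sec F V)" if "b : set (la A)" for b using lw(2)[OF A(1)] sB that by(intro A.sig_closed) auto
  thus "l : words (Sec F V) q" using lw(1)[OF A(1)] A(2) by(auto simp: words_def)
 qed
 have gw: "lwU si M V (wd A) - prod_mset A : N" if "A : msets B q" for A
 proof -
  have "A.lm (si V b) - b : N" if "b : set (la A)" for b using lw[OF \<open>A : _\<close>] sB that by(intro A.lm_cong) auto
  from cong_prod_map[OF N, of "la A" "%b. A.lm (si V b)" "%b. b", OF this] have "lwU si M V (wd A) - prod_list (la A) : N" by(simp add: wd_def o_def)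
  thus ?thesis using la[of A] prod_mset_prod_list by metis
 qed
 have ind: "ALL s:?W. c s : N" if c: "ALL s:?W. c s : sec Ox V" "(SUM s:?W. c s * lwU si M V s) : N" for c
 proof (cases "N = UNIV")
  case False
  have inj: "inj_on wd (msets B q)"
  proof (rule inj_onI, rule ccontr)
   fix A A' assume A: "A : msets B q" "A' : msets B q" "wd A = wd A'" "A ~= A'"
   have "prod_mset A - prod_mset A' : N" using c_trans[OF N c_sym[OF N gw[OF A(1)]]] gw[OF A(2)] unfolding A(3) by blast
   thus False using mon_indep_inj[OF fr_atD(1)[OF fr] mi A(1,2,4)] False by simp
  qed
  let ?c = "%A. if A : msets B q then c (wd A) else 0"
  have d: "(SUM A:msets B q. ?c A * prod_mset A) - (SUM A:msets B q. c (wd A) * lwU si M V (wd A)) : N"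
   using gw c_sym[OF N] by(intro c_sum[OF N] c_mult[OF N]) (auto simp: osubD(1)[OF N])
  have e: "(SUM A:msets B q. c (wd A) * lwU si M V (wd A)) = (SUM s:?W. c s * lwU si M V s)" by(simp add: sum.reindex[OF inj])
  have s: "(SUM A:msets B q. ?c A * prod_mset A) : N" by(rule iffD2[OF c_mem[OF N d]]) (simp only: e c(2))
  have "sec Ox V [= K" using V x OxK by(auto simp: sec_def)
  hence k: "?c A : K" for A using c(1) osrD(3)[OF K] by auto
  have "?c A : N" if "A : msets B q" for A by(rule mon_indepD[OF mi k s that])
  thus ?thesis by auto
 qed simp
 have "submodule (P.red ?W) (SX V) P.F" by(rule P.red_submodule)
 moreover have rs: "P.Sp [= P.red ?W" by(rule P.red_Sp)
 have rel: "wrel (SX V) (Sec F V) sy q [= P.Sp" by(rule mrec.span_incl[OF P.F_mod])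
 hence "multilinear_relations (SX V) q (Sec F V) [= P.red ?W" using rs unfolding wrel_def by auto
 moreover have "si V ` B [= cr (Sec F V)" using sB A.sig_closed by auto
 moreover note sec_span[OF F V(1,4) fr]
 moreover have "bas (SX V) l : P.red ?W" if l: "l : words (Sec F V) q" "set l [= si V ` B" for l
 proof -
  have "EX m. l = map (si V) m & set m [= B" using l(2)
  proof (induction l)
   case (Cons a l)
   then obtain m b where "l = map (si V) m" "set m [= B" "a = si V b" "b : B" by auto
   thus ?case by(intro exI[of _ "b # m"]) auto
  qed simp
  then obtain m where m: "l = map (si V) m" "set m [= B" by auto
  have mm: "mset m : msets B q" using m l(1) by(auto simp: msets_def words_def)
  hence ww: "wd (mset m) : words (Sec F V) q" using W by auto
  note rb = P.red_basis[OF ww imageI[OF mm, of wd]]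
  show ?thesis
  proof (cases "sy")
   case True
   have "mset l = mset (wd (mset m))" unfolding m(1) wd_def mset_map la ..
   hence "(%s. bas (SX V) l s \<ominus>\<^bsub>SX V\<^esub> bas (SX V) (wd (mset m)) s) : permutation_relations (SX V) q (Sec F V)"
    unfolding mA.permutation_iff using l(1) ww by blast
   hence "(%s. bas (SX V) l s \<ominus>\<^bsub>SX V\<^esub> bas (SX V) (wd (mset m)) s) : P.Sp" using rel True by(auto simp: wrel_def)
   thus ?thesis by(rule P.red_cls_eq[OF rb A.bas_cr[OF l(1)]])
  next
   case False
   hence c1: "card B <= 1" using c by simp
   \<comment> \<open>With at most one letter available a word is determined by its length, so it
     equals the chosen ordering of its multiset.\<close>
   have "la (mset m) = m"
   proof (cases "B = {}")
    case True
    thus ?thesis using m(2) la[of "mset m"] by auto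
   next
    case F: False
    hence "card B ~= 0" using fr_atD(1)[OF fr] by simp
    hence "card B = 1" using c1 by linarith
    then obtain b where b: "B = {b}" by(rule card_1_singletonE)
    have e: "set_mset (mset (la (mset m))) = set m" "size (mset (la (mset m))) = length m" unfolding la by simp_all
    have "m = replicate (length m) b" using m(2) b by(metis replicate_length_same singletonD subsetD)
    moreover have "la (mset m) = replicate (length (la (mset m))) b"
     using m(2) b e(1) by(metis replicate_length_same singletonD subsetD set_mset_mset)
    ultimately show ?thesis using e(2) by simp
   qed
   hence "wd (mset m) = l" unfolding wd_def m(1) by simp
   thus ?thesis using rb by simp
  qed
 qed
 ultimately have "bas (SX V) l : P.red ?W" if "l : words (Sec F V) q" for l by(rule mA.words_expand[OF _ _ _ _ _ that])
 hence sp: "ALL s:words (Sec F V) q. EX f:cr P.F. {t. f t ~= 0[SX V]} [= ?W & (%t. bas (SX V) s t \<ominus>\<^bsub>SX V\<^esub> f t) : P.Sp"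
  using P.red_basis_diff by blast
 have ind': "ALL c. (ALL s:?W. c s : sec Ox V) & (SUM s:?W. c s * lwU si M V s) : N --> (ALL s:?W. c s : N)" by(intro allI impI, elim conjE, rule ind)
 show ?case by(rule exI[of _ V], rule exI[of _ ?W], intro conjI V(1-3) W ind' sp finite_imageI finite_msets fr_atD(1)[OF fr])
qed

theorem words_realizes: assumes F: "realizes F si M" and M: "framed M"
  and good: "!!x. x : pts ==> EX U B. oin T U & x : U & fr_at M U B & mon_indep B q & (sy \<or> card B <= 1)" shows "EX si'. realizes (sheafify X
  \<lparr>sections = (%U. presented_module (SX U) (words (Sec F U) q) (wrel (SX U) (Sec F U) sy q)),
  restr = (%U V. presented_map (SX U) (SX V) (words (Sec F V) q)
    (wrel (SX V) (Sec F V) sy q) (restr OX U V) (map (restr F U V)))\<rparr>) si' (pw M q)" (is "EX si'. realizes (sheafify X ?P) si' _")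
proof -
 interpret P: pres_sheaf X K N Ox tu "%U. words (Sec F U) q" "%U. wrel (SX U) (Sec F U) sy q" "%U V. map (restr F U V)" "%U l. lwU si M U l"
  by(rule words_pres_sheaf[OF F M good])
 have eP: "?P = P.P" by(simp add: P.P_def)
 obtain si' where s: "realizes (sheafify X P.P) si' P.LT" using P.pres_realizes by auto
 have lt: "P.LT x = pw M q x" if x: "x : pts" for x
 proof (rule P.LT_eq[OF x pw_osub[OF x] pw_N[OF x]])
  fix U s assume U: "oin T U" "x : U" "s : words (Sec F U) q"
  hence U0: "U ~= {}" by auto
  interpret A: nmod "SX U" "sec Ox U" N "tu U" "Sec F U" "sec M U" "si U" by(rule r_mod[OF F U(1) U0])
  show "lwU si M U s : pw M q x" using U A.lm(1) by(intro pw_prod[OF x]) (auto simp: words_def sec_def)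
 next
  let ?G = "{lwU si M U s | U s. oin T U & x : U & s : words (Sec F U) q} Un N"
  note os = ospan_osub[OF Ox[OF x], of ?G]
  have N': "N [= ospan (Ox x) ?G" using ospanI[OF Ox[OF x], of ?G] by auto
  have "prod_list l : ospan (Ox x) ?G" if l: "length l = q" "set l [= M x" for l
  proof -
   have "EX U. oin T U & x : U & set l [= sec M U" using l(2)
   proof (induction l)
    case Nil
    thus ?case using x by(intro exI[of _ pts]) auto
   next
    case (Cons a l)
    then obtain U where U: "oin T U" "x : U" "set l [= sec M U" by auto
    obtain V where V: "oin T V" "x : V" "a : sec M V" using framed_open[OF M x, of a] Cons.prems by auto
    show ?case by(rule exI[of _ "U Int V"]) (use U V in \<open>auto simp: sec_def\<close>)
   qed
   then obtain U where U: "oin T U" "x : U" "set l [= sec M U" by auto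
   hence U0: "U ~= {}" by auto
   interpret A: nmod "SX U" "sec Ox U" N "tu U" "Sec F U" "sec M U" "si U" by(rule r_mod[OF F U(1) U0])
   let ?s = "map (si U) l"
   have "?s : words (Sec F U) q" using l U A.sig_closed by(auto simp: words_def)
   hence "lwU si M U ?s : ?G" using U by blast
   hence 1: "lwU si M U ?s : ospan (Ox x) ?G" by(rule subsetD[OF ospanI[OF Ox[OF x]]])
   have "A.lm (si U b) - b : N" if "b : set l" for b using U(3) that by(intro A.lm_cong) auto
   from cong_prod_map[OF N, of l "%b. A.lm (si U b)" "%b. b", OF this] have "lwU si M U ?s - prod_list l : N" by(simp add: o_def)
   from osub_tr[OF os N' c_sym[OF N this] 1] show ?thesis .
  qed
  thus "pw M q x [= ospan (Ox x) ?G" unfolding pw_def by(intro ospan_least[OF os]) (use N' in auto)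
 qed
 have "sec P.LT U = sec (pw M q) U" if "oin T U" for U using lt sub_top[OF that] unfolding sec_def by auto
 hence "realizes (sheafify X P.P) si' (pw M q)" using s unfolding realizes_def by auto
 thus ?thesis unfolding eP by blast
qed

corollary sym_realizes: assumes F: "realizes F si M" and M: "framed M"
  and good: "!!x. x : pts ==> EX U B. oin T U & x : U & fr_at M U B & mon_indep B q" shows "EX si'. realizes (sym_sheaf X q F) si' (pw M q)"
 using words_realizes[OF F M, of q True] good unfolding sym_sheaf_def Let_def sym_module_def wrel_def by simp

corollary tensor_power_realizes: assumes F: "realizes F si M" and M: "framed M"
  and good: "!!x. x : pts ==> EX U B. oin T U & x : U & fr_at M U B & mon_indep B q & card B <= 1"
 shows "EX si'. realizes (tensor_power_sheaf X q F) si' (pw M q)" using words_realizes[OF F M, of q False] good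
 unfolding tensor_power_sheaf_def Let_def tensor_power_module_def wrel_def by simp

end

section \<open>Tensor products with line bundles\<close>

locale mod_pair = A: mrec R M + B: mrec R Q for R :: "('r, 'a) ring_scheme" (structure) and M :: "('r, 'm) module" and Q :: "('r, 'n) module"
begin

abbreviation "S \<equiv> cr M \<times> cr Q"
abbreviation "Fp \<equiv> FM R S"
abbreviation "be \<equiv> bas R"

lemma pr_bas: "x : cr M ==> y : cr Q ==> be (x, y) : cr Fp" by(rule A.R.bas_cr) simp

lemma pair_minus: "a : cr Fp ==> b : cr Fp ==> c : cr Fp ==> a \<ominus>\<^bsub>Fp\<^esub> (b +[Fp] c) = (%s. a s \<ominus> (b s \<oplus> c s))"
 "a : cr Fp ==> b : cr Fp ==> r : cr R ==> a \<ominus>\<^bsub>Fp\<^esub> (r #[Fp] b) = (%s. a s \<ominus> r \<otimes> b s)"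
 using A.R.free_minus[OF _ A.R.f_add] A.R.free_minus[OF _ A.R.f_smult] by simp_all

lemma bilinear_cases: assumes "f : bilinear_relations R M Q" obtains (add1) x x' y where "x : cr M" "x' : cr M" "y : cr Q"
   "f = (%s. be (x +[M] x', y) s \<ominus> (be (x, y) s \<oplus> be (x', y) s))" | (add2) x y y' where "x : cr M" "y : cr Q" "y' : cr Q"
   "f = (%s. be (x, y +[Q] y') s \<ominus> (be (x, y) s \<oplus> be (x, y') s))" | (smult1) r x y where "r : cr R" "x : cr M" "y : cr Q"
   "f = (%s. be (r #[M] x, y) s \<ominus> r \<otimes> be (x, y) s)" | (smult2) r x y where "r : cr R" "x : cr M" "y : cr Q"
   "f = (%s. be (x, r #[Q] y) s \<ominus> r \<otimes> be (x, y) s)" using assms unfolding bilinear_relations_def Let_def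
proof (elim UnE CollectE exE conjE, goal_cases)
 case (1 x x' y)
 show ?case by(rule 1(1)[OF 1(6-8)], unfold 1(5), rule pair_minus(1)) (use 1 in \<open>auto intro: pr_bas\<close>)
next
 case (2 x y y')
 show ?case by(rule 2(2)[OF 2(6-8)], unfold 2(5), rule pair_minus(1)) (use 2 in \<open>auto intro: pr_bas\<close>)
next
 case (3 r x y)
 show ?case by(rule 3(3)[OF 3(6-8)], unfold 3(5), rule pair_minus(2)) (use 3 in \<open>auto intro: pr_bas\<close>)
next
 case (4 r x y)
 show ?case by(rule 4(4)[OF 4(6-8)], unfold 4(5), rule pair_minus(2)) (use 4 in \<open>auto intro: pr_bas\<close>)
qed

lemma bilinear_mem: "x : cr M ==> x' : cr M ==> y : cr Q ==>
  (%s. be (x +[M] x', y) s \<ominus> (be (x, y) s \<oplus> be (x', y) s)) : bilinear_relations R M Q" "x : cr M ==> y : cr Q ==> y' : cr Q ==>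
  (%s. be (x, y +[Q] y') s \<ominus> (be (x, y) s \<oplus> be (x, y') s)) : bilinear_relations R M Q" "r : cr R ==> x : cr M ==> y : cr Q ==>
  (%s. be (r #[M] x, y) s \<ominus> r \<otimes> be (x, y) s) : bilinear_relations R M Q" "r : cr R ==> x : cr M ==> y : cr Q ==>
  (%s. be (x, r #[Q] y) s \<ominus> r \<otimes> be (x, y) s) : bilinear_relations R M Q"
proof goal_cases
 case 1
 from 1 have e: "be (x +[M] x', y) \<ominus>\<^bsub>Fp\<^esub> (be (x, y) +[Fp] be (x', y)) =
   (%s. be (x +[M] x', y) s \<ominus> (be (x, y) s \<oplus> be (x', y) s))" by(intro pair_minus pr_bas) auto
 show ?case unfolding e[symmetric] bilinear_relations_def Let_def using 1 by blast
next
 case 2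
 from 2 have e: "be (x, y +[Q] y') \<ominus>\<^bsub>Fp\<^esub> (be (x, y) +[Fp] be (x, y')) =
   (%s. be (x, y +[Q] y') s \<ominus> (be (x, y) s \<oplus> be (x, y') s))" by(intro pair_minus pr_bas) auto
 show ?case unfolding e[symmetric] bilinear_relations_def Let_def using 2 by blast
next
 case 3
 from 3 have e: "be (r #[M] x, y) \<ominus>\<^bsub>Fp\<^esub> (r #[Fp] be (x, y)) = (%s. be (r #[M] x, y) s \<ominus> r \<otimes> be (x, y) s)"
  by(intro pair_minus pr_bas) auto
 show ?case unfolding e[symmetric] bilinear_relations_def Let_def using 3 by blast
next
 case 4
 from 4 have e: "be (x, r #[Q] y) \<ominus>\<^bsub>Fp\<^esub> (r #[Fp] be (x, y)) = (%s. be (x, r #[Q] y) s \<ominus> r \<otimes> be (x, y) s)"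
  by(intro pair_minus pr_bas) auto
 show ?case unfolding e[symmetric] bilinear_relations_def Let_def using 4 by blast
qed

lemma pair_diff_closed: assumes "f : cr Fp" "g : cr Fp" shows "(%s. f s \<ominus> g s) : cr Fp"
proof -
 interpret F: mrec R Fp by(intro mrec.intro A.R.f_mod)
 show ?thesis using F.M.minus_closed[OF assms] A.R.free_minus[OF assms] by simp
qed

lemma bilinear_sub: "bilinear_relations R M Q [= cr Fp"
proof
 fix f assume "f : bilinear_relations R M Q"
 thus "f : cr Fp" by(cases rule: bilinear_cases) (auto intro!: pair_diff_closed A.R.f_add A.R.f_smult pr_bas)
qed

lemma bilinear_expand: assumes Z: "submodule Z R Fp" and rZ: "bilinear_relations R M Q [= Z" and G: "G [= cr M" "sspan R M G = cr M"
  and G': "G' [= cr Q" "sspan R Q G' = cr Q" and g: "!!x y. x : G ==> y : G' ==> be (x, y) : Z" and x: "x : cr M" and y: "y : cr Q"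
 shows "be (x, y) : Z"
proof -
 note mem = bilinear_mem[THEN subsetD[OF rZ]]
 have 1: "be (x, y) : Z" if "x : cr M" "y : G'" for x y by(rule A.expand_linear[OF Z _ _ _ G(2) _ that(1), where d = "%u. be (u, y)"])
   (use that G G' g mem pr_bas in auto)
 show ?thesis by(rule B.expand_linear[OF Z _ _ _ G'(2) _ y, where d = "%u. be (x, u)"]) (use 1 x G G' mem pr_bas in auto)
qed

end

context gmodel
begin

text \<open>\<open>u\<close> and \<open>v\<close> generate the same \<open>A\<close>-module modulo
  \<open>N\<close>, see \<open>ueq_fspan\<close>.\<close>

definition ueq :: "'w set => 'w => 'w => bool" where "ueq A u v \<longleftrightarrow> (EX c:A. u - c * v : N) & (EX c:A. v - c * u : N)"

text \<open>The lattice of a line bundle is \<open>u x \<cdot> Ox x\<close> for a family \<open>u\<close> of elements invertible modulo \<open>N\<close>.\<close>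

definition unitfam :: "('p => 'w) => bool" where "unitfam u \<longleftrightarrow> (ALL x:pts. u x : K & (EX v:K. u x * v - 1 : N) &
  (EX U. oin T U & x : U & (ALL y:U. ueq (Ox y) (u y) (u x))))"

definition lt :: "('p => 'w) => 'p => 'w set" where "lt u x = fspan N (Ox x) {u x}"

definition tw :: "('p => 'w set) => ('p => 'w) => 'p => 'w set" where "tw M u x = {w. EX v:M x. w - u x * v : N}"

lemma fsp_one: "w : fspan N A {u} \<longleftrightarrow> (EX c:A. w - c * u : N)"
proof
 assume "EX c:A. w - c * u : N"
 then obtain c where "c : A" "w - c * u : N" by auto
 thus "w : fspan N A {u}" unfolding fspan_def by(auto intro: exI[of _ "%_. c"])
qed (auto simp: fspan_def)

lemma ueq_fspan: assumes A: "osubring A" and e: "ueq A u v" shows "fspan N A {u} = fspan N A {v}"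
proof -
 have "fspan N A {u} [= fspan N A {v}" if c: "c : A" "u - c * v : N" for u v c
 proof
  fix w assume "w : fspan N A {u}"
  then obtain d where d: "d : A" "w - d * u : N" unfolding fsp_one by auto
  have "w - (d * c) * v : N" using c_trans[OF N d(2) c_mult[OF N c_refl[OF N, of d] c(2)]] by(simp add: mult.assoc)
  thus "w : fspan N A {v}" unfolding fsp_one using osrD(5)[OF A d(1) c(1)] by blast
 qed
 thus ?thesis using e unfolding ueq_def by blast
qed

lemma unitfam_frame: assumes u: "unitfam u" and x: "x : pts" shows "EX U. oin T U & x : U & fr_at (lt u) U {u x}"
proof -
 obtain U v where U: "oin T U" "x : U" "!!y. y : U ==> ueq (Ox y) (u y) (u x)" and v: "v : K" "u x * v - 1 : N"
  using u x unfolding unitfam_def by metis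
 have "c : N" if "c * u x : N" for c
 proof -
  have "v * (c * u x) - c * (u x * v - 1) : N" by(intro osub_UNIV_minus[OF N] osubD(3)[OF N UNIV_I] that v)
  thus ?thesis by(simp add: algebra_simps)
 qed
 hence "fr_at (lt u) U {u x}" unfolding fr_at_def lt_def using U ueq_fspan[OF Ox[OF sub_top[OF U(1)]]] by auto
 thus ?thesis using U by blast
qed

lemma unitfam_framed: "unitfam u ==> framed (lt u)" unfolding framed_def using unitfam_frame by blast

text \<open>Near \<open>x\<close> the elements \<open>u y\<close> and \<open>u x\<close> generate
  the same module over \<open>Ox y\<close>, so the frame can be scaled by the fixed unit
  \<open>u x\<close> on a whole neighbourhood.\<close>

lemma framed_tw: assumes M: "framed M" and u: "unitfam u" and x: "x : pts" and fr: "oin T U" "x : U" "fr_at M U B"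
 shows "EX V. oin T V & x : V & V [= U & fr_at (tw M u) V ((*) (u x) ` B)"
proof -
 obtain W v where W: "oin T W" "x : W" "!!y. y : W ==> ueq (Ox y) (u y) (u x)" and v: "v : K" "u x * v - 1 : N"
  using u x unfolding unitfam_def by metis
 have canc: "c : N" if "u x * c : N" for c
 proof -
  have "v * (u x * c) - c * (u x * v - 1) : N" by(intro osub_UNIV_minus[OF N] osubD(3)[OF N UNIV_I] that v)
  thus ?thesis by(simp add: algebra_simps)
 qed
 let ?B = "(*) (u x) ` B"
 have fB: "finite B" using fr_atD(1)[OF fr(3)] .
 have lat: "tw M u y = fspan N (Ox y) ?B" if y: "y : U Int W" for y
 proof -
  have yp: "y : pts" using y sub_top[OF fr(1)] by auto
  note A = Ox[OF yp]
  have My: "M y = ospan (Ox y) (B Un N)" using fr_at_span[OF fr(1,3)] y by auto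
  note os = ospan_osub[OF A]
  have e: "fspan N (Ox y) ?B = ospan (Ox y) (?B Un N)" by(rule fspan_ospan[OF _ A N NOx[OF yp]]) (use fB in simp)
  have NB: "N [= ospan (Ox y) (?B Un N)" using ospanI[OF A, of "?B Un N"] by auto
  obtain c d where c: "c : Ox y" "u y - c * u x : N" "d : Ox y" "u x - d * u y : N" using W(3)[of y] y unfolding ueq_def by auto
  have 1: "u x * w : ospan (Ox y) (?B Un N)" if "w : ospan (Ox y) (B Un N)" for w using that
  proof induction
   case zero
   thus ?case by(simp add: ospan.zero)
  next
   case (step a s w)
   have "u x * s : ospan (Ox y) (?B Un N)"
   proof (cases "s : N")
    case True
    thus ?thesis using osubD(3)[OF N UNIV_I] NB by blast
   next
    case False
    thus ?thesis using step ospanI[OF A, of "?B Un N"] by auto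
   qed
   hence "a * (u x * s) + u x * w : ospan (Ox y) (?B Un N)" using step osubD(2,3)[OF os] by blast
   thus ?case by(simp add: algebra_simps)
  qed
  have 2: "osub (Ox y) (tw M u y)" unfolding osub_def tw_def
  proof (intro conjI ballI CollectI)
   show "EX v:M y. 0 - u y * v : N" using osubD(1)[OF os] osubD(1)[OF N] My by(intro bexI[of _ 0]) auto
  next
   fix w w' assume "w : {w. EX v:M y. w - u y * v : N}" "w' : {w. EX v:M y. w - u y * v : N}"
   then obtain v v' where v: "v : M y" "w - u y * v : N" "v' : M y" "w' - u y * v' : N" by auto
   show "EX v:M y. w + w' - u y * v : N" using c_add[OF N v(2,4)] osubD(2)[OF os] v My by(intro bexI[of _ "v + v'"]) (auto simp: distrib_left)
  next
   fix a w assume "a : Ox y" "w : {w. EX v:M y. w - u y * v : N}"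
   then obtain v where v: "a : Ox y" "v : M y" "w - u y * v : N" by auto
   show "EX v:M y. a * w - u y * v : N" using c_mult[OF N c_refl[OF N, of a] v(3)] osubD(3)[OF os] v My
    by(intro bexI[of _ "a * v"]) (auto simp: mult.left_commute)
  qed
  have "?B Un N [= tw M u y"
  proof
   fix z assume "z : ?B Un N"
   then consider "z : N" | b where "b : B" "z = u x * b" by auto
   thus "z : tw M u y"
   proof cases
    case 1
    thus ?thesis unfolding tw_def using osubD(1)[OF os] My by(auto intro!: bexI[of _ 0])
   next
    case 2
    have "b : M y" using 2 My ospanI[OF A, of "B Un N"] by auto
    hence db: "d * b : M y" using My osubD(3)[OF os] c(3) by auto
    have "u x * b - (d * u y) * b : N" by(rule c_mult[OF N c(4) c_refl[OF N]])
    hence "z - u y * (d * b) : N" using 2 by(simp add: mult_ac)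
    thus ?thesis unfolding tw_def using db by blast
   qed
  qed
  hence "fspan N (Ox y) ?B [= tw M u y" unfolding e by(rule ospan_least[OF 2])
  moreover have "tw M u y [= fspan N (Ox y) ?B"
  proof
   fix w assume "w : tw M u y"
   then obtain v where v: "v : M y" "w - u y * v : N" unfolding tw_def by auto
   have "u x * v : ospan (Ox y) (?B Un N)" using 1 v My by simp
   hence "c * (u x * v) : ospan (Ox y) (?B Un N)" using osubD(3)[OF os c(1)] by blast
   moreover have "w - c * (u x * v) : N" using c_trans[OF N v(2) c_mult[OF N c(2) c_refl[OF N, of v]]] by(simp add: mult.assoc)
   ultimately show "w : fspan N (Ox y) ?B" unfolding e using osub_tr[OF os NB] by blast
  qed
  ultimately show ?thesis by blast
 qed
 have "fr_at (tw M u) (U Int W) ?B" unfolding fr_at_def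
 proof (intro conjI ballI allI impI)
  show "finite ?B" using fB by simp
  show "tw M u y = fspan N (Ox y) ?B" if "y : U Int W" for y by(rule lat[OF that])
  fix c b assume c: "(ALL b:?B. c b : K) & (SUM b:?B. c b * b) : N" and b: "b : ?B"
  show "c b : N"
  proof (cases "N = UNIV")
   case False
   have inj: "inj_on ((*) (u x)) B"
   proof (rule inj_onI, rule ccontr)
    fix b b' assume bb: "b : B" "b' : B" "u x * b = u x * b'" "b ~= b'"
    hence "u x * (b - b') : N" using osubD(1)[OF N] by(simp add: algebra_simps)
    thus False using framed_at_inj[OF fr(3) bb(1,2) canc bb(4)] False by simp
   qed
   have "(SUM b:?B. c b * b) = u x * (SUM b:B. c (u x * b) * b)" by(subst sum.reindex[OF inj]) (simp add: sum_distrib_left o_def mult_ac)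
   hence "(SUM b:B. c (u x * b) * b) : N" using c canc by simp
   moreover obtain b' where b': "b' : B" "b = u x * b'" using b by auto
   moreover have "c (u x * b) : K" if "b : B" for b using c that by auto
   ultimately show ?thesis using fr_atD(3)[OF fr(3), of "%b. c (u x * b)" b'] by auto
  qed simp
 qed
 thus ?thesis using fr W by(intro exI[of _ "U Int W"]) auto
qed

abbreviation "pg si M si' M' U p \<equiv> lmU si M U (fst p) * lmU si' M' U (snd p)"

text \<open>The second factor has rank one, so the pairs of a frame element and the generator
  \<open>u x\<close> represent everything. Their values \<open>b * u x\<close> stay independent
  because \<open>u x\<close> is invertible modulo \<open>N\<close>.\<close>

theorem tensor_pres_sheaf: assumes F: "realizes F si M" and M: "framed M" and G: "realizes G si' (lt u)" and u: "unitfam u"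
 shows "pres_sheaf X K N Ox tu (%U. cr (Sec F U) \<times> cr (Sec G U)) (%U. bilinear_relations (SX U) (Sec F U) (Sec G U))
  (%U V. map_prod (restr F U V) (restr G U V)) (pg si M si' (lt u))"
proof (unfold_locales, goal_cases)
 case (1 U)
 show ?case by(intro mod_pair.bilinear_sub mod_pair.intro mrec.intro nmod.is_mod[OF r_mod[OF F 1]] nmod.is_mod[OF r_mod[OF G 1]])
next
 case (2 U V)
 show ?case using r_res_cl(1)[OF F 2] r_res_cl(1)[OF G 2] by auto
next
 case (3 U V f)
 note o = 3(1-4)
 have U0: "U ~= {}" using o by auto
 interpret A: nmod "SX U" "sec Ox U" N "tu U" "Sec F U" "sec M U" "si U" by(rule r_mod[OF F 3(1) U0])
 interpret A': nmod "SX U" "sec Ox U" N "tu U" "Sec G U" "sec (lt u) U" "si' U" by(rule r_mod[OF G 3(1) U0])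
 interpret B: nmod "SX V" "sec Ox V" N "tu V" "Sec F V" "sec M V" "si V" by(rule r_mod[OF F 3(2,3)])
 interpret B': nmod "SX V" "sec Ox V" N "tu V" "Sec G V" "sec (lt u) V" "si' V" by(rule r_mod[OF G 3(2,3)])
 interpret mA: mod_pair "SX U" "Sec F U" "Sec G U" by(intro mod_pair.intro mrec.intro A.is_mod A'.is_mod)
 interpret mB: mod_pair "SX V" "Sec F V" "Sec G V" by(intro mod_pair.intro mrec.intro B.is_mod B'.is_mod)
 let ?te = "map_prod (restr F U V) (restr G U V)"
 note rc = r_res_cl[OF F o] and rc' = r_res_cl[OF G o]
 have th: "?te : mA.S \<rightarrow> mB.S" using rc(1) rc'(1) by auto
 interpret p: push "SX U" "SX V" "restr OX U V" mA.S mB.S ?te by(intro push.intro push_axioms.intro nr_cring restr_hom o th)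
 have pb: "p.pu (mA.be (x, y)) = mB.be (restr F U V x, restr G U V y)" if "x : cr (Sec F U)" "y : cr (Sec G U)" for x y
  using p.push_basis[of "(x, y)"] that by simp
 note pb_c = mA.pr_bas
 from 3(5) have "p.pu f : bilinear_relations (SX V) (Sec F V) (Sec G V)"
 proof (cases rule: mA.bilinear_cases)
  case (add1 x x' y)
  note c = pb_c[OF mA.A.M.a_closed[OF add1(1,2)] add1(3)] pb_c[OF add1(1,3)] pb_c[OF add1(2,3)]
  show ?thesis unfolding add1(4) p.push_minus[OF c(1) A.f_add[OF c(2,3)]] p.push_add[OF c(2,3)]
    pb[OF add1(1,3)] pb[OF add1(2,3)] pb[OF mA.A.M.a_closed[OF add1(1,2)] add1(3)] rc(2)[OF add1(1,2)]
   by(rule mB.bilinear_mem(1)[OF rc(1)[OF add1(1)] rc(1)[OF add1(2)] rc'(1)[OF add1(3)]])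
 next
  case (add2 x y y')
  note c = pb_c[OF add2(1) mA.B.M.a_closed[OF add2(2,3)]] pb_c[OF add2(1,2)] pb_c[OF add2(1,3)]
  show ?thesis unfolding add2(4) p.push_minus[OF c(1) A.f_add[OF c(2,3)]] p.push_add[OF c(2,3)]
    pb[OF add2(1,2)] pb[OF add2(1,3)] pb[OF add2(1) mA.B.M.a_closed[OF add2(2,3)]] rc'(2)[OF add2(2,3)]
   by(rule mB.bilinear_mem(2)[OF rc(1)[OF add2(1)] rc'(1)[OF add2(2)] rc'(1)[OF add2(3)]])
 next
  case (smult1 r x y)
  note c = pb_c[OF mA.A.smult_closed[OF smult1(1,2)] smult1(3)] pb_c[OF smult1(2,3)]
  show ?thesis unfolding smult1(4) p.push_minus[OF c(1) A.f_smult[OF c(2) smult1(1)]] p.push_smult[OF smult1(1) c(2)]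
    pb[OF smult1(2,3)] pb[OF mA.A.smult_closed[OF smult1(1,2)] smult1(3)] rc(3)[OF smult1(1,2)]
   by(rule mB.bilinear_mem(3)[OF _ rc(1)[OF smult1(2)] rc'(1)[OF smult1(3)]]) (use smult1 in simp)
 next
  case (smult2 r x y)
  note c = pb_c[OF smult2(2) mA.B.smult_closed[OF smult2(1,3)]] pb_c[OF smult2(2,3)]
  show ?thesis unfolding smult2(4) p.push_minus[OF c(1) A.f_smult[OF c(2) smult2(1)]] p.push_smult[OF smult2(1) c(2)]
    pb[OF smult2(2,3)] pb[OF smult2(2) mA.B.smult_closed[OF smult2(1,3)]] rc'(3)[OF smult2(1,3)]
   by(rule mB.bilinear_mem(4)[OF _ rc(1)[OF smult2(2)] rc'(1)[OF smult2(3)]]) (use smult2 in simp)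
 qed
 thus ?case using mrec.span_incl[OF p.F'_mod] by(rule subsetD[rotated])
next
 case (4 U f)
 interpret A: nmod "SX U" "sec Ox U" N "tu U" "Sec F U" "sec M U" "si U" by(rule r_mod[OF F 4(1,2)])
 interpret A': nmod "SX U" "sec Ox U" N "tu U" "Sec G U" "sec (lt u) U" "si' U" by(rule r_mod[OF G 4(1,2)])
 interpret mA: mod_pair "SX U" "Sec F U" "Sec G U" by(intro mod_pair.intro mrec.intro A.is_mod A'.is_mod)
 let ?ga = "pg si M si' (lt u) U"
 note pb_c = mA.pr_bas
 from 4(3) show ?case
 proof (cases rule: mA.bilinear_cases)
  case (add1 x x' y)
  note c = pb_c[OF mA.A.M.a_closed[OF add1(1,2)] add1(3)] pb_c[OF add1(1,3)] pb_c[OF add1(2,3)]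
  have 1: "A.ev ?ga f - (?ga (x +[Sec F U] x', y) - (?ga (x, y) + ?ga (x', y))) : N" unfolding add1(4)
   by(rule c_trans[OF N A.ev_diff[OF c(1) A.f_add[OF c(2,3)]] c_diff[OF N A.ev_basis
      c_trans[OF N A.ev_add[OF c(2,3)] c_add[OF N A.ev_basis A.ev_basis]]]])
  have "A'.lm y * (A.lm (x +[Sec F U] x') - (A.lm x + A.lm x')) : N" by(rule osubD(3)[OF N UNIV_I A.lm_add[OF add1(1,2)]])
  hence "?ga (x +[Sec F U] x', y) - (?ga (x, y) + ?ga (x', y)) : N" by(simp add: algebra_simps)
  thus ?thesis using 1 c_mem[OF N] by blast
 next
  case (add2 x y y')
  note c = pb_c[OF add2(1) mA.B.M.a_closed[OF add2(2,3)]] pb_c[OF add2(1,2)] pb_c[OF add2(1,3)]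
  have 1: "A.ev ?ga f - (?ga (x, y +[Sec G U] y') - (?ga (x, y) + ?ga (x, y'))) : N" unfolding add2(4)
   by(rule c_trans[OF N A.ev_diff[OF c(1) A.f_add[OF c(2,3)]] c_diff[OF N A.ev_basis
      c_trans[OF N A.ev_add[OF c(2,3)] c_add[OF N A.ev_basis A.ev_basis]]]])
  have "A.lm x * (A'.lm (y +[Sec G U] y') - (A'.lm y + A'.lm y')) : N" by(rule osubD(3)[OF N UNIV_I A'.lm_add[OF add2(2,3)]])
  hence "?ga (x, y +[Sec G U] y') - (?ga (x, y) + ?ga (x, y')) : N" by(simp add: algebra_simps)
  thus ?thesis using 1 c_mem[OF N] by blast
 next
  case (smult1 r x y)
  note c = pb_c[OF mA.A.smult_closed[OF smult1(1,2)] smult1(3)] pb_c[OF smult1(2,3)]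
  have 1: "A.ev ?ga f - (?ga (r #[Sec F U] x, y) - A.lr r * ?ga (x, y)) : N" unfolding smult1(4)
   by(rule c_trans[OF N A.ev_diff[OF c(1) A.f_smult[OF c(2) smult1(1)]] c_diff[OF N A.ev_basis
      c_trans[OF N A.ev_smult[OF smult1(1) c(2)] c_mult[OF N c_refl[OF N] A.ev_basis]]]])
  have "A'.lm y * (A.lm (r #[Sec F U] x) - A.lr r * A.lm x) : N" by(rule osubD(3)[OF N UNIV_I A.lm_smult[OF smult1(1,2)]])
  hence "?ga (r #[Sec F U] x, y) - A.lr r * ?ga (x, y) : N" by(simp add: algebra_simps)
  thus ?thesis using 1 c_mem[OF N] by blast
 next
  case (smult2 r x y)
  note c = pb_c[OF smult2(2) mA.B.smult_closed[OF smult2(1,3)]] pb_c[OF smult2(2,3)]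
  have 1: "A.ev ?ga f - (?ga (x, r #[Sec G U] y) - A.lr r * ?ga (x, y)) : N" unfolding smult2(4)
   by(rule c_trans[OF N A.ev_diff[OF c(1) A.f_smult[OF c(2) smult2(1)]] c_diff[OF N A.ev_basis
      c_trans[OF N A.ev_smult[OF smult2(1) c(2)] c_mult[OF N c_refl[OF N] A.ev_basis]]]])
  have "A.lm x * (A'.lm (r #[Sec G U] y) - A.lr r * A'.lm y) : N" by(rule osubD(3)[OF N UNIV_I A'.lm_smult[OF smult2(1,3)]])
  hence "?ga (x, r #[Sec G U] y) - A.lr r * ?ga (x, y) : N" by(simp add: algebra_simps)
  thus ?thesis using 1 c_mem[OF N] by blast
 qed
next
 case (5 U V s)
 show ?case using lm_restr[OF F 5(1-4), of "fst s"] lm_restr[OF G 5(1-4), of "snd s"] 5(5) by(cases s) (auto intro: c_mult[OF N])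
next
 case (6 U x)
 have x: "x : pts" using sub_top[OF 6] .
 obtain U1 B where U1: "oin T U1" "x : U1" "fr_at M U1 B" using M x unfolding framed_def by blast
 obtain U2 where U2: "oin T U2" "x : U2" "fr_at (lt u) U2 {u x}" using unitfam_frame[OF u x] by blast
 define V where "V = U Int U1 Int U2"
 have V: "oin T V" "x : V" "V [= U" "V ~= {}" using 6 U1 U2 by(auto simp: V_def)
 have fr: "fr_at M V B" by(rule fr_at_mono[OF U1(3)]) (auto simp: V_def)
 have fr': "fr_at (lt u) V {u x}" by(rule fr_at_mono[OF U2(3)]) (auto simp: V_def)
 interpret A: nmod "SX V" "sec Ox V" N "tu V" "Sec F V" "sec M V" "si V" by(rule r_mod[OF F V(1,4)])
 interpret A': nmod "SX V" "sec Ox V" N "tu V" "Sec G V" "sec (lt u) V" "si' V" by(rule r_mod[OF G V(1,4)])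
 interpret mA: mod_pair "SX V" "Sec F V" "Sec G V" by(intro mod_pair.intro mrec.intro A.is_mod A'.is_mod)
 let ?Rel = "bilinear_relations (SX V) (Sec F V) (Sec G V)"
 interpret P: presented "SX V" mA.S ?Rel by(intro presented.intro presented_axioms.intro A.is_cring mA.bilinear_sub)
 have sB: "B [= sec M V" unfolding framed_sec[OF V(1,4) fr] using ospanI[OF A.A, of "B Un N"] by auto
 have su: "u x : sec (lt u) V" unfolding framed_sec[OF V(1,4) fr'] using ospanI[OF A.A, of "{u x} Un N"] by auto
 define wd where "wd b = (si V b, si' V (u x))" for b
 let ?W = "wd ` B"
 have W: "?W [= mA.S" using sB su A.sig_closed A'.sig_closed by(auto simp: wd_def)
 have gw: "pg si M si' (lt u) V (wd b) - b * u x : N" if "b : B" for b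
  unfolding wd_def fst_conv snd_conv by(intro c_mult[OF N] A.lm_cong A'.lm_cong refl su) (use sB that in auto)
 obtain v where v: "v : K" "u x * v - 1 : N" using u x unfolding unitfam_def by blast
 have canc: "c : N" if "c * u x : N" for c
 proof -
  have "v * (c * u x) - c * (u x * v - 1) : N" by(intro osub_UNIV_minus[OF N] osubD(3)[OF N UNIV_I] that v)
  thus ?thesis by(simp add: algebra_simps)
 qed
 have ind: "ALL s:?W. c s : N" if c: "ALL s:?W. c s : sec Ox V" "(SUM s:?W. c s * pg si M si' (lt u) V s) : N" for c
 proof (cases "N = UNIV")
  case False
  have inj: "inj_on wd B"
  proof (rule inj_onI, rule ccontr)
   fix b b' assume b: "b : B" "b' : B" "wd b = wd b'" "b ~= b'"
   hence "b - b' : N" using A.sig_eq[of b b'] sB by(auto simp: wd_def)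
   thus False using framed_at_inj[OF fr b(1,2) _ b(4)] False by simp
  qed
  have d: "(SUM b:B. c (wd b) * (b * u x)) - (SUM b:B. c (wd b) * pg si M si' (lt u) V (wd b)) : N"
   by(intro c_sum[OF N] c_mult[OF N c_refl[OF N]] c_sym[OF N gw])
  have e: "(SUM b:B. c (wd b) * pg si M si' (lt u) V (wd b)) = (SUM s:?W. c s * pg si M si' (lt u) V s)" by(simp add: sum.reindex[OF inj])
  have "(SUM b:B. c (wd b) * (b * u x)) : N" by(rule iffD2[OF c_mem[OF N d]]) (simp only: e c(2))
  hence "(SUM b:B. c (wd b) * b) * u x : N" by(simp add: sum_distrib_right mult.assoc)
  hence s: "(SUM b:B. c (wd b) * b) : N" by(rule canc)
  have "sec Ox V [= K" using V x OxK by(auto simp: sec_def)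
  hence k: "c (wd b) : K" if "b : B" for b using c(1) that by auto
  have "c (wd b) : N" if "b : B" for b by(rule fr_atD(3)[OF fr k s that])
  thus ?thesis by auto
 qed simp
 have rs: "P.Sp [= P.red ?W" by(rule P.red_Sp)
 have rel: "?Rel [= P.Sp" by(rule mrec.span_incl[OF P.F_mod])
 have be: "mA.be (s, t) : P.red ?W" if "s : cr (Sec F V)" "t : cr (Sec G V)" for s t
 proof (rule mA.bilinear_expand[OF P.red_submodule _ _ sec_span[OF F V(1,4) fr] _ sec_span[OF G V(1,4) fr'] _ that])
  show "?Rel [= P.red ?W" using rel rs by(rule subset_trans)
  show "si V ` B [= cr (Sec F V)" using sB A.sig_closed by auto
  show "si' V ` {u x} [= cr (Sec G V)" using su A'.sig_closed by auto
  fix s t assume "s : si V ` B" "t : si' V ` {u x}"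
  hence "(s, t) : ?W" by(auto simp: wd_def)
  thus "mA.be (s, t) : P.red ?W" using W by(intro P.red_basis) auto
 qed
 have sp: "ALL s:mA.S. EX f:cr P.F. {t. f t ~= 0[SX V]} [= ?W & (%t. mA.be s t \<ominus>\<^bsub>SX V\<^esub> f t) : P.Sp"
 proof
  fix s assume "s : mA.S"
  hence "mA.be s : P.red ?W" using be[of "fst s" "snd s"] by auto
  thus "EX f:cr P.F. {t. f t ~= 0[SX V]} [= ?W & (%t. mA.be s t \<ominus>\<^bsub>SX V\<^esub> f t) : P.Sp" by(rule P.red_basis_diff)
 qed
 have ind': "ALL c. (ALL s:?W. c s : sec Ox V) & (SUM s:?W. c s * pg si M si' (lt u) V s) : N --> (ALL s:?W. c s : N)"
  by(intro allI impI, elim conjE, rule ind)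
 show ?case by(rule exI[of _ V], rule exI[of _ ?W], intro conjI V(1-3) W ind' sp finite_imageI fr_atD(1)[OF fr])
qed

theorem tensor_realizes: assumes F: "realizes F si M" and M: "framed M" and G: "realizes G si' (lt u)" and u: "unitfam u"
 shows "EX si''. realizes (tensor_sheaf X F G) si'' (tw M u)"
proof -
 interpret P: pres_sheaf X K N Ox tu "%U. cr (Sec F U) \<times> cr (Sec G U)" "%U. bilinear_relations (SX U) (Sec F U) (Sec G U)"
  "%U V. map_prod (restr F U V) (restr G U V)" "pg si M si' (lt u)" by(rule tensor_pres_sheaf[OF F M G u])
 have eP: "tensor_sheaf X F G = sheafify X P.P" by(simp add: P.P_def tensor_sheaf_def Let_def tensor_module_def)
 obtain s where s: "realizes (sheafify X P.P) s P.LT" using P.pres_realizes by auto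
 have fr: "framed (tw M u)" unfolding framed_def
 proof
  fix x assume x: "x : pts"
  obtain U B where "oin T U" "x : U" "fr_at M U B" using M x unfolding framed_def by blast
  from framed_tw[OF M u x this] show "EX U B. oin T U & x : U & fr_at (tw M u) U B" by blast
 qed
 have lt: "P.LT x = tw M u x" if x: "x : pts" for x
 proof (rule P.LT_eq[OF x framed_osub[OF fr x]])
  fix U p assume U: "oin T U" "x : U" "p : cr (Sec F U) \<times> cr (Sec G U)"
  hence U0: "U ~= {}" by auto
  interpret A: nmod "SX U" "sec Ox U" N "tu U" "Sec F U" "sec M U" "si U" by(rule r_mod[OF F U(1) U0])
  interpret A': nmod "SX U" "sec Ox U" N "tu U" "Sec G U" "sec (lt u) U" "si' U" by(rule r_mod[OF G U(1) U0])
  have m: "A.lm (fst p) : M x" using A.lm(1)[of "fst p"] U by(auto simp: sec_def)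
  have "A'.lm (snd p) : lt u x" using A'.lm(1)[of "snd p"] U by(auto simp: sec_def)
  then obtain c where c: "c : Ox x" "A'.lm (snd p) - c * u x : N" unfolding lt_def fsp_one by auto
  have "A.lm (fst p) * A'.lm (snd p) - A.lm (fst p) * (c * u x) : N" by(intro c_mult[OF N c_refl[OF N]] c)
  hence "pg si M si' (lt u) U p - u x * (c * A.lm (fst p)) : N" by(simp add: mult_ac)
  thus "pg si M si' (lt u) U p : tw M u x" unfolding tw_def using osubD(3)[OF framed_osub(1)[OF M x] c(1) m] by blast
 next
  let ?G = "{pg si M si' (lt u) U s | U s. oin T U & x : U & s : cr (Sec F U) \<times> cr (Sec G U)} Un N"
  note os = ospan_osub[OF Ox[OF x], of ?G]
  have N': "N [= ospan (Ox x) ?G" using ospanI[OF Ox[OF x], of ?G] by auto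
  show "tw M u x [= ospan (Ox x) ?G"
  proof
   fix w assume "w : tw M u x"
   then obtain v where v: "v : M x" "w - u x * v : N" unfolding tw_def by auto
   obtain U1 where U1: "oin T U1" "x : U1" "v : sec M U1" using framed_open[OF M x v(1)] by auto
   have "u x : lt u x" unfolding lt_def fsp_one using osrD(1)[OF Ox[OF x]] osubD(1)[OF N] by(intro bexI[of _ 1]) auto
   then obtain U2 where U2: "oin T U2" "x : U2" "u x : sec (lt u) U2" using framed_open[OF unitfam_framed[OF u] x] by blast
   let ?U = "U1 Int U2"
   have U: "oin T ?U" "x : ?U" "?U ~= {}" using U1 U2 by auto
   have vv: "v : sec M ?U" "u x : sec (lt u) ?U" using U1 U2 by(auto simp: sec_def)
   interpret A: nmod "SX ?U" "sec Ox ?U" N "tu ?U" "Sec F ?U" "sec M ?U" "si ?U" by(rule r_mod[OF F U(1,3)])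
   interpret A': nmod "SX ?U" "sec Ox ?U" N "tu ?U" "Sec G ?U" "sec (lt u) ?U" "si' ?U" by(rule r_mod[OF G U(1,3)])
   let ?p = "(si ?U v, si' ?U (u x))"
   have "?p : cr (Sec F ?U) \<times> cr (Sec G ?U)" using A.sig_closed[OF vv(1)] A'.sig_closed[OF vv(2)] by simp
   hence "pg si M si' (lt u) ?U ?p : ?G" using U(1,2) by blast
   hence 1: "pg si M si' (lt u) ?U ?p : ospan (Ox x) ?G" by(rule subsetD[OF ospanI[OF Ox[OF x]]])
   have "pg si M si' (lt u) ?U ?p - v * u x : N" unfolding fst_conv snd_conv by(intro c_mult[OF N] A.lm_cong A'.lm_cong refl vv)
   hence "w - pg si M si' (lt u) ?U ?p : N" using c_trans[OF N v(2)] c_sym[OF N] by(simp add: mult.commute)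
   from osub_tr[OF os N' this 1] show "w : ospan (Ox x) ?G" .
  qed
 qed
 have "sec P.LT U = sec (tw M u) U" if "oin T U" for U using lt sub_top[OF that] unfolding sec_def by auto
 hence "realizes (sheafify X P.P) s (tw M u)" using s unfolding realizes_def by auto
 thus ?thesis unfolding eP by blast
qed

end

section \<open>Base loci in terms of lattices, by Nakayama's lemma\<close>

section \<open>Global generation and base loci\<close>

lemma (in mrec) submoduleI_smult: assumes H: "H [= cr M" "0[M] : H" and add: "!!a b. a : H ==> b : H ==> a +[M] b : H"
  and sm: "!!r a. r : cr R ==> a : H ==> r #[M] a : H" shows "submodule H R M"
proof (rule submoduleI[OF H _ add sm])
 fix a assume a: "a : H"
 hence "\<ominus>\<^bsub>M\<^esub> a = (\<ominus> \<one>) #[M] a" using H smult_l_minus[of \<one> a] smult_one[of a] by auto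
 thus "\<ominus>\<^bsub>M\<^esub> a : H" using sm[OF _ a, of "\<ominus> \<one>"] by simp
qed

context cring
begin

lemma chain_Union_ideal: assumes C: "C ~= {}" "!!I. I : C ==> ideal I R" "!!I J. I : C ==> J : C ==> I [= J \<or> J [= I" shows "ideal (\<Union>C) R"
proof (rule idealI[OF ring_axioms])
 have add: "a \<oplus> b : \<Union>C" if ab: "a : \<Union>C" "b : \<Union>C" for a b
 proof -
  obtain I J where IJ: "a : I" "I : C" "b : J" "J : C" using ab by auto
  obtain L where L: "L : C" "a : L" "b : L" using C(3)[OF IJ(2,4)] IJ by auto
  thus ?thesis using additive_subgroup.a_closed[OF ideal.axioms(1)[OF C(2)[OF L(1)]]] by blast
 qed
 have inv: "\<ominus> a : \<Union>C" if a: "a : \<Union>C" for a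
 proof -
  obtain I where I: "a : I" "I : C" using a by auto
  thus ?thesis using additive_subgroup.a_inv_closed[OF ideal.axioms(1)[OF C(2)[OF I(2)]]] by blast
 qed
 obtain I where I: "I : C" using C(1) by auto
 show "subgroup (\<Union>C) (add_monoid R)"
 proof (rule add.subgroupI)
  show "\<Union>C [= cr R" using ideal.Icarr[OF C(2)] by blast
  show "\<Union>C ~= {}" using additive_subgroup.zero_closed[OF ideal.axioms(1)[OF C(2)[OF I]]] I by blast
 qed (use add inv in \<open>auto simp: a_inv_def\<close>)
 show "x \<otimes> a : \<Union>C" if "a : \<Union>C" "x : cr R" for a x using that ideal.I_l_closed[OF C(2)] by blast
 show "a \<otimes> x : \<Union>C" if "a : \<Union>C" "x : cr R" for a x using that ideal.I_r_closed[OF C(2)] by blast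
qed

text \<open>Krull's theorem, by Zorn's lemma. \<open>local_ring\<close> is defined by uniqueness of
  the maximal ideal, whereas Nakayama's lemma needs that the elements outside of it are
  units.\<close>

lemma nonunit_in_maximal: assumes a: "a : cr R" "a \<notin> Units R" shows "EX J. maximalideal J R & a : J"
proof -
 define \<A> where "\<A> = {I. ideal I R & a : I & \<one> \<notin> I}"
 have "PIdl a : \<A>"
 proof -
  have "\<one> \<notin> PIdl a"
  proof
   assume "\<one> : PIdl a"
   then obtain x where "x : cr R" "\<one> = x \<otimes> a" unfolding cgenideal_def by auto
   thus False using a m_comm[of x a] unfolding Units_def by auto
  qed
  thus ?thesis unfolding \<A>_def using cgenideal_ideal[OF a(1)] cgenideal_self[OF a(1)] by auto
 qed
 hence "EX J:\<A>. ALL I:\<A>. J [= I --> I = J"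
 proof (intro subset_Zorn_nonempty)
  fix C assume C: "C ~= {}" "subset.chain \<A> C"
  hence sub: "C [= \<A>" and ch: "!!I J. I : C ==> J : C ==> I [= J \<or> J [= I" unfolding subset.chain_def by auto
  have "ideal (\<Union>C) R" by(rule chain_Union_ideal[OF C(1) _ ch]) (use sub in \<open>auto simp: \<A>_def\<close>)
  thus "\<Union>C : \<A>" using C(1) sub unfolding \<A>_def by blast
 qed auto
 then obtain J where J: "J : \<A>" "!!I. I : \<A> ==> J [= I ==> I = J" by auto
 have Ji: "ideal J R" using J by(auto simp: \<A>_def)
 have "maximalideal J R"
 proof (rule maximalidealI[OF Ji])
  show "cr R ~= J" using J(1) by(auto simp: \<A>_def)
  fix I assume I: "ideal I R" "J [= I" "I [= cr R"
  show "I = J \<or> I = cr R"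
  proof (cases "\<one> : I")
   case True
   thus ?thesis using ideal.one_imp_carrier[OF I(1)] by simp
  next
   case False
   hence "I : \<A>" using I J(1) by(auto simp: \<A>_def)
   thus ?thesis using J(2) I(2) by auto
  qed
 qed
 thus ?thesis using J(1) by(auto simp: \<A>_def)
qed

lemma local_max_ideal: assumes "local_ring R" shows "maximalideal (max_ideal R) R" "a : cr R ==> a \<notin> max_ideal R ==> a : Units R"
proof -
 have u: "EX! \<mm>. maximalideal \<mm> R" using assms by(simp add: local_ring_def)
 show m: "maximalideal (max_ideal R) R" unfolding max_ideal_def by(rule theI'[OF u])
 show "a : cr R ==> a \<notin> max_ideal R ==> a : Units R" using nonunit_in_maximal[of a] u m by blast
qed

lemma residue_sel: "cr (residue_field_module R) = cr (R Quot max_ideal R)" "add (residue_field_module R) = add (R Quot max_ideal R)"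
 "zero (residue_field_module R) = zero (R Quot max_ideal R)" "one (residue_field_module R) = one (R Quot max_ideal R)"
 "r #[residue_field_module R] c = (max_ideal R +>\<^bsub>R\<^esub> r) *[R Quot max_ideal R] c" by(simp_all add: residue_field_module_def Let_def)

lemma residue_module: assumes "local_ring R" shows "module R (residue_field_module R)"
proof -
 interpret m: maximalideal "max_ideal R" R by(rule local_max_ideal[OF assms])
 let ?Q = "R Quot max_ideal R"
 interpret Q: cring ?Q by(rule m.quotient_is_cring[OF is_cring])
 note h = m.rcos_ring_hom
 show ?thesis
 proof (rule moduleI[OF is_cring])
  show "abelian_group (residue_field_module R)"
  proof (rule abelian_groupI)
   show "x +[residue_field_module R] y = y +[residue_field_module R] x" if "x : cr (residue_field_module R)" "y : cr (residue_field_module R)" for x y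
    using that Q.a_comm[of x y] by(simp add: residue_sel)
  qed (auto simp: residue_sel Q.a_assoc intro: Q.add.l_inv_ex)
 qed (auto simp: residue_sel Q.l_distr Q.r_distr Q.m_assoc ring_hom_add[OF h] ring_hom_mult[OF h] ring_hom_one[OF h] ring_hom_closed[OF h])
qed

lemma residue_span: assumes "local_ring R" shows "sspan R (residue_field_module R) {1[residue_field_module R]} = cr (residue_field_module R)"
proof -
 let ?\<kappa> = "residue_field_module R" and ?Q = "R Quot max_ideal R"
 interpret m: maximalideal "max_ideal R" R by(rule local_max_ideal[OF assms])
 interpret Q: cring ?Q by(rule m.quotient_is_cring[OF is_cring])
 interpret k: mrec R ?\<kappa> by(intro mrec.intro residue_module assms)
 have o: "{1[?\<kappa>]} [= cr ?\<kappa>" by(simp add: residue_sel)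
 note s = k.span_sub[OF o]
 have "c : sspan R ?\<kappa> {1[?\<kappa>]}" if c: "c : cr ?\<kappa>" for c
 proof -
  obtain r where r: "r : cr R" "c = max_ideal R +> r" using c unfolding residue_sel FactRing_def A_RCOSETS_def' by auto
  hence "c = r #[?\<kappa>] 1[?\<kappa>]" using ring_hom_closed[OF m.rcos_ring_hom r(1)] by(simp add: residue_sel)
  thus ?thesis using k.submoduleE(4)[OF s r(1)] k.span_incl[of "{1[?\<kappa>]}"] by blast
 qed
 thus ?thesis using k.submoduleE(1)[OF s] by blast
qed

end

text \<open>One generator is removed at a time. Modulo \<open>I\<close> times \<open>M\<close> the
  generator \<open>b\<close> is congruent to an element of \<open>Q\<close>, so
  \<open>(1 - i) * b\<close> lies in the span of \<open>Q\<close> and the other generators for some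
  \<open>i : I\<close>, and \<open>1 - i\<close> is invertible modulo \<open>N\<close>.\<close>

lemma nakayama: assumes A: "osubring A" and N: "osub UNIV N" and Q: "osub A Q" "N [= Q"
  and I: "osub A I" "!!i. i : I ==> EX v:A. v * (1 - i) - 1 : N" "I [= A" and B: "finite B" and M: "M [= ospan A (Q Un B)" "B [= M"
  and D: "!!m. m : M ==> EX q:Q. m - q : ospan A {i * m | i m. i : I & m : M}" shows "M [= Q" using B M(1,2)
proof (induction B rule: finite_induct)
 case empty
 have "ospan A Q [= Q" by(rule ospan_least[OF Q(1)]) simp
 thus ?case using empty by simp
next
 case (insert b B)
 let ?S = "ospan A (Q Un B)"
 note os = ospan_osub[OF A, of "Q Un B"]
 have QS: "Q [= ?S" "B [= ?S" using ospanI[OF A, of "Q Un B"] by auto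
 have dec: "EX a:A. EX s:?S. m = a * b + s" if "m : ospan A (Q Un insert b B)" for m using that
 proof induction
  case zero
  thus ?case using osrD(3)[OF A] osubD(1)[OF os] by(intro bexI[of _ 0]) auto
 next
  case (step c t v)
  then obtain a s where as: "a : A" "s : ?S" "v = a * b + s" by auto
  show ?case
  proof (cases "t : Q Un B")
   case True
   hence "c * t + s : ?S" using QS osubD(2,3)[OF os] step(1) as(2) by blast
   thus ?thesis using as by(intro bexI[of _ a] bexI[of _ "c * t + s"]) (auto simp: algebra_simps)
  next
   case False
   hence "t = b" using step(2) by auto
   thus ?thesis using as step(1) osrD(4)[OF A] by(intro bexI[of _ "c + a"] bexI[of _ s]) (auto simp: algebra_simps)
  qed
 qed
 have dec2: "EX i:I. EX s:?S. z = i * b + s" if "z : ospan A {i * m | i m. i : I & m : M}" for z using that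
 proof induction
  case zero
  thus ?case using osubD(1)[OF I(1)] osubD(1)[OF os] by(intro bexI[of _ 0]) auto
 next
  case (step c t v)
  then obtain i s where ij: "i : I" "s : ?S" "v = i * b + s" by auto
  obtain j m where jm: "t = j * m" "j : I" "m : M" using step(2) by auto
  obtain a s' where as: "a : A" "s' : ?S" "m = a * b + s'" using dec jm(3) insert.prems(1) by blast
  have "a * (c * j) + i : I" by(intro osubD(2,3)[OF I(1)] as jm ij step(1))
  moreover have "(c * j) * s' + s : ?S" using osubD(2,3)[OF os] osubD(3)[OF I(1) step(1) jm(2)] I(3) as ij by blast
  ultimately show ?case by(intro bexI[of _ "a * (c * j) + i"] bexI[of _ "(c * j) * s' + s"]) (auto simp: jm as ij algebra_simps)
 qed
 have "b : M" using insert.prems by auto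
 then obtain q where q: "q : Q" "b - q : ospan A {i * m | i m. i : I & m : M}" using D by blast
 obtain i s where ij: "i : I" "s : ?S" "b - q = i * b + s" using dec2[OF q(2)] by auto
 obtain v where v: "v : A" "v * (1 - i) - 1 : N" using I(2)[OF ij(1)] by auto
 \<comment> \<open>Multiplying by the inverse \<open>v\<close> of \<open>1 - i\<close> gives
   \<open>b\<close> back modulo \<open>N\<close>, so \<open>b\<close> already lies in the smaller
   span \<open>?S\<close>.\<close>
 have "q + s = (1 - i) * b" using ij(3) by(simp add: algebra_simps)
 hence "b - v * (q + s) = b - v * ((1 - i) * b)" by(simp only:)
 also have "\<dots> = - (b * (v * (1 - i) - 1))" by(simp add: algebra_simps)
 finally have "b - v * (q + s) = - (b * (v * (1 - i) - 1))" .
 hence "b - v * (q + s) : N" using osub_UNIV_uminus[OF N osubD(3)[OF N UNIV_I v(2)]] by simp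
 moreover have "v * (q + s) : ?S" using osubD(2,3)[OF os] q(1) QS ij(2) v(1) by blast
 ultimately have bS: "b : ?S" using osub_tr[OF os] Q(2) QS by blast
 have "ospan A (Q Un insert b B) [= ?S" by(rule ospan_least[OF os]) (use bS QS in auto)
 thus ?case using insert.prems by(intro insert.IH) auto
qed

context gmodel
begin

definition GG :: "('p => 'w set) => 'p => bool" where "GG M x \<longleftrightarrow> M x [= ospan (Ox x) (sec M pts)"

definition sgm :: "('p set => 'w => 'm) => ('p => 'w set) => 'p => 'w => ('p set \<times> 'm) set" where
 "sgm si M = names.gm X (%U w t. w : sec M U & si U w = t)"

lemma framed_names: "realizes F si M ==> framed M ==> names X K N Ox tu F (%U w t. w : sec M U & si U w = t) M" by(rule r_names[OF _ framed_open])

lemma stalk_module: assumes F: "realizes F si M" and M: "framed M" and x: "x : pts"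
 shows "nmod (stalk_ring X x) (Ox x) N (go x) (stalk_module X F x) (M x) (sgm si M x)"
 unfolding sgm_def by(rule names.stalk_named_module[OF framed_names[OF F M] x])

lemma sgm_germ: assumes F: "realizes F si M" and M: "framed M" and x: "x : pts" and w: "w : sec M pts"
 shows "germ T F x pts (si pts w) = sgm si M x w" unfolding sgm_def by(rule names.germ_eq[OF framed_names[OF F M] open_top x]) (use w in simp)

lemma global_germs: assumes F: "realizes F si M" and M: "framed M" and x: "x : pts" shows "germ T F x pts ` cr (Sec F pts) = sgm si M x ` sec M pts"
proof -
 have "pts ~= {}" using x by auto
 from nmod.M_carrier[OF r_mod[OF F open_top this]]
 show ?thesis using sgm_germ[OF F M x] by(auto simp: image_image)
qed

lemma span_global: assumes F: "realizes F si M" and M: "framed M" and x: "x : pts"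
 shows "sspan (stalk_ring X x) (stalk_module X F x) (germ T F x pts ` cr (Sec F pts)) = cr (stalk_module X F x) \<longleftrightarrow> GG M x"
proof -
 interpret s: nmod "stalk_ring X x" "Ox x" N "go x" "stalk_module X F x" "M x" "sgm si M x" by(rule stalk_module[OF F M x])
 have sub: "sec M pts [= M x" using x by(auto simp: sec_def)
 have NS: "N [= ospan (Ox x) (sec M pts)" using framed_osub(2)[OF M] ospanI[OF s.A, of "sec M pts"] by(fastforce simp: sec_def)
 note os = ospan_osub[OF s.A, of "sec M pts"]
 have e: "sspan (stalk_ring X x) (stalk_module X F x) (germ T F x pts ` cr (Sec F pts)) = sgm si M x ` ospan (Ox x) (sec M pts)"
  unfolding global_germs[OF F M x] by(rule s.span_image[OF sub])
 have oM: "ospan (Ox x) (sec M pts) [= M x" by(rule ospan_least[OF s.L sub])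
 show ?thesis unfolding e s.M_carrier GG_def
 proof
  assume i: "sgm si M x ` ospan (Ox x) (sec M pts) = sgm si M x ` M x"
  show "M x [= ospan (Ox x) (sec M pts)"
  proof
   fix w assume w: "w : M x"
   hence "sgm si M x w : sgm si M x ` ospan (Ox x) (sec M pts)" unfolding i by(rule imageI)
   then obtain v where v: "v : ospan (Ox x) (sec M pts)" "sgm si M x w = sgm si M x v" by auto
   hence "w - v : N" using s.sig_eq[OF w] oM by auto
   thus "w : ospan (Ox x) (sec M pts)" by(rule osub_tr[OF os NS _ v(1)])
  qed
 next
  assume "M x [= ospan (Ox x) (sec M pts)"
  hence "M x = ospan (Ox x) (sec M pts)" using oM by blast
  thus "sgm si M x ` ospan (Ox x) (sec M pts) = sgm si M x ` M x" by simp
 qed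
qed

theorem globally_generated_iff: assumes F: "realizes F si M" and M: "framed M"
 shows "globally_generated X F \<longleftrightarrow> (ALL x:pts. GG M x)" unfolding globally_generated_def Let_def using span_global[OF F M] by simp

text \<open>If the global sections generate \<open>M x\<close>, bilinear expansion with the
  generator 1 of the residue field spans the fibre. Conversely, evaluation maps the fibre to
  \<open>M x\<close> modulo \<open>DD\<close>; if the global sections span the fibre, then
  \<open>DD\<close> contains \<open>M x\<close>, and Nakayama's lemma applies.\<close>

theorem Bs_iff: assumes F: "realizes F si M" and M: "framed M" and x: "x : pts" shows "x \<notin> Bs X F \<longleftrightarrow> GG M x"
proof -
 let ?R = "stalk_ring X x" and ?V = "stalk_module X F x"
 let ?\<kappa> = "residue_field_module ?R" and ?m = "max_ideal ?R"
 interpret s: nmod ?R "Ox x" N "go x" ?V "M x" "sgm si M x" by(rule stalk_module[OF F M x])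
 have lo: "local_ring ?R" using lrs x by(simp add: is_locally_ringed_space_def)
 interpret m: maximalideal ?m ?R by(rule s.local_max_ideal[OF lo])
 interpret Q: cring "?R Quot ?m" by(rule m.quotient_is_cring[OF s.is_cring])
 note h = m.rcos_ring_hom
 interpret p: mod_pair ?R ?V ?\<kappa> by(intro mod_pair.intro mrec.intro s.is_mod s.residue_module[OF lo])
 let ?Rel = "bilinear_relations ?R ?V ?\<kappa>"
 interpret P: presented ?R p.S ?Rel by(intro presented.intro presented_axioms.intro s.is_cring p.bilinear_sub)
 have fib: "fibre X F x = P.P" by(simp add: fibre_def tensor_module_def)
 interpret Pm: mrec ?R P.P by(intro mrec.intro P.pres_module)
 have val: "fibre_value X F x t = P.cls (p.be (germ T F x pts t, 1[?\<kappa>]))" for t by(simp add: fibre_value_def pure_tensor_def Let_def)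
 have one: "1[?\<kappa>] : cr ?\<kappa>" by(simp add: s.residue_sel)
 have p0: "pts ~= {}" using x by auto
 interpret g: nmod "SX pts" "sec Ox pts" N "tu pts" "Sec F pts" "sec M pts" "si pts" by(rule r_mod[OF F open_top p0])
 have gc: "sgm si M x w : cr ?V" if "w : M x" for w using s.sig_closed that .
 have secM: "sec M pts [= M x" using x by(auto simp: sec_def)
 let ?Vals = "fibre_value X F x ` cr (Sec F pts)"
 have Vals: "?Vals = (%w. P.cls (p.be (sgm si M x w, 1[?\<kappa>]))) ` sec M pts"
  unfolding g.M_carrier val using sgm_germ[OF F M x] by(auto simp: image_image)
 have Vc: "?Vals [= cr P.P" unfolding Vals P.pres_carrier using p.pr_bas[OF gc one] secM by auto
 note sp = Pm.span_sub[OF Vc]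
 have ne: "x \<notin> Bs X F \<longleftrightarrow> sspan ?R P.P ?Vals = cr P.P" using x by(simp add: Bs_def fib)
 show ?thesis unfolding ne
 proof
  assume gg: "GG M x"
  let ?Z = "{f : cr P.F. P.cls f : sspan ?R P.P ?Vals}"
  interpret F: mrec ?R P.F by(rule P.F_mod)
  have Z: "submodule ?Z ?R P.F"
  proof (rule F.submoduleI_smult)
   show "0[P.F] : ?Z" using F.zero_closed Pm.sub_zero[OF sp] P.pres_zero by simp
   show sm: "r #[P.F] f : ?Z" if "r : cr ?R" "f : ?Z" for r f
    using that Pm.submoduleE(4)[OF sp, of r "P.cls f"] P.pres_smult[of r f] by(simp add: s.f_smult)
   show "f +[P.F] f' : ?Z" if "f : ?Z" "f' : ?Z" for f f'
    using that Pm.submoduleE(5)[OF sp, of "P.cls f" "P.cls f'"] P.pres_add[of f f'] by(simp add: s.f_add)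
  qed auto
  have rZ: "?Rel [= ?Z"
  proof
   fix f assume f: "f : ?Rel"
   hence fc: "f : cr P.F" using p.bilinear_sub by auto
   have "f : P.Sp" using f mrec.span_incl[OF P.F_mod] by blast
   moreover have zc: "(%_. 0[?R]) : cr P.F" using F.zero_closed by simp
   moreover have "(%t. f t \<ominus>\<^bsub>?R\<^esub> 0[?R]) = f" using s.f_val[OF fc] by(simp add: s.minus_eq)
   ultimately have "P.cls f = P.cls (%_. 0[?R])" using P.cls_eq[OF fc zc] by simp
   thus "f : ?Z" using fc Pm.sub_zero[OF sp] P.pres_zero by simp
  qed
  let ?G = "germ T F x pts ` cr (Sec F pts)"
  have G: "?G [= cr ?V" unfolding global_germs[OF F M x] using gc secM by auto
  have Gs: "sspan ?R ?V ?G = cr ?V" using span_global[OF F M x] gg by simp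
  have g1: "p.be (v, k) : ?Z" if vk: "v : ?G" "k : {1[?\<kappa>]}" for v k
  proof -
   obtain t where t: "t : cr (Sec F pts)" "v = germ T F x pts t" using vk by auto
   have "P.cls (p.be (v, 1[?\<kappa>])) : ?Vals" using t val by auto
   moreover have "v : cr ?V" using vk(1) G by blast
   ultimately show ?thesis using Pm.span_incl[of ?Vals] vk(2) p.pr_bas[OF _ one] by auto
  qed
  have be: "p.be (v, k) : ?Z" if "v : cr ?V" "k : cr ?\<kappa>" for v k
   by(rule p.bilinear_expand[OF Z rZ G Gs _ s.residue_span[OF lo] g1 that]) (use one in auto)
  have "cr P.F [= ?Z" by(rule s.free_submodule_all[OF Z]) (use be in auto)
  hence "cr P.P [= sspan ?R P.P ?Vals" unfolding P.pres_carrier by auto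
  thus "sspan ?R P.P ?Vals = cr P.P" using Pm.submoduleE(1)[OF sp] by blast
 next
  assume sur: "sspan ?R P.P ?Vals = cr P.P"
  let ?Qs = "ospan (Ox x) (sec M pts)"
  let ?I = "{c : Ox x. go x c : ?m}"
  let ?IM = "ospan (Ox x) {i * m | i m. i : ?I & m : M x}"
  \<comment> \<open>The span of the global sections plus the maximal ideal times
    \<open>M x\<close>.\<close>
  define DD where "DD = {d. EX q:?Qs. d - q : ?IM}"
  note os = ospan_osub[OF s.A]
  have NQ: "N [= ?Qs" using framed_osub(2)[OF M] ospanI[OF s.A, of "sec M pts"] by(fastforce simp: sec_def)
  have I: "osub (Ox x) ?I" unfolding osub_def
  proof (intro conjI ballI)
   show "0 : ?I" using osrD(3)[OF s.A] s.tau_zero m.zero_closed by simp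
   show "v + w : ?I" if "v : ?I" "w : ?I" for v w using that osrD(4)[OF s.A] s.tau_add m.a_closed by simp
   show "a * v : ?I" if "a : Ox x" "v : ?I" for a v using that osrD(5)[OF s.A] s.tau_mult m.I_l_closed s.tau_cl by simp
  qed
  have NI: "n : ?I" if "n : N" for n using that s.NA s.tau_ker[of n] m.zero_closed by auto
  have D: "osub (Ox x) DD" unfolding osub_def DD_def
  proof (intro conjI ballI CollectI)
   show "EX q:?Qs. 0 - q : ?IM" using osubD(1)[OF os] by(intro bexI[of _ 0]) auto
  next
   fix v w assume "v : {d. EX q:?Qs. d - q : ?IM}" "w : {d. EX q:?Qs. d - q : ?IM}"
   then obtain q q' where q: "q : ?Qs" "v - q : ?IM" "q' : ?Qs" "w - q' : ?IM" by blast
   thus "EX q:?Qs. v + w - q : ?IM" using osubD(2)[OF os q(1,3)] osubD(2)[OF os q(2,4)] by(intro bexI[of _ "q + q'"]) (auto simp: algebra_simps)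
  next
   fix a w assume "a : Ox x" "w : {d. EX q:?Qs. d - q : ?IM}"
   then obtain q where q: "a : Ox x" "q : ?Qs" "w - q : ?IM" by blast
   thus "EX q:?Qs. a * w - q : ?IM" using osubD(3)[OF os q(1,2)] osubD(3)[OF os q(1,3)] by(intro bexI[of _ "a * q"]) (auto simp: algebra_simps)
  qed
  have QD: "?Qs [= DD"
  proof
   fix q assume "q : ?Qs"
   thus "q : DD" using osubD(1)[OF os] unfolding DD_def by(intro CollectI bexI[of _ q]) auto
  qed
  have ND: "N [= DD" using NQ QD by blast
  have IMD: "i * w : DD" if "i : ?I" "w : M x" for i w
  proof -
   have "i * w : ?IM" using that ospanI[OF s.A, of "{i * m | i m. i : ?I & m : M x}"] by blast
   thus ?thesis using osubD(1)[OF os, of "sec M pts"] unfolding DD_def by(intro CollectI bexI[of _ 0]) auto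
  qed
  \<comment> \<open>A lift to \<open>Ox x\<close> of an element of the residue field. It is
    determined only modulo \<open>?I\<close>, so the values \<open>?ga\<close> below respect the
    bilinear relations only modulo \<open>DD\<close>, which contains \<open>?I\<close> times
    \<open>M x\<close>.\<close>
  define lk where "lk k = (SOME c. c : Ox x & ?m +>\<^bsub>?R\<^esub> go x c = k)" for k
  have lk: "lk k : Ox x & ?m +>\<^bsub>?R\<^esub> go x (lk k) = k" if k: "k : cr ?\<kappa>" for k
  proof -
   obtain r where r: "r : cr ?R" "k = ?m +>\<^bsub>?R\<^esub> r" using k unfolding s.residue_sel FactRing_def A_RCOSETS_def' by auto
   hence "EX c. c : Ox x & ?m +>\<^bsub>?R\<^esub> go x c = k" using s.tau_surj[of r] by auto
   thus ?thesis unfolding lk_def by(rule someI_ex)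
  qed
  have lkI: "lk k - c : ?I" if k: "k : cr ?\<kappa>" and c: "c : Ox x" "?m +>\<^bsub>?R\<^esub> go x c = k" for k c
  proof -
   have l: "lk k : Ox x" "?m +>\<^bsub>?R\<^esub> go x (lk k) = ?m +>\<^bsub>?R\<^esub> go x c" using lk[OF k] c(2) by auto
   have "go x (lk k) \<ominus>\<^bsub>?R\<^esub> go x c : ?m"
    using s.quotient_eq_iff_same_a_r_cos[OF m.ideal_axioms s.tau_cl[OF l(1)] s.tau_cl[OF c(1)]] l(2) by simp
   thus ?thesis using s.tau_diff[OF l(1) c(1)] osrD(7)[OF s.A l(1) c(1)] by simp
  qed
  let ?ga = "%p. lk (snd p) * s.lm (fst p)"
  have trD: "b : DD" if "b - a : N" "a : DD" for a b by(rule osub_tr[OF D ND that])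
  have evR: "s.ev ?ga f : DD" if f: "f : ?Rel" for f using f
  proof (cases rule: p.bilinear_cases)
   case (add1 v v' k)
   note c = p.pr_bas[OF p.A.M.a_closed[OF add1(1,2)] add1(3)] p.pr_bas[OF add1(1,3)] p.pr_bas[OF add1(2,3)]
   have 1: "s.ev ?ga f - (?ga (v +[?V] v', k) - (?ga (v, k) + ?ga (v', k))) : N" unfolding add1(4)
    by(rule c_trans[OF N s.ev_diff[OF c(1) s.f_add[OF c(2,3)]] c_diff[OF N s.ev_basis
       c_trans[OF N s.ev_add[OF c(2,3)] c_add[OF N s.ev_basis s.ev_basis]]]])
   have "lk k * (s.lm (v +[?V] v') - (s.lm v + s.lm v')) : N" by(rule osubD(3)[OF N UNIV_I s.lm_add[OF add1(1,2)]])
   hence "?ga (v +[?V] v', k) - (?ga (v, k) + ?ga (v', k)) : DD" using ND by(auto simp: algebra_simps)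
   thus ?thesis by(rule trD[OF 1])
  next
   case (add2 v k k')
   note c = p.pr_bas[OF add2(1) p.B.M.a_closed[OF add2(2,3)]] p.pr_bas[OF add2(1,2)] p.pr_bas[OF add2(1,3)]
   have 1: "s.ev ?ga f - (?ga (v, k +[?\<kappa>] k') - (?ga (v, k) + ?ga (v, k'))) : N" unfolding add2(4)
    by(rule c_trans[OF N s.ev_diff[OF c(1) s.f_add[OF c(2,3)]] c_diff[OF N s.ev_basis
       c_trans[OF N s.ev_add[OF c(2,3)] c_add[OF N s.ev_basis s.ev_basis]]]])
   have l: "lk k : Ox x" "lk k' : Ox x" "?m +>\<^bsub>?R\<^esub> go x (lk k) = k" "?m +>\<^bsub>?R\<^esub> go x (lk k') = k'" using lk add2 by auto
   have "lk (k +[?\<kappa>] k') - (lk k + lk k') : ?I" using l s.tau_cl ring_hom_add[OF h, of "go x (lk k)" "go x (lk k')"] osrD(4)[OF s.A]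
    by(intro lkI p.B.M.a_closed add2) (auto simp: s.tau_add s.residue_sel)
   from IMD[OF this s.lm(1)[OF add2(1)]]
   have "?ga (v, k +[?\<kappa>] k') - (?ga (v, k) + ?ga (v, k')) : DD" by(simp only: fst_conv snd_conv left_diff_distrib distrib_right)
   thus ?thesis by(rule trD[OF 1])
  next
   case (smult1 r v k)
   note c = p.pr_bas[OF p.A.smult_closed[OF smult1(1,2)] smult1(3)] p.pr_bas[OF smult1(2,3)]
   have 1: "s.ev ?ga f - (?ga (r #[?V] v, k) - s.lr r * ?ga (v, k)) : N" unfolding smult1(4)
    by(rule c_trans[OF N s.ev_diff[OF c(1) s.f_smult[OF c(2) smult1(1)]] c_diff[OF N s.ev_basis
       c_trans[OF N s.ev_smult[OF smult1(1) c(2)] c_mult[OF N c_refl[OF N] s.ev_basis]]]])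
   have "lk k * (s.lm (r #[?V] v) - s.lr r * s.lm v) : N" by(rule osubD(3)[OF N UNIV_I s.lm_smult[OF smult1(1,2)]])
   hence "?ga (r #[?V] v, k) - s.lr r * ?ga (v, k) : DD" using ND by(auto simp: algebra_simps)
   thus ?thesis by(rule trD[OF 1])
  next
   case (smult2 r v k)
   note c = p.pr_bas[OF smult2(2) p.B.smult_closed[OF smult2(1,3)]] p.pr_bas[OF smult2(2,3)]
   have 1: "s.ev ?ga f - (?ga (v, r #[?\<kappa>] k) - s.lr r * ?ga (v, k)) : N" unfolding smult2(4)
    by(rule c_trans[OF N s.ev_diff[OF c(1) s.f_smult[OF c(2) smult2(1)]] c_diff[OF N s.ev_basis
       c_trans[OF N s.ev_smult[OF smult2(1) c(2)] c_mult[OF N c_refl[OF N] s.ev_basis]]]])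
   have l: "lk k : Ox x" "?m +>\<^bsub>?R\<^esub> go x (lk k) = k" "s.lr r : Ox x" "go x (s.lr r) = r" using lk smult2 s.lr by auto
   have "lk (r #[?\<kappa>] k) - s.lr r * lk k : ?I" using l smult2(1) s.tau_cl ring_hom_mult[OF h, of "go x (s.lr r)" "go x (lk k)"] osrD(5)[OF s.A]
    by(intro lkI p.B.smult_closed smult2) (auto simp: s.tau_mult s.residue_sel)
   from IMD[OF this s.lm(1)[OF smult2(2)]]
   have "?ga (v, r #[?\<kappa>] k) - s.lr r * ?ga (v, k) : DD" by(simp only: fst_conv snd_conv left_diff_distrib mult.assoc)
   thus ?thesis by(rule trD[OF 1])
  qed
  have evS: "s.ev ?ga f : DD" if "f : P.Sp" for f by(rule s.ev_span[OF D ND p.bilinear_sub evR that])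
  have evb: "w : DD \<longleftrightarrow> s.ev ?ga (p.be (sgm si M x w, 1[?\<kappa>])) : DD" if w: "w : M x" for w
  proof -
   have 1: "s.ev ?ga (p.be (sgm si M x w, 1[?\<kappa>])) - lk 1[?\<kappa>] * s.lm (sgm si M x w) : N"
    using s.ev_basis[of ?ga "(sgm si M x w, 1[?\<kappa>])"] by simp
   have 2: "lk 1[?\<kappa>] * s.lm (sgm si M x w) - lk 1[?\<kappa>] * w : N" by(intro c_mult[OF N c_refl[OF N]] s.lm_cong w refl)
   have "lk 1[?\<kappa>] - 1 : ?I" by(rule lkI[OF one osrD(1)[OF s.A]]) (simp add: s.tau_one s.residue_sel ring_hom_one[OF h])
   from IMD[OF this w] have 3: "lk 1[?\<kappa>] * w - w : DD" by(simp add: left_diff_distrib)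
   have 4: "s.ev ?ga (p.be (sgm si M x w, 1[?\<kappa>])) - w : DD" using osubD(2)[OF D 3 subsetD[OF ND c_trans[OF N 1 2]]] by simp
   show ?thesis using osubD(2)[OF D 4, of w] osub_minus[OF s.A D _ 4, of "s.ev ?ga (p.be (sgm si M x w, 1[?\<kappa>]))"] by auto
  qed
  let ?Z = "{t. EX f:cr P.F. t = P.cls f & s.ev ?ga f : DD}"
  interpret F: mrec ?R P.F by(rule P.F_mod)
  have Z: "submodule ?Z ?R P.P"
  proof (rule Pm.submoduleI_smult)
   show "?Z [= cr P.P" unfolding P.pres_carrier by blast
   show "0[P.P] : ?Z" unfolding P.pres_zero using F.zero_closed osubD(1)[OF D] by(intro CollectI bexI[of _ "%_. 0[?R]"]) (auto simp: s.ev_zero)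
   fix t assume "t : ?Z"
   then obtain f where f: "f : cr P.F" "t = P.cls f" "s.ev ?ga f : DD" by blast
   show "t +[P.P] t' : ?Z" if "t' : ?Z" for t'
   proof -
    from \<open>t' : ?Z\<close> obtain f' where f': "f' : cr P.F" "t' = P.cls f'" "s.ev ?ga f' : DD" by blast
    show ?thesis unfolding f(2) f'(2) P.pres_add[OF f(1) f'(1)] by(intro CollectI bexI[OF _ s.f_add[OF f(1) f'(1)]] conjI refl
       trD[OF s.ev_add[OF f(1) f'(1)] osubD(2)[OF D f(3) f'(3)]])
   qed
   show "r #[P.P] t : ?Z" if r: "r : cr ?R" for r unfolding f(2) P.pres_smult[OF r f(1)] by(intro CollectI bexI[OF _ s.f_smult[OF f(1) r]] conjI refl
       trD[OF s.ev_smult[OF r f(1)] osubD(3)[OF D s.lr(1)[OF r] f(3)]])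
  qed
  have "?Vals [= ?Z"
  proof
   fix t assume "t : ?Vals"
   then obtain w where w: "w : sec M pts" "t = P.cls (p.be (sgm si M x w, 1[?\<kappa>]))" unfolding Vals by blast
   have wM: "w : M x" using w secM by auto
   have "w : DD" using w ospanI[OF s.A, of "sec M pts"] QD by blast
   thus "t : ?Z" unfolding w(2) using evb[OF wM] p.pr_bas[OF gc[OF wM] one] by blast
  qed
  hence "sspan ?R P.P ?Vals [= ?Z" by(rule Pm.span_least[OF Z])
  hence all: "cr P.P [= ?Z" using sur by simp
  have MD: "w : DD" if w: "w : M x" for w
  proof -
   let ?b = "p.be (sgm si M x w, 1[?\<kappa>])"
   have b: "?b : cr P.F" by(rule p.pr_bas[OF gc[OF w] one])
   have "P.cls ?b : cr P.P" unfolding P.pres_carrier using b by blast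
   then obtain f where f: "f : cr P.F" "P.cls ?b = P.cls f" "s.ev ?ga f : DD" using all by blast
   have "s.ev ?ga (%t. ?b t \<ominus>\<^bsub>?R\<^esub> f t) : DD" using P.cls_eq[OF b f(1)] f(2) evS by simp
   hence "s.ev ?ga ?b - s.ev ?ga f : DD" by(rule trD[OF c_sym[OF N s.ev_diff[OF b f(1)]]])
   hence "s.ev ?ga ?b : DD" using osubD(2)[OF D _ f(3), of "s.ev ?ga ?b - s.ev ?ga f"] by simp
   thus ?thesis using evb[OF w] by simp
  qed
  \<comment> \<open>A local frame makes \<open>M x\<close> finitely generated, as Nakayama's lemma
    requires.\<close>
  obtain U B where U: "oin T U" "x : U" "fr_at M U B" using M x unfolding framed_def by blast
  have MB: "M x = ospan (Ox x) (B Un N)" by(rule fr_at_span[OF U(1,3,2)])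
  have "M x [= ?Qs"
  proof (rule nakayama[OF s.A N os NQ I _ _ fr_atD(1)[OF U(3)]])
   show "EX v:Ox x. v * (1 - i) - 1 : N" if i: "i : ?I" for i
   proof -
    have 1: "1 - i : Ox x" using i osrD[OF s.A] by auto
    have "go x (1 - i) \<notin> ?m"
    proof
     assume "go x (1 - i) : ?m"
     hence "go x (1 - i) +[?R] go x i : ?m" using i m.a_closed by simp
     hence "1[?R] : ?m" using s.tau_add[OF 1, of i] i s.tau_one by simp
     thus False using m.one_imp_carrier m.I_notcarr by simp
    qed
    hence "go x (1 - i) : Units ?R" by(rule s.local_max_ideal(2)[OF lo s.tau_cl[OF 1]])
    then obtain r where r: "r : cr ?R" "r *[?R] go x (1 - i) = 1[?R]" unfolding Units_def by auto
    note l = s.lr[OF r(1)]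
    have "go x (s.lr r * (1 - i)) = go x 1" using s.tau_mult[OF l(1) 1] l(2) r(2) s.tau_one by simp
    thus ?thesis using s.tau_eq[OF osrD(5)[OF s.A l(1) 1] osrD(1)[OF s.A]] l(1) by blast
   qed
   show "?I [= Ox x" by blast
   show "M x [= ospan (Ox x) (?Qs Un B)" unfolding MB by(rule ospan_mono) (use NQ in auto)
   show "B [= M x" unfolding MB using ospanI[OF s.A, of "B Un N"] by auto
   show "EX q:?Qs. m - q : ?IM" if "m : M x" for m using MD[OF that] unfolding DD_def by blast
  qed
  thus "GG M x" unfolding GG_def .
 qed
qed

end

section \<open>Lattices of tensor powers and duals of line bundles\<close>

section \<open>Powers and duals of line bundles\<close>

context gmodel
begin

lemma ueq_mult: assumes A: "osubring A" and "ueq A u v" "ueq A u' v'" shows "ueq A (u * u') (v * v')"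
proof -
 have "EX c:A. u * u' - c * (v * v') : N" if c: "c : A" "u - c * v : N" "d : A" "u' - d * v' : N" for c d u v u' v'
  using c_mult[OF N c(2,4)] osrD(5)[OF A c(1,3)] by(intro bexI[of _ "c * d"]) (simp_all add: mult_ac)
 thus ?thesis using assms(2,3) unfolding ueq_def by blast
qed

lemma unitfamD: assumes "unitfam u" "x : pts" shows "u x : K" "EX v:K. u x * v - 1 : N" "EX U. oin T U & x : U & (ALL y:U. ueq (Ox y) (u y) (u x))"
 using assms unfolding unitfam_def by blast+

lemma unitfam_mult: assumes u: "unitfam u" and v: "unitfam v" shows "unitfam (%x. u x * v x)" unfolding unitfam_def
proof (intro ballI conjI)
 fix x assume x: "x : pts"
 show "u x * v x : K" using unitfamD(1)[OF u x] unitfamD(1)[OF v x] osrD(5)[OF K] by blast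
 obtain a b where ab: "a : K" "u x * a - 1 : N" "b : K" "v x * b - 1 : N" using unitfamD(2)[OF u x] unitfamD(2)[OF v x] by blast
 show "EX c:K. u x * v x * c - 1 : N" using c_mult[OF N ab(2,4)] osrD(5)[OF K ab(1,3)] by(intro bexI[of _ "a * b"]) (simp_all add: mult_ac)
 obtain U V where U: "oin T U" "x : U" "ALL y:U. ueq (Ox y) (u y) (u x)" and V: "oin T V" "x : V" "ALL y:V. ueq (Ox y) (v y) (v x)"
  using unitfamD(3)[OF u x] unitfamD(3)[OF v x] by blast
 have "ueq (Ox y) (u y * v y) (u x * v x)" if "y : U Int V" for y using that U V Ox[OF sub_top[OF U(1)], of y] by(intro ueq_mult) auto
 thus "EX U. oin T U & x : U & (ALL y:U. ueq (Ox y) (u y * v y) (u x * v x))" using U V by(intro exI[of _ "U Int V"]) auto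
qed

lemma unitfam_one: "unitfam (%_. 1)" unfolding unitfam_def ueq_def
proof (intro ballI conjI)
 fix x assume x: "x : pts"
 show "1 : K" "EX v:K. 1 * v - 1 : N" using osrD(1)[OF K] osubD(1)[OF N] by(auto intro: bexI[of _ 1])
 have "EX c:Ox y. 1 - c * 1 : N" if "y : pts" for y using osrD(1)[OF Ox[OF that]] osubD(1)[OF N] by(intro bexI[of _ 1]) auto
 thus "EX U. oin T U & x : U & (ALL y:U. (EX c:Ox y. 1 - c * 1 : N) & (EX c:Ox y. 1 - c * 1 : N))" using x open_top by blast
qed

lemma unitfam_power: "unitfam u ==> unitfam (%x. u x ^ m)" by(induction m) (auto intro: unitfam_one unitfam_mult)

definition ui :: "('p => 'w) => 'p => 'w" where "ui u x = (SOME v. v : K & u x * v - 1 : N)"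

lemma ui: assumes "unitfam u" "x : pts" shows "ui u x : K" "u x * ui u x - 1 : N" "ui u x * u x - 1 : N"
proof -
 have "EX v. v : K & u x * v - 1 : N" using unitfamD(2)[OF assms] by blast
 from someI_ex[OF this] show "ui u x : K" "u x * ui u x - 1 : N" unfolding ui_def by auto
 thus "ui u x * u x - 1 : N" by(simp add: mult.commute)
qed

lemma ui_cancel: assumes "unitfam u" "x : pts" shows "w - w * u x * ui u x : N" "w * u x : N ==> w : N"
proof -
 have "w * (u x * ui u x - 1) : N" by(rule osubD(3)[OF N UNIV_I ui(2)[OF assms]])
 from osub_UNIV_uminus[OF N this] show 1: "w - w * u x * ui u x : N" by(simp add: algebra_simps)
 show "w : N" if "w * u x : N"
 proof -
  have "ui u x * (w * u x) : N" by(rule osubD(3)[OF N UNIV_I that])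
  hence "w * u x * ui u x : N" by(simp add: mult.commute)
  thus ?thesis using 1 c_mem[OF N] by blast
 qed
qed

lemma unitfam_ui: assumes u: "unitfam u" shows "unitfam (ui u)" unfolding unitfam_def
proof (intro ballI conjI)
 fix x assume x: "x : pts"
 show "ui u x : K" by(rule ui[OF u x])
 show "EX v:K. ui u x * v - 1 : N" using ui(3)[OF u x] unitfamD(1)[OF u x] by blast
 obtain U where U: "oin T U" "x : U" "ALL y:U. ueq (Ox y) (u y) (u x)" using unitfamD(3)[OF u x] by blast
 have 1: "ui u y - c * ui u z : N" if y: "y : pts" and z: "z : pts" and c: "u z - c * u y : N" for y z c
 proof -
  have "ui u y - ui u y * u z * ui u z : N" by(rule ui_cancel[OF u z])
  moreover have "ui u y * u z * ui u z - ui u y * (c * u y) * ui u z : N" by(intro c_mult[OF N] c_refl[OF N] c)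
  moreover have "ui u y * (c * u y) * ui u z - c * ui u z : N" using osubD(3)[OF N UNIV_I ui(3)[OF u y], of "c * ui u z"] by(simp add: algebra_simps)
  ultimately show ?thesis using c_trans[OF N] by blast
 qed
 have "ueq (Ox y) (ui u y) (ui u x)" if y: "y : U" for y using U(3) y 1[OF _ x, of y] 1[OF x, of y] sub_top[OF U(1) y] unfolding ueq_def by blast
 thus "EX U. oin T U & x : U & (ALL y:U. ueq (Ox y) (ui u y) (ui u x))" using U by blast
qed

lemma msets_single: "msets {a} m = {replicate_mset m a}" unfolding msets_def
proof (intro equalityI subsetI)
 fix A assume "A : {A. set_mset A [= {a} & size A = m}"
 hence "set_mset A [= {a}" "size A = m" by auto
 thus "A : {replicate_mset m a}" by(auto simp: set_mset_subset_singletonD)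
qed auto

lemma line_pw: assumes u: "unitfam u" and x: "x : pts" shows "pw (lt u) m x = lt (%x. u x ^ m) x"
proof -
 obtain U where U: "oin T U" "x : U" "fr_at (lt u) U {u x}" using unitfam_frame[OF u x] by blast
 show ?thesis unfolding pw_frame_span[OF U] msets_single lt_def by simp
qed

lemma realizes_cong: assumes "realizes F si M" "!!x. x : pts ==> M x = M' x" shows "realizes F si M'"
proof -
 have "sec M U = sec M' U" if "oin T U" for U using assms(2) sub_top[OF that] unfolding sec_def by auto
 thus ?thesis using assms(1) unfolding realizes_def by auto
qed

theorem line_power_realizes: assumes L: "realizes L si (lt u)" and u: "unitfam u"
 shows "EX si'. realizes (tensor_power_sheaf X m L) si' (lt (%x. u x ^ m))"
proof -
 have "EX si'. realizes (tensor_power_sheaf X m L) si' (pw (lt u) m)"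
 proof (rule tensor_power_realizes[OF L unitfam_framed[OF u]])
  fix x assume x: "x : pts"
  have "mon_indep {u x} m" unfolding mon_indep_def msets_single
  proof (intro allI impI ballI)
   fix c A assume "(SUM A:{replicate_mset m (u x)}. c A * prod_mset A) : N" and A: "A : {replicate_mset m (u x)}"
   hence "c A * u x ^ m : N" by simp
   thus "c A : N" by(rule ui_cancel(2)[OF unitfam_power[OF u] x])
  qed
  thus "EX U B. oin T U & x : U & fr_at (lt u) U B & mon_indep B m & card B <= 1"
   using unitfam_frame[OF u x] by(metis card.empty card.insert empty_iff finite.emptyI le_refl One_nat_def)
 qed
 thus ?thesis using realizes_cong line_pw[OF u] by blast
qed

text \<open>Two sections over the empty set agree on every member of the empty cover. This matters
  because the homomorphisms in \<open>dual_sheaf\<close> also have a component on the empty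
  set.\<close>

lemma zero_ring_empty: "a : cr (SX {}) ==> b : cr (SX {}) ==> a = b"
proof -
 assume ab: "a : cr (SX {})" "b : cr (SX {})"
 have "is_sheaf T OX" using rs by(simp add: is_ringed_space_def)
 hence "ALL \<U>. (ALL U:\<U>. oin T U) --> (ALL s:cr (SX (\<Union>\<U>)). ALL t:cr (SX (\<Union>\<U>)).
     (ALL U:\<U>. restr OX (\<Union>\<U>) U s = restr OX (\<Union>\<U>) U t) --> s = t)" unfolding is_sheaf_def by blast
 from this[rule_format, of "{}" a b] ab show "a = b" by simp
qed

lemma tau_cl: "oin T U ==> U ~= {} ==> a : sec Ox U ==> tu U a : cr (SX U)" using nring.tau_cl[OF nr] by blast

lemma tau_eq: "oin T U ==> U ~= {} ==> a : sec Ox U ==> b : sec Ox U ==> tu U a = tu U b \<longleftrightarrow> a - b : N"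
 using nring.tau_eq[OF nr] by blast

lemma dual_product: assumes u: "unitfam u" and U: "oin T U" and w: "w : sec (lt (ui u)) U" and m: "m : sec (lt u) U" shows "w * m : sec Ox U"
 unfolding sec_def
proof (intro CollectI ballI)
 fix y assume y: "y : U"
 note p = sub_top[OF U y]
 obtain a where a: "a : Ox y" "w - a * ui u y : N" using secD[OF w y] unfolding lt_def fsp_one by blast
 obtain b where b: "b : Ox y" "m - b * u y : N" using secD[OF m y] unfolding lt_def fsp_one by blast
 have "w * m - (a * ui u y) * (b * u y) : N" by(rule c_mult[OF N a(2) b(2)])
 moreover have "(a * ui u y) * (b * u y) - a * b : N" using osubD(3)[OF N UNIV_I ui(3)[OF u p], of "a * b"] by(simp add: algebra_simps)
 ultimately have "w * m - a * b : N" by(rule c_trans[OF N])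
 thus "w * m : Ox y" by(rule osub_tr[OF osr_osub[OF Ox[OF p]] NOx[OF p]]) (rule osrD(5)[OF Ox[OF p] a(1) b(1)])
qed

text \<open>A homomorphism from a line bundle to the structure sheaf is multiplication by an element
  of the inverse lattice. Locally that element is read off from the image of the generator
  \<open>u x\<close>; irreducibility makes the local elements agree modulo \<open>N\<close>.\<close>

theorem dual_realizes: assumes L: "realizes L si (lt u)" and u: "unitfam u" and ms: "mod_sheaf X L"
 shows "EX si'. realizes (dual_sheaf X L) si' (lt (ui u))"
proof -
 let ?D = "dual_sheaf X L" and ?i = "lt (ui u)"
 define op where "op U = {V. oin T V & V [= U}" for U
 \<comment> \<open>On the empty set nothing is named, so the component there is given explicitly; in
   the zero ring 0 is the only value.\<close>
 define s' where "s' U w = (\<lambda>V\<in>op U. \<lambda>s\<in>cr (Sec L V). if V = {} then 0[SX V] else tu V (w * lmU si (lt u) V s))" for U w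
 have car: "cr (Sec ?D U) = {h : (\<Pi>\<^sub>E V\<in>op U. cr (Sec L V) \<rightarrow>\<^sub>E cr (SX V)).
      mod_sheaf_hom X U L (struct_module X) h}" for U by(simp add: dual_sheaf_def Let_def op_def)
 have sel: "g +[Sec ?D U] h = (\<lambda>V\<in>op U. \<lambda>s\<in>cr (Sec L V). g V s +[SX V] h V s)"
  "r #[Sec ?D U] h = (\<lambda>V\<in>op U. \<lambda>s\<in>cr (Sec L V). restr OX U V r *[SX V] h V s)"
  "0[Sec ?D U] = (\<lambda>V\<in>op U. \<lambda>s\<in>cr (Sec L V). 0[SX V])" "restr ?D U V h = restrict h (op V)" for g h U V r
  by(simp_all add: dual_sheaf_def Let_def op_def)
 have Lmod: "Module.module (SX V) (Sec L V)" if "oin T V" for V using ms that by(simp add: mod_sheaf_def)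
 have Lrestr: "restr L V W s : cr (Sec L W)" if "oin T V" "oin T W" "W [= V" "s : cr (Sec L V)" for V W s
  using ms that by(auto simp: mod_sheaf_def semilinear_def Pi_iff)
 have zc: "0[SX V] : cr (SX V)" if "oin T V" for V using cring.cring_simprules(2)[OF nr_cring[OF that]] .
 have val: "s' U w V s : cr (SX V)" if "oin T U" "w : sec ?i U" "V : op U" "s : cr (Sec L V)" for U w V s
 proof (cases "V = {}")
  case True
  thus ?thesis using that zc by(simp add: s'_def op_def)
 next
  case False
  have V: "oin T V" "V [= U" using that by(auto simp: op_def)
  interpret A: nmod "SX V" "sec Ox V" N "tu V" "Sec L V" "sec (lt u) V" "si V" by(rule r_mod[OF L V(1) False])
  have "tu V (w * A.lm s) : cr (SX V)" by(intro tau_cl V False dual_product[OF u V(1)] sec_mono[OF V(2) that(2)] A.lm that(4))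
  thus ?thesis using that False by(simp add: s'_def)
 qed
 have sv: "s' U w V s = tu V (w * m)" if "oin T U" "w : sec ?i U" "V : op U" "V ~= {}" "m : sec (lt u) V" "s = si V m" for U w V s m
 proof -
  have V: "oin T V" "V [= U" using that by(auto simp: op_def)
  interpret A: nmod "SX V" "sec Ox V" N "tu V" "Sec L V" "sec (lt u) V" "si V" by(rule r_mod[OF L V(1) that(4)])
  have sc: "s : cr (Sec L V)" using A.sig_closed that(5,6) by simp
  have "w * A.lm s - w * m : N" by(intro c_mult[OF N c_refl[OF N]] A.lm_cong that(5) that(6)[symmetric])
  moreover have "w * A.lm s : sec Ox V" "w * m : sec Ox V" by(auto intro!: dual_product[OF u V(1)] sec_mono[OF V(2) that(2)] A.lm sc that)
  ultimately have "tu V (w * A.lm s) = tu V (w * m)" using tau_eq[OF V(1) that(4)] by simp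
  thus ?thesis using that sc by(simp add: s'_def)
 qed
 have rep: "EX m:sec (lt u) V. s = si V m" if "oin T V" "V ~= {}" "s : cr (Sec L V)" for V s
  using nmod.sig_surj[OF r_mod[OF L that(1,2)] that(3)] by blast
 have cl: "s' U w : cr (Sec ?D U)" if U: "oin T U" and w: "w : sec ?i U" for U w unfolding car mod_sheaf_hom_def semilinear_def
 proof (intro CollectI conjI PiE_I allI impI ballI funcsetI, goal_cases)
  case (1 V s) thus ?case using val[OF U w] by simp
 next
  case (2 V s) thus ?case by(simp add: s'_def)
 next
  case (3 V) thus ?case by(simp add: s'_def)
 next
  case (4 V s) thus ?case using val[OF U w, of V s] by(simp add: op_def)
 next
  case (5 V s t)
  hence V: "oin T V" "V : op U" by(auto simp: op_def)
  interpret M: mrec "SX V" "Sec L V" by(intro mrec.intro Lmod V)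
  note v = val[OF U w V(2)]
  show ?case
  proof (cases "V = {}")
   case True
   thus ?thesis using zero_ring_empty v[OF 5(2)] v[OF 5(3)] v[OF M.M.a_closed[OF 5(2,3)]] M.R.a_closed by simp
  next
   case False
   interpret A: nmod "SX V" "sec Ox V" N "tu V" "Sec L V" "sec (lt u) V" "si V" by(rule r_mod[OF L V(1) False])
   obtain m n where m: "m : sec (lt u) V" "s = si V m" "n : sec (lt u) V" "t = si V n" using rep[OF V(1) False 5(2)] rep[OF V(1) False 5(3)] by blast
   have wV: "w : sec ?i V" using w V(2) by(auto simp: op_def intro: sec_mono)
   show ?thesis using sv[OF U w V(2) False m(1,2)] sv[OF U w V(2) False m(3,4)]
     sv[OF U w V(2) False osubD(2)[OF A.L m(1,3)], of "s +[Sec L V] t"] A.sig_add[OF m(1,3)] m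
     A.tau_add[OF dual_product[OF u V(1) wV m(1)] dual_product[OF u V(1) wV m(3)]] by(simp add: distrib_left)
  qed
 next
  case (6 V r s)
  hence V: "oin T V" "V : op U" by(auto simp: op_def)
  interpret M: mrec "SX V" "Sec L V" by(intro mrec.intro Lmod V)
  note v = val[OF U w V(2)]
  show ?case
  proof (cases "V = {}")
   case True
   thus ?thesis using zero_ring_empty v[OF 6(3)] v[OF M.smult_closed[OF 6(2,3)]] 6(2) M.R.m_closed by simp
  next
   case False
   interpret A: nmod "SX V" "sec Ox V" N "tu V" "Sec L V" "sec (lt u) V" "si V" by(rule r_mod[OF L V(1) False])
   obtain m b where m: "m : sec (lt u) V" "s = si V m" "b : sec Ox V" "r = tu V b" using rep[OF V(1) False 6(3)] A.tau_surj[OF 6(2)] by blast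
   have wV: "w : sec ?i V" using w V(2) by(auto simp: op_def intro: sec_mono)
   show ?thesis using sv[OF U w V(2) False m(1,2)] sv[OF U w V(2) False osubD(3)[OF A.L m(3,1)], of "r #[Sec L V] s"] A.sig_smult[OF m(3,1)] m
     A.tau_mult[OF m(3) dual_product[OF u V(1) wV m(1)]] by(simp add: mult.left_commute)
  qed
 next
  case (7 V W s)
  hence V: "oin T V" "V : op U" and W: "oin T W" "W : op U" "W [= V" by(auto simp: op_def)
  have rc: "restr L V W s : cr (Sec L W)" by(rule Lrestr[OF V(1) W(1,3) 7(2)])
  show ?case
  proof (cases "W = {}")
   case True
   thus ?thesis using zero_ring_empty val[OF U w W(2) rc] ring_hom_closed[OF restr_hom[OF V(1) W(1,3)] val[OF U w V(2) 7(2)]] by simp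
  next
   case False
   hence V0: "V ~= {}" using W(3) by auto
   obtain m where m: "m : sec (lt u) V" "s = si V m" using rep[OF V(1) V0 7(2)] by blast
   have wV: "w : sec ?i V" using w V(2) by(auto simp: op_def intro: sec_mono)
   show ?thesis using sv[OF U w V(2) V0 m] sv[OF U w W(2) False sec_mono[OF W(3) m(1)]] r_restr[OF L V(1) W(1) False W(3) m(1)] m(2)
     tau_restr[OF V(1) W(1) False W(3) dual_product[OF u V(1) wV m(1)]] by simp
  qed
 qed
 have loc: "EX V. oin T V & x : V & V [= U & V ~= {} & V : op U & u x : sec (lt u) V & (ALL y:V. ueq (Ox y) (u y) (u x))"
  if U: "oin T U" "x : U" for U x
 proof -
  obtain V where V: "oin T V" "x : V" "ALL y:V. ueq (Ox y) (u y) (u x)" using unitfamD(3)[OF u sub_top[OF U]] by blast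
  have "u x : lt u y" if "y : V" for y using V(3) that unfolding lt_def fsp_one ueq_def by blast
  thus ?thesis using U V by(intro exI[of _ "V Int U"]) (auto simp: sec_def op_def)
 qed
 have "realizes ?D s' ?i" unfolding realizes_def
 proof (intro conjI allI impI)
  fix U assume U': "oin T U & U ~= {}"
  hence U: "oin T U" "U ~= {}" by auto
  interpret R: nring "SX U" "sec Ox U" N "tu U" by(rule nr[OF U])
  note fo = framed_osub[OF unitfam_framed[OF unitfam_ui[OF u]] sub_top[OF U(1)]]
  have kerD: "w : N" if w: "w : sec ?i U" and V: "V : op U" "x : V" "u x : sec (lt u) V" and 0: "tu V (w * u x) = 0[SX V]" for w V x
  proof -
   have V': "oin T V" "V ~= {}" "V [= U" using V by(auto simp: op_def)
   interpret B: nring "SX V" "sec Ox V" N "tu V" by(rule nr[OF V'(1,2)])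
   have "w * u x : N" using B.tau_ker dual_product[OF u V'(1) sec_mono[OF V'(3) w] V(3)] 0 by blast
   thus "w : N" by(rule ui_cancel(2)[OF u sub_top[OF V'(1) V(2)]])
  qed
  show "nmod (SX U) (sec Ox U) N (tu U) (Sec ?D U) (sec ?i U) (s' U)"
  proof (unfold_locales, goal_cases)
   case 1
   thus ?case using osubD[OF fo(1)] unfolding osub_def sec_def by auto
  next
   case 2
   thus ?case using fo(2) unfolding sec_def by auto
  next
   case (3 w)
   thus ?case by(rule cl[OF U(1)])
  next
   case (4 h)
   have hc: "h V s : cr (SX V)" if "V : op U" "s : cr (Sec L V)" for V s using 4 that unfolding car by(auto simp: PiE_def Pi_def)
   have hs: "h V (r #[Sec L V] s) = r *[SX V] h V s" if "V : op U" "s : cr (Sec L V)" "r : cr (SX V)" for V r s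
    using 4 that unfolding car mod_sheaf_hom_def semilinear_def op_def by auto
   have hr: "restr OX V W (h V s) = h W (restr L V W s)" if "V : op U" "oin T W" "W [= V" "s : cr (Sec L V)" for V W s
    using 4 that unfolding car mod_sheaf_hom_def op_def by auto
   have key: "EX V w. oin T V & x : V & V [= U & w : ?i x & (ALL W m. oin T W & W ~= {} & W [= V & m : sec (lt u) W -->
      w * m : sec Ox W & h W (si W m) = tu W (w * m))" if x: "x : U" for x
   proof -
    obtain V where V: "oin T V" "x : V" "V [= U" "u x : sec (lt u) V"
     and V0: "V ~= {}" "V : op U" and ue: "ALL y:V. ueq (Ox y) (u y) (u x)" using loc[OF U(1) x] by blast
    have p: "x : pts" by(rule sub_top[OF V(1,2)])
    interpret A: nmod "SX V" "sec Ox V" N "tu V" "Sec L V" "sec (lt u) V" "si V" by(rule r_mod[OF L V(1) V0(1)])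
    \<comment> \<open>\<open>c\<close> names the image of the generator \<open>u x\<close>, so on
      \<open>V\<close> the map \<open>h\<close> is multiplication by \<open>c\<close> divided by
      \<open>u x\<close>.\<close>
    define c where "c = A.lr (h V (si V (u x)))"
    note hV = hc[OF V0(2) A.sig_closed[OF V(4)]]
    have c: "c : sec Ox V" "tu V c = h V (si V (u x))" using A.lr[OF hV] by(auto simp: c_def)
    let ?w = "c * ui u x"
    have "?w : ?i x" unfolding lt_def fsp_one using secD[OF c(1) V(2)] osubD(1)[OF N] by(intro bexI[of _ c]) auto
    moreover have "?w * m : sec Ox W & h W (si W m) = tu W (?w * m)" if W: "oin T W" "W ~= {}" "W [= V" "m : sec (lt u) W" for W m
    proof -
     interpret B: nmod "SX W" "sec Ox W" N "tu W" "Sec L W" "sec (lt u) W" "si W" by(rule r_mod[OF L W(1,2)])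
     define a where "a = m * ui u x"
     have ux: "u x : sec (lt u) W" by(rule sec_mono[OF W(3) V(4)])
     have cW: "c : sec Ox W" by(rule sec_mono[OF W(3) c(1)])
     have a: "a : sec Ox W" unfolding sec_def
     proof (intro CollectI ballI)
      fix y assume y: "y : W"
      note q = sub_top[OF W(1) y]
      obtain b where b: "b : Ox y" "m - b * u y : N" using secD[OF W(4) y] unfolding lt_def fsp_one by blast
      obtain d where d: "d : Ox y" "u y - d * u x : N" using ue W(3) y unfolding ueq_def by blast
      have "m - (b * d) * u x : N" using c_trans[OF N b(2) c_mult[OF N c_refl[OF N, of b] d(2)]] by(simp add: mult.assoc)
      hence "a - (b * d) * u x * ui u x : N" unfolding a_def by(rule c_mult[OF N _ c_refl[OF N]])
      from c_trans[OF N this c_sym[OF N ui_cancel(1)[OF u p]]] show "a : Ox y"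
       by(rule osub_tr[OF osr_osub[OF Ox[OF q]] NOx[OF q]]) (rule osrD(5)[OF Ox[OF q] b(1) d(1)])
     qed
     have e: "?w * m = a * c" by(simp add: a_def mult_ac)
     have mm: "m - a * u x : N" using ui_cancel(1)[OF u p, of m] by(simp add: a_def mult_ac)
     have "si W m = si W (a * u x)" using B.sig_eq[OF W(4) osubD(3)[OF B.L a ux]] mm by simp
     also have "\<dots> = tu W a #[Sec L W] restr L V W (si V (u x))" using B.sig_smult[OF a ux] r_restr[OF L V(1) W(1,2,3) V(4)] by simp
     finally have "h W (si W m) = tu W a *[SX W] h W (restr L V W (si V (u x)))"
      using hs[of W "restr L V W (si V (u x))" "tu W a"] Lrestr[OF V(1) W(1,3) A.sig_closed[OF V(4)]] B.tau_cl[OF a] V(3) W by(simp add: op_def)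
     also have "\<dots> = tu W a *[SX W] tu W c" using hr[OF V0(2) W(1,3) A.sig_closed[OF V(4)]] c(2) tau_restr[OF V(1) W(1,2,3) c(1)] by simp
     also have "\<dots> = tu W (?w * m)" unfolding e using B.tau_mult[OF a cW] by simp
     finally show ?thesis unfolding e using osrD(5)[OF B.A a cW] by simp
    qed
    ultimately show ?thesis using V by blast
   qed
   then obtain V w where Vw: "!!x. x : U ==> oin T (V x) & x : V x & V x [= U & w x : ?i x"
    and hw: "!!x W m. x : U ==> oin T W ==> W ~= {} ==> W [= V x ==> m : sec (lt u) W ==> w x * m : sec Ox W & h W (si W m) = tu W (w x * m)" by metis
   obtain x0 where x0: "x0 : U" using U by blast
   \<comment> \<open>Both candidates describe \<open>h\<close> on a small open set inside
     \<open>V x Int V x0\<close>, which is non-empty by irreducibility; evaluating at a unit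
     \<open>u z\<close> shows that they agree modulo \<open>N\<close>.\<close>
   have d: "w x0 - w x : N" if x: "x : U" for x
   proof -
    have o: "oin T (V x Int V x0)" using Vw[OF x] Vw[OF x0] by blast
    have "V x Int V x0 ~= {}" using irr[of "V x" "V x0"] Vw[OF x] Vw[OF x0] by blast
    then obtain z where z: "z : V x Int V x0" by blast
    obtain W where W: "oin T W" "z : W" "W [= V x Int V x0" "W ~= {}" "u z : sec (lt u) W" using loc[OF o z] by blast
    have "tu W (w x0 * u z) = tu W (w x * u z)" "w x0 * u z : sec Ox W" "w x * u z : sec Ox W"
     using hw[OF x W(1,4) _ W(5)] hw[OF x0 W(1,4) _ W(5)] W(3) by auto
    hence "(w x0 - w x) * u z : N" using tau_eq[OF W(1,4)] by(simp add: left_diff_distrib)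
    thus ?thesis by(rule ui_cancel(2)[OF u sub_top[OF W(1,2)]])
   qed
   have wi: "w x0 : sec ?i U" unfolding sec_def using osub_tr[OF fo d] Vw by blast
   have eq: "h V' s = s' U (w x0) V' s" if V': "V' : op U" and s: "s : cr (Sec L V')" for V' s
   proof (cases "V' = {}")
    case True
    thus ?thesis using zero_ring_empty hc[OF V' s] val[OF U(1) wi V' s] by simp
   next
    case False
    have o: "oin T V'" "V' [= U" using V' by(auto simp: op_def)
    interpret A: nmod "SX V'" "sec Ox V'" N "tu V'" "Sec L V'" "sec (lt u) V'" "si V'" by(rule r_mod[OF L o(1) False])
    obtain x where x: "x : V'" using False by blast
    hence xU: "x : U" using o by blast
    let ?W = "V' Int V x"
    have W: "oin T ?W" "?W ~= {}" "?W [= V'" "?W [= V x" using o Vw[OF xU] x by auto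
    obtain m where m: "m : sec (lt u) V'" "s = si V' m" using A.sig_surj[OF s] by blast
    note mW = sec_mono[OF W(3) m(1)]
    note wm = dual_product[OF u o(1) sec_mono[OF o(2) wi] m(1)]
    obtain b where b: "b : sec Ox V'" "tu V' b = h V' s" using A.tau_surj[OF hc[OF V' s]] by blast
    have "tu ?W b = h ?W (si ?W m)" using tau_restr[OF o(1) W(1-3) b(1)] b(2) hr[OF V' W(1,3) s] r_restr[OF L o(1) W(1-3) m(1)] m(2) by simp
    also have "\<dots> = tu ?W (w x * m)" using hw[OF xU W(1,2,4) mW] by blast
    finally have "b - w x * m : N" using tau_eq[OF W(1,2) sec_mono[OF W(3) b(1)]] hw[OF xU W(1,2,4) mW] by blast
    moreover have "w x * m - w x0 * m : N" by(rule c_mult[OF N c_sym[OF N d[OF xU]] c_refl[OF N]])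
    ultimately have "b - w x0 * m : N" by(rule c_trans[OF N])
    hence "h V' s = tu V' (w x0 * m)" using tau_eq[OF o(1) False b(1) wm] b(2) by simp
    thus ?thesis using sv[OF U(1) wi V' False m] by simp
   qed
   have hE: "h : (\<Pi>\<^sub>E V\<in>op U. cr (Sec L V) \<rightarrow>\<^sub>E cr (SX V))" using 4 unfolding car by blast
   have sE: "s' U (w x0) : (\<Pi>\<^sub>E V\<in>op U. cr (Sec L V) \<rightarrow>\<^sub>E cr (SX V))" using cl[OF U(1) wi] unfolding car by blast
   have "s' U (w x0) = h"
   proof (rule PiE_ext[OF sE hE])
    fix V assume V: "V : op U"
    show "s' U (w x0) V = h V" by(rule PiE_ext[OF PiE_mem[OF sE V] PiE_mem[OF hE V]]) (simp add: eq[OF V])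
   qed
   thus ?case using wi by blast
  next
   case (5 v w)
   have "tu V ((v + w) * lmU si (lt u) V s) = tu V (v * lmU si (lt u) V s) +[SX V] tu V (w * lmU si (lt u) V s)"
    if "V : op U" "V ~= {}" "s : cr (Sec L V)" for V s
   proof -
    have V: "oin T V" "V [= U" using that by(auto simp: op_def)
    interpret A: nmod "SX V" "sec Ox V" N "tu V" "Sec L V" "sec (lt u) V" "si V" by(rule r_mod[OF L V(1) that(2)])
    note l = dual_product[OF u V(1) sec_mono[OF V(2)] A.lm(1)[OF that(3)]]
    show ?thesis using A.tau_add[OF l[OF 5(1)] l[OF 5(2)]] by(simp add: distrib_right)
   qed
   moreover have "0[SX {}] +[SX {}] 0[SX {}] = 0[SX {}]" using cring.cring_simprules(8)[OF nr_cring] zc openin_empty by blast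
   ultimately show ?case unfolding sel by(auto simp: s'_def fun_eq_iff restrict_def)
  next
   case (6 a w)
   have "tu V (a * w * lmU si (lt u) V s) = restr OX U V (tu U a) *[SX V] tu V (w * lmU si (lt u) V s)"
    if "V : op U" "V ~= {}" "s : cr (Sec L V)" for V s
   proof -
    have V: "oin T V" "V [= U" using that by(auto simp: op_def)
    interpret A: nmod "SX V" "sec Ox V" N "tu V" "Sec L V" "sec (lt u) V" "si V" by(rule r_mod[OF L V(1) that(2)])
    note l = dual_product[OF u V(1) sec_mono[OF V(2) 6(2)] A.lm(1)[OF that(3)]]
    show ?thesis using A.tau_mult[OF sec_mono[OF V(2) 6(1)] l] tau_restr[OF U(1) V(1) that(2) V(2) 6(1)] by(simp add: mult.assoc)
   qed
   moreover have "restr OX U {} (tu U a) *[SX {}] 0[SX {}] = 0[SX {}]"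
    using cring.cring_simprules(27)[OF nr_cring] ring_hom_closed[OF restr_hom[OF U(1) openin_empty] tau_cl[OF U 6(1)]] by simp
   ultimately show ?case unfolding sel by(auto simp: s'_def fun_eq_iff restrict_def)
  next
   case (7 w)
   show ?case
   proof
    assume 0: "s' U w = 0[Sec ?D U]"
    obtain x where x: "x : U" using U by blast
    obtain V where V: "oin T V" "x : V" "V ~= {}" "V : op U" "u x : sec (lt u) V" using loc[OF U(1) x] by blast
    have sc: "si V (u x) : cr (Sec L V)" using nmod.sig_closed[OF r_mod[OF L V(1,3)] V(5)] .
    have "tu V (w * u x) = 0[SX V]" using sv[OF U(1) 7 V(4,3,5) refl] 0 sc V(4) by(simp add: sel)
    thus "w : N" by(rule kerD[OF 7 V(4,2,5)])
   next
    assume w: "w : N"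
    have "tu V (w * lmU si (lt u) V s) = 0[SX V]" if "V : op U" "V ~= {}" "s : cr (Sec L V)" for V s
    proof -
     have V: "oin T V" "V [= U" using that by(auto simp: op_def)
     interpret A: nmod "SX V" "sec Ox V" N "tu V" "Sec L V" "sec (lt u) V" "si V" by(rule r_mod[OF L V(1) that(2)])
     have "w * A.lm s : N" using osubD(3)[OF N UNIV_I w, of "A.lm s"] by(simp add: mult.commute)
     thus ?thesis using A.tau_ker A.NA by blast
    qed
    thus "s' U w = 0[Sec ?D U]" unfolding sel by(auto simp: s'_def fun_eq_iff restrict_def)
   qed
  qed
 next
  fix U V w assume "oin T U & oin T V & V ~= {} & V [= U & w : sec ?i U"
  hence VU: "op V [= op U" by(auto simp: op_def)
  show "restr ?D U V (s' U w) = s' V w"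
  proof
   fix W
   show "restr ?D U V (s' U w) W = s' V w W" using subsetD[OF VU, of W] by(cases "W : op V") (simp_all add: sel s'_def)
  qed
 qed
 thus ?thesis by(intro exI[of _ s'])
qed

end

section \<open>Realizing a given lattice by a coherent sheaf of the type fixed in
  \<open>ample\<close>\<close>

section \<open>Coherent sheaves with prescribed lattices\<close>

text \<open>\<open>ample\<close> quantifies over sheaves whose sections have one fixed type. Here a
  lattice is turned into a sheaf of such a type: a section is the code \<open>cd w\<close> of its
  name, and \<open>cd\<close> identifies exactly the names that agree modulo
  \<open>N\<close>.\<close>

locale coded = gmodel X K N Ox tu for X :: "('p, 'r, 'z) ringed_space_scheme" and K N :: "'w::comm_ring_1 set" and Ox and tu +
 fixes M :: "'p => 'w set" and cd :: "'w => 'm" assumes M: "framed M"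
  and cd: "oin T U ==> U ~= {} ==> v : sec M U ==> w : sec M U ==> cd v = cd w \<longleftrightarrow> v - w : N"
begin

definition dc :: "'p set => 'm => 'w" where "dc U f = (SOME w. w : sec M U & cd w = f)"

text \<open>Restriction between non-empty sets does not change the code. The empty set has clauses
  of its own because a sheaf has exactly one section there, whereas \<open>sec M {}\<close> is
  everything.\<close>

definition Fs :: "('p, 'r, 'm) mod_presheaf" where "Fs = \<lparr>sections = (%U.
  \<lparr>carrier = (if U = {} then {cd 0} else cd ` sec M U), mult = undefined, one = undefined, zero = cd 0,
   add = (%f g. if U = {} then cd 0 else cd (dc U f + dc U g)), smult = (%r f. if U = {} then cd 0 else cd (lrU U r * dc U f))\<rparr>),
  restr = (%U V f. if V = {} then cd 0 else f)\<rparr>"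

lemma Fs_sel: "cr (Sec Fs U) = (if U = {} then {cd 0} else cd ` sec M U)" "f +[Sec Fs U] g = (if U = {} then cd 0 else cd (dc U f + dc U g))"
 "0[Sec Fs U] = cd 0" "r #[Sec Fs U] f = (if U = {} then cd 0 else cd (lrU U r * dc U f))" "restr Fs U V f = (if V = {} then cd 0 else f)"
 by(simp_all add: Fs_def)

lemma sec_M: assumes U: "oin T U" shows "osub (sec Ox U) (sec M U)" "N [= sec M U"
 using osubD[OF framed_osub(1)[OF M sub_top[OF U]]] framed_osub(2)[OF M sub_top[OF U]] unfolding osub_def sec_def by(auto, meson subsetD)

lemma dc: assumes U: "oin T U" "U ~= {}" and w: "w : sec M U" shows "dc U (cd w) : sec M U" "dc U (cd w) - w : N"
proof -
 have "EX v. v : sec M U & cd v = cd w" using w by blast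
 from someI_ex[OF this] have 1: "dc U (cd w) : sec M U" "cd (dc U (cd w)) = cd w" unfolding dc_def by auto
 thus "dc U (cd w) : sec M U" "dc U (cd w) - w : N" using cd[OF U 1(1) w] by auto
qed

lemma Fs_realizes: "realizes Fs (%U. cd) M" unfolding realizes_def
proof (intro conjI allI impI)
 fix U assume U': "oin T U & U ~= {}"
 hence U: "oin T U" "U ~= {}" by auto
 interpret R: nring "SX U" "sec Ox U" N "tu U" by(rule nr[OF U])
 note sM = sec_M[OF U(1)]
 show "nmod (SX U) (sec Ox U) N (tu U) (Sec Fs U) (sec M U) cd"
 proof (unfold_locales, goal_cases)
  case (5 v w)
  have "cd (v + w) = cd (dc U (cd v) + dc U (cd w))"
   using dc[OF U 5(1)] dc[OF U 5(2)] 5 c_add[OF N c_sym[OF N dc(2)[OF U 5(1)]] c_sym[OF N dc(2)[OF U 5(2)]]]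
   by(subst cd[OF U]) (auto intro: osubD(2)[OF sM(1)])
  thus ?case using U by(simp add: Fs_sel)
 next
  case (6 a w)
  note l = R.lr(1)[OF R.tau_cl[OF 6(1)]]
  have "cd (a * w) = cd (R.lr (tu U a) * dc U (cd w))" using 6 dc[OF U 6(2)] c_mult[OF N c_sym[OF N R.lr_tau[OF 6(1)]] c_sym[OF N dc(2)[OF U 6(2)]]] l
   by(subst cd[OF U]) (auto intro: osubD(3)[OF sM(1)])
  thus ?case using U by(simp add: Fs_sel)
 next
  case (7 w)
  thus ?case using cd[OF U 7 osubD(1)[OF sM(1)]] by(simp add: Fs_sel)
 qed (use sM U in \<open>auto simp: Fs_sel\<close>)
qed (auto simp: Fs_sel)

lemma Fs_sheaf: "is_sheaf T Fs" unfolding is_sheaf_def is_presheaf_def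
proof (intro conjI allI impI ballI, goal_cases)
 case (1 U V)
 show ?case
 proof (cases "V = {}")
  case False
  hence "U ~= {}" "sec M U [= sec M V" using 1 by(auto simp: sec_def)
  thus ?thesis using False by(auto simp: Fs_sel)
 qed (simp add: Fs_sel)
next
 case (2 U s)
 thus ?case by(auto simp: Fs_sel)
next
 case (3 U V W s)
 thus ?case by(auto simp: Fs_sel)
next
 case (4 \<U> s t)
 show ?case
 proof (cases "\<Union>\<U> = {}")
  case True
  thus ?thesis using 4(2,3) unfolding True by(simp add: Fs_sel)
 next
  case False
  then obtain U where "U : \<U>" "U ~= {}" by blast
  thus ?thesis using bspec[OF 4(4), of U] False by(simp add: Fs_sel)
 qed
next
 case (5 \<U> s)
 hence s: "!!U. U : \<U> ==> oin T U & s U : cr (Sec Fs U)"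
  and a: "!!U V. U : \<U> ==> V : \<U> ==> restr Fs U (U Int V) (s U) = restr Fs V (U Int V) (s V)" by auto
 show ?case
 proof (cases "\<Union>\<U> = {}")
  case True
  have "U = {}" if "U : \<U>" for U using True that by blast
  thus ?thesis using s unfolding True by(intro bexI[of _ "cd 0"]) (auto simp: Fs_sel)
 next
  case False
  then obtain U0 where U0: "U0 : \<U>" "U0 ~= {}" by blast
  \<comment> \<open>Non-empty members of the cover meet and restriction keeps the code, so they all
    carry the same code.\<close>
  have e: "s U = s U0" if "U : \<U>" "U ~= {}" for U using a[OF that(1) U0(1)] irr[of U U0] s[OF that(1)] s[OF U0(1)] U0 that by(simp add: Fs_sel)
  obtain w where w: "w : sec M U0" "s U0 = cd w" using s[OF U0(1)] U0 by(auto simp: Fs_sel)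
  have "w : sec M (\<Union>\<U>)" unfolding sec_def
  proof (intro CollectI ballI)
   fix x assume "x : \<Union>\<U>"
   then obtain U where U: "U : \<U>" "x : U" "U ~= {}" by blast
   have oU: "oin T U" "oin T U0" using s U U0 by auto
   obtain v where v: "v : sec M U" "s U = cd v" using s[OF U(1)] U by(auto simp: Fs_sel)
   have I: "oin T (U Int U0)" "U Int U0 ~= {}" using oU irr[OF oU U(3) U0(2)] by auto
   have "cd w = cd v" using e[OF U(1,3)] v w by simp
   hence "w - v : N" using cd[OF I, of w v] v w by(auto simp: sec_def)
   thus "w : M x" using osub_tr[OF framed_osub[OF M sub_top[OF oU(1) U(2)]]] v U by(auto simp: sec_def)
  qed
  moreover have "restr Fs (\<Union>\<U>) U (s U0) = s U" if "U : \<U>" for U using e[OF that] s[OF that] by(auto simp: Fs_sel)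
  ultimately show ?thesis using w False by(intro bexI[of _ "s U0"]) (auto simp: Fs_sel)
 qed
qed

lemma Fs_mod_sheaf: "mod_sheaf X Fs" unfolding mod_sheaf_def
proof (intro conjI allI impI)
 show "is_sheaf T Fs" by(rule Fs_sheaf)
 fix U assume U: "oin T U"
 show "Module.module (SX U) (Sec Fs U)"
 proof (cases "U = {}")
  case False
  thus ?thesis using nmod.is_mod[OF r_mod[OF Fs_realizes U]] by simp
 next
  case True
  have "abelian_group (Sec Fs U)" by(rule abelian_groupI) (auto simp: Fs_sel True)
  thus ?thesis by(intro moduleI nr_cring[OF U]) (auto simp: Fs_sel True)
 qed
next
 fix U V assume o: "oin T U & oin T V & V [= U"
 show "semilinear (SX U) (restr OX U V) (Sec Fs U) (Sec Fs V) (restr Fs U V)"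
 proof (cases "V = {}")
  case True
  thus ?thesis by(auto simp: semilinear_def Fs_sel)
 next
  case False
  thus ?thesis using r_res_cl[OF Fs_realizes, of U V] o unfolding semilinear_def by blast
 qed
qed

lemma shf_sel: "cr (Sec (free_sheaf X n) U) = {..<n} \<rightarrow>\<^sub>E cr (SX U)"
 "f +[Sec (free_sheaf X n) U] g = (\<lambda>i\<in>{..<n}. f i +[SX U] g i)" "r #[Sec (free_sheaf X n) U] f = (\<lambda>i\<in>{..<n}. r *[SX U] f i)"
 "restr (free_sheaf X n) U V f = (\<lambda>i\<in>{..<n}. restr OX U V (f i))" by(simp_all add: free_sheaf_def Let_def)

text \<open>A frame gives an isomorphism from a free sheaf on each small open set, so the
  presentation has no relations: \<open>m = 0\<close>, and \<open>g\<close> is the zero map.\<close>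

theorem Fs_coherent: "coherent X Fs" unfolding coherent_def
proof (intro conjI ballI)
 show "mod_sheaf X Fs" by(rule Fs_mod_sheaf)
 fix x assume x: "x : pts"
 obtain U B where U: "oin T U" "x : U" and fr: "fr_at M U B" using M x unfolding framed_def by blast
 define n where "n = card B"
 obtain b where b: "bij_betw b {..<n} B" using ex_bij_betw_nat_finite[OF fr_atD(1)[OF fr]] by(auto simp: atLeast0LessThan n_def)
 have bB: "b i : B" if "i < n" for i using b that by(auto simp: bij_betw_def)
 define g where "g V = (%s::nat => 'r. \<lambda>i\<in>{..<n}. 0[SX V])" for V
 define h where "h V s = (if V = {} then cd 0 else cd (\<Sum>i<n. lrU V (s i) * b i))" for V and s :: "nat => 'r"
 have oV: "fr_at M V B" if "V [= U" for V by(rule fr_at_mono[OF fr that])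
 have B: "B [= sec M V" if "oin T V" "V ~= {}" "V [= U" for V
  unfolding framed_sec[OF that(1,2) oV[OF that(3)]] using ospanI[OF osr_sec[OF that(1)], of "B Un N"] by auto
 have s_mem: "(\<Sum>i<n. c i * b i) : sec M V" if "oin T V" "V ~= {}" "V [= U" "!!i. i < n ==> c i : sec Ox V" for V c
  using B[OF that(1-3)] bB that(4) by(intro osub_sum[OF sec_M(1)[OF that(1)]] osubD(3)[OF sec_M(1)[OF that(1)]]) auto
 have h_eq: "h V s = cd (\<Sum>i<n. c i * b i)" if V: "oin T V" "V ~= {}" "V [= U" and s: "!!i. i < n ==> c i : sec Ox V & s i = tu V (c i)" for V s c
 proof -
  interpret R: nring "SX V" "sec Ox V" N "tu V" by(rule nr[OF V(1,2)])
  have l: "lrU V (s i) : sec Ox V" "lrU V (s i) - c i : N" if "i < n" for i using s[OF that] R.tau_cl R.lr(1) R.lr_tau by auto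
  have "(\<Sum>i<n. lrU V (s i) * b i) - (\<Sum>i<n. c i * b i) : N" by(intro c_sum[OF N] c_mult[OF N _ c_refl[OF N]] l) simp
  moreover have "(\<Sum>i<n. lrU V (s i) * b i) : sec M V" by(rule s_mem[OF V]) (rule l(1))
  moreover have "(\<Sum>i<n. c i * b i) : sec M V" by(rule s_mem[OF V]) (use s in blast)
  ultimately have "cd (\<Sum>i<n. lrU V (s i) * b i) = cd (\<Sum>i<n. c i * b i)" using cd[OF V(1,2)] by blast
  thus ?thesis using V by(simp add: h_def)
 qed
 have rep: "EX c. ALL i<n. c i : sec Ox V & s i = tu V (c i)" if "oin T V" "V ~= {}" "s : {..<n} \<rightarrow>\<^sub>E cr (SX V)" for V s
 proof -
  have "EX c. c : sec Ox V & s i = tu V c" if "i < n" for i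
   using nring.tau_surj[OF nr[OF \<open>oin T V\<close> \<open>V ~= {}\<close>], of "s i"] PiE_mem[OF \<open>s : _\<close>, of i] that by auto
  thus ?thesis by metis
 qed
 have z: "0[SX V] +[SX V] 0[SX V] = 0[SX V]" "r : cr (SX V) ==> r *[SX V] 0[SX V] = 0[SX V]" "0[SX V] : cr (SX V)" if "oin T V" for V r
  using nr_cring[OF that] cring.cring_simprules(2,8,27) by metis+
 have rz: "restr OX V W 0[SX V] = 0[SX W]" if "oin T V" "oin T W" "W [= V" for V W
  using ring_hom_cring.hom_zero[OF ring_hom_cring.intro[OF nr_cring nr_cring ring_hom_cring_axioms.intro[OF restr_hom]]] that by blast
 have g: "mod_sheaf_hom X U (free_sheaf X 0) (free_sheaf X n) g" unfolding mod_sheaf_hom_def semilinear_def g_def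
  by(auto simp: shf_sel z rz fun_eq_iff restrict_def split: if_splits)
 have hh: "mod_sheaf_hom X U (free_sheaf X n) Fs h" unfolding mod_sheaf_hom_def semilinear_def
 proof (intro allI impI conjI ballI, goal_cases)
  case (1 V)
  show ?case
  proof (rule funcsetI)
   fix s assume s: "s : cr (Sec (free_sheaf X n) V)"
   show "h V s : cr (Sec Fs V)"
   proof (cases "V = {}")
    case False
    obtain c where c: "ALL i<n. c i : sec Ox V & s i = tu V (c i)" using rep[of V s] 1 s False by(auto simp: shf_sel)
    thus ?thesis using h_eq[of V c s] s_mem[of V c] 1 False by(auto simp: Fs_sel)
   qed (simp add: h_def Fs_sel)
  qed
 next
  case (2 V s t)
  show ?case
  proof (cases "V = {}")
   case False
   hence V: "oin T V" "V ~= {}" "V [= U" using 2 by auto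
   interpret A: nmod "SX V" "sec Ox V" N "tu V" "Sec Fs V" "sec M V" cd by(rule r_mod[OF Fs_realizes V(1,2)])
   obtain c d where c: "ALL i<n. c i : sec Ox V & s i = tu V (c i)" "ALL i<n. d i : sec Ox V & t i = tu V (d i)"
    using rep[OF V(1,2), of s] rep[OF V(1,2), of t] 2 unfolding shf_sel by blast
   have m: "(\<Sum>i<n. c i * b i) : sec M V" "(\<Sum>i<n. d i * b i) : sec M V" by(rule s_mem[OF V], use c in blast)+
   have "h V (s +[Sec (free_sheaf X n) V] t) = cd (\<Sum>i<n. (c i + d i) * b i)"
    using c osrD(4)[OF A.A] by(intro h_eq V) (auto simp: shf_sel A.tau_add)
   thus ?thesis using h_eq[OF V, of c s] h_eq[OF V, of d t] A.sig_add[OF m] c by(simp add: distrib_right sum.distrib)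
  qed (simp add: h_def Fs_sel)
 next
  case (3 V r s)
  show ?case
  proof (cases "V = {}")
   case False
   hence V: "oin T V" "V ~= {}" "V [= U" using 3 by auto
   interpret A: nmod "SX V" "sec Ox V" N "tu V" "Sec Fs V" "sec M V" cd by(rule r_mod[OF Fs_realizes V(1,2)])
   obtain c where c: "ALL i<n. c i : sec Ox V & s i = tu V (c i)" using rep[OF V(1,2), of s] 3 unfolding shf_sel by blast
   obtain a where a: "a : sec Ox V" "tu V a = r" using A.tau_surj[of r] 3 by blast
   have m: "(\<Sum>i<n. c i * b i) : sec M V" by(rule s_mem[OF V]) (use c in blast)
   have "h V (r #[Sec (free_sheaf X n) V] s) = cd (\<Sum>i<n. (a * c i) * b i)"
    using c a osrD(5)[OF A.A] by(intro h_eq V) (auto simp: shf_sel A.tau_mult)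
   thus ?thesis using h_eq[OF V, of c s] A.sig_smult[OF a(1) m] c a by(simp add: sum_distrib_left mult.assoc)
  qed (simp add: h_def Fs_sel)
 next
  case (4 V W s)
  show ?case
  proof (cases "W = {}")
   case False
   hence V: "oin T V" "V ~= {}" "V [= U" and W: "oin T W" "W ~= {}" "W [= V" "W [= U" using 4 by auto
   obtain c where c: "ALL i<n. c i : sec Ox V & s i = tu V (c i)" using rep[OF V(1,2), of s] 4 unfolding shf_sel by blast
   have "h W (restr (free_sheaf X n) V W s) = cd (\<Sum>i<n. c i * b i)"
    using c tau_restr[OF V(1) W(1-3)] sec_mono[OF W(3), of _ Ox] by(intro h_eq W) (auto simp: shf_sel)
   thus ?thesis using h_eq[OF V, of c s] c W by(simp add: Fs_sel)
  qed (simp add: h_def Fs_sel)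
 qed
 show "EX U m n g h. oin T U & x : U & mod_sheaf_hom X U (free_sheaf X m) (free_sheaf X n) g & mod_sheaf_hom X U (free_sheaf X n) Fs h &
    (ALL V. oin T V & V [= U --> (ALL t:cr (Sec Fs V). in_image_sheaf X (free_sheaf X n) Fs h V t) & (ALL s:cr (Sec (free_sheaf X n) V).
       h V s = 0[Sec Fs V] \<longleftrightarrow> in_image_sheaf X (free_sheaf X m) (free_sheaf X n) g V s))"
 proof (rule exI[of _ U], rule exI[of _ 0], rule exI[of _ n], rule exI[of _ g], rule exI[of _ h], intro conjI allI impI ballI U g hh, goal_cases)
  case (1 V t)
  show ?case
  proof (cases "V = {}")
   case False
   hence V: "oin T V" "V ~= {}" "V [= U" using 1 by auto
   obtain w where w: "w : sec M V" "t = cd w" using 1(2) V by(auto simp: Fs_sel)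
   have "sec M V = fspan N (sec Ox V) B" unfolding framed_sec[OF V(1,2) oV[OF V(3)]]
    by(rule fspan_ospan[symmetric, OF fr_atD(1)[OF fr] osr_sec[OF V(1)] N N_sec[OF V(1)]])
   then obtain c where c: "ALL b:B. c b : sec Ox V" "w - (SUM b:B. c b * b) : N" using w(1) unfolding fspan_def by blast
   have e: "(SUM b:B. c b * b) = (\<Sum>i<n. c (b i) * b i)" using sum.reindex_bij_betw[OF b, of "%b. c b * b"] by simp
   let ?s = "\<lambda>i\<in>{..<n}. tu V (c (b i))"
   have "?s : cr (Sec (free_sheaf X n) V)" using c bB tau_cl[OF V(1,2)] by(auto simp: shf_sel)
   moreover have "h V ?s = cd (\<Sum>i<n. c (b i) * b i)" using c bB by(intro h_eq V) auto
   moreover have "cd (\<Sum>i<n. c (b i) * b i) = t"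
    using c w s_mem[OF V, of "%i. c (b i)"] bB c_sym[OF N c(2)] unfolding w(2) e by(subst cd[OF V(1,2)]) auto
   ultimately show ?thesis unfolding in_image_sheaf_def using V by(intro ballI exI[of _ V]) (auto simp: Fs_sel intro!: image_eqI[of _ _ ?s])
  qed (simp add: in_image_sheaf_def)
 next
  case (2 V s)
  show ?case
  proof (cases "V = {}")
   case False
   hence V: "oin T V" "V ~= {}" "V [= U" using 2 by auto
   interpret A: nmod "SX V" "sec Ox V" N "tu V" "Sec Fs V" "sec M V" cd by(rule r_mod[OF Fs_realizes V(1,2)])
   have sE: "s : {..<n} \<rightarrow>\<^sub>E cr (SX V)" using 2(2) by(simp add: shf_sel)
   obtain c where c: "ALL i<n. c i : sec Ox V & s i = tu V (c i)" using rep[OF V(1,2) sE] by blast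
   have s0: "(ALL i<n. s i = 0[SX V]) \<longleftrightarrow> (ALL i<n. c i : N)" using c A.tau_ker by auto
   have "h V s = 0[Sec Fs V] \<longleftrightarrow> (\<Sum>i<n. c i * b i) : N" using h_eq[OF V, of c s] A.sig_ker[OF s_mem[OF V, of c]] c by simp
   also have "\<dots> \<longleftrightarrow> (ALL i<n. c i : N)"
   proof
    assume sN: "(\<Sum>i<n. c i * b i) : N"
    define c' where "c' = c \<circ> the_inv_into {..<n} b"
    have c': "c' (b i) = c i" if "i < n" for i using the_inv_into_f_f[of b "{..<n}" i] b that by(auto simp: c'_def bij_betw_def)
    have "(SUM x:B. c' x * x) = (\<Sum>i<n. c i * b i)" using sum.reindex_bij_betw[OF b, of "%b. c' b * b"] c' by simp
    moreover have "c' x : K" if x: "x : B" for x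
    proof -
     obtain i where i: "i < n" "x = b i" using b x by(auto simp: bij_betw_def)
     obtain y where "y : V" using V by blast
     hence "c i : K" using c i(1) OxK[OF sub_top[OF V(1)], of y] by(auto simp: sec_def)
     thus ?thesis using c' i by simp
    qed
    ultimately have "ALL x:B. c' x : N" using fr_atD(3)[OF fr, of c'] sN by auto
    thus "ALL i<n. c i : N" using c' bB by metis
   next
    assume "ALL i<n. c i : N"
    thus "(\<Sum>i<n. c i * b i) : N" using osubD(3)[OF N UNIV_I] by(intro osub_sum[OF N]) (metis lessThan_iff mult.commute)
   qed
   also have "\<dots> \<longleftrightarrow> in_image_sheaf X (free_sheaf X 0) (free_sheaf X n) g V s"
   proof
    assume "ALL i<n. c i : N"
    hence "s = (\<lambda>i\<in>{..<n}. 0[SX V])" using s0 sE by(auto simp: fun_eq_iff PiE_def extensional_def)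
    hence "restr (free_sheaf X n) V V s : g V ` cr (Sec (free_sheaf X 0) V)"
     using rz[OF V(1) V(1)] by(auto simp: shf_sel g_def fun_eq_iff restrict_def)
    thus "in_image_sheaf X (free_sheaf X 0) (free_sheaf X n) g V s" unfolding in_image_sheaf_def using V by blast
   next
    assume im: "in_image_sheaf X (free_sheaf X 0) (free_sheaf X n) g V s"
    obtain y where y: "y : V" using V by blast
    obtain W where W: "oin T W" "y : W" "W [= V" "restr (free_sheaf X n) V W s : g W ` cr (Sec (free_sheaf X 0) W)"
     using bspec[OF im[unfolded in_image_sheaf_def] y] by(elim exE conjE)
    have W0: "W ~= {}" using W by auto
    interpret B: nring "SX W" "sec Ox W" N "tu W" by(rule nr[OF W(1) W0])
    have R: "restr (free_sheaf X n) V W s = (\<lambda>i\<in>{..<n}. 0[SX W])" using W(4) by(auto simp: g_def)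
    have r: "restr OX V W (s i) = 0[SX W]" if "i < n" for i using that fun_cong[OF R, of i] by(simp add: shf_sel)
    show "ALL i<n. c i : N"
    proof (intro allI impI)
     fix i assume i: "i < n"
     hence ci: "c i : sec Ox V" "s i = tu V (c i)" using c by auto
     have "tu W (c i) = 0[SX W]" using tau_restr[OF V(1) W(1) W0 W(3) ci(1)] r[OF i] ci(2) by simp
     thus "c i : N" using B.tau_ker[OF sec_mono[OF W(3) ci(1)]] by simp
    qed
   qed
   finally show ?thesis .
  qed (simp add: h_def Fs_sel in_image_sheaf_def)
 qed
qed

end

section \<open>Lattices of line bundles and vector bundles, from one trivialisation\<close>

section \<open>Lattices of locally free sheaves\<close>

context names
begin

lemma nm_fun: assumes sh: "is_sheaf T P" and U: "oin T U" "U ~= {}" and t: "NM U w t" "NM U w t'" shows "t = t'"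
proof -
 define C where "C = {V. oin T V & V [= U & restr P U V t = restr P U V t'}"
 have "EX V:C. x : V" if "x : U" for x using nm_inj[OF U(1) U(1) t, of x] that unfolding C_def by auto
 hence e: "\<Union>C = U" unfolding C_def by blast
 have "ALL V:C. oin T V" by(simp add: C_def)
 moreover have "ALL V:C. restr P (\<Union>C) V t = restr P (\<Union>C) V t'" unfolding e by(simp add: C_def)
 moreover have "t : cr (Sec P (\<Union>C))" "t' : cr (Sec P (\<Union>C))" unfolding e using nm_closed[OF U] t by auto
 ultimately show ?thesis using conjunct1[OF conjunct2[OF sh[unfolded is_sheaf_def]]] by blast
qed

lemma nm_glue: assumes sh: "is_sheaf T P" and U: "oin T U" "U ~= {}" and w: "w : sec M U" shows "EX t. NM U w t"
proof -
 define C where "C = {V. oin T V & V ~= {} & V [= U & (EX t. NM V w t)}"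
 define s where "s V = (SOME t. NM V w t)" for V
 have C: "oin T V" "V ~= {}" "V [= U" if "V : C" for V using that unfolding C_def by blast+
 have s: "NM V w (s V)" if "V : C" for V using that someI_ex[of "NM V w"] unfolding C_def s_def by blast
 have "EX V:C. x : V" if x: "x : U" for x
 proof -
  obtain V t where V: "oin T V" "x : V" "NM V w t" using M_iff[OF sub_top[OF U(1) x]] secD[OF w x] by auto
  have I: "oin T (U Int V)" "U Int V ~= {}" "x : U Int V" using U V x by auto
  have "NM (U Int V) w (restr P V (U Int V) t)" by(rule nm_restr[OF V(1) I(1,2) _ V(3)]) simp
  hence "U Int V : C" unfolding C_def using I by blast
  thus ?thesis using I by blast
 qed
 hence e: "\<Union>C = U" using C by blast
 have ag: "restr P V (V Int V') (s V) = restr P V' (V Int V') (s V')" if V: "V : C" "V' : C" for V V'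
 proof -
  have I: "oin T (V Int V')" "V Int V' ~= {}" using irr C V by auto
  have "NM (V Int V') w (restr P V (V Int V') (s V))" by(rule nm_restr[OF C(1)[OF V(1)] I _ s[OF V(1)]]) simp
  moreover have "NM (V Int V') w (restr P V' (V Int V') (s V'))" by(rule nm_restr[OF C(1)[OF V(2)] I _ s[OF V(2)]]) simp
  ultimately show ?thesis by(rule nm_fun[OF sh I])
 qed
 have "(ALL V:C. oin T V & s V : cr (Sec P V)) & (ALL V:C. ALL V':C. restr P V (V Int V') (s V) = restr P V' (V Int V') (s V'))"
  using ag C nm_closed[OF _ _ s] by auto
 hence "EX t:cr (Sec P (\<Union>C)). ALL V:C. restr P (\<Union>C) V t = s V" using conjunct2[OF conjunct2[OF sh[unfolded is_sheaf_def]]] by blast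
 then obtain t where t: "t : cr (Sec P U)" "!!V. V : C ==> restr P U V t = s V" unfolding e by blast
 obtain w' where w': "NM U w' t" using nm_ex[OF U t(1)] by blast
 obtain V where V: "V : C" using e U by blast
 have "NM V w' (s V)" using nm_restr[OF U(1) C(1,2,3)[OF V] w'] t(2)[OF V] by simp
 hence "w - w' : N" using nm_uniq[OF C(1,2)[OF V]] s[OF V] by blast
 thus ?thesis using nm_cong[OF U w'] by blast
qed

text \<open>For a sheaf, sections with the same name over small sets glue (\<open>nm_glue\<close>),
  and a name determines its section (\<open>nm_fun\<close>), so the relation \<open>NM\<close>
  becomes a function.\<close>

theorem sheaf_realizes: assumes sh: "is_sheaf T P" shows "realizes P (%U w. SOME t. NM U w t) M"
proof -
 define si where "si U w = (SOME t. NM U w t)" for U w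
 have s: "NM U w (si U w)" if "oin T U" "U ~= {}" "w : sec M U" for U w using someI_ex[OF nm_glue[OF sh that]] by(simp add: si_def)
 have e: "si U w = t" "w : sec M U" if "oin T U" "U ~= {}" "NM U w t" for U w t
 proof -
  show m: "w : sec M U" unfolding sec_def using M_I[OF that(1) _ that(3)] by blast
  show "si U w = t" by(rule nm_fun[OF sh that(1,2) s[OF that(1,2) m] that(3)])
 qed
 have "realizes P si M" unfolding realizes_def
 proof (intro conjI allI impI, goal_cases)
  case (1 U)
  hence U: "oin T U" "U ~= {}" by auto
  interpret R: nring "SX U" "sec Ox U" N "tu U" by(rule nr[OF U])
  show ?case
  proof (unfold_locales, goal_cases)
   case 1
   thus ?case using osubD[OF M_osub[OF sub_top[OF U(1)]]] unfolding osub_def sec_def by blast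
  next
   case 2
   thus ?case using M_N[OF sub_top[OF U(1)]] unfolding sec_def by blast
  next
   case (3 w)
   show ?case using nm_closed[OF U s[OF U 3]] .
  next
   case (4 t)
   thus ?case using nm_ex[OF U 4] e[OF U] by blast
  next
   case (5 v w)
   thus ?case using e(1)[OF U nm_add[OF U s[OF U 5(1)] s[OF U 5(2)]]] by simp
  next
   case (6 a w)
   thus ?case using e(1)[OF U nm_smult[OF U 6(1) s[OF U 6(2)]]] by simp
  next
   case (7 w)
   show ?case
   proof
    assume "si U w = 0[Sec P U]"
    thus "w : N" using nm_uniq[OF U s[OF U 7], of 0] nm_zero[OF U] by simp
   next
    assume "w : N"
    thus "si U w = 0[Sec P U]" using e(1)[OF U nm_cong[OF U nm_zero[OF U]]] by simp
   qed
  qed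
 next
  case (2 U V w)
  hence "U ~= {}" by auto
  hence "NM V w (restr P U V (si U w))" using nm_restr[of U V w] s[of U w] 2 by blast
  thus ?case using e(1)[of V w] 2 by simp
 qed
 thus ?thesis by(simp add: si_def[abs_def])
qed

end

text \<open>One trivialisation \<open>h0\<close> on a non-empty open set \<open>U0\<close> is fixed,
  and every section is named through its coordinates on the intersection with \<open>U0\<close>. The
  independent elements \<open>\<beta>\<close> turn a coordinate vector into an element of
  \<open>'w\<close>: 1 for line bundles, variables for vector bundles.\<close>

locale lfree = gmodel X K N Ox tu for X :: "('p, 'r, 'z) ringed_space_scheme" and K N :: "'w::comm_ring_1 set" and Ox and tu +
 fixes F :: "('p, 'r, 'm) mod_presheaf" and n :: nat and \<beta> :: "nat => 'w" and U0 :: "'p set" and h0 :: "'p set => (nat => 'r) => 'm"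
 assumes lf: "locally_free X n F" and K_open: "a : K ==> EX U. oin T U & U ~= {} & a : sec Ox U"
  and \<beta>: "(!!i. i < n ==> c i : K) ==> (\<Sum>i<n. c i * \<beta> i) : N ==> i < n ==> c i : N" and U0_ne: "U0 ~= {}"
  and triv0: "oin T U0 & mod_sheaf_hom X U0 (free_sheaf X n) F h0 & (ALL V. oin T V & V [= U0 -->
     bij_betw (h0 V) (cr (Sec (free_sheaf X n) V)) (cr (Sec F V)))"
begin

definition triv :: "'p set => ('p set => (nat => 'r) => 'm) => bool" where
 "triv U h \<longleftrightarrow> oin T U & mod_sheaf_hom X U (free_sheaf X n) F h & (ALL V. oin T V & V [= U -->
     bij_betw (h V) (cr (Sec (free_sheaf X n) V)) (cr (Sec F V)))"

definition tup :: "'p set => (nat => 'w) => nat => 'r" where "tup V c = (\<lambda>i\<in>{..<n}. tu V (c i))"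

lemma F_mod_sheaf: "mod_sheaf X F" using lf by(simp add: locally_free_def)

lemma F_sheaf: "is_sheaf T F" using F_mod_sheaf by(simp add: mod_sheaf_def)

lemma fs_sel: "cr (Sec (free_sheaf X n) U) = {..<n} \<rightarrow>\<^sub>E cr (SX U)"
 "f +[Sec (free_sheaf X n) U] g = (\<lambda>i\<in>{..<n}. f i +[SX U] g i)" "r #[Sec (free_sheaf X n) U] f = (\<lambda>i\<in>{..<n}. r *[SX U] f i)"
 "restr (free_sheaf X n) U V f = (\<lambda>i\<in>{..<n}. restr OX U V (f i))" by(simp_all add: free_sheaf_def Let_def)

lemma F_restr: assumes "oin T U" "oin T V" "V [= U" shows "s : cr (Sec F U) ==> restr F U V s : cr (Sec F V)"
  "oin T W ==> W [= V ==> s : cr (Sec F U) ==> restr F V W (restr F U V s) = restr F U W s" "s : cr (Sec F U) ==> t : cr (Sec F U) ==>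
   restr F U V (s +[Sec F U] t) = restr F U V s +[Sec F V] restr F U V t" "r : cr (SX U) ==> s : cr (Sec F U) ==>
   restr F U V (r #[Sec F U] s) = restr OX U V r #[Sec F V] restr F U V s"
proof -
 have p: "is_presheaf T F" using F_sheaf by(simp add: is_sheaf_def)
 have l: "semilinear (SX U) (restr OX U V) (Sec F U) (Sec F V) (restr F U V)" using F_mod_sheaf assms by(simp add: mod_sheaf_def)
 show "s : cr (Sec F U) ==> restr F U V s : cr (Sec F V)" using l unfolding semilinear_def by blast
 show "oin T W ==> W [= V ==> s : cr (Sec F U) ==> restr F V W (restr F U V s) = restr F U W s" using p assms unfolding is_presheaf_def by blast
 show "s : cr (Sec F U) ==> t : cr (Sec F U) ==> restr F U V (s +[Sec F U] t) = restr F U V s +[Sec F V] restr F U V t"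
  using l unfolding semilinear_def by blast
 show "r : cr (SX U) ==> s : cr (Sec F U) ==> restr F U V (r #[Sec F U] s) = restr OX U V r #[Sec F V] restr F U V s"
  using l unfolding semilinear_def by blast
qed

lemma tup_closed: "oin T V ==> V ~= {} ==> (ALL i<n. c i : sec Ox V) ==> tup V c : cr (Sec (free_sheaf X n) V)"
 using tau_cl[of V] by(auto simp: tup_def fs_sel)

context fixes U h V assumes tr: "triv U h" and V: "oin T V" "V ~= {}" "V [= U"
begin

lemma triv_lin: "semilinear (SX V) id (Sec (free_sheaf X n) V) (Sec F V) (h V)" using tr V unfolding triv_def mod_sheaf_hom_def by blast

lemma triv_bij: "bij_betw (h V) (cr (Sec (free_sheaf X n) V)) (cr (Sec F V))" using tr V unfolding triv_def by blast

lemma triv_closed: "(ALL i<n. c i : sec Ox V) ==> h V (tup V c) : cr (Sec F V)" using triv_bij tup_closed[OF V(1,2), of c] by(auto simp: bij_betw_def)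

lemma triv_surj: assumes s: "s : cr (Sec F V)" shows "EX c. (ALL i<n. c i : sec Ox V) & s = h V (tup V c)"
proof -
 obtain f where f: "f : {..<n} \<rightarrow>\<^sub>E cr (SX V)" "s = h V f" using triv_bij s unfolding bij_betw_def fs_sel by blast
 have "EX c. c : sec Ox V & f i = tu V c" if "i < n" for i using nring.tau_surj[OF nr[OF V(1,2)], of "f i"] PiE_mem[OF f(1), of i] that by auto
 then obtain c where c: "ALL i<n. c i : sec Ox V & f i = tu V (c i)" by metis
 hence "f = tup V c" using f(1) by(auto simp: tup_def fun_eq_iff PiE_def extensional_def)
 thus ?thesis using c f(2) by blast
qed

lemma triv_inj: assumes c: "ALL i<n. c i : sec Ox V" "ALL i<n. d i : sec Ox V"
 shows "h V (tup V c) = h V (tup V d) \<longleftrightarrow> (ALL i<n. c i - d i : N)"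
proof -
 have "h V (tup V c) = h V (tup V d) \<longleftrightarrow> tup V c = tup V d"
  using inj_on_eq_iff[OF bij_betw_imp_inj_on[OF triv_bij] tup_closed[OF V(1,2)] tup_closed[OF V(1,2)]] c by blast
 also have "\<dots> \<longleftrightarrow> (ALL i<n. tu V (c i) = tu V (d i))"
 proof
  assume "tup V c = tup V d"
  thus "ALL i<n. tu V (c i) = tu V (d i)" unfolding tup_def by(metis lessThan_iff restrict_apply')
 qed (auto simp: tup_def)
 also have "\<dots> \<longleftrightarrow> (ALL i<n. c i - d i : N)" using tau_eq[OF V(1,2)] c by blast
 finally show ?thesis .
qed

lemma triv_add: assumes c: "ALL i<n. c i : sec Ox V" "ALL i<n. d i : sec Ox V"
 shows "h V (tup V (%i. c i + d i)) = h V (tup V c) +[Sec F V] h V (tup V d)"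
proof -
 interpret R: nring "SX V" "sec Ox V" N "tu V" by(rule nr[OF V(1,2)])
 have "tup V (%i. c i + d i) = tup V c +[Sec (free_sheaf X n) V] tup V d" using c by(auto simp: fs_sel tup_def fun_eq_iff R.tau_add)
 thus ?thesis using triv_lin tup_closed[OF V(1,2), of c] tup_closed[OF V(1,2), of d] c unfolding semilinear_def by simp
qed

lemma triv_smult: assumes c: "ALL i<n. c i : sec Ox V" and a: "a : sec Ox V" shows "h V (tup V (%i. a * c i)) = tu V a #[Sec F V] h V (tup V c)"
proof -
 interpret R: nring "SX V" "sec Ox V" N "tu V" by(rule nr[OF V(1,2)])
 have "tup V (%i. a * c i) = tu V a #[Sec (free_sheaf X n) V] tup V c" using c a by(auto simp: fs_sel tup_def fun_eq_iff R.tau_mult)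
 thus ?thesis using triv_lin tup_closed[OF V(1,2), of c] c R.tau_cl[OF a] unfolding semilinear_def by simp
qed

lemma triv_restr: assumes c: "ALL i<n. c i : sec Ox V" and W: "oin T W" "W ~= {}" "W [= V" shows "restr F V W (h V (tup V c)) = h W (tup W c)"
proof -
 have WU: "W [= U" using W V by blast
 have "restr F V W (h V (tup V c)) = h W (restr (free_sheaf X n) V W (tup V c))"
  using tr V W WU tup_closed[OF V(1,2), of c] c unfolding triv_def mod_sheaf_hom_def by metis
 moreover have "restr (free_sheaf X n) V W (tup V c) = tup W c" using tau_restr[OF V(1) W] c by(auto simp: fs_sel tup_def fun_eq_iff)
 ultimately show ?thesis by simp
qed

end

text \<open>Locally the sheaf is free, and coordinates that agree on a smaller non-empty set agree
  on the larger one, because congruence modulo \<open>N\<close> does not depend on the set. The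
  separation axiom makes this global.\<close>

lemma res_inj: assumes U: "oin T U" and V: "oin T V" "V ~= {}" "V [= U"
  and s: "s : cr (Sec F U)" "t : cr (Sec F U)" and e: "restr F U V s = restr F U V t" shows "s = t"
proof -
 define C where "C = {W. oin T W & W [= U & restr F U W s = restr F U W t}"
 have "EX W:C. x : W" if x: "x : U" for x
 proof -
  obtain U1 h where tr: "triv U1 h" "x : U1" using lf sub_top[OF U x] unfolding locally_free_def triv_def by blast
  have o1: "oin T U1" using tr by(simp add: triv_def)
  have W: "oin T (U Int U1)" "U Int U1 ~= {}" "U Int U1 [= U1" "U Int U1 [= U" using U o1 x tr by auto
  let ?W = "U Int U1 Int V"
  have W': "oin T ?W" "?W ~= {}" "?W [= U Int U1" "?W [= V" "?W [= U" using irr[OF W(1) V(1) W(2) V(2)] W(1) V by auto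
  have cl: "restr F U (U Int U1) s : cr (Sec F (U Int U1))" "restr F U (U Int U1) t : cr (Sec F (U Int U1))" using F_restr(1)[OF U W(1,4)] s by auto
  obtain c where c: "ALL i<n. c i : sec Ox (U Int U1)" "restr F U (U Int U1) s = h (U Int U1) (tup (U Int U1) c)"
   using triv_surj[OF tr(1) W(1-3) cl(1)] by blast
  obtain d where d: "ALL i<n. d i : sec Ox (U Int U1)" "restr F U (U Int U1) t = h (U Int U1) (tup (U Int U1) d)"
   using triv_surj[OF tr(1) W(1-3) cl(2)] by blast
  have "restr F U ?W s = restr F U ?W t" using F_restr(2)[OF U V(1,3) W'(1,4) s(1)] F_restr(2)[OF U V(1,3) W'(1,4) s(2)] e by simp
  hence "h ?W (tup ?W c) = h ?W (tup ?W d)" using F_restr(2)[OF U W(1,4) W'(1,3) s(1)] F_restr(2)[OF U W(1,4) W'(1,3) s(2)]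
    triv_restr[OF tr(1) W(1-3) c(1) W'(1-3)] triv_restr[OF tr(1) W(1-3) d(1) W'(1-3)] c(2) d(2) by simp
  hence "ALL i<n. c i - d i : N" using triv_inj[OF tr(1) W'(1,2), of c d] W'(3) c(1) d(1) by(auto intro: sec_mono)
  hence "restr F U (U Int U1) s = restr F U (U Int U1) t" using triv_inj[OF tr(1) W(1-3) c(1) d(1)] c(2) d(2) by simp
  hence "U Int U1 : C" using W by(simp add: C_def)
  thus ?thesis using x tr(2) by blast
 qed
 hence eq: "\<Union>C = U" unfolding C_def by blast
 have "ALL V:C. oin T V" by(simp add: C_def)
 moreover have "ALL V:C. restr F (\<Union>C) V s = restr F (\<Union>C) V t" unfolding eq by(simp add: C_def)
 moreover have "s : cr (Sec F (\<Union>C))" "t : cr (Sec F (\<Union>C))" unfolding eq using s by auto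
 ultimately show ?thesis using conjunct1[OF conjunct2[OF F_sheaf[unfolded is_sheaf_def]]] by blast
qed

definition NM :: "'p set => 'w => 'm => bool" where "NM U w s \<longleftrightarrow> s : cr (Sec F U) & (EX c. (ALL i<n. c i : sec Ox (U Int U0)) &
  w - (\<Sum>i<n. c i * \<beta> i) : N & restr F U (U Int U0) s = h0 (U Int U0) (tup (U Int U0) c))"

definition M :: "'p => 'w set" where "M x = {w. EX U s. oin T U & x : U & NM U w s}"

lemma NM_E: assumes "NM U w s" obtains c where "ALL i<n. c i : sec Ox (U Int U0)" "w - (\<Sum>i<n. c i * \<beta> i) : N"
  "restr F U (U Int U0) s = h0 (U Int U0) (tup (U Int U0) c)" "s : cr (Sec F U)" using assms unfolding NM_def by blast

lemma NM_I: assumes "ALL i<n. c i : sec Ox (U Int U0)" "w - (\<Sum>i<n. c i * \<beta> i) : N"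
  "restr F U (U Int U0) s = h0 (U Int U0) (tup (U Int U0) c)" "s : cr (Sec F U)" shows "NM U w s" using assms unfolding NM_def by blast

lemma tr0: "triv U0 h0" using triv0 by(simp add: triv_def)

lemma U0_int: assumes "oin T U" "U ~= {}" shows "oin T (U Int U0)" "U Int U0 ~= {}" "U Int U0 [= U0" "U Int U0 [= U"
 using irr[of U U0] U0_ne triv0 assms by auto

lemma \<beta>_eq: assumes U: "oin T U" "U ~= {}" and c: "ALL i<n. c i : sec Ox U" "ALL i<n. d i : sec Ox U"
  and e: "(\<Sum>i<n. c i * \<beta> i) - (\<Sum>i<n. d i * \<beta> i) : N" and i: "i < n" shows "c i - d i : N"
proof -
 obtain x where x: "x : U" using U by blast
 have "(\<Sum>i<n. (c i - d i) * \<beta> i) : N" using e by(simp add: left_diff_distrib sum_subtractf)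
 moreover have "c i - d i : K" if "i < n" for i
  using secD[OF c(1)[rule_format, OF that] x] secD[OF c(2)[rule_format, OF that] x] OxK[OF sub_top[OF U(1) x]] by(intro osrD(7)[OF K]) auto
 ultimately show ?thesis using \<beta>[of "%i. c i - d i" i] i by blast
qed

lemma NM_eq: assumes U: "oin T U" "U ~= {}" and s: "NM U w s" "NM U w' t" shows "s = t \<longleftrightarrow> w - w' : N"
proof -
 obtain c where c: "ALL i<n. c i : sec Ox (U Int U0)" "w - (\<Sum>i<n. c i * \<beta> i) : N"
  "restr F U (U Int U0) s = h0 (U Int U0) (tup (U Int U0) c)" "s : cr (Sec F U)" using NM_E[OF s(1)] by blast
 obtain d where d: "ALL i<n. d i : sec Ox (U Int U0)" "w' - (\<Sum>i<n. d i * \<beta> i) : N"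
  "restr F U (U Int U0) t = h0 (U Int U0) (tup (U Int U0) d)" "t : cr (Sec F U)" using NM_E[OF s(2)] by blast
 note I = U0_int[OF U]
 have "s = t \<longleftrightarrow> restr F U (U Int U0) s = restr F U (U Int U0) t" using res_inj[OF U(1) I(1,2,4) c(4) d(4)] by blast
 also have "\<dots> \<longleftrightarrow> (ALL i<n. c i - d i : N)" unfolding c(3) d(3) by(rule triv_inj[OF tr0 I(1-3) c(1) d(1)])
 also have "\<dots> \<longleftrightarrow> (\<Sum>i<n. c i * \<beta> i) - (\<Sum>i<n. d i * \<beta> i) : N"
 proof
  assume "ALL i<n. c i - d i : N"
  thus "(\<Sum>i<n. c i * \<beta> i) - (\<Sum>i<n. d i * \<beta> i) : N" by(intro c_sum[OF N] c_mult[OF N _ c_refl[OF N]]) auto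
 next
  assume "(\<Sum>i<n. c i * \<beta> i) - (\<Sum>i<n. d i * \<beta> i) : N"
  thus "ALL i<n. c i - d i : N" using \<beta>_eq[OF I(1,2) c(1) d(1)] by blast
 qed
 also have "\<dots> \<longleftrightarrow> w - w' : N" using c_trans[OF N c_trans[OF N c(2)] c_sym[OF N d(2)]]
   c_trans[OF N c_trans[OF N c_sym[OF N c(2)]] d(2)] by blast
 finally show ?thesis .
qed

lemma F_names: "names X K N Ox tu F NM M"
proof (unfold_locales, goal_cases)
 case (1 U w t)
 thus ?case by(simp add: NM_def)
next
 case (2 U t)
 note I = U0_int[OF 2(1,2)]
 have "restr F U (U Int U0) t : cr (Sec F (U Int U0))" by(rule F_restr(1)[OF 2(1) I(1,4) 2(3)])
 then obtain c where c: "ALL i<n. c i : sec Ox (U Int U0)" "restr F U (U Int U0) t = h0 (U Int U0) (tup (U Int U0) c)"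
  using triv_surj[OF tr0 I(1-3)] by blast
 thus ?case by(intro exI[of _ "\<Sum>i<n. c i * \<beta> i"] NM_I[of c]) (use 2 osubD(1)[OF N] in auto)
next
 case (3 U w t w')
 thus ?case using NM_eq by blast
next
 case (4 U w t w')
 show ?case using 4(3) c_trans[OF N 4(4)] unfolding NM_def by blast
next
 case (5 U w t w' t')
 note I = U0_int[OF 5(1,2)]
 from 5(3) obtain c where c: "ALL i<n. c i : sec Ox (U Int U0)" "w - (\<Sum>i<n. c i * \<beta> i) : N"
  "restr F U (U Int U0) t = h0 (U Int U0) (tup (U Int U0) c)" "t : cr (Sec F U)" using NM_E by blast
 from 5(4) obtain d where d: "ALL i<n. d i : sec Ox (U Int U0)" "w' - (\<Sum>i<n. d i * \<beta> i) : N"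
  "restr F U (U Int U0) t' = h0 (U Int U0) (tup (U Int U0) d)" "t' : cr (Sec F U)" using NM_E by blast
 have m: "module (SX U) (Sec F U)" using F_mod_sheaf 5(1) by(simp add: mod_sheaf_def)
 show ?case
 proof (rule NM_I[of "%i. c i + d i"])
  show "ALL i<n. c i + d i : sec Ox (U Int U0)" using c(1) d(1) osrD(4)[OF osr_sec[OF I(1)]] by blast
  show "w + w' - (\<Sum>i<n. (c i + d i) * \<beta> i) : N" using c_add[OF N c(2) d(2)] by(simp add: distrib_right sum.distrib)
  show "restr F U (U Int U0) (t +[Sec F U] t') = h0 (U Int U0) (tup (U Int U0) (%i. c i + d i))"
   using F_restr(3)[OF 5(1) I(1,4) c(4) d(4)] triv_add[OF tr0 I(1-3) c(1) d(1)] c(3) d(3) by simp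
  show "t +[Sec F U] t' : cr (Sec F U)" using abelian_groupE(1)[OF module.axioms(2)[OF m]] c(4) d(4) by blast
 qed
next
 case (6 U a w t)
 note I = U0_int[OF 6(1,2)]
 from 6(4) obtain c where c: "ALL i<n. c i : sec Ox (U Int U0)" "w - (\<Sum>i<n. c i * \<beta> i) : N"
  "restr F U (U Int U0) t = h0 (U Int U0) (tup (U Int U0) c)" "t : cr (Sec F U)" using NM_E by blast
 have m: "module (SX U) (Sec F U)" using F_mod_sheaf 6(1) by(simp add: mod_sheaf_def)
 have a: "a : sec Ox (U Int U0)" using 6(3) I by(auto intro: sec_mono)
 show ?case
 proof (rule NM_I[of "%i. a * c i"])
  show "ALL i<n. a * c i : sec Ox (U Int U0)" using c(1) a osrD(5)[OF osr_sec[OF I(1)]] by blast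
  show "a * w - (\<Sum>i<n. (a * c i) * \<beta> i) : N" using c_mult[OF N c_refl[OF N] c(2), of a] by(simp add: sum_distrib_left mult.assoc)
  show "restr F U (U Int U0) (tu U a #[Sec F U] t) = h0 (U Int U0) (tup (U Int U0) (%i. a * c i))"
   using F_restr(4)[OF 6(1) I(1,4) tau_cl[OF 6(1-3)] c(4)] triv_smult[OF tr0 I(1-3) c(1) a] c(3) tau_restr[OF 6(1) I(1,2,4) 6(3)] by simp
  show "tu U a #[Sec F U] t : cr (Sec F U)" using module.smult_closed[OF m] tau_cl[OF 6(1-3)] c(4) by blast
 qed
next
 case (7 U)
 hence m: "module (SX U) (Sec F U)" using F_mod_sheaf by(simp add: mod_sheaf_def)
 interpret R: nring "SX U" "sec Ox U" N "tu U" by(rule nr[OF 7])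
 interpret Mm: mrec "SX U" "Sec F U" using m by(rule mrec.intro)
 note I = U0_int[OF 7]
 have 0: "0[Sec F U] : cr (Sec F U)" using Mm.zero_closed .
 have "restr F U (U Int U0) 0[Sec F U] : cr (Sec F (U Int U0))" by(rule F_restr(1)[OF 7(1) I(1,4) 0])
 then obtain c where c: "ALL i<n. c i : sec Ox (U Int U0)" "restr F U (U Int U0) 0[Sec F U] = h0 (U Int U0) (tup (U Int U0) c)"
  using triv_surj[OF tr0 I(1-3)] by blast
 have "tu U 0 #[Sec F U] 0[Sec F U] = 0[Sec F U]" using R.tau_zero Mm.smult_l_null 0 by simp
 hence "restr F U (U Int U0) 0[Sec F U] = tu (U Int U0) 0 #[Sec F (U Int U0)] restr F U (U Int U0) 0[Sec F U]"
  using F_restr(4)[OF 7(1) I(1,4) R.tau_cl[OF osrD(3)[OF R.A]] 0] tau_restr[OF 7(1) I(1,2,4) osrD(3)[OF R.A]] by simp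
 also have "\<dots> = h0 (U Int U0) (tup (U Int U0) (%i. 0 * c i))"
  unfolding c(2) by(rule triv_smult[OF tr0 I(1-3) c(1) osrD(3)[OF osr_sec[OF I(1)]], symmetric])
 finally have e: "restr F U (U Int U0) 0[Sec F U] = h0 (U Int U0) (tup (U Int U0) (%i. 0 * c i))" .
 show ?case by(rule NM_I[OF _ _ e 0]) (use osubD(1)[OF N] osrD(3)[OF osr_sec[OF I(1)]] in auto)
next
 case (8 U V w t)
 hence U: "U ~= {}" by blast
 note I = U0_int[OF 8(1) U] and J = U0_int[OF 8(2,3)]
 from 8(5) obtain c where c: "ALL i<n. c i : sec Ox (U Int U0)" "w - (\<Sum>i<n. c i * \<beta> i) : N"
  "restr F U (U Int U0) t = h0 (U Int U0) (tup (U Int U0) c)" "t : cr (Sec F U)" using NM_E by blast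
 have s: "V Int U0 [= U Int U0" using 8 by blast
 show ?case
 proof (rule NM_I[OF _ c(2)])
  show c': "ALL i<n. c i : sec Ox (V Int U0)" using c(1) s unfolding sec_def by blast
  show "restr F U V t : cr (Sec F V)" by(rule F_restr(1)[OF 8(1,2,4) c(4)])
  have "restr F V (V Int U0) (restr F U V t) = restr F U (V Int U0) t" by(rule F_restr(2)[OF 8(1,2,4) J(1,4) c(4)])
  also have "\<dots> = restr F (U Int U0) (V Int U0) (restr F U (U Int U0) t)" by(rule F_restr(2)[OF 8(1) I(1,4) J(1) s c(4), symmetric])
  finally show "restr F V (V Int U0) (restr F U V t) = h0 (V Int U0) (tup (V Int U0) c)" using triv_restr[OF tr0 I(1-3) c(1) J(1,2) s] c(3) by simp
 qed
next
 case (9 U U' w t t' x)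
 hence I: "oin T (U Int U')" "U Int U' ~= {}" "U Int U' [= U" "U Int U' [= U'" and ne: "U ~= {}" "U' ~= {}" by auto
 let ?V = "U Int U'"
 note J = U0_int[OF I(1,2)] and JU = U0_int[OF 9(1) ne(1)] and JU' = U0_int[OF 9(2) ne(2)]
 from 9(3) obtain c where c: "ALL i<n. c i : sec Ox (U Int U0)" "w - (\<Sum>i<n. c i * \<beta> i) : N"
  "restr F U (U Int U0) t = h0 (U Int U0) (tup (U Int U0) c)" "t : cr (Sec F U)" using NM_E by blast
 from 9(4) obtain d where d: "ALL i<n. d i : sec Ox (U' Int U0)" "w - (\<Sum>i<n. d i * \<beta> i) : N"
  "restr F U' (U' Int U0) t' = h0 (U' Int U0) (tup (U' Int U0) d)" "t' : cr (Sec F U')" using NM_E by blast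
 have s: "?V Int U0 [= U Int U0" "?V Int U0 [= U' Int U0" by auto
 have e: "restr F ?V (?V Int U0) (restr F U ?V t) = h0 (?V Int U0) (tup (?V Int U0) c)"
  using F_restr(2)[OF 9(1) I(1,3) J(1,4) c(4)] F_restr(2)[OF 9(1) JU(1,4) J(1) s(1) c(4)] triv_restr[OF tr0 JU(1-3) c(1) J(1,2) s(1)] c(3) by simp
 have e': "restr F ?V (?V Int U0) (restr F U' ?V t') = h0 (?V Int U0) (tup (?V Int U0) d)"
  using F_restr(2)[OF 9(2) I(1,4) J(1,4) d(4)] F_restr(2)[OF 9(2) JU'(1,4) J(1) s(2) d(4)] triv_restr[OF tr0 JU'(1-3) d(1) J(1,2) s(2)] d(3) by simp
 have cV: "ALL i<n. c i : sec Ox (?V Int U0)" "ALL i<n. d i : sec Ox (?V Int U0)" using c(1) d(1) s unfolding sec_def by blast+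
 have "NM ?V w (restr F U ?V t)" by(rule NM_I[OF cV(1) c(2) e F_restr(1)[OF 9(1) I(1,3) c(4)]])
 moreover have "NM ?V w (restr F U' ?V t')" by(rule NM_I[OF cV(2) d(2) e' F_restr(1)[OF 9(2) I(1,4) d(4)]])
 ultimately have "restr F U ?V t = restr F U' ?V t'" using NM_eq[OF I(1,2)] c_refl[OF N, of w] by blast
 thus ?case using I 9(5) by blast
next
 case (10 x w)
 thus ?case by(simp add: M_def)
qed

end

lemma fspan_reindex: assumes "inj_on b {..<n::nat}"
 shows "w : fspan N A (b ` {..<n}) \<longleftrightarrow> (EX d. (ALL j<n. d j : A) & w - (\<Sum>j<n. d j * b j) : N)"
proof
 assume "w : fspan N A (b ` {..<n})"
 then obtain c where "ALL j<n. c (b j) : A" "w - (SUM x:b ` {..<n}. c x * x) : N" unfolding fspan_def by auto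
 thus "EX d. (ALL j<n. d j : A) & w - (\<Sum>j<n. d j * b j) : N" by(intro exI[of _ "c \<circ> b"]) (simp add: sum.reindex[OF assms])
next
 assume "EX d. (ALL j<n. d j : A) & w - (\<Sum>j<n. d j * b j) : N"
 then obtain d where d: "ALL j<n. d j : A" "w - (\<Sum>j<n. d j * b j) : N" by blast
 have i: "the_inv_into {..<n} b (b j) = j" if "j < n" for j using the_inv_into_f_f[OF assms] that by simp
 have "(SUM x:b ` {..<n}. d (the_inv_into {..<n} b x) * x) = (\<Sum>j<n. d j * b j)" by(simp add: sum.reindex[OF assms] i)
 thus "w : fspan N A (b ` {..<n})" unfolding fspan_def using d by(intro CollectI exI[of _ "d \<circ> the_inv_into {..<n} b"]) (auto simp: i)
qed

context gmodel
begin

text \<open>All frames span the same \<open>K\<close>-module as the fixed set \<open>S\<close>. With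
  variables for \<open>S\<close> this keeps frames inside the linear forms, which makes the
  monomials in them independent.\<close>

definition based :: "('p => 'w set) => 'w set => bool" where
 "based M S \<longleftrightarrow> (ALL x:pts. EX U B. oin T U & x : U & fr_at M U B & B [= fspan N K S & S [= fspan N K B)"

lemma based_framed: "based M S ==> framed M" unfolding based_def framed_def by(intro ballI, drule (1) bspec, elim exE conjE, intro exI conjI)

end

context lfree
begin

lemma K_open_fin: fixes c :: "nat => 'w" assumes "ALL j<m. c j : K" shows "EX U. oin T U & U ~= {} & (ALL j<m. c j : sec Ox U)" using assms
proof (induction m)
 case 0
 thus ?case using U0_ne triv0 by blast
next
 case (Suc m)
 then obtain U where U: "oin T U" "U ~= {}" "ALL j<m. c j : sec Ox U" by auto
 obtain V where V: "oin T V" "V ~= {}" "c m : sec Ox V" using K_open Suc.prems by blast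
 have "ALL j<Suc m. c j : sec Ox (U Int V)" using U(3) V(3) by(auto simp: sec_def less_Suc_eq)
 thus ?case using irr[OF U(1) V(1) U(2) V(2)] U(1) V(1) by blast
qed

interpretation F: names X K N Ox tu F NM M by(rule F_names)

context fixes U1 h b assumes tr: "triv U1 h" and ne: "U1 ~= {}" and b: "!!j. j < n ==> NM U1 (b j) (h U1 (tup U1 (%i. if i = j then 1 else 0)))"
begin

lemma o1: "oin T U1" using tr by(simp add: triv_def)

lemma frame_names: assumes V: "oin T V" "V ~= {}" "V [= U1" and d: "ALL i<n. d i : sec Ox V" shows "NM V (\<Sum>j<n. d j * b j) (h V (tup V d))"
proof -
 note sr = osrD[OF osr_sec[OF V(1)]]
 \<comment> \<open>Induction on the number \<open>k\<close> of coordinates that have not been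
   replaced by 0.\<close>
 have "k <= n ==> NM V (\<Sum>j<k. d j * b j) (h V (tup V (%i. if i < k then d i else 0)))" for k
 proof (induction k)
  case 0
  have z: "ALL i<n. (0::'w) : sec Ox V" using sr by blast
  obtain v where "NM V v (h V (tup V (%_. 0)))" using F.nm_ex[OF V(1,2) triv_closed[OF tr V z]] by blast
  from F.nm_smult[OF V(1,2) sr(3) this] show ?case using triv_smult[OF tr V z sr(3)] by simp
 next
  case (Suc k)
  hence k: "k < n" by simp
  let ?e = "%i. if i = k then 1 else (0::'w)" and ?f = "%i. if i < k then d i else 0"
  have e1: "ALL i<n. ?e i : sec Ox U1" using osrD[OF osr_sec[OF o1]] by simp
  have e: "ALL i<n. ?e i : sec Ox V" "ALL i<n. ?f i : sec Ox V" "ALL i<n. d k * ?e i : sec Ox V" using sr d k by auto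
  have dk: "d k : sec Ox V" using d k by blast
  have "NM V (b k) (h V (tup V ?e))" using F.nm_restr[OF o1 V b[OF k]] triv_restr[OF tr o1 ne order_refl e1 V] by simp
  from F.nm_smult[OF V(1,2) dk this] have "NM V (d k * b k) (h V (tup V (%i. d k * ?e i)))" using triv_smult[OF tr V e(1) dk] by simp
  from F.nm_add[OF V(1,2) Suc.IH this]
  have "NM V ((\<Sum>j<k. d j * b j) + d k * b k) (h V (tup V (%i. ?f i + d k * ?e i)))" using triv_add[OF tr V e(2,3)] Suc.prems by simp
  moreover have "(%i. ?f i + d k * ?e i) = (%i. if i < Suc k then d i else 0)" by(auto simp: fun_eq_iff less_Suc_eq)
  ultimately show ?case by simp
 qed
 from this[of n] have "NM V (\<Sum>j<n. d j * b j) (h V (tup V (%i. if i < n then d i else 0)))" by simp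
 moreover have "tup V (%i. if i < n then d i else 0) = tup V d" by(auto simp: tup_def)
 ultimately show ?thesis by simp
qed

text \<open>Finitely many coefficients from \<open>K\<close> are regular on a common non-empty open
  set, so the relation can be read there as an equation between sections, where the trivialisation
  \<open>h\<close> is injective.\<close>

lemma frame_indep: assumes c: "ALL j<n. c j : K" and s: "(\<Sum>j<n. c j * b j) : N" and j: "j < n" shows "c j : N"
proof -
 obtain U where U: "oin T U" "U ~= {}" "ALL j<n. c j : sec Ox U" using K_open_fin[OF c] by blast
 let ?V = "U Int U1"
 have V: "oin T ?V" "?V ~= {}" "?V [= U1" using irr[OF U(1) o1 U(2) ne] U(1) o1 by auto
 have cV: "ALL j<n. c j : sec Ox ?V" using U(3) by(auto simp: sec_def)
 have zV: "ALL j<n. 0 : sec Ox ?V" using osrD(3)[OF osr_sec[OF V(1)]] by blast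
 have "h ?V (tup ?V c) = h ?V (tup ?V (%_. 0))" using NM_eq[OF V(1,2) frame_names[OF V cV] frame_names[OF V zV]] s by simp
 thus ?thesis using triv_inj[OF tr V cV zV] j by simp
qed

lemma frame_span: assumes y: "y : U1" shows "w : M y \<longleftrightarrow> (EX d. (ALL j<n. d j : Ox y) & w - (\<Sum>j<n. d j * b j) : N)"
proof
 note yp = sub_top[OF o1 y]
 assume "EX d. (ALL j<n. d j : Ox y) & w - (\<Sum>j<n. d j * b j) : N"
 then obtain d where d: "ALL j<n. d j : Ox y" "w - (\<Sum>j<n. d j * b j) : N" by blast
 have "b j : M y" if "j < n" for j by(rule F.M_I[OF o1 y b[OF that]])
 hence "(\<Sum>j<n. d j * b j) : M y" using d(1) by(intro osub_sum[OF F.M_osub[OF yp]] osubD(3)[OF F.M_osub[OF yp]]) auto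
 thus "w : M y" by(rule osub_tr[OF F.M_osub[OF yp] F.M_N[OF yp] d(2)])
next
 assume "w : M y"
 then obtain U s where U: "oin T U" "y : U" "NM U w s" unfolding M_def by blast
 let ?V = "U Int U1"
 have V: "oin T ?V" "?V ~= {}" "?V [= U1" "?V [= U" using U o1 y by auto
 have n: "NM ?V w (restr F U ?V s)" by(rule F.nm_restr[OF U(1) V(1,2,4) U(3)])
 obtain d where d: "ALL j<n. d j : sec Ox ?V" "restr F U ?V s = h ?V (tup ?V d)" using triv_surj[OF tr V(1-3) F.nm_closed[OF V(1,2) n]] by blast
 have "w - (\<Sum>j<n. d j * b j) : N" using F.nm_uniq[OF V(1,2) n] frame_names[OF V(1-3) d(1)] unfolding d(2) by blast
 thus "EX d. (ALL j<n. d j : Ox y) & w - (\<Sum>j<n. d j * b j) : N" using d(1) U(2) y by(intro exI[of _ d]) (auto simp: sec_def)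
qed

lemma sec_K: "oin T V ==> V ~= {} ==> a : sec Ox V ==> a : K" using OxK[OF sub_top] unfolding sec_def by blast

lemma frame_base: "j < n ==> EX c. (ALL i<n. c i : K) & b j - (\<Sum>i<n. c i * \<beta> i) : N"
 "i < n ==> EX d. (ALL j<n. d j : K) & \<beta> i - (\<Sum>j<n. d j * b j) : N"
proof -
 note I = U0_int[OF o1 ne]
 show "j < n ==> EX c. (ALL i<n. c i : K) & b j - (\<Sum>i<n. c i * \<beta> i) : N" using b[of j] sec_K[OF I(1,2)] unfolding NM_def by blast
 assume i: "i < n"
 let ?V = "U1 Int U0" and ?e = "%k. if k = i then 1 else (0::'w)"
 have e: "ALL k<n. ?e k : sec Ox ?V" using osrD[OF osr_sec[OF I(1)]] by simp
 note cl = triv_closed[OF tr0 I(1-3) e]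
 obtain d where d: "ALL j<n. d j : sec Ox ?V" "h0 ?V (tup ?V ?e) = h ?V (tup ?V d)" using triv_surj[OF tr I(1,2,4) cl] by blast
 have V: "?V Int U0 = ?V" by blast
 have "(\<Sum>k<n. ?e k * \<beta> k) = (\<Sum>k<n. if k = i then \<beta> k else 0)" by(intro sum.cong) auto
 hence "(\<Sum>k<n. ?e k * \<beta> k) = \<beta> i" using i by simp
 hence "NM ?V (\<beta> i) (h0 ?V (tup ?V ?e))" using e triv_restr[OF tr0 I(1-3) e I(1,2) order_refl] cl osubD(1)[OF N]
  by(intro NM_I[of ?e]) (simp_all only: V diff_self)
 from F.nm_uniq[OF I(1,2) this] have "\<beta> i - (\<Sum>j<n. d j * b j) : N" using frame_names[OF I(1,2,4) d(1)] unfolding d(2) by blast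
 thus "EX d. (ALL j<n. d j : K) & \<beta> i - (\<Sum>j<n. d j * b j) : N" using d(1) sec_K[OF I(1,2)] by blast
qed

end

lemma indep_inj: fixes f :: "nat => 'w" assumes "!!c j. ALL j<n. c j : K ==> (\<Sum>j<n. c j * f j) : N ==> j < n ==> c j : N" and N1: "1 \<notin> N"
 shows "inj_on f {..<n}"
proof (rule inj_onI)
 fix i j assume ij: "i : {..<n}" "j : {..<n}" "f i = f j"
 show "i = j"
 proof (rule ccontr)
  assume ne: "i ~= j"
  let ?c = "%k. if k = i then 1 else if k = j then - 1 else (0::'w)"
  have "(\<Sum>k<n. ?c k * f k) = (SUM k:{i, j}. ?c k * f k)" using ij by(intro sum.mono_neutral_right) auto
  hence "(\<Sum>k<n. ?c k * f k) = 0" using ne ij(3) by simp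
  hence "?c i : N" using osrD[OF K] osubD(1)[OF N] ij by(intro assms(1)[of ?c]) auto
  thus False using N1 by simp
 qed
qed

lemma M_based: assumes N1: "1 \<notin> N" shows "based M (\<beta> ` {..<n})" unfolding based_def
proof
 fix x assume x: "x : pts"
 obtain U1 h where tr: "triv U1 h" "x : U1" using lf x unfolding locally_free_def triv_def by blast
 hence ne: "U1 ~= {}" and o: "oin T U1" by(auto simp: triv_def)
 have "EX b. NM U1 b (h U1 (tup U1 (%i. if i = j then 1 else 0)))" for j
  by(intro F.nm_ex[OF o ne] triv_closed[OF tr(1) o ne order_refl]) (use osrD[OF osr_sec[OF o]] in auto)
 then obtain b where b: "!!j. NM U1 (b j) (h U1 (tup U1 (%i. if i = j then 1 else 0)))" by metis
 note fi = frame_indep[OF tr(1) ne b] and fs = frame_span[OF tr(1) ne b] and fb = frame_base[OF tr(1) ne b]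
 have ib: "inj_on b {..<n}" by(rule indep_inj[OF _ N1]) (rule fi)
 have i\<beta>: "inj_on \<beta> {..<n}" by(rule indep_inj[OF _ N1]) (use \<beta> in blast)
 have "fr_at M U1 (b ` {..<n})" unfolding fr_at_def
 proof (intro conjI allI impI ballI)
  show "M y = fspan N (Ox y) (b ` {..<n})" if "y : U1" for y using fs[OF that] fspan_reindex[OF ib] by blast
  fix c x assume c: "(ALL x:b ` {..<n}. c x : K) & (SUM x:b ` {..<n}. c x * x) : N" and x: "x : b ` {..<n}"
  thus "c x : N" using fi[of "c \<circ> b"] by(auto simp: sum.reindex[OF ib])
 qed simp
 moreover have "b ` {..<n} [= fspan N K (\<beta> ` {..<n})" using fb(1) fspan_reindex[OF i\<beta>] by blast
 moreover have "\<beta> ` {..<n} [= fspan N K (b ` {..<n})" using fb(2) fspan_reindex[OF ib] by blast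
 ultimately show "EX U B. oin T U & x : U & fr_at M U B & B [= fspan N K (\<beta> ` {..<n}) & \<beta> ` {..<n} [= fspan N K B" using o tr(2) by blast
qed

end

context gmodel
begin

theorem locally_free_realizes: assumes lf: "locally_free X n F" and N1: "1 \<notin> N" and ne: "pts ~= {}"
  and K_open: "!!a. a : K ==> EX U. oin T U & U ~= {} & a : sec Ox U"
  and \<beta>: "!!c i. (!!i. i < n ==> c i : K) ==> (\<Sum>i<n. c i * \<beta> i) : N ==> i < n ==> c i : N"
 shows "EX si M. realizes F si M & based M (\<beta> ` {..<n})"
proof -
 obtain x where x: "x : pts" using ne by blast
 obtain U0 h0 where tr: "oin T U0" "x : U0" "mod_sheaf_hom X U0 (free_sheaf X n) F h0"
  "ALL V. oin T V & V [= U0 --> bij_betw (h0 V) (cr (Sec (free_sheaf X n) V)) (cr (Sec F V))" using lf x unfolding locally_free_def by blast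
 interpret L: lfree X K N Ox tu F n \<beta> U0 h0 by unfold_locales (use lf K_open \<beta> tr in auto)
 show ?thesis using names.sheaf_realizes[OF L.F_names L.F_sheaf] L.M_based[OF N1] by blast
qed

end

section \<open>Existence of a model for a projective variety\<close>

section \<open>The generic point of a projective variety\<close>

lemma (in ring) minus_eq_zero_iff: assumes "a : cr R" "b : cr R" shows "a \<ominus> b = \<zero> \<longleftrightarrow> a = b"
proof
 assume e: "a \<ominus> b = \<zero>"
 have "a = (a \<ominus> b) \<oplus> b" using assms by(simp add: a_minus_def a_assoc l_neg)
 thus "a = b" unfolding e using assms by simp
qed (use assms in \<open>simp add: a_minus_def r_neg\<close>)

text \<open>What is used of the homogeneous coordinate ring: it is a domain with a non-zero element
  of positive degree, which makes the zero ideal a point of Proj.\<close>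

locale graded_domain = domain S for S :: "'s ring" (structure) + fixes gr :: "nat => 's set"
 assumes gr_carrier: "gr d [= cr S" and gr_zero: "\<zero> : gr d" and gr_one: "\<one> : gr 0" and irrelevant: "\<not> (UN d:{1..}. gr d) [= {\<zero>}"
begin

lemma zero_relevant: "relevant_prime S gr {\<zero>}"
proof -
 have "ideal {\<zero>} S" by(rule zeroideal)
 moreover have "{\<zero>} Int (\<Union>d. gr d) = {\<zero>}" using gr_zero by auto
 moreover have "{\<zero>} = Idl {\<zero>}" using genideal_zero by simp
 ultimately show ?thesis unfolding relevant_prime_def homogeneous_ideal_def using zeroprimeideal irrelevant by simp
qed

text \<open>A non-empty basic open set is given by some \<open>f\<close> outside of a prime, so
  \<open>f\<close> is not zero and the zero ideal belongs to the set as well.\<close>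

lemma generic_open: assumes "oin (Proj_top S gr) U" "U ~= {}" shows "{\<zero>} : U"
proof -
 have "generate_topology_on {{\<pp> : Proj_points S gr. f \<notin> \<pp>} | f. f : (\<Union>d. gr d)} U"
  using assms(1) unfolding Proj_top_def openin_topology_generated_by_iff .
 hence "U ~= {} --> {\<zero>} : U"
 proof (induction rule: generate_topology_on.induct)
  case (Basis s)
  then obtain f where f: "f : (\<Union>d. gr d)" "s = {\<pp> : Proj_points S gr. f \<notin> \<pp>}" by blast
  show ?case
  proof
   assume "s ~= {}"
   then obtain \<pp> where p: "relevant_prime S gr \<pp>" "f \<notin> \<pp>" unfolding f by(auto simp: Proj_points_def)
   hence "\<zero> : \<pp>" using additive_subgroup.zero_closed[OF ideal.axioms(1)[OF primeideal.axioms(1)]] unfolding relevant_prime_def by blast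
   thus "{\<zero>} : s" unfolding f using p zero_relevant by(auto simp: Proj_points_def)
  qed
 qed auto
 thus ?thesis using assms(2) by blast
qed

lemma prime_zero: "\<pp> : Proj_points S gr ==> \<zero> : \<pp>" "\<pp> : Proj_points S gr ==> \<one> \<notin> \<pp>"
proof -
 assume "\<pp> : Proj_points S gr"
 hence p: "primeideal \<pp> S" by(simp add: Proj_points_def relevant_prime_def)
 show "\<zero> : \<pp>" by(rule additive_subgroup.zero_closed[OF ideal.axioms(1)[OF primeideal.axioms(1)[OF p]]])
 show "\<one> \<notin> \<pp>" using ideal.one_imp_carrier[OF primeideal.axioms(1)[OF p]] primeideal.I_notcarr[OF p] by blast
qed

text \<open>In a domain the factor \<open>t\<close> in the definition of a fraction can be
  cancelled, so equality of fractions is the same cross-multiplied equation at every point.\<close>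

lemma hom_frac_iff: assumes p: "\<pp> : Proj_points S gr" and a: "a : gr e" "b : gr e"
 shows "(c, d) : hom_frac S gr \<pp> a b \<longleftrightarrow> (EX e. c : gr e & d : gr e - \<pp>) & a \<otimes> d = c \<otimes> b"
proof -
 have "(EX t:(\<Union>j. gr j) - \<pp>. t \<otimes> (a \<otimes> d \<ominus> c \<otimes> b) = \<zero>) \<longleftrightarrow> a \<otimes> d = c \<otimes> b"
  if c: "c : cr S" "d : cr S"
 proof -
  have cl: "a \<otimes> d : cr S" "c \<otimes> b : cr S" using c a gr_carrier by auto
  show ?thesis
  proof
   assume "EX t:(\<Union>j. gr j) - \<pp>. t \<otimes> (a \<otimes> d \<ominus> c \<otimes> b) = \<zero>"
   then obtain t j where t: "t : gr j" "t \<notin> \<pp>" "t \<otimes> (a \<otimes> d \<ominus> c \<otimes> b) = \<zero>" by blast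
   hence "t ~= \<zero>" "t : cr S" using prime_zero(1)[OF p] gr_carrier by auto
   hence "a \<otimes> d \<ominus> c \<otimes> b = \<zero>" using integral[OF t(3)] cl by auto
   thus "a \<otimes> d = c \<otimes> b" using minus_eq_zero_iff cl by blast
  next
   assume "a \<otimes> d = c \<otimes> b"
   hence "\<one> \<otimes> (a \<otimes> d \<ominus> c \<otimes> b) = \<zero>" using cl minus_eq_zero_iff by auto
   thus "EX t:(\<Union>j. gr j) - \<pp>. t \<otimes> (a \<otimes> d \<ominus> c \<otimes> b) = \<zero>" using gr_one prime_zero(2)[OF p] by blast
  qed
 qed
 thus ?thesis unfolding hom_frac_def using gr_carrier by blast
qed

lemma Proj_carrier: "cr (Proj_sections S gr U) = {s : (\<Pi>\<^sub>E \<pp>\<in>U. cr (homogeneous_localization S gr \<pp>)).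
  ALL \<pp>:U. EX V e a b. oin (Proj_top S gr) V & \<pp> : V & V [= U & a : gr e & b : gr e &
     (ALL \<qq>:V. b \<notin> \<qq> & s \<qq> = hom_frac S gr \<qq> a b)}" by(simp add: Proj_sections_def Let_def)

definition frac_on :: "('s set => ('s \<times> 's) set) => 's set set => nat => 's => 's => bool" where
 "frac_on s V e a b \<longleftrightarrow> oin (Proj_top S gr) V & a : gr e & b : gr e & (ALL q:V. b \<notin> q & s q = hom_frac S gr q a b)"

lemma Proj_E: assumes "s : cr (Proj_sections S gr U)" "p : U" shows "EX V e a b. p : V & V [= U & frac_on s V e a b"
proof -
 have "ALL p:U. EX V e a b. oin (Proj_top S gr) V & p : V & V [= U & a : gr e & b : gr e &
  (ALL q:V. b \<notin> q & s q = hom_frac S gr q a b)" using assms(1) unfolding Proj_carrier by simp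
 thus ?thesis using assms(2) unfolding frac_on_def by meson
qed

lemma frac_onD: assumes "frac_on s V e a b"
 shows "oin (Proj_top S gr) V" "a : gr e" "b : gr e" "q : V ==> b \<notin> q" "q : V ==> s q = hom_frac S gr q a b"
 using assms unfolding frac_on_def by auto

lemma Proj_restr_closed: assumes V: "oin (Proj_top S gr) V" "V [= U" and s: "s : cr (Proj_sections S gr U)"
 shows "restrict s V : cr (Proj_sections S gr V)"
proof -
 have "EX W e a b. oin (Proj_top S gr) W & p : W & W [= V & a : gr e & b : gr e &
   (ALL q:W. b \<notin> q & restrict s V q = hom_frac S gr q a b)" if p: "p : V" for p
 proof -
  obtain W e a b where W: "p : W" "W [= U" "frac_on s W e a b" using Proj_E[OF s subsetD[OF V(2) p]] by blast
  note W = this frac_onD[OF W(3)]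
  show ?thesis by(rule exI[of _ "W Int V"], rule exI[of _ e], rule exI[of _ a], rule exI[of _ b]) (use V(1) p W in auto)
 qed
 moreover have "restrict s V : (\<Pi>\<^sub>E p\<in>V. cr (homogeneous_localization S gr p))" using s V(2) unfolding Proj_carrier by auto
 ultimately show ?thesis unfolding Proj_carrier by blast
qed

text \<open>Sections that agree on \<open>V\<close> agree at the generic point
  \<open>{\<zero>}\<close>. Near any point they are given by fractions, whose cross products are
  then equal, and by \<open>hom_frac_iff\<close> the fractions agree at that point too.\<close>

lemma Proj_restr_inj: assumes U: "oin (Proj_top S gr) U" and V: "oin (Proj_top S gr) V" "V ~= {}" "V [= U"
  and s: "s : cr (Proj_sections S gr U)" "t : cr (Proj_sections S gr U)" and e: "restrict s V = restrict t V" shows "s = t"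
proof -
 have top: "W [= Proj_points S gr" if "oin (Proj_top S gr) W" for W
  using openin_subset[OF that] unfolding Proj_top_def by(auto simp: topology_generated_by_topspace)
 have "s p = t p" if p: "p : U" for p
 proof -
  obtain W i a b where W0: "p : W" "frac_on s W i a b" using Proj_E[OF s(1) p] by blast
  note W = frac_onD[OF W0(2)]
  obtain W' j c d where W0': "p : W'" "frac_on t W' j c d" using Proj_E[OF s(2) p] by blast
  note W' = frac_onD[OF W0'(2)]
  have g: "{\<zero>} : W" "{\<zero>} : W'" "{\<zero>} : V" using generic_open[OF W(1)] generic_open[OF W'(1)] generic_open[OF V(1,2)] W0(1) W0'(1) by auto
  have gp: "{\<zero>} : Proj_points S gr" and pp: "p : Proj_points S gr" using top[OF V(1)] g top[OF U] p by auto
  have "s {\<zero>} = t {\<zero>}" using e g(3) by(metis restrict_apply')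
  hence eq: "hom_frac S gr {\<zero>} a b = hom_frac S gr {\<zero>} c d" using W(5)[OF g(1)] W'(5)[OF g(2)] by simp
  have b0: "b ~= \<zero>" "d ~= \<zero>" using W(4)[OF g(1)] W'(4)[OF g(2)] by auto
  have cl: "a : cr S" "b : cr S" "c : cr S" "d : cr S" using W(2,3) W'(2,3) gr_carrier by auto
  have "(a, b) : hom_frac S gr {\<zero>} a b" unfolding hom_frac_iff[OF gp W(2,3)] using W(2,3) b0 by blast
  hence ad: "c \<otimes> b = a \<otimes> d" unfolding eq hom_frac_iff[OF gp W'(2,3)] by blast
  have "a \<otimes> y = x \<otimes> b \<longleftrightarrow> c \<otimes> y = x \<otimes> d" if x: "x : cr S" "y : cr S" for x y
  proof -
   have "a \<otimes> y = x \<otimes> b \<longleftrightarrow> d \<otimes> (a \<otimes> y) = d \<otimes> (x \<otimes> b)" using m_lcancel[OF b0(2)] cl x by simp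
   also have "d \<otimes> (a \<otimes> y) = b \<otimes> (c \<otimes> y)" using ad cl x by(metis m_assoc m_comm)
   also have "d \<otimes> (x \<otimes> b) = b \<otimes> (x \<otimes> d)" using cl x by(simp add: m_ac)
   also have "b \<otimes> (c \<otimes> y) = b \<otimes> (x \<otimes> d) \<longleftrightarrow> c \<otimes> y = x \<otimes> d" using m_lcancel[OF b0(1)] cl x by simp
   finally show ?thesis .
  qed
  hence "(x, y) : hom_frac S gr p a b \<longleftrightarrow> (x, y) : hom_frac S gr p c d" for x y
   unfolding hom_frac_iff[OF pp W(2,3)] hom_frac_iff[OF pp W'(2,3)] using gr_carrier by blast
  hence "hom_frac S gr p a b = hom_frac S gr p c d" by auto
  thus ?thesis using W(5)[OF W0(1)] W'(5)[OF W0'(1)] by simp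
 qed
 moreover have "s : extensional U" "t : extensional U" using s unfolding Proj_carrier by(auto simp: PiE_def)
 ultimately show ?thesis by(rule extensionalityI[rotated 2])
qed

end

lemma coord_graded_domain: assumes I: "relevant_prime (poly_ring_n n) (homogeneous_polys n) I"
 shows "graded_domain (coord_ring n I) (coord_grading n I)"
proof -
 interpret I: primeideal I "poly_ring_n n" using I by(simp add: relevant_prime_def)
 interpret Q: domain "coord_ring n I" unfolding coord_ring_def by(rule I.quotient_is_domain)
 have hp: "homogeneous_polys n d [= cr (poly_ring_n n)" for d by(auto simp: homogeneous_polys_def)
 have z: "0[coord_ring n I] = I" by(simp add: coord_ring_def FactRing_def)
 show ?thesis
 proof
  show "coord_grading n I d [= cr (coord_ring n I)" for d
   unfolding coord_grading_def coord_ring_def FactRing_def using hp[of d] I.a_rcosetsI[OF I.a_subset] by auto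
  have "0[poly_ring_n n] : homogeneous_polys n d" for d unfolding homogeneous_polys_def using I.zero_closed by(simp add: poly_ring_n_def)
  thus "0[coord_ring n I] : coord_grading n I d" for d
   unfolding z coord_grading_def using I.a_rcos_const[OF additive_subgroup.zero_closed[OF I.additive_subgroup_axioms]] by(metis image_eqI)
  have "1[poly_ring_n n] : homogeneous_polys n 0" unfolding homogeneous_polys_def using I.one_closed by(simp add: poly_ring_n_def)
  thus "1[coord_ring n I] : coord_grading n I 0" unfolding coord_grading_def coord_ring_def FactRing_def by(simp, intro imageI)
  obtain p d where p: "d >= 1" "p : homogeneous_polys n d" "p \<notin> I" using I unfolding relevant_prime_def by auto
  have "I +>\<^bsub>poly_ring_n n\<^esub> p ~= I" using I.a_rcos_self[of p] p hp by auto
  thus "\<not> (UN d:{1..}. coord_grading n I d) [= {0[coord_ring n I]}" unfolding z coord_grading_def using p by auto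
 qed
qed

text \<open>The generic point and the injectivity of restrictions are transported from Proj along
  the homeomorphism and the ring isomorphisms on open sets.\<close>

theorem projective_generic: assumes X: "projective_variety X" obtains \<xi> where "\<xi> : topspace (space_top X)"
  "!!U. oin (space_top X) U ==> U ~= {} ==> \<xi> : U" "!!U V s t. oin (space_top X) U ==> oin (space_top X) V ==> V ~= {} ==> V [= U ==>
   s : cr (Sec (str_sheaf X) U) ==> t : cr (Sec (str_sheaf X) U) ==> restr (str_sheaf X) U V s = restr (str_sheaf X) U V t ==> s = t"
proof -
 obtain n I where I: "relevant_prime (poly_ring_n n) (homogeneous_polys n) I"
  "isomorphic_over X (closed_subvariety n I)" using X unfolding projective_variety_def by blast
 define S gr where "S = coord_ring n I" and "gr = coord_grading n I"
 interpret S: graded_domain S gr unfolding S_def gr_def by(rule coord_graded_domain[OF I(1)])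
 define Y where "Y = closed_subvariety n I"
 have Y: "space_top Y = Proj_top S gr" "Sec (str_sheaf Y) = Proj_sections S gr" "restr (str_sheaf Y) U V s = restrict s V" for U V s
  by(simp_all add: Y_def S_def gr_def closed_subvariety_def Let_def Proj_def)
 let ?T = "space_top X"
 let ?pre = "%\<phi> V. {x : topspace ?T. \<phi> x : V}"
 have "EX \<phi> \<psi>. homeomorphic_map ?T (Proj_top S gr) \<phi> &
  ((ALL V. oin (Proj_top S gr) V --> \<psi> V : ring_iso (Proj_sections S gr V) (Sec (str_sheaf X) (?pre \<phi> V))) &
  (ALL V W. oin (Proj_top S gr) V & oin (Proj_top S gr) W & W [= V --> (ALL s:cr (Proj_sections S gr V).
     restr (str_sheaf X) (?pre \<phi> V) (?pre \<phi> W) (\<psi> V s) = \<psi> W (restrict s W)))) &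
  (ALL c. \<psi> (topspace (Proj_top S gr)) (scalar_map Y c) = scalar_map X c)" using I(2) unfolding isomorphic_over_def Y_def[symmetric] Y Let_def .
 then obtain \<phi> \<psi> where \<phi>: "homeomorphic_map ?T (Proj_top S gr) \<phi>"
  and 1: "ALL V. oin (Proj_top S gr) V --> \<psi> V : ring_iso (Proj_sections S gr V) (Sec (str_sheaf X) (?pre \<phi> V))"
  and 2: "ALL V W. oin (Proj_top S gr) V & oin (Proj_top S gr) W & W [= V --> (ALL s:cr (Proj_sections S gr V).
     restr (str_sheaf X) (?pre \<phi> V) (?pre \<phi> W) (\<psi> V s) = \<psi> W (restrict s W))" by(elim exE conjE)
 have im: "oin (Proj_top S gr) (\<phi> ` U)" if "oin ?T U" for U using homeomorphic_map_openness_eq[OF \<phi>] that by blast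
 have inj: "inj_on \<phi> (topspace ?T)" using \<phi> by(simp add: homeomorphic_eq_everything_map)
 have pre: "{x : topspace ?T. \<phi> x : \<phi> ` U} = U" if "oin ?T U" for U using openin_subset[OF that] inj unfolding inj_on_def by blast
 have ne: "topspace ?T ~= {}"
 proof
  assume "topspace ?T = {}"
  hence "topspace (Proj_top S gr) = {}" using homeomorphic_imp_surjective_map[OF \<phi>] by simp
  moreover obtain d f where "f : gr d" "f ~= 0[S]" using S.irrelevant by blast
  hence "{\<pp> : Proj_points S gr. f \<notin> \<pp>} ~= {}" using S.zero_relevant by(auto simp: Proj_points_def)
  moreover have "{\<pp> : Proj_points S gr. f \<notin> \<pp>} [= topspace (Proj_top S gr)"
   unfolding Proj_top_def topology_generated_by_topspace using \<open>f : gr d\<close> by blast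
  ultimately show False by blast
 qed
 obtain \<xi> where x: "\<xi> : topspace ?T" "\<phi> \<xi> = {0[S]}" using S.generic_open[OF im[OF openin_topspace]] ne by auto
 show thesis
 proof (rule that[OF x(1)])
  show "\<xi> : U" if U: "oin ?T U" "U ~= {}" for U
  proof -
   have "\<phi> \<xi> : \<phi> ` U" using S.generic_open[OF im[OF U(1)]] U(2) x(2) by simp
   thus ?thesis using pre[OF U(1)] x(1) by blast
  qed
 next
  fix U V s t assume U: "oin ?T U" and V: "oin ?T V" "V ~= {}" "V [= U" and s: "s : cr (Sec (str_sheaf X) U)" "t : cr (Sec (str_sheaf X) U)"
   and e: "restr (str_sheaf X) U V s = restr (str_sheaf X) U V t"
  have b: "bij_betw (\<psi> (\<phi> ` W)) (cr (Proj_sections S gr (\<phi> ` W))) (cr (Sec (str_sheaf X) W))"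
   "\<psi> (\<phi> ` W) : ring_hom (Proj_sections S gr (\<phi> ` W)) (Sec (str_sheaf X) W)"
   if "oin ?T W" for W using 1[rule_format, OF im[OF that]] unfolding pre[OF that] ring_iso_def by auto
  obtain s' where s': "s' : cr (Proj_sections S gr (\<phi> ` U))" "s = \<psi> (\<phi> ` U) s'" using s(1) bij_betw_imp_surj_on[OF b(1)[OF U]] by blast
  obtain t' where t': "t' : cr (Proj_sections S gr (\<phi> ` U))" "t = \<psi> (\<phi> ` U) t'" using s(2) bij_betw_imp_surj_on[OF b(1)[OF U]] by blast
  have VU: "\<phi> ` V [= \<phi> ` U" "\<phi> ` V ~= {}" using V by auto
  have "\<psi> (\<phi> ` V) (restrict s' (\<phi> ` V)) = \<psi> (\<phi> ` V) (restrict t' (\<phi> ` V))"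
   using 2[rule_format, OF conjI[OF im[OF U] conjI[OF im[OF V(1)] VU(1)]] s'(1)]
    2[rule_format, OF conjI[OF im[OF U] conjI[OF im[OF V(1)] VU(1)]] t'(1)] e unfolding pre[OF U] pre[OF V(1)] s'(2) t'(2) by simp
  moreover have "restrict u (\<phi> ` V) : cr (Proj_sections S gr (\<phi> ` V))" if u: "u : cr (Proj_sections S gr (\<phi> ` U))" for u
   by(rule S.Proj_restr_closed[OF im[OF V(1)] VU(1) u])
  ultimately have "restrict s' (\<phi> ` V) = restrict t' (\<phi> ` V)" using inj_onD[OF bij_betw_imp_inj_on[OF b(1)[OF V(1)]]] s'(1) t'(1) by blast
  hence "s' = t'" by(rule S.Proj_restr_inj[OF im[OF U] im[OF V(1)] VU(2,1) s'(1) t'(1)])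
  thus "s = t" using s' t' by simp
 qed
qed

section \<open>Polynomials over a ring modulo an ideal of constants\<close>

text \<open>Monomials are multisets of indices of variables, so a product of monomials is a sum of
  multisets.\<close>

type_synonym 'c wpoly = "nat multiset \<Rightarrow>\<^sub>0 'c"

abbreviation cf :: "'c::comm_ring_1 wpoly => nat multiset => 'c" where "cf \<equiv> Poly_Mapping.lookup"
abbreviation mon :: "nat multiset => 'c::comm_ring_1 wpoly" where "mon m \<equiv> Poly_Mapping.single m 1"
abbreviation cst :: "'c::comm_ring_1 => 'c wpoly" where "cst \<equiv> Poly_Mapping.single 0"

lemma cst_mono: "cst c * mon m = Poly_Mapping.single m c" by(simp add: mult_single)

lemma wpoly_sum: fixes w :: "'c::comm_ring_1 wpoly" assumes "finite A" "Poly_Mapping.keys w [= A" shows "w = (SUM m:A. cst (cf w m) * mon m)"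
proof (rule poly_mapping_eqI)
 fix k
 have "cf (SUM m:A. cst (cf w m) * mon m) k = (SUM m:A. if m = k then cf w k else 0)"
  unfolding lookup_sum cst_mono by(intro sum.cong) (auto simp: lookup_single when_def)
 thus "cf w k = cf (SUM m:A. cst (cf w m) * mon m) k" using assms by(auto simp: in_keys_iff)
qed

lemma cf_cst_mult: fixes w :: "'c::comm_ring_1 wpoly" shows "cf (cst c * w) m = c * cf w m"
proof -
 have "cst c * w = Poly_Mapping.map ((*) c) w" by(simp add: mult_map_scale_conv_mult)
 thus ?thesis by(simp add: Poly_Mapping.map.rep_eq when_def)
qed

text \<open>The extension of a map on monomials that is linear over constants. The renaming of
  monomials and comultiplication are only linear; \<open>lin_mult\<close> covers the maps that are
  substitutions.\<close>

definition lin :: "(nat multiset => 'c::comm_ring_1 wpoly) => 'c wpoly => 'c wpoly" where "lin g w = (SUM m:Poly_Mapping.keys w. cst (cf w m) * g m)"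

lemma lin_alt: assumes "finite A" "Poly_Mapping.keys w [= A" shows "lin g w = (SUM m:A. cst (cf w m) * g m)"
 unfolding lin_def by(rule sum.mono_neutral_left) (use assms in \<open>auto simp: in_keys_iff\<close>)

lemma lin_add: "lin g (v + w) = lin g v + lin g w"
proof -
 let ?A = "Poly_Mapping.keys v Un Poly_Mapping.keys w"
 have "lin g (v + w) = (SUM m:?A. cst (cf (v + w) m) * g m)" by(rule lin_alt) (auto dest: subsetD[OF keys_add])
 also have "\<dots> = (SUM m:?A. cst (cf v m) * g m) + (SUM m:?A. cst (cf w m) * g m)" by(simp add: lookup_add single_add distrib_right sum.distrib)
 also have "\<dots> = lin g v + lin g w" using lin_alt[of ?A v g] lin_alt[of ?A w g] by simp
 finally show ?thesis .
qed

lemma lin_cst: "lin g (cst c * w) = cst c * lin g w"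
proof -
 have "lin g (cst c * w) = (SUM m:Poly_Mapping.keys w. cst (cf (cst c * w) m) * g m)" by(rule lin_alt) (auto simp: in_keys_iff cf_cst_mult)
 thus ?thesis by(simp add: cf_cst_mult lin_def sum_distrib_left mult_single flip: mult.assoc)
qed

lemma lin_mono: "lin g (mon m) = g m"
proof -
 have "lin g (mon m) = (SUM k:{m}. cst (cf (mon m) k) * g k)" by(rule lin_alt) auto
 thus ?thesis by simp
qed

lemma lin_zero: "lin g 0 = 0" by(simp add: lin_def)

lemma lin_sum: "lin g (sum f A) = (SUM a:A. lin g (f a))" by(induction A rule: infinite_finite_induct) (simp_all add: lin_zero lin_add)

lemma lin_sum_mono: "lin g (SUM a:A. cst (c a) * mon (e a)) = (SUM a:A. cst (c a) * g (e a))" by(simp add: lin_sum lin_cst lin_mono)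

lemma lin_uminus: "lin g (- w) = - lin g w" using lin_add[of g "- w" w] by(simp add: lin_zero eq_neg_iff_add_eq_0)

lemma lin_diff: "lin g (v - w) = lin g v - lin g w" using lin_add[of g v "- w"] by(simp add: lin_uminus)

lemma lin_mult: assumes g: "!!m m'. g (m + m') = g m * g m'" shows "lin g (v * w) = lin g v * lin g w"
proof -
 have s: "w = (SUM m:Poly_Mapping.keys w. cst (cf w m) * mon m)" for w :: "'a wpoly" by(rule wpoly_sum) auto
 have m: "lin g (cst c * mon m * (cst d * mon m')) = (cst c * g m) * (cst d * g m')" for c d m m'
 proof -
  have "cst c * mon m * (cst d * mon m') = cst (c * d) * (mon (m + m') :: 'a wpoly)" by(simp add: mult_single)
  hence "lin g (cst c * mon m * (cst d * mon m')) = cst (c * d) * (g m * g m')"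
   using lin_cst[of g "c * d" "mon (m + m')"] lin_mono[of g "m + m'"] g[of m m'] by simp
  also have "cst (c * d) = cst c * (cst d :: 'a wpoly)" by(simp add: mult_single)
  finally show ?thesis by(simp add: ac_simps)
 qed
 have "lin g (v * w) = lin g ((SUM m:Poly_Mapping.keys v. cst (cf v m) * mon m) * (SUM m:Poly_Mapping.keys w. cst (cf w m) * mon m))"
  using s[of v] s[of w] by simp
 also have "\<dots> = (SUM m:Poly_Mapping.keys v. cst (cf v m) * g m) * (SUM m:Poly_Mapping.keys w. cst (cf w m) * g m)"
  unfolding sum_product lin_sum m ..
 finally show ?thesis by(simp add: lin_def)
qed

lemma lin_id: "lin mon w = w" using wpoly_sum[of "Poly_Mapping.keys w" w] by(simp add: lin_def)

locale polyring = fixes N0 :: "'c::comm_ring_1 set" assumes N0: "osub UNIV N0"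
begin

text \<open>Since the quotient of \<open>'c\<close> by \<open>N0\<close> is not formed as a type,
  polynomials over it are represented by polynomials modulo \<open>PN\<close>, and its elements by
  \<open>PK\<close>, the polynomials that are constant modulo \<open>PN\<close>.\<close>

definition PN :: "'c wpoly set" where "PN = {w. ALL m. cf w m : N0}"
definition PK :: "'c wpoly set" where "PK = {w. ALL m. m ~= 0 --> cf w m : N0}"

lemma PN_mono: "c : N0 ==> cst c * w : PN" using osubD(3)[OF N0 UNIV_I, of c] by(simp add: PN_def cf_cst_mult mult.commute[of c])

lemma PN: "osub UNIV PN" unfolding osub_def
proof (intro conjI ballI)
 show "0 : PN" using osubD(1)[OF N0] by(simp add: PN_def)
 show a: "v + w : PN" if "v : PN" "w : PN" for v w using that osubD(2)[OF N0] by(simp add: PN_def lookup_add)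
 fix v w assume w: "w : PN"
 have "w = (SUM m:Poly_Mapping.keys w. cst (cf w m) * mon m)" by(rule wpoly_sum) auto
 hence "v * w = (SUM m:Poly_Mapping.keys w. cst (cf w m) * (v * mon m))" by(metis (no_types, lifting) mult.left_commute sum.cong sum_distrib_left)
 also have "\<dots> : PN"
 proof -
  have "(SUM m:A. cst (cf w m) * (v * mon m)) : PN" if "finite A" for A
   using that by induction (use a \<open>0 : PN\<close> PN_mono w in \<open>auto simp: PN_def\<close>)
  thus ?thesis by simp
 qed
 finally show "v * w : PN" .
qed

lemma cst_PN: "cst c : PN \<longleftrightarrow> c : N0" using osubD(1)[OF N0] by(auto simp: PN_def lookup_single when_def split: if_splits)

lemma PK_cst: "cst c : PK" using osubD(1)[OF N0] by(auto simp: PK_def lookup_single when_def)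

lemma PK_dec: "a : PK \<longleftrightarrow> a - cst (cf a 0) : PN"
proof -
 have "cf (a - cst (cf a 0)) m = (if m = 0 then 0 else cf a m)" for m by(simp add: lookup_minus lookup_single when_def)
 thus ?thesis using osubD(1)[OF N0] by(auto simp: PN_def PK_def)
qed

lemma PK_cong: assumes "a - b : PN" "b : PK" shows "a : PK" unfolding PK_def
proof (intro CollectI allI impI)
 fix m :: "nat multiset" assume "m ~= 0"
 hence "cf b m : N0" "cf a m - cf b m : N0" using assms by(auto simp: PN_def PK_def lookup_minus)
 thus "cf a m : N0" using osubD(2)[OF N0, of "cf a m - cf b m" "cf b m"] by simp
qed

lemma PN_PK: "PN [= PK" by(auto simp: PN_def PK_def)

lemma PK: "osubring PK" unfolding osubring_def osub_def
proof (intro conjI ballI)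
 show "1 : PK" "- 1 : PK" "0 : PK" using PK_cst[of 1] PK_cst[of "- 1"] PK_cst[of 0] by(simp_all add: single_uminus)
 show "v + w : PK" if "v : PK" "w : PK" for v w using that osubD(2)[OF N0] by(simp add: PK_def lookup_add)
 fix a b assume "a : PK" "b : PK"
 hence "a * b - cst (cf a 0) * cst (cf b 0) : PN" by(intro c_mult[OF PN]) (simp_all add: PK_dec)
 thus "a * b : PK" using PK_cong PK_cst by(simp add: mult_single)
qed

lemma PN_coef: "v - w : PN ==> cf v m - cf w m : N0" by(auto simp: PN_def lookup_minus)

lemma coef_mult: "a : PK ==> b : PK ==> cf (a * b) 0 - cf a 0 * cf b 0 : N0"
 using PN_coef[of "a * b" "cst (cf a 0) * cst (cf b 0)" 0] c_mult[OF PN, of a "cst (cf a 0)" b "cst (cf b 0)"] by(simp add: PK_dec mult_single)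

lemma lin_PN: "w : PN ==> lin g w : PN" unfolding lin_def by(intro osub_sum[OF PN] PN_mono) (simp add: PN_def)

text \<open>An element of \<open>PK\<close> is a constant modulo \<open>PN\<close>, and
  \<open>lin\<close> is linear over constants and preserves \<open>PN\<close>.\<close>

lemma lin_PK: assumes a: "a : PK" shows "lin g (a * w) - a * lin g w : PN"
proof -
 have d: "a - cst (cf a 0) : PN" using a by(simp add: PK_dec)
 have "lin g (a * w) - lin g (cst (cf a 0) * w) : PN" unfolding lin_diff[symmetric] by(intro lin_PN c_mult[OF PN d c_refl[OF PN]])
 moreover have "cst (cf a 0) * lin g w - a * lin g w : PN" by(intro c_mult[OF PN c_sym[OF PN d] c_refl[OF PN]])
 ultimately show ?thesis using c_trans[OF PN] by(simp add: lin_cst)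
qed

lemma lin_cong: "v - w : PN ==> lin g v - lin g w : PN" unfolding lin_diff[symmetric] by(rule lin_PN)

text \<open>Modulo \<open>PN\<close> the coefficients are constants, so each of them can be read off
  as the coefficient of its monomial.\<close>

lemma mono_indep: assumes A: "finite A" and e: "inj_on e A" and c: "!!a. a : A ==> c a : PK" and s: "(SUM a:A. c a * mon (e a)) : PN" and a: "a : A"
 shows "c a : PN"
proof -
 have d: "c x - cst (cf (c x) 0) : PN" if "x : A" for x using c[OF that] by(simp add: PK_dec)
 have "(SUM a:A. c a * mon (e a)) - (SUM a:A. cst (cf (c a) 0) * mon (e a)) : PN" by(intro c_sum[OF PN] c_mult[OF PN d c_refl[OF PN]])
 hence n: "(SUM a:A. cst (cf (c a) 0) * mon (e a)) : PN" using s c_mem[OF PN] by blast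
 have "cf (SUM a:A. cst (cf (c a) 0) * mon (e a)) (e a) = (SUM x:A. if x = a then cf (c a) 0 else 0)"
  unfolding lookup_sum cst_mono using inj_onD[OF e _ _ a] by(intro sum.cong) (auto simp: lookup_single when_def)
 hence "cf (SUM a:A. cst (cf (c a) 0) * mon (e a)) (e a) = cf (c a) 0" using A a by simp
 moreover have "ALL m. cf (SUM a:A. cst (cf (c a) 0) * mon (e a)) m : N0" using n by(simp add: PN_def)
 ultimately have "cf (c a) 0 : N0" by(auto dest: spec[of _ "e a"])
 hence "cst (cf (c a) 0) : PN" by(simp add: cst_PN)
 thus ?thesis using d[OF a] c_mem[OF PN] by blast
qed

end

section \<open>A model over the stalk at the generic point\<close>

text \<open>
 A type-class ring has to surject onto the stalk at the generic point, which is a ring on a carrier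
 set depending on \<open>X\<close>. The families choosing an element in each commutative ring on the type form one.
\<close>

typedef 'u uring = "{f :: 'u set ring => 'u set. ALL R. f R : (if cring R then cr R else {undefined})}" morphisms fam Uring
proof
 show "(%R. if cring R then 0[R] else undefined) : {f :: 'u set ring => 'u set. ALL R. f R : (if cring R then cr R else {undefined})}"
  by(auto intro: cring.cring_simprules)
qed

definition ufam :: "('u set ring => 'u set) => 'u uring" where "ufam f = Uring (%R. if cring R then f R else undefined)"

lemma fam_closed: "cring R ==> fam u R : cr R" using fam[of u] by(auto split: if_splits)

lemma fam_ufam: assumes "!!R. cring R ==> f R : cr R" "cring R" shows "fam (ufam f) R = f R"
 unfolding ufam_def using assms by(subst Uring_inverse) auto

lemma uring_eqI: assumes "!!R. cring R ==> fam u R = fam v R" shows "u = v"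
proof -
 have "fam u R = fam v R" for R using assms[of R] fam[of u] fam[of v] by(cases "cring R") (auto split: if_splits dest!: spec[of _ R])
 thus ?thesis by(simp add: fam_inject[symmetric] fun_eq_iff)
qed

text \<open>The Boolean ring of subsets. It is a non-zero ring on every type \<open>'u set\<close>,
  which is what the axiom that 0 and 1 differ requires of the families.\<close>

lemma power_set_cring: "cring \<lparr>carrier = UNIV :: 'u set set, mult = (Int), one = UNIV, zero = {}, add = (%A B. (A - B) Un (B - A))\<rparr>"
proof (rule cringI)
 show "abelian_group \<lparr>carrier = UNIV :: 'u set set, mult = (Int), one = UNIV, zero = {}, add = (%A B. (A - B) Un (B - A))\<rparr>"
  by(rule abelian_groupI) auto
 show "Group.comm_monoid \<lparr>carrier = UNIV :: 'u set set, mult = (Int), one = UNIV, zero = {}, add = (%A B. (A - B) Un (B - A))\<rparr>"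
  by(rule comm_monoidI) auto
qed auto

instantiation uring :: (type) comm_ring_1
begin

definition "0 = ufam (%R. 0[R])"
definition "1 = ufam (%R. 1[R])"
definition "u + v = ufam (%R. fam u R +[R] fam v R)"
definition "u * v = ufam (%R. fam u R *[R] fam v R)"
definition "- u = ufam (%R. \<ominus>\<^bsub>R\<^esub> fam u R)"
definition "u - v = ufam (%R. fam u R \<ominus>\<^bsub>R\<^esub> fam v R)"

lemma fam_ops: assumes "cring R" shows "fam 0 R = 0[R]" "fam 1 R = 1[R]" "fam (u + v) R = fam u R +[R] fam v R"
  "fam (u * v) R = fam u R *[R] fam v R" "fam (- u) R = \<ominus>\<^bsub>R\<^esub> fam u R" "fam (u - v) R = fam u R \<ominus>\<^bsub>R\<^esub> fam v R"
 unfolding zero_uring_def one_uring_def plus_uring_def times_uring_def uminus_uring_def minus_uring_def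
 by(intro fam_ufam assms; simp add: cring.cring_simprules fam_closed)+

instance
proof (standard, goal_cases)
 case (10)
 show ?case
 proof
  assume "(0::'a uring) = 1"
  hence "fam (0::'a uring) R = fam 1 R" for R by simp
  from this[of "\<lparr>carrier = UNIV, mult = (Int), one = UNIV, zero = {}, add = (%A B. (A - B) Un (B - A))\<rparr>"]
  show False by(simp add: fam_ops[OF power_set_cring])
 qed
qed (rule uring_eqI, simp add: fam_ops fam_closed cring.cring_simprules)+

end

locale generic = fixes X :: "('p, 'r, 'z) ringed_space_scheme" and \<xi> :: 'p
 assumes lrs: "is_locally_ringed_space X" and \<xi>: "\<xi> : topspace (space_top X)" and gen: "oin (space_top X) U ==> U ~= {} ==> \<xi> : U"
  and inj: "oin (space_top X) U ==> oin (space_top X) V ==> V ~= {} ==> V [= U ==> s : cr (Sec (str_sheaf X) U) ==> t : cr (Sec (str_sheaf X) U) ==>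
   restr (str_sheaf X) U V s = restr (str_sheaf X) U V t ==> s = t"
begin

abbreviation "T \<equiv> space_top X"
abbreviation "pts \<equiv> topspace T"
abbreviation "OX \<equiv> str_sheaf X"
abbreviation "SX \<equiv> Sec OX"
abbreviation "Sc U \<equiv> SX U"
abbreviation "R0 \<equiv> stalk_ring X \<xi>"
abbreviation "g U s \<equiv> germ T OX \<xi> U s"

definition opn :: "'p set => bool" where "opn U \<longleftrightarrow> oin T U & \<xi> : U"

lemma opn: "oin T U ==> U ~= {} ==> opn U" "opn U ==> oin T U" "opn U ==> U ~= {}" "opn U ==> \<xi> : U" "opn U ==> opn V ==> opn (U Int V)" "opn pts"
 using gen \<xi> by(auto simp: opn_def)

lemma O_cring: "oin T U ==> cring (Sc U)" using lrs by(simp add: is_locally_ringed_space_def is_ringed_space_def)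

lemma O_sheaf: "is_sheaf T OX" using lrs by(simp add: is_locally_ringed_space_def is_ringed_space_def)

lemma O_hom: "oin T U ==> oin T V ==> V [= U ==> restr OX U V : ring_hom (Sc U) (Sc V)"
 using lrs by(simp add: is_locally_ringed_space_def is_ringed_space_def)

lemma R0_cring: "cring R0" using lrs \<xi> by(simp add: is_locally_ringed_space_def local_ring_def)

lemma O_closed: "opn U ==> opn V ==> V [= U ==> s : cr (Sc U) ==> restr OX U V s : cr (Sc V)" using ring_hom_closed[OF O_hom] opn(2) by blast

lemma O_id: "opn U ==> s : cr (Sc U) ==> restr OX U U s = s"
 using conjunct1[OF conjunct2[OF conjunct1[OF O_sheaf[unfolded is_sheaf_def], unfolded is_presheaf_def]]] opn(2)[of U] by simp

lemma O_comp: "opn U ==> opn V ==> opn W ==> W [= V ==> V [= U ==> s : cr (Sc U) ==> restr OX V W (restr OX U V s) = restr OX U W s"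
 using conjunct2[OF conjunct2[OF conjunct1[OF O_sheaf[unfolded is_sheaf_def], unfolded is_presheaf_def]]]
  opn(2)[of U] opn(2)[of V] opn(2)[of W] by simp

lemma g_mem: "(V, t) : g U s \<longleftrightarrow> opn V & t : cr (Sc V) & (EX W. opn W & W [= U Int V & restr OX U W s = restr OX V W t)"
 unfolding germ_def opn_def by blast

lemma g_sub: assumes U: "opn U" "opn V" "opn Z" "Z [= U Int V" and s: "s : cr (Sc U)" "t : cr (Sc V)" and e: "restr OX U Z s = restr OX V Z t"
 shows "g U s [= g V t"
proof (rule subsetI, unfold split_paired_all)
 fix V' t' assume "(V', t') : g U s"
 then obtain W where W: "opn V'" "t' : cr (Sc V')" "opn W" "W [= U Int V'" "restr OX U W s = restr OX V' W t'" unfolding g_mem by blast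
 let ?W = "W Int Z"
 have o: "opn ?W" using opn(5) W(3) U(3) by blast
 have "restr OX V ?W t = restr OX Z ?W (restr OX V Z t)" using O_comp[OF U(2,3) o _ _ s(2)] U(4) by simp
 also have "\<dots> = restr OX U ?W s" unfolding e[symmetric] using O_comp[OF U(1,3) o _ _ s(1)] U(4) by simp
 also have "\<dots> = restr OX W ?W (restr OX U W s)" using O_comp[OF U(1) W(3) o _ _ s(1)] W(4) by simp
 also have "\<dots> = restr OX V' ?W t'" unfolding W(5) using O_comp[OF W(1,3) o _ _ W(2)] W(4) by simp
 finally show "(V', t') : g V t" unfolding g_mem using o W U(4) by blast
qed

text \<open>Injectivity of restrictions makes equality of germs at the generic point the same as
  equality on any single neighbourhood \<open>Z\<close> of it inside the intersection.\<close>

lemma g_eq: assumes U: "opn U" "opn V" "opn Z" "Z [= U Int V" and s: "s : cr (Sc U)" "t : cr (Sc V)"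
 shows "g U s = g V t \<longleftrightarrow> restr OX U Z s = restr OX V Z t"
proof
 assume e: "restr OX U Z s = restr OX V Z t"
 show "g U s = g V t" using g_sub[OF U s e] g_sub[OF U(2,1,3) _ s(2,1) e[symmetric]] U(4) by blast
next
 assume e: "g U s = g V t"
 have "(V, t) : g V t" unfolding g_mem using U(2) s(2) by blast
 then obtain W where W: "opn W" "W [= U Int V" "restr OX U W s = restr OX V W t" unfolding e[symmetric] g_mem by blast
 have o: "opn (U Int V)" "opn (W Int Z)" using opn(5) U W by auto
 have c: "restr OX U (U Int V) s : cr (Sc (U Int V))" "restr OX V (U Int V) t : cr (Sc (U Int V))"
  using O_closed[OF U(1) o(1) _ s(1)] O_closed[OF U(2) o(1) _ s(2)] by auto
 have "restr OX (U Int V) W (restr OX U (U Int V) s) = restr OX (U Int V) W (restr OX V (U Int V) t)"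
  using O_comp[OF U(1) o(1) W(1,2) _ s(1)] O_comp[OF U(2) o(1) W(1,2) _ s(2)] W(3) by simp
 from inj[OF opn(2)[OF o(1)] opn(2)[OF W(1)] opn(3)[OF W(1)] W(2) c this]
 have "restr OX U (U Int V) s = restr OX V (U Int V) t" .
 thus "restr OX U Z s = restr OX V Z t" using O_comp[OF U(1) o(1) U(3,4) _ s(1)] O_comp[OF U(2) o(1) U(3,4) _ s(2)] by simp
qed

lemma g_inj: "opn U ==> s : cr (Sc U) ==> t : cr (Sc U) ==> g U s = g U t ==> s = t" using g_eq[of U U U s t] O_id by auto

lemma g_restr: "opn U ==> opn V ==> V [= U ==> s : cr (Sc U) ==> g V (restr OX U V s) = g U s" by(subst g_eq[of V U V]) (auto simp: O_closed O_id)

lemma g_surj: "a : cr R0 \<longleftrightarrow> (EX U s. opn U & s : cr (Sc U) & a = g U s)"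
 unfolding stalk_ring_def Let_def stalk_carrier_def opn_def by auto

lemma g_ne: "opn U ==> s : cr (Sc U) ==> g U s ~= {}" using g_mem[of U s U s] by blast

text \<open>One argument for sums and products: \<open>f\<close> stands for an operation that is
  compatible with restriction.\<close>

lemma g_op: assumes U: "opn U" "opn U'" and s: "s : cr (Sc U)" "s' : cr (Sc U')"
  and f: "!!U V a b. opn U ==> opn V ==> V [= U ==> a : cr (Sc U) ==> b : cr (Sc U) ==>
   f U a b : cr (Sc U) & restr OX U V (f U a b) = f V (restr OX U V a) (restr OX U V b)"
 shows "(UN (V, t):g U s. UN (V', t'):g U' s'. g (V Int V') (f (V Int V') (restr OX V (V Int V') t) (restr OX V' (V Int V') t')))
  = g (U Int U') (f (U Int U') (restr OX U (U Int U') s) (restr OX U' (U Int U') s'))"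
proof (rule UN_pair_const[OF g_ne[OF U(1) s(1)] g_ne[OF U(2) s(2)]])
 fix V t V' t' assume "(V, t) : g U s" "(V', t') : g U' s'"
 then obtain W W' where V: "opn V" "t : cr (Sc V)" "opn W" "W [= U Int V" "restr OX U W s = restr OX V W t"
  and V': "opn V'" "t' : cr (Sc V')" "opn W'" "W' [= U' Int V'" "restr OX U' W' s' = restr OX V' W' t'" unfolding g_mem by blast
 let ?V = "V Int V'" and ?U = "U Int U'" and ?W = "W Int W'"
 have o: "opn ?V" "opn ?U" "opn ?W" using opn(5) U V V' by auto
 note c = O_closed[OF V(1) o(1) _ V(2)] O_closed[OF V'(1) o(1) _ V'(2)] O_closed[OF U(1) o(2) _ s(1)] O_closed[OF U(2) o(2) _ s(2)]
 have sub: "?W [= ?V" "?W [= ?U" "?W [= W" "?W [= W'" "W [= U" "W [= V" "W' [= U'" "W' [= V'" "?V [= V" "?V [= V'" "?U [= U" "?U [= U'"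
  using V V' by auto
 have e: "restr OX V ?W t = restr OX U ?W s" "restr OX V' ?W t' = restr OX U' ?W s'"
  using O_comp[OF V(1,3) o(3) sub(3,6) V(2)] O_comp[OF U(1) V(3) o(3) sub(3,5) s(1)] V(5)
   O_comp[OF V'(1,3) o(3) sub(4,8) V'(2)] O_comp[OF U(2) V'(3) o(3) sub(4,7) s(2)] V'(5) by simp_all
 have "restr OX ?V ?W (f ?V (restr OX V ?V t) (restr OX V' ?V t')) = restr OX ?U ?W (f ?U (restr OX U ?U s) (restr OX U' ?U s'))"
  using f[OF o(1,3) sub(1) c(1,2)] f[OF o(2,3) sub(2) c(3,4)] O_comp[OF V(1) o(1,3) sub(1,9) V(2)]
   O_comp[OF V'(1) o(1,3) sub(1,10) V'(2)] O_comp[OF U(1) o(2,3) sub(2,11) s(1)] O_comp[OF U(2) o(2,3) sub(2,12) s(2)] e sub by simp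
 thus "g ?V (f ?V (restr OX V ?V t) (restr OX V' ?V t')) = g ?U (f ?U (restr OX U ?U s) (restr OX U' ?U s'))"
  using f[OF o(1,1) order_refl c(1,2)] f[OF o(2,2) order_refl c(3,4)] sub by(subst g_eq[OF o(1,2,3)]) auto
qed

lemma g_hom: assumes U: "opn U" shows "g U : ring_hom (Sc U) R0"
proof (rule ring_hom_memI)
 show "g U s : cr R0" if "s : cr (Sc U)" for s using that U g_surj by blast
 fix s t assume s: "s : cr (Sc U)" "t : cr (Sc U)"
 have fm: "opn U ==> opn V ==> V [= U ==> a : cr (Sc U) ==> b : cr (Sc U) ==>
   a *[Sc U] b : cr (Sc U) & restr OX U V (a *[Sc U] b) = restr OX U V a *[Sc V] restr OX U V b" for U V a b
  using ring_hom_mult[OF O_hom] cring.cring_simprules(5)[OF O_cring] opn(2) by metis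
 have fa: "opn U ==> opn V ==> V [= U ==> a : cr (Sc U) ==> b : cr (Sc U) ==>
   a +[Sc U] b : cr (Sc U) & restr OX U V (a +[Sc U] b) = restr OX U V a +[Sc V] restr OX U V b" for U V a b
  using ring_hom_add[OF O_hom] cring.cring_simprules(1)[OF O_cring] opn(2) by metis
 show "g U (s *[Sc U] t) = g U s *[R0] g U t" using g_op[OF U U s, of "%U a b. a *[Sc U] b", OF fm] O_id[OF U s(1)] O_id[OF U s(2)]
  by(simp add: stalk_ring_def Let_def)
 show "g U (s +[Sc U] t) = g U s +[R0] g U t" using g_op[OF U U s, of "%U a b. a +[Sc U] b", OF fa] O_id[OF U s(1)] O_id[OF U s(2)]
  by(simp add: stalk_ring_def Let_def stalk_add_def)
next
 have "restr OX pts U 1[Sc pts] = 1[Sc U]" using ring_hom_one[OF O_hom[OF openin_topspace opn(2)[OF U] openin_subset[OF opn(2)[OF U]]]] .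
 thus "g U 1[Sc U] = 1[R0]" using g_restr[OF opn(6) U, of "1[Sc pts]"] openin_subset[OF opn(2)[OF U]] cring.cring_simprules(6)[OF O_cring]
  by(simp add: stalk_ring_def Let_def)
qed

end

text \<open>A model inside polynomials over \<open>'c\<close>, with the constants modulo
  \<open>PN\<close> as \<open>K\<close>. \<open>\<pi>\<close> sends a constant to a germ and is used
  to code the test sheaves for ampleness; \<open>K_open\<close> says that a germ at the generic
  point is regular on a non-empty open set; \<open>nat_inv\<close> is how characteristic zero
  enters.\<close>

locale wmodel = polyring N0 + gmodel X "polyring.PK N0" "polyring.PN N0" Ox tu
 for N0 :: "'c::comm_ring_1 set" and X :: "('p, 'r, 'z) ringed_space_scheme" and Ox tu + fixes \<pi> :: "'c => ('p set \<times> 'r) set"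
 assumes pi_eq: "\<pi> c = \<pi> d \<longleftrightarrow> c - d : N0" and K_open: "a : PK ==> EX U. oin (space_top X) U & U ~= {} & a : sec Ox U"
  and one_PN: "1 \<notin> PN" and nat_inv: "m > 0 ==> EX i:sec Ox (topspace (space_top X)). of_nat m * i - 1 : PN"
  and pts_ne: "topspace (space_top X) ~= {}"

context generic
begin

definition pz :: "('p set \<times> 'r) uring => ('p set \<times> 'r) set" where "pz c = fam c R0"
definition Nz :: "('p set \<times> 'r) uring set" where "Nz = {c. pz c = 0[R0]}"

lemmas R0_simps = cring.cring_simprules[OF R0_cring]

lemma pz: "pz c : cr R0" "pz 0 = 0[R0]" "pz 1 = 1[R0]" "pz (c + d) = pz c +[R0] pz d"
 "pz (c * d) = pz c *[R0] pz d" "pz (- c) = \<ominus>\<^bsub>R0\<^esub> pz c" "pz (c - d) = pz c \<ominus>\<^bsub>R0\<^esub> pz d"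
 by(simp_all add: pz_def fam_ops[OF R0_cring] fam_closed[OF R0_cring])

text \<open>An element of \<open>R0\<close> is completed to a family by taking zero at all other
  rings.\<close>

lemma pz_surj: "a : cr R0 ==> EX c. pz c = a"
proof
 assume a: "a : cr R0"
 have "fam (ufam (%R. if R = R0 then a else 0[R])) R0 = (if R0 = R0 then a else 0[R0])"
  using a cring.cring_simprules(2) by(intro fam_ufam R0_cring) auto
 thus "pz (ufam (%R. if R = R0 then a else 0[R])) = a" by(simp add: pz_def)
qed

lemma Nz: "osub UNIV Nz" unfolding osub_def Nz_def by(auto simp: pz R0_simps)

lemma pz_eq: "pz c = pz d \<longleftrightarrow> c - d : Nz"
 using ring.minus_eq_zero_iff[OF cring.axioms(1)[OF R0_cring], of "pz c" "pz d"] by(simp add: Nz_def pz)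

interpretation polyring Nz by(rule polyring.intro[OF Nz])

text \<open>The other coefficients are ignored, so \<open>kp\<close> is multiplicative only on
  \<open>PK\<close>.\<close>

definition kp :: "('p set \<times> 'r) uring wpoly => ('p set \<times> 'r) set" where "kp w = pz (cf w 0)"

lemma kp: "kp w : cr R0" "kp 0 = 0[R0]" "kp 1 = 1[R0]" "kp (v + w) = kp v +[R0] kp w" "kp (- w) = \<ominus>\<^bsub>R0\<^esub> kp w"
 by(simp_all add: kp_def pz lookup_add)

lemma kp_mult: "a : PK ==> b : PK ==> kp (a * b) = kp a *[R0] kp b"
 using coef_mult[of a b] pz_eq[of "cf (a * b) 0" "cf a 0 * cf b 0"] by(simp add: kp_def pz)

lemma kp_zero: assumes "a : PK" shows "kp a = 0[R0] \<longleftrightarrow> a : PN"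
proof -
 have "kp a = 0[R0] \<longleftrightarrow> cf a 0 : Nz" by(simp add: kp_def Nz_def)
 also have "\<dots> \<longleftrightarrow> a : PN" using assms unfolding PK_def PN_def by(simp, metis)
 finally show ?thesis .
qed

definition Oz :: "'p => ('p set \<times> 'r) uring wpoly set" where "Oz x = {w : PK. EX U s. opn U & x : U & s : cr (Sc U) & g U s = kp w}"

definition tz :: "'p set => ('p set \<times> 'r) uring wpoly => 'r" where "tz U w = (SOME s. s : cr (Sc U) & g U s = kp w)"

lemma g_cring: "opn U ==> ring_hom_cring (Sc U) R0 (g U)" by(intro ring_hom_cring.intro ring_hom_cring_axioms.intro g_hom R0_cring O_cring opn(2))

lemma Oz_osubring: assumes x: "x : pts" shows "osubring (Oz x)"
proof -
 interpret P: ring_hom_cring "Sc pts" R0 "g pts" by(rule g_cring[OF opn(6)])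
 have "kp (- 1) = \<ominus>\<^bsub>R0\<^esub> 1[R0]" by(simp only: kp)
 moreover have pI: "w : PK ==> s : cr (Sc pts) ==> g pts s = kp w ==> w : Oz x" for w s unfolding Oz_def using opn(6) x by blast
 ultimately have 1: "1 : Oz x" "- 1 : Oz x" "0 : Oz x"
  using pI[of 1 "1[Sc pts]"] pI[of "- 1" "\<ominus>\<^bsub>Sc pts\<^esub> 1[Sc pts]"] pI[of 0 "0[Sc pts]"] osrD(1-3)[OF PK]
   P.hom_one P.hom_zero P.hom_a_inv[of "1[Sc pts]"] kp(2,3) by simp_all
 have 2: "a + b : Oz x & a * b : Oz x" if ab: "a : Oz x" "b : Oz x" for a b
 proof -
  obtain U s where U: "opn U" "x : U" "s : cr (Sc U)" "g U s = kp a" "a : PK" using ab unfolding Oz_def by blast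
  obtain V t where V: "opn V" "x : V" "t : cr (Sc V)" "g V t = kp b" "b : PK" using ab unfolding Oz_def by blast
  have o: "opn (U Int V)" using opn(5) U V by blast
  interpret I: ring_hom_cring "Sc (U Int V)" R0 "g (U Int V)" by(rule g_cring[OF o])
  let ?s = "restr OX U (U Int V) s" and ?t = "restr OX V (U Int V) t"
  have c: "?s : cr (Sc (U Int V))" "?t : cr (Sc (U Int V))" using O_closed[OF U(1) o _ U(3)] O_closed[OF V(1) o _ V(3)] by auto
  have e: "g (U Int V) ?s = kp a" "g (U Int V) ?t = kp b" using g_restr[OF U(1) o _ U(3)] g_restr[OF V(1) o _ V(3)] U V by auto
  have "g (U Int V) (?s +[Sc (U Int V)] ?t) = kp (a + b)" "g (U Int V) (?s *[Sc (U Int V)] ?t) = kp (a * b)"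
   using c e kp(4) kp_mult[OF U(5) V(5)] by simp_all
  thus ?thesis unfolding Oz_def using o U V c osrD(4,5)[OF PK U(5) V(5)] I.R.a_closed I.R.m_closed by blast
 qed
 show ?thesis unfolding osubring_def osub_def using 1 2 by blast
qed

text \<open>Regularity at each point gives local sections with the same germ at the generic point.
  By injectivity of restrictions they agree on overlaps, and the sheaf axiom glues them.\<close>

lemma sec_Oz_glue: assumes U: "opn U" and a: "a : sec Oz U" shows "EX s. s : cr (Sc U) & g U s = kp a"
proof -
 define C where "C = {V. opn V & V [= U & (EX s. s : cr (Sc V) & g V s = kp a)}"
 define s where "s V = (SOME s. s : cr (Sc V) & g V s = kp a)" for V
 have s: "s V : cr (Sc V)" "g V (s V) = kp a" if "V : C" for V
  using that someI_ex[of "%s. s : cr (Sc V) & g V s = kp a"] unfolding C_def s_def by blast+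
 have C: "opn V" "V [= U" if "V : C" for V using that by(auto simp: C_def)
 have "EX V:C. x : V" if x: "x : U" for x
 proof -
  obtain V t where V: "opn V" "x : V" "t : cr (Sc V)" "g V t = kp a" using secD[OF a x] unfolding Oz_def by blast
  have o: "opn (U Int V)" using opn(5) U V by blast
  have "U Int V : C" unfolding C_def
   using o O_closed[OF V(1) o _ V(3)] g_restr[OF V(1) o _ V(3)] V(4) by(auto intro!: exI[of _ "restr OX V (U Int V) t"])
  thus ?thesis using x V by blast
 qed
 hence e: "\<Union>C = U" using C by blast
 have ag: "restr OX V (V Int V') (s V) = restr OX V' (V Int V') (s V')" if V: "V : C" "V' : C" for V V'
  using g_eq[OF C(1)[OF V(1)] C(1)[OF V(2)] opn(5)[OF C(1)[OF V(1)] C(1)[OF V(2)]] order_refl s(1)[OF V(1)] s(1)[OF V(2)]]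
   s(2)[OF V(1)] s(2)[OF V(2)] by simp
 have "(ALL V:C. oin T V & s V : cr (Sc V)) & (ALL V:C. ALL V':C. restr OX V (V Int V') (s V) = restr OX V' (V Int V') (s V'))"
  using ag s(1) opn(2)[OF C(1)] by auto
 hence "EX t:cr (Sc (\<Union>C)). ALL V:C. restr OX (\<Union>C) V t = s V"
  by(rule mp[OF spec[OF spec[OF conjunct2[OF conjunct2[OF O_sheaf[unfolded is_sheaf_def]]]]]])
 then obtain t where t: "t : cr (Sc U)" "!!V. V : C ==> restr OX U V t = s V" unfolding e by blast
 obtain V where V: "V : C" using e opn(3)[OF U] by blast
 have "g U t = kp a" using g_restr[OF U C[OF V] t(1)] t(2)[OF V] s(2)[OF V] by simp
 thus ?thesis using t(1) by blast
qed

lemma sec_Oz: assumes U: "opn U" shows "a : sec Oz U \<longleftrightarrow> a : PK & (EX s. s : cr (Sc U) & g U s = kp a)"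
proof
 assume a: "a : sec Oz U"
 have "a : PK" using secD[OF a opn(4)[OF U]] by(simp add: Oz_def)
 thus "a : PK & (EX s. s : cr (Sc U) & g U s = kp a)" using sec_Oz_glue[OF U a] by blast
next
 assume "a : PK & (EX s. s : cr (Sc U) & g U s = kp a)"
 thus "a : sec Oz U" unfolding sec_def Oz_def using U by blast
qed

lemma tz: assumes U: "opn U" and a: "a : sec Oz U"
 shows "tz U a : cr (Sc U)" "g U (tz U a) = kp a" "s : cr (Sc U) ==> g U s = kp a ==> tz U a = s" "a : PK"
proof -
 show 1: "tz U a : cr (Sc U)" "g U (tz U a) = kp a" using someI_ex[OF sec_Oz_glue[OF U a]] by(simp_all add: tz_def)
 show "s : cr (Sc U) ==> g U s = kp a ==> tz U a = s" using g_inj[OF U 1(1)] 1(2) by simp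
 show "a : PK" using sec_Oz[OF U] a by blast
qed

lemma Oz_sub: "PN [= Oz x" if "x : pts" for x
proof
 fix a assume a: "a : PN"
 interpret P: ring_hom_cring "Sc pts" R0 "g pts" by(rule g_cring[OF opn(6)])
 have "kp a = 0[R0]" using kp_zero a PN_PK by blast
 thus "a : Oz x" unfolding Oz_def using subsetD[OF PN_PK a] opn(6) that P.hom_zero P.R.zero_closed by blast
qed

lemma Oz_named_ring: assumes U': "oin T U" "U ~= {}" shows "nring (Sc U) (sec Oz U) PN (tz U)"
proof -
 have U: "opn U" by(rule opn(1)[OF U'])
 interpret G: ring_hom_cring "Sc U" R0 "g U" by(rule g_cring[OF U])
 have A: "osubring (sec Oz U)"
 proof -
  have 1: "osubring (Oz x)" if "x : U" for x using Oz_osubring openin_subset[OF U'(1)] that by blast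
  show ?thesis by(auto simp: osubring_def osub_def sec_def osrD[OF 1])
 qed
 show "nring (Sc U) (sec Oz U) PN (tz U)"
 proof (unfold_locales, goal_cases)
  case 1 show ?case by(rule A)
 next
  case 2 show ?case by(rule PN)
 next
  case 3 show ?case using Oz_sub openin_subset[OF U'(1)] unfolding sec_def by blast
 next
  case (4 a) thus ?case using tz(1)[OF U] by blast
 next
  case (5 r)
  obtain c where c: "pz c = g U r" using pz_surj[OF G.hom_closed[OF 5]] by blast
  have k: "kp (cst c) = g U r" by(simp add: kp_def c)
  have "cst c : sec Oz U" using sec_Oz[OF U] PK_cst k 5 by metis
  thus ?case using tz(3)[OF U _ 5] k by metis
 next
  case (6 a b)
  note ab = tz(1,2)[OF U 6(1)] tz(1,2)[OF U 6(2)]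
  have "tz U a +[Sc U] tz U b : cr (Sc U)" "g U (tz U a +[Sc U] tz U b) = kp (a + b)"
   using G.R.a_closed[OF ab(1,3)] G.hom_add[OF ab(1,3)] ab(2,4) by(simp_all add: kp)
  thus ?case by(rule tz(3)[OF U osrD(4)[OF A 6]])
 next
  case (7 a b)
  note ab = tz(1,2)[OF U 7(1)] tz(1,2)[OF U 7(2)]
  have "tz U a *[Sc U] tz U b : cr (Sc U)" "g U (tz U a *[Sc U] tz U b) = kp (a * b)"
   using G.R.m_closed[OF ab(1,3)] G.hom_mult[OF ab(1,3)] ab(2,4) kp_mult[OF tz(4)[OF U 7(1)] tz(4)[OF U 7(2)]] by simp_all
  thus ?case by(rule tz(3)[OF U osrD(5)[OF A 7]])
 next
  case 8
  show ?case by(rule tz(3)[OF U osrD(1)[OF A] G.R.one_closed]) (simp add: kp)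
 next
  case (9 a)
  have "tz U a = 0[Sc U] \<longleftrightarrow> kp a = 0[R0]" using tz(2)[OF U 9] g_inj[OF U tz(1)[OF U 9] G.R.zero_closed] G.hom_zero by auto
  thus ?case using kp_zero tz(4)[OF U 9] by blast
 qed
qed

theorem generic_gmodel: "gmodel X PK PN Oz tz"
proof (rule gmodel.intro)
 show "is_locally_ringed_space X" by(rule lrs)
 show "U Int V ~= {}" if "oin T U" "oin T V" "U ~= {}" "V ~= {}" for U V using gen that by blast
 show "osubring PK" by(rule PK)
 show "osub UNIV PN" by(rule PN)
 show "osubring (Oz x)" if "x : pts" for x by(rule Oz_osubring[OF that])
 show "PN [= Oz x" if "x : pts" for x by(rule Oz_sub[OF that])
 show "Oz x [= PK" for x by(auto simp: Oz_def)
 show "EX U. oin T U & x : U & a : sec Oz U" if x: "x : pts" and a: "a : Oz x" for x a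
 proof -
  obtain U s where U: "opn U" "x : U" "s : cr (Sc U)" "g U s = kp a" "a : PK" using a unfolding Oz_def by blast
  have "a : sec Oz U" using sec_Oz[OF U(1)] U by blast
  thus ?thesis using opn(2)[OF U(1)] U(2) by blast
 qed
 show "nring (Sc U) (sec Oz U) PN (tz U)" if "oin T U" "U ~= {}" for U by(rule Oz_named_ring[OF that])
 show "restr OX U V (tz U a) = tz V a" if o: "oin T U" "oin T V" "V ~= {}" "V [= U" "a : sec Oz U" for U V a
 proof -
  have U: "opn U" "opn V" using opn(1) o by blast+
  have "a : sec Oz V" using o(5) by(rule sec_mono[OF o(4)])
  thus ?thesis using tz(1,2)[OF U(1) o(5)] O_closed[OF U o(4) tz(1)[OF U(1) o(5)]] g_restr[OF U o(4) tz(1)[OF U(1) o(5)]] tz(3)[OF U(2)] by simp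
 qed
qed

text \<open>The image of \<open>inverse (of_nat m)\<close> under \<open>sc\<close> is a global
  function, and any name of it is the inverse required by \<open>nat_inv\<close>.
  \<open>1 : PN\<close> is impossible because the generic stalk is a local ring, hence not the zero
  ring.\<close>

theorem generic_wmodel:
 assumes sc: "sc : ring_hom \<lparr>carrier = UNIV :: 'k::field_char_0 set, mult = (*), one = 1, zero = 0, add = (+)\<rparr> (Sc pts)"
 shows "wmodel Nz X Oz tz pz"
proof -
 interpret G: gmodel X PK PN Oz tz by(rule generic_gmodel)
 interpret P: nring "Sc pts" "sec Oz pts" PN "tz pts" using G.nr \<xi> by auto
 show ?thesis
 proof (intro wmodel.intro wmodel_axioms.intro)
  show "polyring Nz" by(rule polyring.intro[OF Nz])
  show "gmodel X PK PN Oz tz" by(rule generic_gmodel)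
  show "pz c = pz d \<longleftrightarrow> c - d : Nz" for c d by(rule pz_eq)
  show "pts ~= {}" using \<xi> by blast
  show "1 \<notin> PN"
  proof
   assume "1 : PN"
   hence z: "1[R0] = 0[R0]" using kp_zero[OF osrD(1)[OF PK]] kp(3) by simp
   have "local_ring R0" using lrs \<xi> by(simp add: is_locally_ringed_space_def)
   then obtain m where m: "maximalideal m R0" unfolding local_ring_def by blast
   have "1[R0] : m" unfolding z by(rule additive_subgroup.zero_closed[OF ideal.axioms(1)[OF maximalideal.axioms(1)[OF m]]])
   thus False using ideal.one_imp_carrier[OF maximalideal.axioms(1)[OF m]] maximalideal.I_notcarr[OF m] by blast
  qed
  show "EX U. oin T U & U ~= {} & a : sec Oz U" if a: "a : PK" for a
  proof -
   obtain U s where U: "opn U" "s : cr (Sc U)" "kp a = g U s" using kp(1)[of a] g_surj by blast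
   thus ?thesis using sec_Oz[OF U(1)] a opn(2,3)[OF U(1)] by metis
  qed
  fix m :: nat assume m: "m > 0"
  have n: "tz pts (of_nat k) = sc (of_nat k)" for k
  proof (induction k)
   case 0
   have "sc 0 +[Sc pts] sc 0 = sc 0" "sc 0 : cr (Sc pts)" using ring_hom_add[OF sc, of 0 0] ring_hom_closed[OF sc, of 0] by simp_all
   thus ?case using P.tau_zero P.add.l_cancel_one by simp
  next
   case (Suc k)
   have "sc (1 + of_nat k) = 1[Sc pts] +[Sc pts] sc (of_nat k)" using ring_hom_add[OF sc, of 1 "of_nat k"] ring_hom_one[OF sc] by simp
   thus ?case using Suc P.tau_add[OF osrD(1)[OF P.A] osubring_of_nat[OF P.A, of k]] P.tau_one by simp
  qed
  obtain i where i: "i : sec Oz pts" "tz pts i = sc (inverse (of_nat m))" using P.tau_surj[OF ring_hom_closed[OF sc]] by auto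
  have "tz pts (of_nat m * i) = 1[Sc pts]" using P.tau_mult[OF osubring_of_nat[OF P.A, of m] i(1)] n[of m] i(2) m
    ring_hom_mult[OF sc, of "of_nat m" "inverse (of_nat m)"] ring_hom_one[OF sc] by simp
  hence "of_nat m * i - 1 : PN" using P.tau_eq[OF osrD(5)[OF P.A osubring_of_nat[OF P.A, of m] i(1)] osrD(1)[OF P.A]] P.tau_one by simp
  thus "EX i:sec Oz pts. of_nat m * i - 1 : PN" using i(1) by blast
 qed
qed

end

theorem projective_wmodel: fixes X :: "('p, 'r, 'k::field_char_0) space_over" assumes X: "projective_variety X"
 shows "EX (N0 :: ('p set \<times> 'r) uring set) Ox tu \<pi>. wmodel N0 X Ox tu \<pi>"
proof (rule projective_generic[OF X])
 fix \<xi> assume x: "\<xi> : topspace (space_top X)" "!!U. oin (space_top X) U ==> U ~= {} ==> \<xi> : U"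
  "!!U V s t. oin (space_top X) U ==> oin (space_top X) V ==> V ~= {} ==> V [= U ==> s : cr (Sec (str_sheaf X) U) ==> t : cr (Sec (str_sheaf X) U) ==>
   restr (str_sheaf X) U V s = restr (str_sheaf X) U V t ==> s = t"
 have l: "is_locally_ringed_space_over X" using X by(simp add: projective_variety_def)
 interpret generic X \<xi> by(rule generic.intro) (use x l in \<open>auto simp: is_locally_ringed_space_over_def\<close>)
 have "wmodel Nz X Oz tz pz" by(rule generic_wmodel[of "scalar_map X"]) (use l in \<open>simp add: is_locally_ringed_space_over_def\<close>)
 thus "EX (N0 :: ('p set \<times> 'r) uring set) Ox tu \<pi>. wmodel N0 X Ox tu \<pi>" by blast
qed

section \<open>Iterated symmetric powers as lattices of linear forms\<close>

section \<open>Lattices of linear forms\<close>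

abbreviation var :: "nat => 'c::comm_ring_1 wpoly" where "var i \<equiv> mon {#i#}"

lemma prod_var: "prod_mset (image_mset var m) = mon m" by(induction m) (simp_all add: mult_single)

context polyring
begin

lemma lin_prod_mset: assumes "!!m m'. f (m + m') = f m * f m'" "f 0 = 1" shows "lin f (prod_mset A) = prod_mset (image_mset (lin f) A)"
proof (induction A)
 case empty
 thus ?case using lin_mono[of f 0] assms(2) by simp
qed (simp add: lin_mult[OF assms(1)])

lemma cong_prod_mset: "(!!b. b \<in># A ==> f b - h b : PN) ==> prod_mset (image_mset f A) - prod_mset (image_mset h A) : PN"
 by(induction A) (auto intro: c_mult[OF PN] simp: osubD(1)[OF PN])

lemma PK_sum: "(!!i. i : I ==> f i : PK) ==> sum f I : PK" by(rule osub_sum[OF osr_osub[OF PK]])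

text \<open>A change of variables turns the members of a basis of a space of linear forms into variables.\<close>

lemma basis_to_vars: assumes B: "finite B" and ind: "ALL c. (ALL b:B. c b : PK) & (SUM b:B. c b * b) : PN --> (ALL b:B. c b : PN)"
  and BI: "B [= fspan PN PK (var ` I)" and IB: "var ` I [= fspan PN PK B"
 shows "EX f. (ALL m m'. f (m + m') = f m * f m') & f 0 = 1 & (ALL b:B. lin f b - var (idx b) : PN)"
proof -
 have "ALL i:I. EX c. (ALL b:B. c b : PK) & var i - (SUM b:B. c b * b) : PN" using IB unfolding fspan_def by blast
 from bchoice[OF this] obtain S where S': "ALL i:I. (ALL b:B. S i b : PK) & var i - (SUM b:B. S i b * b) : PN" by blast
 have S: "S i b : PK" "var i - (SUM b:B. S i b * b) : PN" if "i : I" "b : B" for i b using S' that by auto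
 \<comment> \<open>The substitution that expresses each variable through \<open>B\<close> and then
   replaces every \<open>b\<close> by the variable \<open>var (idx b)\<close>.\<close>
 define f where "f m = prod_mset (image_mset (%i. SUM b:B. S i b * var (idx b)) m)" for m
 have f: "f (m + m') = f m * f m'" "f 0 = 1" for m m' by(simp_all add: f_def)
 have "lin f b - var (idx b) : PN" if b: "b : B" for b
 proof -
  have iv: "inj_on var I" by(rule inj_onI) (auto dest!: arg_cong[of _ _ Poly_Mapping.keys])
  obtain t where t: "ALL v:var ` I. t v : PK" "b - (SUM v:var ` I. t v * v) : PN" using BI b unfolding fspan_def by blast
  have e: "(SUM v:var ` I. t v * h v) = (SUM i:I. t (var i) * h (var i))" for h by(simp add: sum.reindex[OF iv])
  define d where "d b' = (SUM i:I. t (var i) * S i b')" for b'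
  have d: "d b' : PK" if "b' : B" for b' unfolding d_def using t(1) S(1) that by(intro PK_sum osrD(5)[OF PK]) auto
  have sw: "(SUM i:I. t (var i) * (SUM b':B. S i b' * h b')) = (SUM b':B. d b' * h b')" for h
   unfolding d_def sum_distrib_left sum_distrib_right by(subst sum.swap) (simp add: mult.assoc)
  have "(SUM i:I. t (var i) * var i) - (SUM i:I. t (var i) * (SUM b':B. S i b' * b')) : PN"
   by(intro c_sum[OF PN] c_mult[OF PN c_refl[OF PN] S(2)[OF _ b]])
  hence "b - (SUM b':B. d b' * b') : PN" using c_trans[OF PN t(2)] unfolding e sw by blast
  hence "(SUM b':B. d b' * b') - b : PN" by(rule c_sym[OF PN])
  moreover have "(SUM b':B. (if b' = b then 1 else 0) * b') = b" using B b by(subst sum.cong[OF refl, of _ _ "%b'. if b' = b then b' else 0"]) auto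
  ultimately have "(SUM b':B. (d b' - (if b' = b then 1 else 0)) * b') : PN" by(simp only: left_diff_distrib sum_subtractf)
  \<comment> \<open>Expressing \<open>b\<close> through variables and these again through
    \<open>B\<close> gives the identity matrix modulo \<open>PN\<close>, because \<open>B\<close> is
    independent.\<close>
  hence "d b' - (if b' = b then 1 else 0) : PN" if "b' : B" for b'
   using that d osrD[OF PK] ind[rule_format, of "%b'. d b' - (if b' = b then 1 else 0)"] by simp
  hence 1: "(SUM b':B. d b' * var (idx b')) - (SUM b':B. (if b' = b then 1 else 0) * var (idx b')) : PN"
   by(intro c_sum[OF PN] c_mult[OF PN _ c_refl[OF PN]])
  have 2: "(SUM b':B. (if b' = b then 1 else 0) * var (idx b')) = (var (idx b) :: 'c wpoly)"
   using B b by(subst sum.cong[OF refl, of _ _ "%b'. if b' = b then var (idx b') else 0"]) auto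
  have "lin f (SUM i:I. t (var i) * var i) - (SUM i:I. t (var i) * lin f (var i)) : PN"
   unfolding lin_sum using t(1) by(intro c_sum[OF PN] lin_PK) auto
  hence 3: "lin f (SUM i:I. t (var i) * var i) - (SUM b':B. d b' * var (idx b')) : PN" using sw[of "%b. var (idx b)"] by(simp add: lin_mono f_def)
  have "lin f b - lin f (SUM i:I. t (var i) * var i) : PN" using lin_cong[OF t(2)] e by simp
  thus ?thesis using c_trans[OF PN c_trans[OF PN _ 3] 1] unfolding 2 by blast
 qed
 thus ?thesis using f by blast
qed

end

context wmodel
begin

text \<open>After the change of variables of \<open>basis_to_vars\<close> the elements of the frame
  are distinct variables modulo \<open>PN\<close>, and distinct monomials in variables are
  independent.\<close>

lemma vars_mon_indep: assumes B: "fr_at M U B" and BI: "B [= fspan PN PK (var ` I)" and IB: "var ` I [= fspan PN PK B" shows "mon_indep B q"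
 unfolding mon_indep_def
proof (intro allI impI ballI)
 fix c A assume c: "ALL A. c A : PK" and s: "(SUM A:msets B q. c A * prod_mset A) : PN" and A: "A : msets B q"
 note fB = fr_atD(1)[OF B]
 obtain idx :: "'c wpoly => nat" where idx: "inj_on idx B" using finite_imp_inj_to_nat_seg[OF fB] by blast
 obtain f where f: "!!m m'. f (m + m') = f m * f m'" "f 0 = (1::'c wpoly)" "!!b. b : B ==> lin f b - var (idx b) : PN"
  using basis_to_vars[OF fB conjunct2[OF conjunct2[OF B[unfolded fr_at_def]]] BI IB, of idx] by blast
 have "lin f (SUM A:msets B q. c A * prod_mset A) - (SUM A:msets B q. c A * mon (image_mset idx A)) : PN" unfolding lin_sum
 proof (intro c_sum[OF PN])
  fix A assume "A : msets B q"
  hence "prod_mset (image_mset (lin f) A) - prod_mset (image_mset (%b. var (idx b)) A) : PN" by(intro cong_prod_mset f(3)) (auto simp: msets_def)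
  hence "lin f (prod_mset A) - mon (image_mset idx A) : PN"
   unfolding lin_prod_mset[OF f(1,2)] using prod_var[of "image_mset idx A", where 'a = 'c] by(simp add: multiset.map_comp comp_def)
  thus "lin f (c A * prod_mset A) - c A * mon (image_mset idx A) : PN" using c_trans[OF PN lin_PK c_mult[OF PN c_refl[OF PN]]] c by blast
 qed
 hence s': "(SUM A:msets B q. c A * mon (image_mset idx A)) : PN" using lin_PN[OF s] c_mem[OF PN] by blast
 have "inj_on (image_mset idx) (msets B q)"
 proof (rule inj_onI)
  fix A A' assume a: "A : msets B q" "A' : msets B q" "image_mset idx A = image_mset idx A'"
  have inv: "image_mset (the_inv_into B idx) (image_mset idx C) = C" if C: "set_mset C [= B" for C
  proof -
   have "image_mset (%x. the_inv_into B idx (idx x)) C = image_mset (%x. x) C" using the_inv_into_f_f[OF idx] C by(intro image_mset_cong) blast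
   thus ?thesis by(simp add: image_mset.compositionality comp_def)
  qed
  have "set_mset A [= B" "set_mset A' [= B" using a(1,2) by(auto simp: msets_def)
  from inv[OF this(1)] inv[OF this(2)] show "A = A'" using a(3) by metis
 qed
 from mono_indep[OF finite_msets[OF fB] this _ s' A] show "c A : PN" using c by simp
qed

definition lintype :: "('p => 'c wpoly set) => nat set => bool" where "lintype M I \<longleftrightarrow> finite I & based M (var ` I)"

lemma lintype_frame: assumes "lintype M I" "x : pts" shows "EX U B. oin T U & x : U & fr_at M U B & mon_indep B q &
  B [= fspan PN PK (var ` I) & var ` I [= fspan PN PK B"
proof -
 have "based M (var ` I)" using assms(1) by(simp add: lintype_def)
 from bspec[OF this[unfolded based_def] assms(2)]
 obtain U B where U: "oin T U" "x : U" and fr: "fr_at M U B" "B [= fspan PN PK (var ` I)" "var ` I [= fspan PN PK B" by(elim exE conjE)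
 show ?thesis by(rule exI[of _ U], rule exI[of _ B]) (simp add: U fr vars_mon_indep[OF fr, of q])
qed

definition enc :: "nat multiset => nat" where "enc m = to_nat (sorted_list_of_multiset m)"

lemma enc_eq: "enc m = enc m' \<longleftrightarrow> m = m'" unfolding enc_def by(metis mset_sorted_list_of_multiset inj_to_nat injD)

text \<open>Each monomial becomes a variable of its own. This is linear and injective modulo
  \<open>PN\<close> (\<open>ren_PN\<close>) but not multiplicative; it turns the lattice of a
  symmetric power back into one of linear forms.\<close>

abbreviation ren :: "'c wpoly => 'c wpoly" where "ren \<equiv> lin (%m. var (enc m))"

lemma ren_PN: "ren w : PN \<longleftrightarrow> w : PN"
proof
 assume "ren w : PN"
 hence s: "(SUM m:Poly_Mapping.keys w. cst (cf w m) * var (enc m)) : PN" by(simp add: lin_def)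
 have "cst (cf w m) : PN" if "m : Poly_Mapping.keys w" for m by(rule mono_indep[OF _ _ _ s that]) (auto simp: inj_on_def enc_eq PK_cst)
 hence "cf w m : N0" for m using osubD(1)[OF N0] by(cases "cf w m = 0") (auto simp: in_keys_iff cst_PN)
 thus "w : PN" by(simp add: PN_def)
qed (rule lin_PN)

definition rn :: "('p => 'c wpoly set) => 'p => 'c wpoly set" where "rn M x = {w. EX v:M x. w - ren v : PN}"

text \<open>The preimages found at different points agree modulo \<open>PN\<close> because
  \<open>ren\<close> is injective modulo \<open>PN\<close>.\<close>

lemma rn_sec: assumes U: "oin T U" "U ~= {}" and M: "framed M" and w: "w : sec (rn M) U" shows "EX v:sec M U. w - ren v : PN"
proof -
 obtain z where z: "z : U" using U by blast
 obtain v where v: "v : M z" "w - ren v : PN" using secD[OF w z] unfolding rn_def by blast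
 have "v : M y" if y: "y : U" for y
 proof -
  obtain v' where v': "v' : M y" "w - ren v' : PN" using secD[OF w y] unfolding rn_def by blast
  have "ren (v - v') : PN" using c_trans[OF PN c_sym[OF PN v(2)] v'(2)] by(simp add: lin_diff)
  thus ?thesis using osub_tr[OF framed_osub[OF M sub_top[OF U(1) y]] _ v'(1)] ren_PN by blast
 qed
 thus ?thesis using v(2) unfolding sec_def by blast
qed

lemma ren_sec: "v : sec M U ==> ren v : sec (rn M) U" unfolding sec_def rn_def using c_refl[OF PN] by blast

lemma rn_osub: assumes M: "framed M" and x: "x : pts" shows "osub (Ox x) (rn M x)" "PN [= rn M x"
proof -
 note o = osubD[OF framed_osub(1)[OF M x]]
 show "osub (Ox x) (rn M x)" unfolding osub_def
 proof (intro conjI ballI)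
  show "0 : rn M x" unfolding rn_def using o(1) osubD(1)[OF PN] by(auto intro!: bexI[of _ 0] simp: lin_zero)
  show "v + w : rn M x" if vw: "v : rn M x" "w : rn M x" for v w
  proof -
   obtain v' where v': "v' : M x" "v - ren v' : PN" using vw(1) unfolding rn_def by blast
   obtain w' where w': "w' : M x" "w - ren w' : PN" using vw(2) unfolding rn_def by blast
   have "v + w - ren (v' + w') : PN" using c_add[OF PN v'(2) w'(2)] by(simp add: lin_add)
   thus ?thesis unfolding rn_def using o(2)[OF v'(1) w'(1)] by blast
  qed
  show "a * w : rn M x" if aw: "a : Ox x" "w : rn M x" for a w
  proof -
   obtain w' where w': "w' : M x" "w - ren w' : PN" using aw(2) unfolding rn_def by blast
   have "a * w - ren (a * w') : PN" using c_trans[OF PN c_mult[OF PN c_refl[OF PN] w'(2)] c_sym[OF PN lin_PK]] aw(1) OxK[OF x] by blast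
   thus ?thesis unfolding rn_def using o(3) aw(1) w'(1) by blast
  qed
 qed
 show "PN [= rn M x" unfolding rn_def using o(1) by(auto intro!: bexI[of _ 0] simp: lin_zero)
qed

lemma rn_realizes: assumes F: "realizes F si M" and M: "framed M" shows "EX si'. realizes F si' (rn M)"
proof -
 define pre where "pre U w = (SOME v. v : sec M U & w - ren v : PN)" for U w
 have pre: "pre U w : sec M U" "w - ren (pre U w) : PN" if "oin T U" "U ~= {}" "w : sec (rn M) U" for U w
  using someI_ex[of "%v. v : sec M U & w - ren v : PN"] rn_sec[OF that(1,2) M that(3)] unfolding pre_def by blast+
 have e: "si U (pre U w) = si U v" if U: "oin T U" "U ~= {}" and w: "w : sec (rn M) U" and v: "v : sec M U" "w - ren v : PN" for U w v
 proof -
  have "ren (pre U w - v) : PN" using c_trans[OF PN c_sym[OF PN pre(2)[OF U w]] v(2)] by(simp add: lin_diff)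
  thus ?thesis using nmod.sig_eq[OF r_mod[OF F U] pre(1)[OF U w] v(1)] ren_PN by blast
 qed
 have "realizes F (%U w. si U (pre U w)) (rn M)" unfolding realizes_def
 proof (intro conjI allI impI, goal_cases)
  case (1 U)
  hence U: "oin T U" "U ~= {}" by auto
  interpret A: nmod "SX U" "sec Ox U" PN "tu U" "Sec F U" "sec M U" "si U" by(rule r_mod[OF F U])
  show ?case
  proof (unfold_locales, goal_cases)
   case 1 show ?case using osubD[OF rn_osub(1)[OF M sub_top[OF U(1)]]] unfolding osub_def sec_def by blast
  next
   case 2 show ?case using rn_osub(2)[OF M sub_top[OF U(1)]] unfolding sec_def by blast
  next
   case (3 w) thus ?case using A.sig_closed pre(1)[OF U] by blast
  next
   case (4 s)
   then obtain v where v: "v : sec M U" "si U v = s" using A.sig_surj by blast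
   thus ?case using e[OF U ren_sec[OF v(1)] v(1) c_refl[OF PN]] ren_sec[OF v(1)] by blast
  next
   case (5 v w)
   note p = pre[OF U 5(1)] pre[OF U 5(2)]
   have m: "v + w : sec (rn M) U" using 5 osubD(2)[OF rn_osub(1)[OF M sub_top[OF U(1)]]] unfolding sec_def by blast
   have "si U (pre U (v + w)) = si U (pre U v + pre U w)" using c_add[OF PN p(2,4)] by(intro e[OF U m osubD(2)[OF A.L p(1,3)]]) (simp add: lin_add)
   thus ?case using A.sig_add[OF p(1,3)] by simp
  next
   case (6 a w)
   note p = pre[OF U 6(2)]
   have m: "a * w : sec (rn M) U" using 6 osubD(3)[OF rn_osub(1)[OF M sub_top[OF U(1)]]] unfolding sec_def by blast
   obtain z where z: "z : U" using U by blast
   have aK: "a : PK" using secD[OF 6(1) z] OxK[OF sub_top[OF U(1) z]] by blast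
   have "si U (pre U (a * w)) = si U (a * pre U w)" using c_trans[OF PN c_mult[OF PN c_refl[OF PN, of a] p(2)] c_sym[OF PN lin_PK[OF aK]]]
    by(intro e[OF U m osubD(3)[OF A.L 6(1) p(1)]])
   thus ?case using A.sig_smult[OF 6(1) p(1)] by simp
  next
   case (7 w)
   note p = pre[OF U 7]
   have "w : PN \<longleftrightarrow> pre U w : PN" using c_mem[OF PN p(2)] ren_PN by blast
   thus ?case using A.sig_ker[OF p(1)] by blast
  qed
 next
  case (2 U V w)
  hence o: "oin T U" "U ~= {}" "oin T V" "V ~= {}" "V [= U" "w : sec (rn M) U" by auto
  note p = pre[OF o(1,2,6)]
  show ?case using r_restr[OF F o(1,3,4,5) p(1)] e[OF o(3,4) sec_mono[OF o(5,6)] sec_mono[OF o(5) p(1)] p(2)] by simp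
 qed
 thus ?thesis by blast
qed

lemma ren_inj: "ren v - ren w : PN \<longleftrightarrow> v - w : PN" using ren_PN[of "v - w"] by(simp add: lin_diff)

lemma ren_fspan: assumes A: "A [= PK" and i: "inj_on ren B" and v: "v : fspan PN A B" and w: "w - ren v : PN" shows "w : fspan PN A (ren ` B)"
proof -
 obtain c where c: "ALL b:B. c b : A" "v - (SUM b:B. c b * b) : PN" using v unfolding fspan_def by blast
 have "ren (SUM b:B. c b * b) - (SUM b:B. c b * ren b) : PN" unfolding lin_sum using c(1) A by(intro c_sum[OF PN] lin_PK) auto
 hence 1: "w - (SUM b:B. c b * ren b) : PN" using c_trans[OF PN c_trans[OF PN w lin_cong[OF c(2)]]] by blast
 have "(SUM b:ren ` B. c (the_inv_into B ren b) * b) = (SUM b:B. c b * ren b)" by(simp add: sum.reindex[OF i] the_inv_into_f_f[OF i])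
 thus ?thesis unfolding fspan_def using c(1) 1 by(auto intro!: exI[of _ "%b. c (the_inv_into B ren b)"] simp: the_inv_into_f_f[OF i])
qed

lemma ren_framed_at: assumes U: "oin T U" and fr: "fr_at M U B" shows "fr_at (rn M) U (ren ` B)" "inj_on ren B"
proof -
 show i: "inj_on ren B"
 proof (rule inj_onI)
  fix b b' assume b: "b : B" "b' : B" "ren b = ren b'"
  hence "b - b' : PN" using ren_inj[of b b'] osubD(1)[OF PN] by simp
  thus "b = b'" using framed_at_inj[OF fr b(1,2)] one_PN by blast
 qed
 show "fr_at (rn M) U (ren ` B)" unfolding fr_at_def
 proof (intro conjI ballI allI impI)
  show "finite (ren ` B)" using fr_atD(1)[OF fr] by simp
  fix y assume y: "y : U"
  note yp = sub_top[OF U y]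
  show "rn M y = fspan PN (Ox y) (ren ` B)"
  proof
   show "rn M y [= fspan PN (Ox y) (ren ` B)" using ren_fspan[OF OxK[OF yp] i] fr_atD(2)[OF fr y] unfolding rn_def by blast
   show "fspan PN (Ox y) (ren ` B) [= rn M y"
   proof
    fix w assume "w : fspan PN (Ox y) (ren ` B)"
    then obtain c where c: "ALL b:B. c (ren b) : Ox y" "w - (SUM b:B. c (ren b) * ren b) : PN" unfolding fspan_def by(auto simp: sum.reindex[OF i])
    have "ren (SUM b:B. c (ren b) * b) - (SUM b:B. c (ren b) * ren b) : PN" unfolding lin_sum using c(1) OxK[OF yp] by(intro c_sum[OF PN] lin_PK) auto
    hence "w - ren (SUM b:B. c (ren b) * b) : PN" using c_trans[OF PN c(2) c_sym[OF PN]] by blast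
    moreover have "(SUM b:B. c (ren b) * b) : M y" unfolding fr_atD(2)[OF fr y] fspan_def
     using c(1) osubD(1)[OF PN] by(auto intro!: exI[of _ "c \<circ> ren"])
    ultimately show "w : rn M y" unfolding rn_def by blast
   qed
  qed
 next
  fix c b assume "(ALL b:ren ` B. c b : PK) & (SUM b:ren ` B. c b * b) : PN" and b: "b : ren ` B"
  hence c: "!!b. b : B ==> c (ren b) : PK" "(SUM b:B. c (ren b) * ren b) : PN" by(auto simp: sum.reindex[OF i])
  have "ren (SUM b:B. c (ren b) * b) - (SUM b:B. c (ren b) * ren b) : PN" unfolding lin_sum using c(1) by(intro c_sum[OF PN] lin_PK)
  hence "(SUM b:B. c (ren b) * b) : PN" using c(2) c_mem[OF PN] ren_PN by blast
  thus "c b : PN" using fr_atD(3)[OF fr, of "%b. c (ren b)"] c(1) b by blast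
 qed
qed

lemma prod_span: assumes A0: "osubring A0" and B: "B [= ospan A0 (S Un PN)"
 shows "set_mset A [= B ==> prod_mset A : ospan A0 (prod_mset ` msets S (size A) Un PN)"
proof (induction A)
 case empty
 have "(1::'c wpoly) : prod_mset ` msets S (size {#})" by(rule image_eqI[of _ _ "{#}"]) (auto simp: msets_def)
 thus ?case using subsetD[OF ospanI[OF A0] UnI1] by simp
next
 case (add b A)
 let ?D = "ospan A0 (prod_mset ` msets S (Suc (size A)) Un PN)"
 have D: "prod_mset ` msets S (Suc (size A)) Un PN [= ?D" by(rule ospanI[OF A0])
 have st: "s * t : ?D" if s: "s : S Un PN" and t: "t : prod_mset ` msets S (size A) Un PN" for s t
 proof (cases "s : PN \<or> t : PN")
  case True
  hence "s * t : PN" using osubD(3)[OF PN UNIV_I] by(metis mult.commute)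
  thus ?thesis using D by blast
 next
  case False
  then obtain C where C: "C : msets S (size A)" "t = prod_mset C" "s : S" using s t by blast
  hence "add_mset s C : msets S (Suc (size A))" by(auto simp: msets_def)
  hence "s * t : prod_mset ` msets S (Suc (size A))" using C(2) by(intro image_eqI[of _ _ "add_mset s C"]) auto
  thus ?thesis using D by blast
 qed
 have "b : ospan A0 (S Un PN)" "prod_mset A : ospan A0 (prod_mset ` msets S (size A) Un PN)" using add B by auto
 from ospan_product[OF A0 this ospan_osub[OF A0]] have "b * prod_mset A : ?D" using st by blast
 thus ?case by simp
qed

lemma fspan_K: "finite B ==> fspan PN PK B = ospan PK (B Un PN)" by(rule fspan_ospan[OF _ PK PN PN_PK])

lemma prod_fspan: assumes S: "finite S" and B: "B [= fspan PN PK S" shows "prod_mset ` msets B q [= fspan PN PK (prod_mset ` msets S q)"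
proof -
 have "prod_mset A : ospan PK (prod_mset ` msets S q Un PN)" if "A : msets B q" for A
  using prod_span[OF PK B[unfolded fspan_K[OF S]], of A] that by(simp add: msets_def)
 thus ?thesis using fspan_K[OF finite_imageI[OF finite_msets[OF S]]] by blast
qed

lemma msets_var: "prod_mset ` msets (var ` I :: 'c wpoly set) q = mon ` {m. set_mset m [= I & size m = q}"
proof
 show "mon ` {m. set_mset m [= I & size m = q} [= prod_mset ` msets (var ` I :: 'c wpoly set) q"
 proof
  fix w :: "'c wpoly" assume "w : mon ` {m. set_mset m [= I & size m = q}"
  then obtain m where m: "set_mset m [= I" "size m = q" "w = mon m" by blast
  hence "image_mset var m : msets (var ` I :: 'c wpoly set) q" by(auto simp: msets_def)
  thus "w : prod_mset ` msets (var ` I) q" by(rule image_eqI[rotated]) (simp add: m(3) prod_var)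
 qed
 have "EX m. set_mset m [= I & size m = size A & prod_mset A = mon m" if "set_mset A [= var ` I" for A :: "'c wpoly multiset" using that
 proof (induction A)
  case empty
  show ?case by(rule exI[of _ "{#}"]) simp
 next
  case (add a A)
  then obtain m i where "set_mset m [= I" "size m = size A" "prod_mset A = mon m" "i : I" "a = var i" by auto
  thus ?case by(intro exI[of _ "add_mset i m"]) (simp add: mult_single)
 qed
 thus "prod_mset ` msets (var ` I :: 'c wpoly set) q [= mon ` {m. set_mset m [= I & size m = q}" unfolding msets_def by blast
qed

text \<open>The monomials of degree \<open>q\<close> in a frame and those in the variables span the
  same \<open>PK\<close>-module. After renaming, the new frames therefore span the same module as
  the new variables, which is the form needed to take a symmetric power once more.\<close>

theorem sym_lintype: assumes F: "realizes F si M" and M: "lintype M I" shows "EX si'. realizes (sym_sheaf X q F) si' (pw M q)" "framed (pw M q)"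
  "EX I' si'. realizes (sym_sheaf X q F) si' (rn (pw M q)) & lintype (rn (pw M q)) I'"
proof -
 have fM: "framed M" using M based_framed unfolding lintype_def by blast
 have good: "ALL x:pts. EX U B. oin T U & x : U & fr_at M U B & mon_indep B q" using lintype_frame[OF M, of _ q] by meson
 show 1: "EX si'. realizes (sym_sheaf X q F) si' (pw M q)" using sym_realizes[OF F fM] good by blast
 define D where "D = {m. set_mset m [= I & size m = q}"
 have fI: "finite I" using M by(simp add: lintype_def)
 have mv: "prod_mset ` msets (var ` I :: 'c wpoly set) q = mon ` D" using msets_var[of I q] by(simp add: D_def)
 have "finite (prod_mset ` msets (var ` I :: 'c wpoly set) q)" by(intro finite_imageI finite_msets fI)
 hence fD': "finite (mon ` D :: 'c wpoly set)" unfolding mv .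
 have "based (pw M q) (mon ` D)" unfolding based_def
 proof
  fix x assume "x : pts"
  then obtain U B where U: "oin T U" "x : U" and fr: "fr_at M U B" and mi: "mon_indep B q"
   and BI: "B [= fspan PN PK (var ` I)" "var ` I [= fspan PN PK B" using lintype_frame[OF M, of x q] by meson
  note fB = fr_atD(1)[OF fr]
  have "prod_mset ` msets B q [= fspan PN PK (mon ` D)" "mon ` D [= fspan PN PK (prod_mset ` msets B q)"
   unfolding mv[symmetric] using prod_fspan[OF _ BI(1)] prod_fspan[OF fB BI(2)] fI by auto
  thus "EX U B. oin T U & x : U & fr_at (pw M q) U B & B [= fspan PN PK (mon ` D) & mon ` D [= fspan PN PK B"
   using U framed_pw[OF fr U(1) mi] by blast
 qed
 note bp = this
 show fp: "framed (pw M q)" by(rule based_framed[OF bp])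
 have vD: "var ` (enc ` D) = ren ` (mon ` D)" by(simp add: image_image lin_mono)
 have iD: "inj_on ren (mon ` D)" by(rule inj_onI) (auto simp: lin_mono enc_eq dest!: arg_cong[of _ _ Poly_Mapping.keys])
 have "inj_on mon D" by(rule inj_onI) (auto dest!: arg_cong[of _ _ Poly_Mapping.keys])
 hence fD: "finite D" using fD' finite_image_iff by blast
 have "based (rn (pw M q)) (var ` (enc ` D))" unfolding based_def
 proof
  fix x assume "x : pts"
  then obtain U B where U: "oin T U" "x : U" and fr: "fr_at (pw M q) U B"
   and BI: "B [= fspan PN PK (mon ` D)" "mon ` D [= fspan PN PK B" using bspec[OF bp[unfolded based_def]] by meson
  have "ren b : fspan PN PK (ren ` (mon ` D))" if "b : B" for b using BI(1) that by(intro ren_fspan[OF order_refl iD _ c_refl[OF PN]]) blast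
  moreover have "ren b : fspan PN PK (ren ` B)" if "b : mon ` D" for b
   using BI(2) that by(intro ren_fspan[OF order_refl ren_framed_at(2)[OF U(1) fr] _ c_refl[OF PN]]) blast
  ultimately show "EX U B. oin T U & x : U & fr_at (rn (pw M q)) U B & B [= fspan PN PK (var ` (enc ` D)) & var ` (enc ` D) [= fspan PN PK B"
   unfolding vD by(intro exI[of _ U] exI[of _ "ren ` B"] conjI U ren_framed_at(1)[OF U(1) fr] image_subsetI)
 qed
 hence "lintype (rn (pw M q)) (enc ` D)" unfolding lintype_def using fD by blast
 moreover obtain si1 where "realizes (sym_sheaf X q F) si1 (pw M q)" using 1 by blast
 then obtain si2 where "realizes (sym_sheaf X q F) si2 (rn (pw M q))" using rn_realizes[OF _ fp] by blast
 ultimately show "EX I' si'. realizes (sym_sheaf X q F) si' (rn (pw M q)) & lintype (rn (pw M q)) I'" by blast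
qed

end

section \<open>Base loci and ampleness in terms of lattices\<close>

context wmodel
begin

lemma line_realizes: assumes L: "line_bundle X L" shows "EX si u. realizes L si (lt u) & unitfam u"
proof -
 have "EX si M. realizes L si M & based M ((%_. 1) ` {..<1::nat})"
  by(rule locally_free_realizes[OF L[unfolded line_bundle_def] one_PN pts_ne K_open]) auto
 then obtain si M where M: "realizes L si M" "based M {1}" by(auto simp: lessThan_Suc)
 have "ALL x:pts. EX b. b : PK & (EX v:PK. b * v - 1 : PN) & (EX U. oin T U & x : U & (ALL y:U. M y = fspan PN (Ox y) {b}))"
 proof
  fix x assume "x : pts"
  from bspec[OF M(2)[unfolded based_def] this]
  obtain U B where U: "oin T U" "x : U" and fr: "fr_at M U B" and B: "B [= fspan PN PK {1}" "{1} [= fspan PN PK B" by(elim exE conjE)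
  have bK: "b : PK" if bB: "b : B" for b
  proof -
   obtain c where "c : PK" "b - c * 1 : PN" using B(1) bB unfolding subset_iff fsp_one by blast
   thus ?thesis using PK_cong by simp
  qed
  obtain d where d: "ALL b:B. d b : PK" "1 - (SUM b:B. d b * b) : PN" using B(2) unfolding fspan_def by blast
  have "B ~= {}" using d(2) one_PN by auto
  then obtain b where b: "b : B" by blast
  \<comment> \<open>A second element \<open>b'\<close> would satisfy the relation
    \<open>b' * b - b * b' = 0\<close> with coefficients in \<open>PK\<close>. Independence puts
    \<open>b'\<close> into \<open>PN\<close>, and then 1 is the coefficient of a relation.\<close>
  have "B = {b}"
  proof (rule ccontr)
   assume "B ~= {b}"
   then obtain b' where b': "b' : B" "b' ~= b" using b by blast
   let ?c = "%x. if x = b then b' else if x = b' then - b else 0"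
   have "(SUM x:B. ?c x * x) = (SUM x:{b, b'}. ?c x * x)" using b b' fr_atD(1)[OF fr] by(intro sum.mono_neutral_right) auto
   hence "(SUM x:B. ?c x * x) = 0" using b' by simp
   hence "ALL x:B. ?c x : PN" using fr_atD(3)[OF fr, of ?c] bK[OF b] bK[OF b'(1)] osrD[OF PK] osubD(1)[OF PN] by auto
   hence "b' : PN" using b by auto
   hence "(SUM x:B. (if x = b' then 1 else 0) * x) : PN"
    using fr_atD(1)[OF fr] b'(1) by(subst sum.cong[OF refl, of _ _ "%x. if x = b' then x else 0"]) auto
   hence "(if b' = b' then 1 else 0) : PN" using fr_atD(3)[OF fr, of "%x. if x = b' then 1 else 0" b'] osrD[OF PK] b'(1) by auto
   thus False using one_PN by simp
  qed
  hence "b * d b - 1 : PN" using c_sym[OF PN d(2)] by(simp add: mult.commute)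
  thus "EX b. b : PK & (EX v:PK. b * v - 1 : PN) & (EX U. oin T U & x : U & (ALL y:U. M y = fspan PN (Ox y) {b}))"
   using bK[OF b] d(1) b U fr_atD(2)[OF fr] \<open>B = {b}\<close> by blast
 qed
 from bchoice[OF this] obtain u where u: "ALL x:pts. u x : PK & (EX v:PK. u x * v - 1 : PN) &
   (EX U. oin T U & x : U & (ALL y:U. M y = fspan PN (Ox y) {u x}))" by blast
 have e: "M x = lt u x" if "x : pts" for x using u that unfolding lt_def by blast
 have "ueq (Ox y) (u y) (u x)" if y: "y : pts" and m: "M y = fspan PN (Ox y) {u x}" for x y
 proof -
  have s: "v : fspan PN (Ox y) {v}" for v unfolding fsp_one using osrD(1)[OF Ox[OF y]] osubD(1)[OF PN] by(intro bexI[of _ 1]) auto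
  have "fspan PN (Ox y) {u y} = fspan PN (Ox y) {u x}" using e[OF y] m unfolding lt_def by simp
  thus ?thesis unfolding ueq_def using s[of "u x"] s[of "u y"] fsp_one by blast
 qed
 hence "unitfam u" unfolding unitfam_def using u sub_top by meson
 thus ?thesis using realizes_cong[OF M(1) e] by blast
qed

lemma vector_realizes: assumes E: "vector_bundle X E" shows "EX si M I. realizes E si M & lintype M I"
proof -
 obtain n where lf: "locally_free X n E" using E unfolding vector_bundle_def by blast
 have "EX si M. realizes E si M & based M (var ` {..<n})"
 proof (rule locally_free_realizes[OF lf one_PN pts_ne K_open])
  fix c :: "nat => 'c wpoly" and i assume "!!i. i < n ==> c i : PK" "(\<Sum>i<n. c i * var i) : PN" "i < n"
  thus "c i : PN" using mono_indep[of "{..<n}" "%i. {#i#}" c i] by(auto simp: inj_on_def)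
 qed
 thus ?thesis unfolding lintype_def by blast
qed

lemma tw_framed: "framed M ==> unitfam u ==> framed (tw M u)" unfolding framed_def using framed_tw[unfolded framed_def] by meson

lemma Bs_tw: assumes F: "realizes F si M" and M: "framed M" and L: "realizes L si' (lt u)" and u: "unitfam u" and x: "x : pts"
 shows "x : Bs X (tensor_sheaf X F (tensor_power_sheaf X m L)) \<longleftrightarrow> \<not> GG (tw M (%x. u x ^ m)) x"
proof -
 obtain si1 where 1: "realizes (tensor_power_sheaf X m L) si1 (lt (%x. u x ^ m))" using line_power_realizes[OF L u] by blast
 obtain si2 where "realizes (tensor_sheaf X F (tensor_power_sheaf X m L)) si2 (tw M (%x. u x ^ m))"
  using tensor_realizes[OF F M 1 unitfam_power[OF u]] by blast
 from Bs_iff[OF this tw_framed[OF M unitfam_power[OF u]] x] show ?thesis by blast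
qed

text \<open>The consequence of ampleness that is used for lattices; the bound \<open>n0\<close> is
  uniform in the point.\<close>

definition amp :: "('p => 'c wpoly) => bool" where
 "amp u \<longleftrightarrow> unitfam u & (ALL M. framed M --> (EX n0. ALL n>=n0. ALL x:pts. GG (tw M (%x. u x ^ n)) x))"

lemma ample_amp: assumes L: "ample X L" shows "EX si u. realizes L si (lt u) & amp u"
proof -
 obtain si u where u: "realizes L si (lt u)" "unitfam u" using line_realizes L unfolding ample_def by blast
 have "EX n0. ALL n>=n0. ALL x:pts. GG (tw M (%x. u x ^ n)) x" if M: "framed M" for M
 proof -
  \<comment> \<open>The code lists the germs of all coefficients, with the monomials enumerated
    through \<open>from_nat\<close>. It is constant in the point, as one name serves
    everywhere.\<close>
  define cd :: "'c wpoly => 'p => nat => ('p set \<times> 'r) set" where "cd w = (%_ k. \<pi> (cf w (mset (from_nat k))))" for w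
  have "cd v = cd w \<longleftrightarrow> v - w : PN" for v w
  proof
   assume "cd v = cd w"
   hence k: "\<pi> (cf v (mset (from_nat k))) = \<pi> (cf w (mset (from_nat k)))" for k by(simp add: cd_def fun_eq_iff)
   have "cf v m - cf w m : N0" for m using k[of "to_nat (sorted_list_of_multiset m)"] by(simp add: pi_eq)
   thus "v - w : PN" by(simp add: PN_def lookup_minus)
  next
   assume "v - w : PN"
   thus "cd v = cd w" using PN_coef[of v w] by(simp add: cd_def pi_eq fun_eq_iff)
  qed
  then interpret coded X PK PN Ox tu M cd by unfold_locales (use M in auto)
  obtain n0 where n0: "ALL n>=n0. globally_generated X (tensor_sheaf X Fs (tensor_power_sheaf X n L))"
   using L Fs_coherent unfolding ample_def by blast
  have "GG (tw M (%x. u x ^ n)) x" if n: "n >= n0" and x: "x : pts" for n x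
  proof -
   obtain si1 where 1: "realizes (tensor_power_sheaf X n L) si1 (lt (%x. u x ^ n))" using line_power_realizes[OF u] by blast
   obtain si2 where 2: "realizes (tensor_sheaf X Fs (tensor_power_sheaf X n L)) si2 (tw M (%x. u x ^ n))"
    using tensor_realizes[OF Fs_realizes M 1 unitfam_power[OF u(2)]] by blast
   show ?thesis using n0 n x globally_generated_iff[OF 2 tw_framed[OF M unitfam_power[OF u(2)]]] by blast
  qed
  thus ?thesis by blast
 qed
 thus ?thesis using u unfolding amp_def by blast
qed

end

section \<open>Calculus of global generation for twisted powers of a lattice\<close>

section \<open>Global generation and products\<close>

lemma lin_lin: "lin f (lin g w) = lin (%m. lin f (g m)) w" unfolding lin_def[of g] lin_def[of "%m. lin f (g m)"] lin_sum lin_cst ..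

context wmodel
begin

definition G :: "('p => 'c wpoly set) => 'p => 'c wpoly set" where "G M x = ospan (Ox x) (sec M pts)"

definition lat :: "('p => 'c wpoly set) => bool" where "lat M \<longleftrightarrow> (ALL y:pts. osub (Ox y) (M y) & PN [= M y)"

lemma latD: "lat M ==> y : pts ==> osub (Ox y) (M y)" "lat M ==> y : pts ==> PN [= M y" by(auto simp: lat_def)

lemma lat_pw: "lat (pw M q)" unfolding lat_def using pw_osub pw_N by blast

lemma lat_Ox: "lat Ox" unfolding lat_def using osr_osub[OF Ox] NOx by blast

lemma twI: "v : M y ==> w - u y * v : PN ==> w : tw M u y" unfolding tw_def by blast

lemma lat_tw: assumes M: "lat M" shows "lat (tw M u)" unfolding lat_def osub_def
proof (intro ballI conjI subsetI)
 fix y assume y: "y : pts"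
 note o = osubD[OF latD(1)[OF M y]]
 show n: "w : tw M u y" if "w : PN" for w using that o(1) by(intro twI[of 0]) auto
 show "0 : tw M u y" by(rule n[OF osubD(1)[OF PN]])
 fix v assume "v : tw M u y"
 then obtain v' where v: "v' : M y" "v - u y * v' : PN" unfolding tw_def by blast
 show "v + w : tw M u y" if ww: "w : tw M u y" for w
 proof -
  obtain w' where w: "w' : M y" "w - u y * w' : PN" using ww unfolding tw_def by blast
  show ?thesis using c_add[OF PN v(2) w(2)] by(intro twI[of "v' + w'" M y, OF o(2)[OF v(1) w(1)]]) (simp add: distrib_left)
 qed
 fix a assume a: "a : Ox y"
 show "a * v : tw M u y" using c_mult[OF PN c_refl[OF PN, of a] v(2)] by(intro twI[of "a * v'" M y, OF o(3)[OF a v(1)]]) (simp add: ac_simps)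
qed

lemma G_osub: "x : pts ==> osub (Ox x) (G M x)" unfolding G_def by(rule ospan_osub[OF Ox])

lemma G_sec: "x : pts ==> v : sec M pts ==> v : G M x" unfolding G_def using ospanI[OF Ox] by blast

lemma G_PN: "lat M ==> x : pts ==> PN [= G M x" using G_sec latD(2) unfolding sec_def by blast

lemma G_cong: "lat M ==> x : pts ==> v - w : PN ==> w : G M x ==> v : G M x" by(rule osub_tr[OF G_osub G_PN])

text \<open>Products of global sections are global sections, and bilinearity extends this to their
  spans.\<close>

lemma G_mult: assumes x: "x : pts" and m: "!!y v w. y : pts ==> v : M y ==> w : M' y ==> v * w : M'' y" and v: "v : G M x" "w : G M' x"
 shows "v * w : G M'' x"
proof (rule ospan_product[OF Ox[OF x] v[unfolded G_def] G_osub[OF x]])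
 fix s t assume "s : sec M pts" "t : sec M' pts"
 thus "s * t : G M'' x" using m by(intro G_sec[OF x]) (simp add: sec_def)
qed

lemma lin_preimage: assumes y: "y : pts" and D: "osub (Ox y) D" "PN [= D" shows "osub (Ox y) {w. lin f w : D}" unfolding osub_def
proof (intro conjI ballI CollectI)
 show "lin f 0 : D" using osubD(1)[OF D(1)] by(simp add: lin_zero)
 show "lin f (v + w) : D" if "v : {w. lin f w : D}" "w : {w. lin f w : D}" for v w using that osubD(2)[OF D(1)] by(simp add: lin_add)
 show "lin f (a * v) : D" if "a : Ox y" "v : {w. lin f w : D}" for a v using that osubD(3)[OF D(1)] OxK[OF y] by(intro osub_tr[OF D lin_PK]) auto
qed

lemma G_map: assumes x: "x : pts" and M': "lat M'" and m: "!!y v. y : pts ==> v : M y ==> lin f v : M' y" and v: "v : G M x" shows "lin f v : G M' x"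
proof -
 have "G M x [= {w. lin f w : G M' x}" unfolding G_def[of M]
  using m by(intro ospan_least lin_preimage[OF x G_osub[OF x] G_PN[OF M' x]]) (auto simp: sec_def intro!: G_sec[OF x])
 thus ?thesis using v by blast
qed

lemma tw_mult: assumes "v : tw M u y" "w : tw M' u' y" and m: "!!v w. v : M y ==> w : M' y ==> v * w : M'' y"
 shows "v * w : tw M'' (%y. u y * u' y) y"
proof -
 obtain a where a: "a : M y" "v - u y * a : PN" using assms(1) unfolding tw_def by blast
 obtain b where b: "b : M' y" "w - u' y * b : PN" using assms(2) unfolding tw_def by blast
 show ?thesis using c_mult[OF PN a(2) b(2)] by(intro twI[of "a * b" M'' y, OF m[OF a(1) b(1)]]) (simp add: ac_simps)
qed

lemma tw_lin: assumes u: "u y : PK" and m: "!!v. v : M y ==> lin f v : M' y" and w: "w : tw M u y" shows "lin f w : tw M' u y"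
proof -
 obtain a where a: "a : M y" "w - u y * a : PN" using w unfolding tw_def by blast
 have "lin f w - u y * lin f a : PN" by(rule c_trans[OF PN lin_cong[OF a(2)] lin_PK[OF u]])
 thus ?thesis by(rule twI[of "lin f a" M' y, OF m[OF a(1)]])
qed

text \<open>\<open>lin f\<close> commutes with the twist \<open>u x\<close> modulo \<open>PN\<close>
  because \<open>u x\<close> lies in \<open>PK\<close>.\<close>

lemma G_tw_map: assumes x: "x : pts" and u: "!!y. y : pts ==> u y : PK" and M': "lat M'"
  and m: "!!y v. y : pts ==> v : M y ==> lin f v : M' y" and v: "u x * v : G (tw M u) x" shows "u x * lin f v : G (tw M' u) x"
proof -
 have "lin f (u x * v) : G (tw M' u) x" by(rule G_map[OF x lat_tw[OF M'] _ v]) (rule tw_lin[OF u m])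
 thus ?thesis by(rule G_cong[OF lat_tw[OF M'] x c_sym[OF PN lin_PK[OF u[OF x]]]])
qed

lemma GG_D: "GG (tw M u) x ==> v : M x ==> u x * v : G (tw M u) x" unfolding GG_def G_def using twI[of v M x "u x * v" u] c_refl[OF PN] by blast

text \<open>The elements \<open>v\<close> with \<open>u x * v\<close> generated by global sections
  form an \<open>Ox x\<close>-module containing \<open>PN\<close>, so it suffices to test generators
  of \<open>M x\<close>.\<close>

lemma GG_gen: assumes M: "lat M" and x: "x : pts" and S: "M x [= ospan (Ox x) (S Un PN)" and s: "!!s. s : S ==> u x * s : G (tw M u) x"
 shows "GG (tw M u) x"
proof -
 note o = osubD[OF G_osub[OF x, of "tw M u"]] and n = G_PN[OF lat_tw[OF M] x, of u]
 have "ospan (Ox x) (S Un PN) [= {v. u x * v : G (tw M u) x}"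
 proof (rule ospan_least)
  show "osub (Ox x) {v. u x * v : G (tw M u) x}" unfolding osub_def using o by(simp add: distrib_left mult.left_commute)
  show "S Un PN [= {v. u x * v : G (tw M u) x}" using s n osubD(3)[OF PN UNIV_I] by blast
 qed
 hence "u x * v : G (tw M u) x" if "v : M x" for v using S that by blast
 hence "w : G (tw M u) x" if "w : tw M u x" for w using that G_cong[OF lat_tw[OF M] x] unfolding tw_def by blast
 thus ?thesis unfolding GG_def G_def by blast
qed

lemma GG_cong: assumes e: "!!y. y : pts ==> u y - u' y : PN" and x: "x : pts" and g: "GG (tw M u) x" shows "GG (tw M u') x"
proof -
 have "w - u y * v : PN \<longleftrightarrow> w - u' y * v : PN" if "y : pts" for w v y
  using c_trans[OF PN _ c_mult[OF PN e[OF that] c_refl[OF PN, of v]], of w]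
   c_trans[OF PN _ c_sym[OF PN c_mult[OF PN e[OF that] c_refl[OF PN, of v]]], of w] by blast
 hence "tw M u y = tw M u' y" if "y : pts" for y using that unfolding tw_def by blast
 hence "tw M u x = tw M u' x" "sec (tw M u) pts = sec (tw M u') pts" using x unfolding sec_def by auto
 thus ?thesis using g unfolding GG_def by simp
qed

lemma lt_tw: "lt b = tw Ox b" by(auto simp: fun_eq_iff lt_def tw_def fsp_one mult.commute)

lemma GG_lt: assumes M: "lat M" and x: "x : pts" and g: "GG (tw M u) x" "GG (lt b) x" shows "GG (tw M (%y. u y * b y)) x"
proof (rule GG_gen[OF M x])
 show "M x [= ospan (Ox x) (M x Un PN)" using ospanI[OF Ox[OF x]] by blast
 fix v assume v: "v : M x"
 have b: "b x * 1 : G (lt b) x" using GG_D[of Ox b x 1] g(2) osrD(1)[OF Ox[OF x]] unfolding lt_tw by blast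
 have "(u x * v) * (b x * 1) : G (tw M (%y. u y * b y)) x"
 proof (rule G_mult[OF x _ GG_D[OF g(1) v] b], unfold lt_tw, erule (1) tw_mult)
  fix y v w assume "y : pts" "v : M y" "w : Ox y"
  thus "v * w : M y" using osubD(3)[OF latD(1)[OF M]] by(metis mult.commute)
 qed
 thus "u x * b x * v : G (tw M (%y. u y * b y)) x" by(simp add: ac_simps)
qed

lemma GG_one: "x : pts ==> GG (lt (%_. 1)) x" unfolding lt_tw
proof (rule GG_gen[OF lat_Ox, of _ "{1}"])
 assume x: "x : pts"
 show "Ox x [= ospan (Ox x) ({1} Un PN)" using ospan.step[OF _ _ ospan.zero, of _ "Ox x" 1 "{1} Un PN"] by auto
 have "1 : sec (tw Ox (%_. 1)) pts" unfolding sec_def using osrD(1)[OF Ox] osubD(1)[OF PN] by(auto intro!: twI[of 1])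
 thus "1 * s : G (tw Ox (%_. 1)) x" if "s : {1}" for s using that G_sec[OF x] by simp
qed

lemma GG_lt_power: "x : pts ==> GG (lt b) x ==> GG (lt (%y. b y ^ m)) x"
proof (induction m)
 case 0
 thus ?case using GG_one by simp
next
 case (Suc m)
 thus ?case using GG_lt[OF lat_Ox, of x "%y. b y ^ m" b] unfolding lt_tw by(simp add: mult.commute)
qed

lemma tw_lt: "tw (lt b) u = lt (%y. u y * b y)"
proof
 fix y
 show "tw (lt b) u y = lt (%y. u y * b y) y" unfolding lt_tw
 proof
  show "tw (tw Ox b) u y [= tw Ox (%y. u y * b y) y"
  proof
   fix w assume "w : tw (tw Ox b) u y"
   then obtain v c where v: "w - u y * v : PN" "c : Ox y" "v - b y * c : PN" unfolding tw_def by blast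
   thus "w : tw Ox (%y. u y * b y) y" using c_trans[OF PN v(1) c_mult[OF PN c_refl[OF PN] v(3)]] by(intro twI[of c]) (simp_all add: mult.assoc)
  qed
  show "tw Ox (%y. u y * b y) y [= tw (tw Ox b) u y"
  proof
   fix w assume "w : tw Ox (%y. u y * b y) y"
   then obtain c where c: "c : Ox y" "w - u y * b y * c : PN" unfolding tw_def by blast
   have "b y * c : tw Ox b y" by(rule twI[of c Ox y, OF c(1) c_refl[OF PN]])
   thus "w : tw (tw Ox b) u y" by(rule twI[of "b y * c" "tw Ox b" y]) (use c(2) in \<open>simp add: mult.assoc\<close>)
  qed
 qed
qed

text \<open>A line bundle is itself a framed lattice, and its twist is again a line bundle by
  \<open>tw_lt\<close>.\<close>

lemma amp_lt: assumes u: "amp u" and b: "unitfam b" obtains n0 where "!!n x. n >= n0 ==> x : pts ==> GG (lt (%y. u y ^ n * b y)) x"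
proof -
 obtain n0 where "ALL n>=n0. ALL x:pts. GG (tw (lt b) (%x. u x ^ n)) x" using u unitfam_framed[OF b] unfolding amp_def by blast
 thus thesis using that[of n0] unfolding tw_lt by blast
qed

lemma pw_least: assumes "y : pts" "osub (Ox y) D" "PN [= D" "!!l. length l = q ==> set l [= M y ==> prod_list l : D" shows "pw M q y [= D"
 unfolding pw_def using assms by(intro ospan_least) auto

lemma pw_mult: assumes y: "y : pts" and v: "v : pw M p y" "w : pw M q y" shows "v * w : pw M (p + q) y"
proof (rule ospan_product[OF Ox[OF y] v[unfolded pw_def] pw_osub[OF y]])
 fix s t assume s: "s : {prod_list l |l. length l = p & set l [= M y} Un PN" and t: "t : {prod_list l |l. length l = q & set l [= M y} Un PN"
 show "s * t : pw M (p + q) y"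
 proof (cases "s : PN \<or> t : PN")
  case True
  hence "s * t : PN" using osubD(3)[OF PN UNIV_I] by(metis mult.commute)
  thus ?thesis using pw_N[OF y] by blast
 next
  case False
  then obtain l l' where l: "length l = p" "set l [= M y" "s = prod_list l" and l': "length l' = q" "set l' [= M y" "t = prod_list l'"
   using s t by blast
  have "prod_list (l @ l') : pw M (p + q) y" using l l' by(intro pw_prod[OF y]) auto
  thus ?thesis using l l' by simp
 qed
qed

lemma pw_one: "y : pts ==> v : M y ==> v : pw M 1 y" using pw_prod[of y "[v]" 1 M] by simp

lemma pw_gen: assumes x: "x : pts" and g: "!!l. length l = p ==> set l [= M x ==> u x * prod_list l : G (tw (pw M p) u) x"
 shows "GG (tw (pw M p) u) x"
 by(rule GG_gen[OF lat_pw x, of _ _ "{prod_list l | l. length l = p & set l [= M x}"]) (use g in \<open>auto simp: pw_def\<close>)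

lemma GG_prod: assumes x: "x : pts" and g: "GG (tw (pw M p) u) x" "GG (tw (pw M q) v) x" shows "GG (tw (pw M (p + q)) (%y. u y * v y)) x"
proof (rule pw_gen[OF x])
 fix l assume l: "length l = p + q" "set l [= M x"
 have t: "prod_list (take p l) : pw M p x" "prod_list (drop p l) : pw M q x"
  using l set_take_subset[of p l] set_drop_subset[of p l] by(auto intro!: pw_prod[OF x])
 have "(u x * prod_list (take p l)) * (v x * prod_list (drop p l)) : G (tw (pw M (p + q)) (%y. u y * v y)) x"
  by(rule G_mult[OF x _ GG_D[OF g(1) t(1)] GG_D[OF g(2) t(2)]]) (rule tw_mult, auto intro: pw_mult)
 moreover have "prod_list l = prod_list (take p l) * prod_list (drop p l)" unfolding prod_list.append[symmetric] append_take_drop_id ..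
 ultimately show "u x * v x * prod_list l : G (tw (pw M (p + q)) (%y. u y * v y)) x" by(simp add: ac_simps)
qed

lemma one_pw0: "x : pts ==> 1 : G (tw (pw M 0) (%y. 1)) x"
 using pw_prod[of _ "[]" 0 M] osubD(1)[OF PN] by(intro G_sec) (auto simp: sec_def intro!: twI[of 1])

lemma GG_pw_power: assumes x: "x : pts" and g: "GG (tw (pw M p) u) x" shows "GG (tw (pw M (j * p)) (%y. u y ^ j)) x"
proof (induction j)
 case 0
 show ?case using one_pw0[OF x] by(intro pw_gen[OF x]) simp
next
 case (Suc j)
 show ?case using GG_prod[OF x g Suc] by simp
qed

text \<open>The ring homomorphism undoing \<^const>\<open>ren\<close>; it induces \<open>S\<^sup>m S\<^sup>q E \<rightarrow> S\<^bsup>mq\<^esup> E\<close>.\<close>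

definition unren :: "'c wpoly => 'c wpoly" where "unren = lin (%m. prod_mset (image_mset (%k. mon (mset (from_nat k))) m))"

lemma unren: "unren (ren w) = w" "unren (v * w) = unren v * unren w" "unren 1 = 1"
proof -
 show "unren (ren w) = w" by(simp add: unren_def lin_lin lin_mono enc_def lin_id)
 show "unren (v * w) = unren v * unren w" unfolding unren_def by(rule lin_mult) simp
 have "unren (mon 0) = 1" unfolding unren_def lin_mono by simp
 thus "unren 1 = 1" by simp
qed

lemma unren_cong: "v - w : PN ==> unren v - unren w : PN" unfolding unren_def by(rule lin_cong)

lemma unren_pw: assumes y: "y : pts" and w: "w : pw (rn (pw M q)) m y" shows "unren w : pw M (m * q) y"
proof -
 have "unren (prod_list l) : pw M (length l * q) y" if "set l [= rn (pw M q) y" for l using that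
 proof (induction l)
  case Nil
  show ?case using pw_prod[OF y, of "[]" 0 M] by(simp add: unren)
 next
  case (Cons a l)
  then obtain v where v: "v : pw M q y" "a - ren v : PN" unfolding rn_def by auto
  have "unren a - v : PN" using unren_cong[OF v(2)] by(simp add: unren(1))
  hence "unren a : pw M q y" by(rule osub_tr[OF pw_osub[OF y] pw_N[OF y] _ v(1)])
  thus ?case using pw_mult[OF y] Cons by(simp add: unren)
 qed
 note gens = this
 have "pw (rn (pw M q)) m y [= {w. unren w : pw M (m * q) y}"
 proof (rule pw_least[OF y])
  show "osub (Ox y) {w. unren w : pw M (m * q) y}" unfolding unren_def by(rule lin_preimage[OF y pw_osub[OF y] pw_N[OF y]])
  show "PN [= {w. unren w : pw M (m * q) y}" unfolding unren_def using lin_PN pw_N[OF y] by blast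
 qed (use gens in blast)
 thus ?thesis using w by blast
qed

text \<open>The word is cut into \<open>m\<close> blocks of length \<open>q\<close>, and
  \<open>ren\<close> turns each block into a linear form.\<close>

lemma unren_lift: assumes x: "x : pts" shows "length l = m * q ==> set l [= M x ==> EX w:pw (rn (pw M q)) m x. unren w = prod_list l"
proof (induction m arbitrary: l)
 case 0
 thus ?case using pw_prod[OF x, of "[]" 0 "rn (pw M q)"] unren(3) by(intro bexI[of _ 1]) auto
next
 case (Suc m)
 have "set (drop q l) [= M x" "set (take q l) [= M x" using Suc.prems(2) set_take_subset[of q l] set_drop_subset[of q l] by auto
 then obtain w where w: "w : pw (rn (pw M q)) m x" "unren w = prod_list (drop q l)" using Suc.IH[of "drop q l"] Suc.prems(1) by auto
 have "prod_list (take q l) : pw M q x" using \<open>set (take q l) [= M x\<close> Suc.prems(1) by(intro pw_prod[OF x]) auto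
 hence "ren (prod_list (take q l)) : rn (pw M q) x" unfolding rn_def using c_refl[OF PN] by blast
 hence "ren (prod_list (take q l)) * w : pw (rn (pw M q)) (1 + m) x" by(intro pw_mult[OF x pw_one[OF x] w(1)])
 moreover have "unren (ren (prod_list (take q l)) * w) = prod_list l" unfolding unren w(2) prod_list.append[symmetric] append_take_drop_id ..
 ultimately show ?case by auto
qed

lemma GG_unren: assumes x: "x : pts" and u: "!!y. y : pts ==> u y : PK" and g: "GG (tw (pw (rn (pw M q)) m) u) x" shows "GG (tw (pw M (m * q)) u) x"
proof (rule pw_gen[OF x])
 fix l assume "length l = m * q" "set l [= M x"
 then obtain w where w: "w : pw (rn (pw M q)) m x" "unren w = prod_list l" using unren_lift[OF x] by blast
 show "u x * prod_list l : G (tw (pw M (m * q)) u) x" unfolding w(2)[symmetric] unren_def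
  by(rule G_tw_map[OF x u lat_pw _ GG_D[OF g w(1)]]) (use unren_pw in \<open>auto simp: unren_def\<close>)
qed

lemma GG_ren: assumes x: "x : pts" and u: "!!y. y : pts ==> u y : PK" and g: "GG (tw (pw M s) u) x" shows "GG (tw (pw (rn (pw M s)) 1) u) x"
proof (rule pw_gen[OF x])
 fix l assume "length l = 1" "set l [= rn (pw M s) x"
 then obtain w v where l: "l = [w]" and v: "v : pw M s x" "w - ren v : PN" unfolding rn_def by(auto simp: length_Suc_conv)
 have "u x * ren v : G (tw (pw (rn (pw M s)) 1) u) x"
 proof (rule G_tw_map[OF x u lat_pw _ GG_D[OF g v(1)]])
  fix y v assume y: "y : pts" and v: "v : pw M s y"
  have "ren v : rn (pw M s) y" unfolding rn_def using v c_refl[OF PN] by blast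
  thus "ren v : pw (rn (pw M s)) 1 y" by(rule pw_one[OF y])
 qed
 thus "u x * prod_list l : G (tw (pw (rn (pw M s)) 1) u) x" unfolding l using G_cong[OF lat_tw[OF lat_pw] x c_mult[OF PN c_refl[OF PN] v(2)]] by simp
qed

end

section \<open>The comparison of nested and plain symmetric powers\<close>

section \<open>Powers of linear forms\<close>

text \<open>Replacing \<open>p(k)\<close> by \<open>2\<^sup>d p(k) - p(2k)\<close> lowers the degree \<open>d\<close> of \<open>p\<close>.\<close>

lemma coeffs_of_values: fixes S :: "'w::comm_ring_1 set"
 assumes S: "0 : S" "!!v w. v : S ==> w : S ==> v - w : S" "!!v w. v : S ==> w : S ==> v + w : S"
  and div: "!!m y. m > 0 ==> of_nat m * y : S ==> y : S" shows "(!!k::nat. (\<Sum>i\<le>d. of_nat k ^ i * y i) : S) ==> i <= d ==> y i : S"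
proof (induction d arbitrary: y i)
 case 0
 thus ?case using "0.prems"(1)[of 1] by simp
next
 case (Suc d)
 have sum: "(SUM i:A. f i) : S" if "finite A" "!!i. i : A ==> f i : S" for A and f :: "nat => 'w" using that by(induction A) (auto intro: S)
 have nat: "of_nat m * v : S" if "v : S" for m v using that by(induction m) (auto simp: distrib_right intro: S)
 define p where "p k = (\<Sum>i\<le>Suc d. of_nat k ^ i * y i)" for k :: nat
 have y: "y i : S" if i: "i <= d" for i
 proof -
  have "(\<Sum>i\<le>d. of_nat k ^ i * (of_nat (2 ^ Suc d - 2 ^ i) * y i)) : S" for k
  proof -
   have "of_nat (2 ^ Suc d) * p k - p (2 * k) = (\<Sum>i\<le>Suc d. of_nat (2 ^ Suc d) * (of_nat k ^ i * y i) - of_nat (2 * k) ^ i * y i)"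
    unfolding p_def sum_distrib_left sum_subtractf ..
   also have "\<dots> = (\<Sum>i\<le>d. of_nat (2 ^ Suc d) * (of_nat k ^ i * y i) - of_nat (2 * k) ^ i * y i)"
    by(simp add: power_mult_distrib mult.assoc)
   also have "\<dots> = (\<Sum>i\<le>d. of_nat k ^ i * (of_nat (2 ^ Suc d - 2 ^ i) * y i))"
   proof (rule sum.cong[OF refl])
    fix i assume "i : {..d}"
    hence "(2::nat) ^ i <= 2 ^ Suc d" by(intro power_increasing) auto
    hence e: "(of_nat (2 ^ Suc d - 2 ^ i) :: 'w) = of_nat (2 ^ Suc d) - of_nat (2 ^ i)" by(rule of_nat_diff)
    show "of_nat (2 ^ Suc d) * (of_nat k ^ i * y i) - of_nat (2 * k) ^ i * y i = of_nat k ^ i * (of_nat (2 ^ Suc d - 2 ^ i) * y i)"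
     unfolding e by(simp add: power_mult_distrib algebra_simps)
   qed
   finally have eq: "(\<Sum>i\<le>d. of_nat k ^ i * (of_nat (2 ^ Suc d - 2 ^ i) * y i)) = of_nat (2 ^ Suc d) * p k - p (2 * k)" by simp
   have "p k : S" for k using Suc.prems(1) by(simp add: p_def)
   thus ?thesis unfolding eq using S(2) nat by blast
  qed
  from Suc.IH[OF this i] have "of_nat (2 ^ Suc d - 2 ^ i) * y i : S" .
  \<comment> \<open>The factor \<open>2 ^ Suc d - 2 ^ i\<close> is therefore a positive integer, and
    \<open>div\<close> removes it.\<close>
  moreover have "(2::nat) ^ i < 2 ^ Suc d" using i by(intro power_strict_increasing) auto
  ultimately show ?thesis using div[of "2 ^ Suc d - 2 ^ i" "y i"] by simp
 qed
 show ?case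
 proof (cases "i = Suc d")
  \<comment> \<open>The top coefficient is the value at \<open>k = 1\<close> minus all the
    others.\<close>
  case True
  have "(\<Sum>i\<le>d. y i) : S" using sum[of "{..d}" y] y by simp
  moreover have "(\<Sum>i\<le>d. y i) + y (Suc d) : S" using Suc.prems(1)[of 1] by simp
  ultimately show ?thesis unfolding True using S(2) by fastforce
 qed (use y Suc.prems(2) in simp)
qed

text \<open>Polarisation. By induction on \<open>l\<close>, the product
  \<open>t ^ (q - length l) * prod_list l\<close> lies in \<open>S\<close> for all
  \<open>t : L\<close>: for a new letter \<open>v\<close> the hypothesis is applied to
  \<open>of_nat k * v + t\<close> for every \<open>k\<close>, and the coefficient of
  \<open>k\<close> is extracted.\<close>

lemma powers_span: fixes S :: "'w::comm_ring_1 set" assumes S: "0 : S" "!!v w. v : S ==> w : S ==> v - w : S" "!!v w. v : S ==> w : S ==> v + w : S"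
  and div: "!!m y. m > 0 ==> of_nat m * y : S ==> y : S" and L: "0 : L" "!!t v. t : L ==> v : L ==> t + v : L" and p: "!!t. t : L ==> t ^ q : S"
 shows "length l = q ==> set l [= L ==> prod_list l : S"
proof -
 have "length l <= q ==> set l [= L ==> t : L ==> t ^ (q - length l) * prod_list l : S" for t
 proof (induction l arbitrary: t)
  case Nil
  thus ?case using p by simp
 next
  case (Cons v l)
  define d where "d = q - length l"
  have d: "d > 0" "q - length (v # l) = d - 1" using Cons.prems(1) by(auto simp: d_def)
  have "of_nat k * v + t : L" for k using Cons.prems(2,3) by(induction k) (auto simp: distrib_right add.assoc intro: L)
  hence "(of_nat k * v + t) ^ d * prod_list l : S" for k using Cons.IH Cons.prems unfolding d_def by simp
  moreover have "(of_nat k * v + t) ^ d * prod_list l =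
    (\<Sum>i\<le>d. of_nat k ^ i * (of_nat (d choose i) * v ^ i * t ^ (d - i) * prod_list l))" for k
   unfolding binomial_ring sum_distrib_right by(intro sum.cong) (simp_all add: power_mult_distrib ac_simps)
  ultimately have "(\<Sum>i\<le>d. of_nat k ^ i * (of_nat (d choose i) * v ^ i * t ^ (d - i) * prod_list l)) : S" for k by simp
  hence "of_nat (d choose 1) * v ^ 1 * t ^ (d - 1) * prod_list l : S"
   using coeffs_of_values[where S = S and d = d and i = 1 and y = "%i. of_nat (d choose i) * v ^ i * t ^ (d - i) * prod_list l", OF S div] d(1) by simp
  hence "of_nat d * (v * t ^ (d - 1) * prod_list l) : S" by(simp add: mult.assoc)
  from div[OF d(1) this] show ?case unfolding d(2) by(simp add: ac_simps)
 qed
 from this[of 0] L(1) show "length l = q ==> set l [= L ==> prod_list l : S" by simp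
qed

definition wds :: "nat set => nat => nat list set" where "wds I n = {l. set l [= I & length l = n}"

lemma finite_wds: "finite I ==> finite (wds I n)" unfolding wds_def by(rule finite_lists_length_eq)

lemma sum_wds_add: assumes I: "finite I" shows "(SUM v:wds I (m + n). h v) = (SUM u:wds I m. SUM v:wds I n. h (u @ v))"
proof -
 have "wds I (m + n) = (%(u, v). u @ v) ` (wds I m \<times> wds I n)"
 proof
  show "wds I (m + n) [= (%(u, v). u @ v) ` (wds I m \<times> wds I n)"
  proof
   fix l assume l: "l : wds I (m + n)"
   hence "take m l : wds I m" "drop m l : wds I n" using set_take_subset[of m l] set_drop_subset[of m l] by(auto simp: wds_def)
   thus "l : (%(u, v). u @ v) ` (wds I m \<times> wds I n)" by(intro image_eqI[of _ _ "(take m l, drop m l)"]) auto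
  qed
 qed (auto simp: wds_def)
 moreover have "inj_on (%(u, v). u @ v) (wds I m \<times> wds I n)" by(auto simp: inj_on_def wds_def)
 ultimately show ?thesis by(simp add: sum.reindex sum.cartesian_product case_prod_unfold)
qed

primrec blk :: "(nat list => 'w::comm_ring_1) => nat => nat => nat list => 'w" where "blk Y q 0 v = 1"
| "blk Y q (Suc k) v = Y (take q v) * blk Y q k (drop q v)"

text \<open>A word of length \<open>k * q\<close> is the same as \<open>k\<close> words of length
  \<open>q\<close>. Expanding over words rather than monomials avoids multinomial
  coefficients.\<close>

lemma pow_blk: assumes I: "finite I"
 shows "(SUM u:wds I q. cst (prod_list (map ga u)) * Y u) ^ k = (SUM v:wds I (k * q). cst (prod_list (map ga v)) * blk Y q k v)"
proof (induction k)
 case 0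
 have "wds I 0 = {[]}" by(auto simp: wds_def)
 thus ?case by simp
next
 case (Suc k)
 show ?case unfolding power_Suc Suc mult_Suc sum_wds_add[OF I] sum_product
  by(intro sum.cong) (auto simp: wds_def mult_single[of 0 _ 0, simplified, symmetric] ac_simps)
qed

lemma blk_mon: "length v = k ==> blk (%u. mon (mset u)) 1 k v = mon (mset v)" by(induction k arbitrary: v) (auto simp: length_Suc_conv mult_single)

text \<open>
 The map \<open>S\<^bsup>kq\<^esup> \<rightarrow> S\<^sup>k S\<^sup>q\<close> sends a monomial to the sum over its arrangements, cut into
 \<open>k\<close> blocks. The weights make it send \<open>\<ell>\<^bsup>kq\<^esup>\<close> to a multiple of \<open>(\<ell>\<^sup>q)\<^sup>k\<close>.
\<close>

lemma comultiplication: fixes e :: "nat multiset => 'c::comm_ring_1 wpoly" assumes I: "finite I"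
 shows "EX f C. C > (0::nat) & (ALL ga. lin f ((SUM i:I. cst (ga i) * var i) ^ (k * q)) = of_nat C * (lin e ((SUM i:I. cst (ga i) * var i) ^ q)) ^ k)"
proof -
 define Q where "Q = blk (%u. e (mset u)) q k"
 define W where "W = wds I (k * q)"
 define F where "F \<alpha> = {v : W. mset v = \<alpha>}" for \<alpha>
 \<comment> \<open>A monomial \<open>\<alpha>\<close> collects \<open>card (F \<alpha>)\<close>
   equal terms. Weighting \<open>f \<alpha>\<close> with the product of all other fibre sizes makes
   the resulting factor the same number \<open>C\<close> for every monomial, without any
   division.\<close>
 define C where "C = (PROD \<beta>:mset ` W. card (F \<beta>))"
 define f where "f \<alpha> = of_nat (PROD \<beta>:mset ` W - {\<alpha>}. card (F \<beta>)) * (SUM v:F \<alpha>. Q v)" for \<alpha>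
 have fW: "finite W" unfolding W_def by(rule finite_wds[OF I])
 have "card (F \<beta>) > 0" if "\<beta> : mset ` W" for \<beta> using that fW by(auto simp: F_def card_gt_0_iff)
 hence "C > 0" unfolding C_def by(intro prod_pos) auto
 moreover have "lin f ((SUM i:I. cst (ga i) * var i) ^ (k * q)) = of_nat C * (lin e ((SUM i:I. cst (ga i) * var i) ^ q)) ^ k" for ga :: "nat => 'c"
 proof -
  let ?g = "%v. prod_list (map ga v)"
  have "wds I 1 = (%i. [i]) ` I" by(auto simp: wds_def length_Suc_conv)
  hence s1: "(SUM i:I. cst (ga i) * var i) = (SUM u:wds I 1. cst (?g u) * (mon (mset u) :: 'c wpoly))" by(simp add: sum.reindex inj_on_def)
  have p: "(SUM i:I. cst (ga i) * var i) ^ n = (SUM v:wds I n. cst (?g v) * (mon (mset v) :: 'c wpoly))" for n unfolding s1 pow_blk[OF I]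
   by(intro sum.cong arg_cong2[where f = "(*)"] blk_mon) (simp_all add: wds_def)
  have gm: "?g v = prod_mset (image_mset ga (mset v))" for v by(induction v) auto
  have "lin f ((SUM i:I. cst (ga i) * var i) ^ (k * q)) = (SUM v:W. cst (?g v) * f (mset v))" unfolding p lin_sum_mono W_def ..
  also have "\<dots> = (SUM \<alpha>:mset ` W. SUM v:F \<alpha>. cst (?g v) * f (mset v))" unfolding F_def by(rule sum.image_gen[OF fW])
  also have "\<dots> = (SUM \<alpha>:mset ` W. SUM v:F \<alpha>. of_nat C * (cst (?g v) * Q v))"
  proof (rule sum.cong[OF refl])
   fix \<alpha> assume a: "\<alpha> : mset ` W"
   have C: "C = card (F \<alpha>) * (PROD \<beta>:mset ` W - {\<alpha>}. card (F \<beta>))" unfolding C_def using fW a by(subst prod.remove) auto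
   let ?c = "cst (prod_mset (image_mset ga \<alpha>)) :: 'c wpoly"
   have "(SUM v:F \<alpha>. cst (?g v) * f (mset v)) = (SUM v:F \<alpha>. ?c * f \<alpha>)" by(intro sum.cong) (auto simp: F_def gm)
   also have "\<dots> = of_nat C * (?c * (SUM v:F \<alpha>. Q v))" unfolding C f_def by(simp add: ac_simps)
   also have "\<dots> = (SUM v:F \<alpha>. of_nat C * (cst (?g v) * Q v))" unfolding sum_distrib_left by(intro sum.cong) (auto simp: F_def gm)
   finally show "(SUM v:F \<alpha>. cst (?g v) * f (mset v)) = (SUM v:F \<alpha>. of_nat C * (cst (?g v) * Q v))" .
  qed
  also have "\<dots> = (SUM v:W. of_nat C * (cst (?g v) * Q v))" unfolding F_def by(rule sum.image_gen[OF fW, symmetric])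
  also have "\<dots> = of_nat C * (SUM u:wds I q. cst (?g u) * e (mset u)) ^ k" unfolding pow_blk[OF I] Q_def W_def sum_distrib_left ..
  finally show ?thesis unfolding p lin_sum_mono .
 qed
 ultimately show ?thesis by blast
qed

lemma ospan_finite: "v : ospan A S ==> EX F. finite F & F [= S & v : ospan A F"
proof (induction rule: ospan.induct)
 case zero
 thus ?case using ospan.zero by blast
next
 case (step a s v)
 then obtain F where F: "finite F" "F [= S" "v : ospan A F" by blast
 have "v : ospan A (insert s F)" using ospan_mono[of A A F "insert s F"] F(3) by blast
 hence "a * s + v : ospan A (insert s F)" using step by(intro ospan.step) auto
 thus ?case using F step by(intro exI[of _ "insert s F"]) auto
qed

lemma ospan_finite_set: "finite B ==> B [= ospan A (S Un N) ==> EX Z. finite Z & Z [= S & B [= ospan A (Z Un N)"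
proof (induction rule: finite_induct)
 case (insert b B)
 then obtain Z where Z: "finite Z" "Z [= S" "B [= ospan A (Z Un N)" by auto
 obtain F where F: "finite F" "F [= S Un N" "b : ospan A F" using ospan_finite[of b A "S Un N"] insert.prems by auto
 let ?Z = "Z Un (F Int S)"
 have "ospan A F [= ospan A (?Z Un N)" "ospan A (Z Un N) [= ospan A (?Z Un N)" using F(2) by(intro ospan_mono; blast)+
 thus ?case using Z F by(intro exI[of _ ?Z]) auto
qed auto

context wmodel
begin

text \<open>The inverse provided by \<open>nat_inv\<close> is a global function, hence regular at
  \<open>y\<close>.\<close>

lemma nat_div: assumes y: "y : pts" and D: "osub (Ox y) D" "PN [= D" and m: "m > 0" and w: "of_nat m * w : D" shows "w : D"
proof -
 obtain i where i: "i : sec Ox pts" "of_nat m * i - 1 : PN" using nat_inv[OF m] by blast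
 have "1 * w - of_nat m * i * w : PN" by(intro c_mult[OF PN c_sym[OF PN i(2)] c_refl[OF PN]])
 hence "w - i * (of_nat m * w) : PN" by(simp add: ac_simps)
 thus ?thesis using osub_tr[OF D] osubD(3)[OF D(1) secD[OF i(1) y] w] by blast
qed

lemma cong_power: "v - w : PN ==> v ^ n - w ^ n : PN" by(induction n) (auto intro: c_mult[OF PN] simp: osubD(1)[OF PN])

lemma lintype_form: assumes M: "lintype M I" and y: "y : pts" and l: "l : M y" shows "EX ga. l - (SUM i:I. cst (ga i) * var i) : PN"
proof -
 obtain U B where U: "oin T U" "y : U" "fr_at M U B" "B [= fspan PN PK (var ` I)" using lintype_frame[OF M y] by meson
 obtain c where c: "ALL b:B. c b : Ox y" "l - (SUM b:B. c b * b) : PN" using l fr_atD(2)[OF U(3,2)] unfolding fspan_def by blast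
 have o: "osub PK (fspan PN PK (var ` I))" using fspan_K[of "var ` I"] M ospan_osub[OF PK] by(simp add: lintype_def)
 have n: "PN [= fspan PN PK (var ` I)" using fspan_K[of "var ` I"] M ospanI[OF PK, of "var ` I Un PN"] by(auto simp: lintype_def)
 have "(SUM b:B. c b * b) : fspan PN PK (var ` I)" using c(1) U(4) OxK[OF y] by(intro osub_sum[OF o] osubD(3)[OF o]) auto
 hence "l : fspan PN PK (var ` I)" by(rule osub_tr[OF o n c(2)])
 then obtain d where d: "ALL i:I. d (var i) : PK" "l - (SUM b:var ` I. d b * b) : PN" unfolding fspan_def by blast
 have iv: "inj_on var I" by(rule inj_onI) (auto dest!: arg_cong[of _ _ Poly_Mapping.keys])
 have "(SUM i:I. d (var i) * var i) - (SUM i:I. cst (cf (d (var i)) 0) * var i) : PN"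
  using d(1) by(intro c_sum[OF PN] c_mult[OF PN _ c_refl[OF PN]]) (simp add: PK_dec)
 hence "l - (SUM i:I. cst (cf (d (var i)) 0) * var i) : PN" using c_trans[OF PN d(2)] by(simp add: sum.reindex[OF iv])
 thus ?thesis by(rule exI[of _ "%i. cf (d (var i)) 0"])
qed

text \<open>Modulo \<open>PN\<close> every element of \<open>M y\<close> is a linear form with
  constant coefficients (\<open>lintype_form\<close>), so one \<open>f\<close> and one
  \<open>C\<close> serve for all points and all forms.\<close>

lemma comult_exists: assumes M: "lintype M I"
 shows "EX f C. C > (0::nat) & (ALL y:pts. ALL l:M y. lin f (l ^ (k * q)) - of_nat C * ren (l ^ q) ^ k : PN)"
proof -
 have I: "finite I" using M by(simp add: lintype_def)
 obtain f C where f: "C > 0" "!!ga. lin f ((SUM i:I. cst (ga i) * var i) ^ (k * q)) = of_nat C * ren ((SUM i:I. cst (ga i) * var i) ^ q) ^ k"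
  using comultiplication[OF I, of k q "%m. var (enc m)"] by blast
 have "lin f (l ^ (k * q)) - of_nat C * ren (l ^ q) ^ k : PN" if y: "y : pts" "l : M y" for y l
 proof -
  obtain ga where g: "l - (SUM i:I. cst (ga i) * var i) : PN" using lintype_form[OF M y] by blast
  have 1: "of_nat C * ren ((SUM i:I. cst (ga i) * var i) ^ q) ^ k - of_nat C * ren (l ^ q) ^ k : PN"
   by(intro c_mult[OF PN c_refl[OF PN]] cong_power lin_cong c_sym[OF PN g])
  have "lin f (l ^ (k * q)) - of_nat C * ren ((SUM i:I. cst (ga i) * var i) ^ q) ^ k : PN"
   using lin_cong[OF cong_power[OF g, of "k * q"], of f] unfolding f(2) .
  from c_trans[OF PN this 1] show ?thesis .
 qed
 thus ?thesis using f(1) by blast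
qed

text \<open>\<open>powers_span\<close> applies because \<open>D\<close> admits division by positive
  integers.\<close>

lemma pw_powers: assumes M: "framed M" and y: "y : pts" and D: "osub (Ox y) D" "PN [= D" and p: "!!l. l : M y ==> l ^ q : D" shows "pw M q y [= D"
proof (rule pw_least[OF y D])
 fix l assume l: "length l = q" "set l [= M y"
 note m = osubD[OF framed_osub(1)[OF M y]] and d = osubD[OF D(1)]
 show "prod_list l : D" by(rule powers_span[of D "M y" q, OF d(1) osub_minus[OF Ox[OF y] D(1)] d(2) nat_div[OF y D] m(1,2) p l])
qed

lemma pw_power: assumes "y : pts" "v : M y" shows "v ^ n : pw M n y"
proof -
 have "set (replicate n v) [= M y" using assms(2) by auto
 thus ?thesis using pw_prod[of y "replicate n v" n M] assms(1) by(simp add: prod_list_replicate)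
qed

lemma rn_I: "v : M y ==> ren v : rn M y" unfolding rn_def using c_refl[OF PN] by blast

text \<open>Comultiplication maps the lattice of degree \<open>k * q\<close> into that of the nested
  power at every point, because the powers \<open>l ^ (k * q)\<close> generate the former. It
  therefore preserves global sections, and the integer \<open>C\<close> is divided out at the
  end.\<close>

lemma GG_comult: assumes M: "lintype M I" and x: "x : pts" and u: "!!y. y : pts ==> u y : PK" and g: "GG (tw (pw M (k * q)) u) x" and l: "l : M x"
 shows "u x * ren (l ^ q) ^ k : G (tw (pw (rn (pw M q)) k) u) x"
proof -
 let ?R = "rn (pw M q)"
 have fM: "framed M" using M based_framed unfolding lintype_def by blast
 obtain f C where f: "C > (0::nat)" "!!y l. y : pts ==> l : M y ==> lin f (l ^ (k * q)) - of_nat C * ren (l ^ q) ^ k : PN"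
  using comult_exists[OF M, of k q] by blast
 have "lin f v : pw ?R k y" if y: "y : pts" and v: "v : pw M (k * q) y" for y v
 proof -
  have "pw M (k * q) y [= {v. lin f v : pw ?R k y}"
  proof (rule pw_powers[OF fM y lin_preimage[OF y pw_osub[OF y] pw_N[OF y]]])
   show "PN [= {v. lin f v : pw ?R k y}" using lin_PN pw_N[OF y] by blast
   fix l assume l: "l : M y"
   have "of_nat C * ren (l ^ q) ^ k : pw ?R k y"
    by(intro osubD(3)[OF pw_osub[OF y]] osubring_of_nat[OF Ox[OF y]] pw_power[OF y] rn_I[of "l ^ q" "pw M q"] l)
   thus "l ^ (k * q) : {v. lin f v : pw ?R k y}" using osub_tr[OF pw_osub[OF y] pw_N[OF y] f(2)[OF y l]] by blast
  qed
  thus ?thesis using v by blast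
 qed
 from G_tw_map[OF x u lat_pw this GG_D[OF g pw_power[of x l M, OF x l]]]
 have "u x * lin f (l ^ (k * q)) : G (tw (pw ?R k) u) x" .
 hence "u x * (of_nat C * ren (l ^ q) ^ k) : G (tw (pw ?R k) u) x"
  by(rule G_cong[OF lat_tw[OF lat_pw] x c_mult[OF PN c_refl[OF PN] c_sym[OF PN f(2)[OF x l]]]])
 hence "of_nat C * (u x * ren (l ^ q) ^ k) : G (tw (pw ?R k) u) x" by(simp add: ac_simps)
 thus ?thesis by(rule nat_div[OF x G_osub[OF x] G_PN[OF lat_tw[OF lat_pw] x] f(1)])
qed

text \<open>By \<open>pw_powers\<close> all \<open>q\<close>-th powers together generate; a local
  frame is finite, and each of its elements involves only finitely many powers.\<close>

lemma power_generators: assumes M: "framed M" and R: "framed (rn (pw M q))" and x: "x : pts"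
 shows "EX Z. finite Z & Z [= (%l. ren (l ^ q)) ` M x & rn (pw M q) x [= ospan (Ox x) (Z Un PN)"
proof -
 let ?S = "(%l. ren (l ^ q)) ` M x"
 note o = ospan_osub[OF Ox[OF x], of "?S Un PN"] and n = ospanI[OF Ox[OF x], of "?S Un PN"]
 have "pw M q x [= {v. ren v : ospan (Ox x) (?S Un PN)}"
 proof (rule pw_powers[OF M x lin_preimage[OF x o]])
  show "PN [= {v. ren v : ospan (Ox x) (?S Un PN)}" using lin_PN n by blast
 qed (use n in blast)+
 hence gen: "w : ospan (Ox x) (?S Un PN)" if "w : rn (pw M q) x" for w using that osub_tr[OF o] n unfolding rn_def by blast
 obtain U B where U: "oin T U" "x : U" and fr: "fr_at (rn (pw M q)) U B" using R x unfolding framed_def by blast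
 note e = fr_at_span[OF U(1) fr U(2)]
 have "B [= ospan (Ox x) (?S Un PN)" using gen e ospanI[OF Ox[OF x], of "B Un PN"] by blast
 from ospan_finite_set[OF fr_atD(1)[OF fr] this]
 obtain Z where Z: "finite Z" "Z [= ?S" "B [= ospan (Ox x) (Z Un PN)" by blast
 have "ospan (Ox x) (B Un PN) [= ospan (Ox x) (Z Un PN)"
  using Z(3) ospanI[OF Ox[OF x], of "Z Un PN"] by(intro ospan_least ospan_osub[OF Ox[OF x]]) auto
 thus ?thesis using Z e by blast
qed

text \<open>As long as \<open>A\<close> has more than \<open>card Z * k0\<close> factors, some
  \<open>z\<close> occurs at least \<open>k0\<close> times, and \<open>z ^ k0\<close> is split off
  together with one twist \<open>u\<close>. The size of what remains is bounded independently of
  \<open>A\<close>.\<close>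

lemma extract_powers: assumes x: "x : pts" and Z: "finite Z" and k0: "k0 > 0" and z: "!!z. z : Z ==> u x * z ^ k0 : G (tw (pw R k0) u) x"
 shows "set_mset A [= Z ==> EX k B t. size A = k0 * k + size B & set_mset B [= Z & size B <= card Z * k0 &
  prod_mset A = t * prod_mset B & u x ^ k * t : G (tw (pw R (k0 * k)) (%y. u y ^ k)) x"
proof (induction "size A" arbitrary: A rule: less_induct)
 case less
 show ?case
 proof (cases "size A <= card Z * k0")
  case True
  thus ?thesis using less.prems one_pw0[OF x, of R] by(intro exI[of _ 0] exI[of _ A] exI[of _ 1]) simp
 next
  case False
  have "EX z:Z. k0 <= count A z"
  proof (rule ccontr)
   assume "\<not> ?thesis"
   hence "sum (count A) (set_mset A) <= card (set_mset A) * k0" using less.prems by(intro sum_bounded_above[where K = k0, simplified]) (auto simp: not_le subset_iff intro: less_imp_le)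
   also have "\<dots> <= card Z * k0" using card_mono[OF Z less.prems] by simp
   finally show False using False by(simp add: size_multiset_overloaded_eq)
  qed
  then obtain z0 where z0: "z0 : Z" "k0 <= count A z0" by blast
  define A' where "A' = A - replicate_mset k0 z0"
  have A: "A = A' + replicate_mset k0 z0" using z0(2) unfolding A'_def by(simp add: count_le_replicate_mset_subset_eq)
  have "size A' < size A" "set_mset A' [= Z" using k0 less.prems unfolding A by auto
  from less.hyps[OF this] obtain k B t where t: "size A' = k0 * k + size B" "set_mset B [= Z" "size B <= card Z * k0"
   "prod_mset A' = t * prod_mset B" "u x ^ k * t : G (tw (pw R (k0 * k)) (%y. u y ^ k)) x" by blast
  have "(u x ^ k * t) * (u x * z0 ^ k0) : G (tw (pw R (k0 * k + k0)) (%y. u y ^ k * u y)) x"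
   by(rule G_mult[OF x _ t(5) z[OF z0(1)]]) (rule tw_mult, auto intro: pw_mult)
  hence "u x ^ Suc k * (t * z0 ^ k0) : G (tw (pw R (k0 * Suc k)) (%y. u y ^ Suc k)) x" by(simp add: ac_simps)
  thus ?thesis using t unfolding A by(intro exI[of _ "Suc k"] exI[of _ B] exI[of _ "t * z0 ^ k0"]) (simp add: ac_simps)
 qed
qed

text \<open>Each factor \<open>z ^ k0\<close> is generated with the twist
  \<open>h ^ (c * n)\<close>, while \<open>h ^ k0\<close> with \<open>k0 = n + c * n\<close> is
  available, which leaves \<open>h ^ n\<close> per factor. After enough factors the collected
  surplus makes the remaining factor of bounded degree globally generated.\<close>

lemma GG_nested: assumes M: "lintype M I" and R: "framed (rn (pw M q))" and fp: "!!\<rho>. framed (pw (rn (pw M q)) \<rho>)"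
  and h: "amp h" and x: "x : pts" and n: "n >= 1" and g: "GG (tw (pw M ((n * (c + 1)) * q)) (%y. h y ^ (c * n))) x"
 shows "EX m>=1. GG (tw (pw (rn (pw M q)) m) (%y. h y ^ m)) x"
proof -
 let ?R = "rn (pw M q)"
 define k0 where "k0 = n * (c + 1)"
 have k0: "k0 > 0" "k0 = n + c * n" using n by(auto simp: k0_def algebra_simps)
 have hf: "unitfam h" using h by(simp add: amp_def)
 have hK: "y : pts ==> h y ^ j : PK" for y j using unitfam_power[OF hf, of j] unfolding unitfam_def by blast
 have fM: "framed M" using M based_framed unfolding lintype_def by blast
 obtain Z where Z: "finite Z" "Z [= (%l. ren (l ^ q)) ` M x" "?R x [= ospan (Ox x) (Z Un PN)" using power_generators[OF fM R x] by blast
 have z: "h x ^ (c * n) * z ^ k0 : G (tw (pw ?R k0) (%y. h y ^ (c * n))) x" if zZ: "z : Z" for z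
 proof -
  obtain l where l: "l : M x" "z = ren (l ^ q)" using Z(2) zZ by blast
  show ?thesis unfolding l(2) by(rule GG_comult[OF M x hK g[folded k0_def] l(1)])
 qed
 have "ALL \<rho>. EX t0. ALL t>=t0. GG (tw (pw ?R \<rho>) (%y. h y ^ t)) x" using h fp x unfolding amp_def by blast
 then obtain t1 where t1: "!!\<rho> t. t >= t1 \<rho> ==> GG (tw (pw ?R \<rho>) (%y. h y ^ t)) x" by metis
 \<comment> \<open>The sum bounds the thresholds for all degrees up to \<open>card Z * k0\<close> at
   once; \<open>Suc\<close> makes \<open>m\<close> positive.\<close>
 define t0 where "t0 = Suc (\<Sum>\<rho>\<le>card Z * k0. t1 \<rho>)"
 have t0: "t1 \<rho> <= t0" if "\<rho> <= card Z * k0" for \<rho> unfolding t0_def using that by(intro le_SucI member_le_sum) auto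
 \<comment> \<open>The remaining factor has degree at most \<open>card Z * k0\<close>, so this
   \<open>m\<close> forces at least \<open>t0\<close> extracted factors.\<close>
 define m where "m = k0 * t0 + card Z * k0"
 have "GG (tw (pw ?R m) (%y. h y ^ m)) x"
 proof (rule GG_gen[OF lat_pw x])
  show "pw ?R m x [= ospan (Ox x) (prod_mset ` msets Z m Un PN)"
  proof (rule pw_least[OF x ospan_osub[OF Ox[OF x]]])
   show "PN [= ospan (Ox x) (prod_mset ` msets Z m Un PN)" using ospanI[OF Ox[OF x]] by blast
   fix l assume "length l = m" "set l [= ?R x"
   thus "prod_list l : ospan (Ox x) (prod_mset ` msets Z m Un PN)" using prod_span[OF Ox[OF x] Z(3), of "mset l"] by(simp add: prod_mset_prod_list)
  qed
  fix s assume "s : prod_mset ` msets Z m"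
  then obtain A where A: "set_mset A [= Z" "size A = m" "s = prod_mset A" by(auto simp: msets_def)
  from extract_powers[OF x Z(1) k0(1) z A(1)]
  obtain k B t where t: "m = k0 * k + size B" "set_mset B [= Z" "size B <= card Z * k0" "s = t * prod_mset B"
   "(h x ^ (c * n)) ^ k * t : G (tw (pw ?R (k0 * k)) (%y. (h y ^ (c * n)) ^ k)) x" unfolding A(2,3) by blast
  have "k0 * t0 <= k0 * k" using t(1,3) unfolding m_def by linarith
  hence "t0 <= k" using k0(1) by simp
  moreover have "k <= n * k" using n by simp
  ultimately have "t0 <= n * k + size B" by linarith
  hence gB: "GG (tw (pw ?R (size B)) (%y. h y ^ (n * k + size B))) x" using t0[OF t(3)] by(intro t1) simp
  obtain l where l: "mset l = B" using ex_mset by blast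
  have ZR: "Z [= ?R x" using Z(2) rn_I[of _ "pw M q", OF pw_power[of x _ M q, OF x]] by blast
  have "prod_mset B : pw ?R (size B) x" using pw_prod[OF x, of l "size B" ?R] t(2) ZR unfolding l[symmetric] by(auto simp: prod_mset_prod_list)
  note gD = GG_D[OF gB this]
  have "((h x ^ (c * n)) ^ k * t) * (h x ^ (n * k + size B) * prod_mset B) \<in>
   G (tw (pw ?R (k0 * k + size B)) (%y. (h y ^ (c * n)) ^ k * h y ^ (n * k + size B))) x"
   by(rule G_mult[OF x _ t(5) gD]) (rule tw_mult, auto intro: pw_mult)
  moreover have pe: "(h y ^ (c * n)) ^ k * h y ^ (n * k + size B) = h y ^ m" for y
   unfolding t(1) k0(2) power_mult[symmetric] power_add[symmetric] by(simp add: algebra_simps)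
  moreover have "((h x ^ (c * n)) ^ k * t) * (h x ^ (n * k + size B) * prod_mset B) = h x ^ m * s"
   unfolding t(4) pe[of x, symmetric] by(simp only: ac_simps)
  ultimately show "h x ^ m * s : G (tw (pw ?R m) (%y. h y ^ m)) x" unfolding t(1)[symmetric] by simp
 qed
 moreover have "m >= 1" using k0(1) unfolding m_def t0_def by simp
 ultimately show ?thesis by blast
qed

lemma cancel_unit: assumes a: "unitfam a" and y: "y : pts" shows "w * (a y * ui a y) ^ n - w : PN"
 using c_mult[OF PN c_refl[OF PN, of w] cong_power[OF ui(2)[OF a y]], of n] by simp

lemma unit_PK: "unitfam u ==> y : pts ==> u y : PK" unfolding unitfam_def by blast

lemma amp_unit: "amp a ==> unitfam a" by(simp add: amp_def)

text \<open>Ampleness of \<open>a\<close> applied to the inverse of \<open>h\<close>; taking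
  \<open>Suc n0\<close> ensures \<open>c >= 1\<close>.\<close>

lemma amp_quotient: assumes a: "amp a" and h: "amp h" obtains c where "c >= 1" "!!x. x : pts ==> GG (lt (%y. a y ^ c * ui h y)) x"
proof -
 obtain n0 where "!!n x. n >= n0 ==> x : pts ==> GG (lt (%y. a y ^ n * ui h y)) x" using amp_lt[OF a unitfam_ui[OF amp_unit[OF h]]] by blast
 thus thesis by(intro that[of "Suc n0"]) (simp_all del: power_Suc)
qed

text \<open>From left to right the hypothesis is used for \<open>q * c\<close>: the quotient of
  \<open>a ^ c\<close> by \<open>h\<close>, raised to the power \<open>m\<close>, turns the twist
  \<open>h ^ m\<close> into \<open>a ^ (m * c)\<close>, and \<open>m * c\<close> becomes the new
  exponent for \<open>q\<close>. From right to left it is used for \<open>q * (c + 1)\<close>, where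
  the enlarged factor provides the surplus of twists for \<open>GG_nested\<close>.\<close>

theorem minus_iff:
 assumes M: "lintype M I" and R: "!!q. framed (rn (pw M q))" and fp: "!!q \<rho>. framed (pw (rn (pw M q)) \<rho>)" and a: "amp a" and h: "amp h" and x: "x : pts"
 shows "(ALL q>=1. EX m>=1. GG (tw (pw (rn (pw M q)) m) (%y. h y ^ m)) x) \<longleftrightarrow>
  (ALL q>=1. EX m>=1. GG (tw (pw M (m * q)) (%y. a y ^ m)) x)"
proof
 assume l: "ALL q>=1. EX m>=1. GG (tw (pw (rn (pw M q)) m) (%y. h y ^ m)) x"
 obtain c where c: "c >= 1" "!!x. x : pts ==> GG (lt (%y. a y ^ c * ui h y)) x" using amp_quotient[OF a h] by blast
 show "ALL q>=1. EX m>=1. GG (tw (pw M (m * q)) (%y. a y ^ m)) x"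
 proof (intro allI impI)
  fix q :: nat assume "q >= 1"
  hence "q * c >= 1" using c(1) by simp
  then obtain m where m: "m >= 1" "GG (tw (pw (rn (pw M (q * c))) m) (%y. h y ^ m)) x" using l by blast
  have "GG (tw (pw M (m * (q * c))) (%y. h y ^ m)) x" by(rule GG_unren[OF x _ m(2)]) (rule unit_PK[OF unitfam_power[OF amp_unit[OF h]]])
  from GG_lt[OF lat_pw x this GG_lt_power[OF x c(2)[OF x]]]
  have g: "GG (tw (pw M (m * (q * c))) (%y. h y ^ m * (a y ^ c * ui h y) ^ m)) x" .
  have e: "h y ^ m * (a y ^ c * ui h y) ^ m - a y ^ (m * c) : PN" if "y : pts" for y
  proof -
   have "h y ^ m * (a y ^ c * ui h y) ^ m = a y ^ (m * c) * (h y * ui h y) ^ m" by(simp add: power_mult_distrib power_mult[symmetric] ac_simps)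
   thus ?thesis using cancel_unit[OF amp_unit[OF h] that] by simp
  qed
  have "GG (tw (pw M (m * c * q)) (%y. a y ^ (m * c))) x" using GG_cong[OF e x g] by(simp add: ac_simps)
  thus "EX m>=1. GG (tw (pw M (m * q)) (%y. a y ^ m)) x" using m(1) c(1) by(intro exI[of _ "m * c"]) simp
 qed
next
 assume r: "ALL q>=1. EX m>=1. GG (tw (pw M (m * q)) (%y. a y ^ m)) x"
 obtain c where c: "c >= 1" "!!x. x : pts ==> GG (lt (%y. h y ^ c * ui a y)) x" using amp_quotient[OF h a] by blast
 show "ALL q>=1. EX m>=1. GG (tw (pw (rn (pw M q)) m) (%y. h y ^ m)) x"
 proof (intro allI impI)
  fix q :: nat assume "q >= 1"
  hence "q * (c + 1) >= 1" by simp
  then obtain n where n: "n >= 1" "GG (tw (pw M (n * (q * (c + 1)))) (%y. a y ^ n)) x" using r by blast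
  have g: "GG (tw (pw M (n * (q * (c + 1)))) (%y. a y ^ n * (h y ^ c * ui a y) ^ n)) x" by(rule GG_lt[OF lat_pw x n(2) GG_lt_power[OF x c(2)[OF x]]])
  have e: "a y ^ n * (h y ^ c * ui a y) ^ n - h y ^ (c * n) : PN" if "y : pts" for y
  proof -
   have "a y ^ n * (h y ^ c * ui a y) ^ n = h y ^ (c * n) * (a y * ui a y) ^ n" by(simp add: power_mult_distrib power_mult[symmetric] ac_simps)
   thus ?thesis using cancel_unit[OF amp_unit[OF a] that] by simp
  qed
  have "GG (tw (pw M (n * (q * (c + 1)))) (%y. h y ^ (c * n))) x" by(rule GG_cong[OF e x g])
  moreover have "n * (q * (c + 1)) = n * (c + 1) * q" by(simp add: algebra_simps)
  ultimately have "GG (tw (pw M (n * (c + 1) * q)) (%y. h y ^ (c * n))) x" by metis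
  thus "EX m>=1. GG (tw (pw (rn (pw M q)) m) (%y. h y ^ m)) x" by(rule GG_nested[OF M R fp h x n(1)])
 qed
qed

text \<open>Take the \<open>c\<close>-th power and multiply by the \<open>m\<close>-th power of the
  quotient of \<open>h ^ c\<close> by \<open>a\<close>; the powers of \<open>h\<close>
  cancel.\<close>

lemma plus_exchange: assumes a: "amp a" and h: "amp h" and x: "x : pts" and g: "GG (tw (pw M p) (%y. ui h y ^ m)) x"
 shows "EX c>=1. GG (tw (pw M (c * p)) (%y. ui a y ^ m)) x"
proof -
 obtain c where c: "c >= 1" "!!x. x : pts ==> GG (lt (%y. h y ^ c * ui a y)) x" using amp_quotient[OF h a] by blast
 have g': "GG (tw (pw M (c * p)) (%y. (ui h y ^ m) ^ c * (h y ^ c * ui a y) ^ m)) x"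
  by(rule GG_lt[OF lat_pw x GG_pw_power[OF x g] GG_lt_power[OF x c(2)[OF x]]])
 have e: "(ui h y ^ m) ^ c * (h y ^ c * ui a y) ^ m - ui a y ^ m : PN" if "y : pts" for y
 proof -
  have "(ui h y ^ m) ^ c * (h y ^ c * ui a y) ^ m = ui a y ^ m * (h y * ui h y) ^ (m * c)"
   by(simp add: power_mult_distrib power_mult[symmetric] ac_simps)
  thus ?thesis using cancel_unit[OF amp_unit[OF h] that] by simp
 qed
 show ?thesis using c(1) GG_cong[OF e x g'] by blast
qed

text \<open>From right to left, \<open>S^s E\<close> with the twist \<open>ui h ^ m\<close> is read
  as \<open>S^1 S^s E\<close>. Its \<open>j\<close>-th power has the twist
  \<open>ui h ^ (m * j)\<close>, and the excess \<open>(m - 1) * j\<close> is removed by multiplying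
  with a globally generated power of \<open>h\<close>.\<close>

theorem plus_iff: assumes a: "amp a" and h: "amp h" and x: "x : pts"
 shows "(EX q>=1. EX m>=1. GG (tw (pw (rn (pw M q)) m) (%y. ui h y ^ m)) x) \<longleftrightarrow>
  (EX q>=1. EX m>=1. GG (tw (pw M (m * q)) (%y. ui a y ^ m)) x)"
proof
 assume "EX q>=1. EX m>=1. GG (tw (pw (rn (pw M q)) m) (%y. ui h y ^ m)) x"
 then obtain q m where m: "q >= 1" "m >= 1" "GG (tw (pw (rn (pw M q)) m) (%y. ui h y ^ m)) x" by blast
 have "GG (tw (pw M (m * q)) (%y. ui h y ^ m)) x" by(rule GG_unren[OF x _ m(3)]) (rule unit_PK[OF unitfam_power[OF unitfam_ui[OF amp_unit[OF h]]]])
 from plus_exchange[OF a h x this] obtain c where c: "c >= 1" "GG (tw (pw M (c * (m * q))) (%y. ui a y ^ m)) x" by blast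
 hence "c * q >= 1 & GG (tw (pw M (m * (c * q))) (%y. ui a y ^ m)) x" using m(1) by(simp add: ac_simps)
 thus "EX q>=1. EX m>=1. GG (tw (pw M (m * q)) (%y. ui a y ^ m)) x" using m(2) by blast
next
 assume "EX q>=1. EX m>=1. GG (tw (pw M (m * q)) (%y. ui a y ^ m)) x"
 then obtain q m where m: "q >= 1" "m >= 1" "GG (tw (pw M (m * q)) (%y. ui a y ^ m)) x" by blast
 from plus_exchange[OF h a x m(3)] obtain c where c: "c >= 1" "GG (tw (pw M (c * (m * q))) (%y. ui h y ^ m)) x" by blast
 define s where "s = c * (m * q)"
 have s: "s >= 1" using c(1) m(1,2) by(simp add: s_def)
 note hu = amp_unit[OF h]
 have "GG (tw (pw (rn (pw M s)) 1) (%y. ui h y ^ m)) x"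
  by(rule GG_ren[OF x _ c(2)[folded s_def]]) (rule unit_PK[OF unitfam_power[OF unitfam_ui[OF hu]]])
 note g1 = GG_pw_power[OF x this]
 obtain n0 where n0: "!!n x. n >= n0 ==> x : pts ==> GG (lt (%y. h y ^ n * 1)) x" using amp_lt[OF h unitfam_one] by blast
 \<comment> \<open>For \<open>m > 1\<close> the exponent \<open>(m - 1) * j\<close> then exceeds
   \<open>n0\<close>, so that power of \<open>h\<close> is globally generated; for
   \<open>m = 1\<close> the exponent is 0.\<close>
 define j where "j = Suc n0"
 have "GG (lt (%y. h y ^ ((m - 1) * j))) x"
 proof (cases "m = 1")
  case True
  thus ?thesis using GG_one[OF x] by simp
 next
  case False
  hence "1 * n0 <= (m - 1) * j" using m(2) unfolding j_def by(intro mult_le_mono) auto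
  thus ?thesis using n0[OF _ x] by simp
 qed
 from GG_lt[OF lat_pw x g1 this, of j]
 have g2: "GG (tw (pw (rn (pw M s)) j) (%y. (ui h y ^ m) ^ j * h y ^ ((m - 1) * j))) x" by simp
 have e: "(ui h y ^ m) ^ j * h y ^ ((m - 1) * j) - ui h y ^ j : PN" if "y : pts" for y
 proof -
  obtain d where m': "m = Suc d" using m(2) by(cases m) auto
  have "(ui h y ^ m) ^ j * h y ^ ((m - 1) * j) = ui h y ^ j * (h y * ui h y) ^ ((m - 1) * j)"
   unfolding m' diff_Suc_1 power_mult[symmetric] mult_Suc power_add power_mult_distrib by(simp add: ac_simps)
  thus ?thesis using cancel_unit[OF hu that] by simp
 qed
 have "GG (tw (pw (rn (pw M s)) j) (%y. ui h y ^ j)) x" by(rule GG_cong[OF e x g2])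
 moreover have "j >= 1" by(simp add: j_def)
 ultimately show "EX q>=1. EX m>=1. GG (tw (pw (rn (pw M q)) m) (%y. ui h y ^ m)) x" using s by blast
qed

end

text \<open>A point lies in a base locus when global generation fails there, so the equivalences of
  \<open>minus_iff\<close> and \<open>plus_iff\<close> are needed in negated form.\<close>

lemma ex_all_not_iff: fixes P Q :: "nat => nat => bool" assumes "(ALL q>=1. EX m>=1. P q m) \<longleftrightarrow> (ALL q>=1. EX m>=1. Q q m)"
 shows "(EX q:{1..}. ALL m:{1..}. \<not> P q m) \<longleftrightarrow> (EX q:{1..}. ALL m:{1..}. \<not> Q q m)"
 using assms by(simp add: Bex_def Ball_def) blast

lemma all_all_not_iff: fixes P Q :: "nat => nat => bool" assumes "(EX q>=1. EX m>=1. P q m) \<longleftrightarrow> (EX q>=1. EX m>=1. Q q m)"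
 shows "(ALL q:{1..}. ALL m:{1..}. \<not> P q m) \<longleftrightarrow> (ALL q:{1..}. ALL m:{1..}. \<not> Q q m)"
 using assms by(simp add: Bex_def Ball_def) blast

theorem mainTheorem4:
  fixes X :: "('p, 'r, 'k :: {alg_closed_field, field_char_0}) space_over"
    and A :: "('p, 'r, 'a) mod_presheaf"
    and H :: "('p, 'r, 'h) mod_presheaf"
    and E :: "('p, 'r, 'e) mod_presheaf"
  assumes "projective_variety X"
    and "ample X A"
    and "vector_bundle X E"
    and "ample X H" \<comment> \<open>the ample line bundle used to define the base loci of \<open>E\<close>\<close>
  shows "B_minus X H E =
           (\<Union>q\<in>{1..}. \<Inter>m\<in>{1..}.
              Bs X (tensor_sheaf X (sym_sheaf X (m * q) E) (tensor_power_sheaf X m A))) \<and>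
         B_plus X H E =
           (\<Inter>q\<in>{1..}. \<Inter>m\<in>{1..}.
              Bs X (tensor_sheaf X (sym_sheaf X (m * q) E)
                      (tensor_power_sheaf X m (dual_sheaf X A))))"
proof -
 obtain N0 :: "('p set \<times> 'r) uring set" and Ox tu \<pi> where W: "wmodel N0 X Ox tu \<pi>" using projective_wmodel[OF assms(1)] by blast
 interpret wmodel N0 X Ox tu \<pi> by(rule W)
 obtain sia a where a: "realizes A sia (lt a)" "amp a" using ample_amp[OF assms(2)] by blast
 obtain sih h where h: "realizes H sih (lt h)" "amp h" using ample_amp[OF assms(4)] by blast
 have ms: "mod_sheaf X A" "mod_sheaf X H" using assms(2,4) by(simp_all add: ample_def line_bundle_def locally_free_def)
 obtain sia' where a': "realizes (dual_sheaf X A) sia' (lt (ui a))" using dual_realizes[OF a(1) amp_unit[OF a(2)] ms(1)] by blast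
 obtain sih' where h': "realizes (dual_sheaf X H) sih' (lt (ui h))" using dual_realizes[OF h(1) amp_unit[OF h(2)] ms(2)] by blast
 obtain sie M I where E: "realizes E sie M" "lintype M I" using vector_realizes[OF assms(3)] by blast
 note S = sym_lintype[OF E]
 have R: "framed (rn (pw M q))" "framed (pw (rn (pw M q)) m)" "EX si'. realizes (sym_sheaf X m (sym_sheaf X q E)) si' (pw (rn (pw M q)) m)" for q m
 proof -
  obtain I' si' where r: "realizes (sym_sheaf X q E) si' (rn (pw M q))" "lintype (rn (pw M q)) I'" using S(3)[of q] by blast
  show "framed (rn (pw M q))" using r(2) based_framed unfolding lintype_def by blast
  show "framed (pw (rn (pw M q)) m)" "EX si'. realizes (sym_sheaf X m (sym_sheaf X q E)) si' (pw (rn (pw M q)) m)"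
   using sym_lintype(1,2)[OF r] by blast+
 qed
 have nested: "x : Bs X (tensor_sheaf X (sym_sheaf X m (sym_sheaf X q E)) (tensor_power_sheaf X m L)) \<longleftrightarrow>
   \<not> GG (tw (pw (rn (pw M q)) m) (%y. u y ^ m)) x"
  if "realizes L si (lt u)" "unitfam u" "x : topspace (space_top X)" for L :: "('p, 'r, 'l) mod_presheaf" and si u x q m
  using exE[OF R(3)[of m q]] Bs_tw[OF _ R(2) that] by metis
 have single: "x : Bs X (tensor_sheaf X (sym_sheaf X p E) (tensor_power_sheaf X m L)) \<longleftrightarrow> \<not> GG (tw (pw M p) (%y. u y ^ m)) x"
  if "realizes L si (lt u)" "unitfam u" "x : topspace (space_top X)" for L :: "('p, 'r, 'l) mod_presheaf" and si u x p m
  using exE[OF S(1)[of p]] Bs_tw[OF _ S(2) that] by metis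
 note ua = amp_unit[OF a(2)] and uh = amp_unit[OF h(2)]
 \<comment> \<open>Outside of the space both sides are empty: \<open>Bs\<close> contains only points
   of \<open>X\<close>, and the index sets are non-empty.\<close>
 have nb: "x \<notin> Bs X F" if "x \<notin> topspace (space_top X)" for x and F :: "('p, 'r, 'l) mod_presheaf" using that by(simp add: Bs_def)
 have minus: "x : B_minus X H E \<longleftrightarrow> x : (UN q:{1..}. INT m:{1..}.
   Bs X (tensor_sheaf X (sym_sheaf X (m * q) E) (tensor_power_sheaf X m A)))" for x
 proof (cases "x : topspace (space_top X)")
  case True
  show ?thesis unfolding B_minus_def UN_iff INT_iff nested[OF h(1) uh True] single[OF a(1) ua True]
   by(rule ex_all_not_iff[OF minus_iff[OF E(2) R(1,2) a(2) h(2) True]])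
 next
  case False
  show ?thesis unfolding B_minus_def UN_iff INT_iff by(auto simp: nb[OF False])
 qed
 have plus: "x : B_plus X H E \<longleftrightarrow> x : (INT q:{1..}. INT m:{1..}.
   Bs X (tensor_sheaf X (sym_sheaf X (m * q) E) (tensor_power_sheaf X m (dual_sheaf X A))))" for x
 proof (cases "x : topspace (space_top X)")
  case True
  show ?thesis unfolding B_plus_def INT_iff nested[OF h' unitfam_ui[OF uh] True] single[OF a' unitfam_ui[OF ua] True]
   by(rule all_all_not_iff[OF plus_iff[OF a(2) h(2) True]])
 next
  case False
  show ?thesis unfolding B_plus_def INT_iff by(auto simp: nb[OF False])
 qed
 show ?thesis by(intro conjI Set.set_eqI minus plus)
qed

end
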